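(* Let $X=(X,d_X,\mu)$ and $Y=(Y,d_Y,\nu)$ be metric measure spaces, let $\|\cdot\|$ be a planar norm, and equip $X\times Y$ with the metric $d=\|(d_X,d_Y)\|$ and the measure $\mu\times\nu$. Let $p\in(1,\infty)$. If $f\in W^{1,p}(X\times Y)$, then $f\in J^{1,p}(X,Y)$ and $$\|(|D_Xf|,|D_Yf|)\|'\le|Df|$$ $\mu\times\nu$-almost everywhere.
   Context: A metric measure space is a complete separable metric space equipped with a Borel measure that is finite on bounded sets. Planar norm: a norm $\|\cdot\|$ on $\mathbb R^2$ that is monotone on the first quadrant, i.e. $\|(a,b)\|\le\|(a',b')\|$ whenever $0\le a\le a'$ and $0\le b\le b'$, so that $d((x,y),(x',y'))=\|(d_X(x,x'),d_Y(y,y'))\|$ is a metric on $X\times Y$. The partial dual norm is, for $a,b\ge0$, $\|(a,b)\|'=\sup\{at+bs:\ t,s\ge0,\ \|(t,s)\|\le1\}$. Sobolev space. Let $(Z,d_Z,m)$ be a metric measure space, $p\in(1,\infty)$ and $q=p/(p-1)$. A $q$-test plan on $Z$ is a Borel probability measure $\boldsymbol{\eta}$ on $C([0,1];Z)$, concentrated on absolutely continuous curves, such that $\int\int_0^1|\gamma_t'|^q\,dt\,d\boldsymbol{\eta}(\gamma)<\infty$ (where $|\gamma'_t|$ is the metric speed) and such that for some $C>0$ the push-forward of $\boldsymbol{\eta}$ under $\gamma\mapsto\gamma_t$ is at most $Cm$ for every $t\in[0,1]$. A function $u\in L^p(Z)$ belongs to $W^{1,p}(Z)$ if there is a nonnegative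 $g\in L^p(Z)$ such that for every $q$-test plan $\boldsymbol{\eta}$ $$|u(\gamma_1)-u(\gamma_0)|\le\int_0^1 g(\gamma_t)|\gamma'_t|\,dt\quad\text{for }\boldsymbol{\eta}\text{-a.e. }\gamma.$$ There is an $m$-a.e. minimal such $g$, denoted $|Du|$ (the minimal $p$-weak upper gradient; its dependence on $p$ and the metric is suppressed). Functions are identified when equal a.e. Beppo--Levi space. $J^{1,p}(X,Y)$ consists of the $f\in L^p(X\times Y)$ such that $f(x,\cdot)\in W^{1,p}(Y)$ for $\mu$-a.e. $x\in X$, $f(\cdot,y)\in W^{1,p}(X)$ for $\nu$-a.e. $y\in Y$, and $\|(|D_Xf|,|D_Yf|)\|'\in L^p(X\times Y)$, where $|D_Xf|(x,y)=|Df(\cdot,y)|(x)$ and $|D_Yf|(x,y)=|Df(x,\cdot)|(y)$ (taken to be Borel measurable on $X\times Y$; such representatives can be chosen). *)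

theory Defs
  imports "HOL-Analysis.Analysis" "HOL-Probability.Probability"
begin

definition borel_of_metric :: "'z metric \<Rightarrow> 'z measure" where
  "borel_of_metric Z = sigma (mspace Z) {U. openin (mtopology_of Z) U}"

definition metric_measure_space :: "'z metric \<Rightarrow> 'z measure \<Rightarrow> bool" where
  "metric_measure_space Z m \<longleftrightarrow>
     mcomplete_of Z \<and> separable_space (mtopology_of Z) \<and>
     sets m = sets (borel_of_metric Z) \<and>
     (\<forall>B\<in>sets m. Metric_space.mbounded (mspace Z) (mdist Z) B \<longrightarrow> emeasure m B < \<infinity>)"


definition planar_norm :: "(real \<times> real \<Rightarrow> real) \<Rightarrow> bool" where
  "planar_norm N \<longleftrightarrow>
     (\<forall>v. 0 \<le> N v) \<and> (\<forall>v. N v = 0 \<longleftrightarrow> v = 0) \<and>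
     (\<forall>c v. N (c *\<^sub>R v) = \<bar>c\<bar> * N v) \<and>
     (\<forall>v w. N (v + w) \<le> N v + N w) \<and>
     (\<forall>a b a' b'. 0 \<le> a \<and> a \<le> a' \<and> 0 \<le> b \<and> b \<le> b' \<longrightarrow> N (a, b) \<le> N (a', b'))"

definition partial_dual_norm :: "(real \<times> real \<Rightarrow> real) \<Rightarrow> real \<Rightarrow> real \<Rightarrow> real" where
  "partial_dual_norm N a b = Sup {a * t + b * s | t s. 0 \<le> t \<and> 0 \<le> s \<and> N (t, s) \<le> 1}"

definition planar_prod_metric ::
    "(real \<times> real \<Rightarrow> real) \<Rightarrow> 'a metric \<Rightarrow> 'b metric \<Rightarrow> ('a \<times> 'b) metric" where
  "planar_prod_metric N X Y =
     metric (mspace X \<times> mspace Y, \<lambda>(x, y) (x', y'). N (mdist X x x', mdist Y y y'))"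

(* The constructor metric is only specified on genuine metrics; the next lemmas
   confirm that planar_prod_metric is the intended object. *)
lemma Metric_space_planar_prod:
  assumes "planar_norm N"
  shows "Metric_space (mspace X \<times> mspace Y) (\<lambda>(x, y) (x', y'). N (mdist X x x', mdist Y y y'))"
proof
  have N: "\<And>v. 0 \<le> N v" "\<And>v. N v = 0 \<longleftrightarrow> v = 0" "\<And>v w. N (v + w) \<le> N v + N w"
    "\<And>a b a' b'. 0 \<le> a \<Longrightarrow> a \<le> a' \<Longrightarrow> 0 \<le> b \<Longrightarrow> b \<le> b' \<Longrightarrow> N (a, b) \<le> N (a', b')"
    using assms unfolding planar_norm_def by blast+
  let ?d = "\<lambda>(x, y) (x', y'). N (mdist X x x', mdist Y y y')"
  show "0 \<le> ?d u v" for u v by (auto simp: N split: prod.splits)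
  show "?d u v = ?d v u" for u v by (auto simp: mdist_commute split: prod.splits)
  show "?d u v = 0 \<longleftrightarrow> u = v" if "u \<in> mspace X \<times> mspace Y" "v \<in> mspace X \<times> mspace Y" for u v
    using that by (auto simp: N zero_prod_def)
  show "?d u w \<le> ?d u v + ?d v w"
    if mem: "u \<in> mspace X \<times> mspace Y" "v \<in> mspace X \<times> mspace Y" "w \<in> mspace X \<times> mspace Y" for u v w
  proof -
    obtain a b c d e f where eq: "u = (a, b)" "v = (c, d)" "w = (e, f)" by (metis surj_pair)
    have "N (mdist X a e, mdist Y b f) \<le> N (mdist X a c + mdist X c e, mdist Y b d + mdist Y d f)"
      using mem by (intro N(4)) (auto simp: eq mdist_triangle)
    also have "\<dots> \<le> N (mdist X a c, mdist Y b d) + N (mdist X c e, mdist Y d f)"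
      using N(3)[of "(mdist X a c, mdist Y b d)" "(mdist X c e, mdist Y d f)"] by simp
    finally show ?thesis by (simp add: eq)
  qed
qed

lemma mspace_planar_prod_metric [simp]:
  "planar_norm N \<Longrightarrow> mspace (planar_prod_metric N X Y) = mspace X \<times> mspace Y"
  unfolding planar_prod_metric_def
  by (rule Metric_space.mspace_metric[OF Metric_space_planar_prod])

lemma mdist_planar_prod_metric [simp]:
  "planar_norm N \<Longrightarrow>
     mdist (planar_prod_metric N X Y) (x, y) (x', y') = N (mdist X x x', mdist Y y y')"
  unfolding planar_prod_metric_def
  by (simp add: Metric_space.mdist_metric[OF Metric_space_planar_prod])


(* Elements of L^p are represented by measurable real-valued functions;
   identification of functions equal a.e. is expressed with AE where needed. *)
definition Lp_space :: "real \<Rightarrow> 'z measure \<Rightarrow> ('z \<Rightarrow> real) set" where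
  "Lp_space p m = {u \<in> borel_measurable m. integrable m (\<lambda>z. \<bar>u z\<bar> powr p)}"


(* C([0,1];Z) with the uniform distance. Its elements are undefined outside [0,1]. *)
definition curve_space :: "'z metric \<Rightarrow> (real \<Rightarrow> 'z) metric" where
  "curve_space Z = cfunspace (top_of_set {0..1}) Z"

definition abs_continuous_curve :: "'z metric \<Rightarrow> (real \<Rightarrow> 'z) \<Rightarrow> bool" where
  "abs_continuous_curve Z \<gamma> \<longleftrightarrow>
     (\<exists>h :: real \<Rightarrow> real. set_integrable lborel {0..1} h \<and>
        (\<forall>s t. 0 \<le> s \<and> s \<le> t \<and> t \<le> 1 \<longrightarrow>
           mdist Z (\<gamma> s) (\<gamma> t) \<le> (LINT r:{s..t}|lborel. h r)))"

(* For an absolutely continuous curve the limit exists for almost every t in [0,1];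
   the value 0 on the remaining null set is a convention. *)
definition metric_speed :: "'z metric \<Rightarrow> (real \<Rightarrow> 'z) \<Rightarrow> real \<Rightarrow> real" where
  "metric_speed Z \<gamma> t =
     (if \<exists>l. ((\<lambda>s. mdist Z (\<gamma> s) (\<gamma> t) / \<bar>s - t\<bar>) \<longlongrightarrow> l) (at t within {0..1})
      then Lim (at t within {0..1}) (\<lambda>s. mdist Z (\<gamma> s) (\<gamma> t) / \<bar>s - t\<bar>)
      else 0)"

definition test_plan :: "'z metric \<Rightarrow> 'z measure \<Rightarrow> real \<Rightarrow> (real \<Rightarrow> 'z) measure \<Rightarrow> bool" where
  "test_plan Z m q \<eta> \<longleftrightarrow>
     prob_space \<eta> \<and> sets \<eta> = sets (borel_of_metric (curve_space Z)) \<and>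
     (AE \<gamma> in \<eta>. abs_continuous_curve Z \<gamma>) \<and>
     (\<integral>\<^sup>+\<gamma>. (\<integral>\<^sup>+t\<in>{0..1}. ennreal (metric_speed Z \<gamma> t powr q) \<partial>lborel) \<partial>\<eta>) < \<infinity> \<and>
     (\<exists>C>0. \<forall>t\<in>{0..1}. \<forall>A\<in>sets m.
        emeasure (distr \<eta> m (\<lambda>\<gamma>. \<gamma> t)) A \<le> ennreal C * emeasure m A)"

(* The line integral takes values in [0,\<infinity>], so that nonintegrability makes the
   inequality void instead of setting the right-hand side to 0. *)
definition weak_upper_gradient ::
    "'z metric \<Rightarrow> 'z measure \<Rightarrow> real \<Rightarrow> ('z \<Rightarrow> real) \<Rightarrow> ('z \<Rightarrow> real) \<Rightarrow> bool" where
  "weak_upper_gradient Z m p u g \<longleftrightarrow>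
     g \<in> Lp_space p m \<and> (\<forall>z\<in>mspace Z. 0 \<le> g z) \<and>
     (\<forall>\<eta>. test_plan Z m (p / (p - 1)) \<eta> \<longrightarrow>
        (AE \<gamma> in \<eta>. ennreal \<bar>u (\<gamma> 1) - u (\<gamma> 0)\<bar> \<le>
           (\<integral>\<^sup>+t\<in>{0..1}. ennreal (g (\<gamma> t) * metric_speed Z \<gamma> t) \<partial>lborel)))"

definition sobolev_space :: "'z metric \<Rightarrow> 'z measure \<Rightarrow> real \<Rightarrow> ('z \<Rightarrow> real) set" where
  "sobolev_space Z m p = {u \<in> Lp_space p m. \<exists>g. weak_upper_gradient Z m p u g}"

(* |Du|: the minimal weak upper gradient exists for every Sobolev function and is unique
   up to a.e. equality; the choice operator selects a representative. *)
definition minimal_wug ::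
    "'z metric \<Rightarrow> 'z measure \<Rightarrow> real \<Rightarrow> ('z \<Rightarrow> real) \<Rightarrow> 'z \<Rightarrow> real" where
  "minimal_wug Z m p u =
     (SOME g. weak_upper_gradient Z m p u g \<and>
        (\<forall>h. weak_upper_gradient Z m p u h \<longrightarrow> (AE z in m. g z \<le> h z)))"


(* DX is a Borel representative on the product of (x,y) \<mapsto> |Df(.,y)|(x); by Fubini any two
   such representatives agree almost everywhere. Likewise for the second factor. *)
definition partial_gradient_X ::
    "'a metric \<Rightarrow> 'a measure \<Rightarrow> 'b measure \<Rightarrow> real \<Rightarrow> ('a \<times> 'b \<Rightarrow> real) \<Rightarrow> ('a \<times> 'b \<Rightarrow> real) \<Rightarrow> bool" where
  "partial_gradient_X X \<mu> \<nu> p f DX \<longleftrightarrow>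
     DX \<in> borel_measurable (\<mu> \<Otimes>\<^sub>M \<nu>) \<and>
     (AE y in \<nu>. AE x in \<mu>. DX (x, y) = minimal_wug X \<mu> p (\<lambda>x'. f (x', y)) x)"

definition partial_gradient_Y ::
    "'a measure \<Rightarrow> 'b metric \<Rightarrow> 'b measure \<Rightarrow> real \<Rightarrow> ('a \<times> 'b \<Rightarrow> real) \<Rightarrow> ('a \<times> 'b \<Rightarrow> real) \<Rightarrow> bool" where
  "partial_gradient_Y \<mu> Y \<nu> p f DY \<longleftrightarrow>
     DY \<in> borel_measurable (\<mu> \<Otimes>\<^sub>M \<nu>) \<and>
     (AE x in \<mu>. AE y in \<nu>. DY (x, y) = minimal_wug Y \<nu> p (\<lambda>y'. f (x, y')) y)"

definition beppo_levi_space ::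
    "(real \<times> real \<Rightarrow> real) \<Rightarrow> 'a metric \<Rightarrow> 'a measure \<Rightarrow> 'b metric \<Rightarrow> 'b measure \<Rightarrow> real \<Rightarrow>
     ('a \<times> 'b \<Rightarrow> real) set" where
  "beppo_levi_space N X \<mu> Y \<nu> p =
     {f \<in> Lp_space p (\<mu> \<Otimes>\<^sub>M \<nu>).
        (AE x in \<mu>. (\<lambda>y. f (x, y)) \<in> sobolev_space Y \<nu> p) \<and>
        (AE y in \<nu>. (\<lambda>x. f (x, y)) \<in> sobolev_space X \<mu> p) \<and>
        (\<exists>DX DY. partial_gradient_X X \<mu> \<nu> p f DX \<and> partial_gradient_Y \<mu> Y \<nu> p f DY \<and>
           (\<lambda>z. partial_dual_norm N (DX z) (DY z)) \<in> Lp_space p (\<mu> \<Otimes>\<^sub>M \<nu>))}"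

end

theory Submission
  imports Defs
begin

text \<open>
A test plan on each factor gives a test plan on the product: an independent pair of curves, run simultaneously, has metric speed equal to the norm of
the pair of speeds. Plans are stable under affine changes of time, and Fubini over all pairs of affine
clocks gives, along almost every pair of curves, a bound for the increment of \<open>f\<close> in every direction
\<open>(a, b)\<close> of the square of time parameters. Dividing by the length and averaging over rectangles yields
\<open>\<bar>a d\<^sub>1 + b d\<^sub>2\<bar> \<le> g N(\<bar>a\<bar> V, \<bar>b\<bar> W)\<close> almost everywhere, where \<open>d\<^sub>1\<close>, \<open>d\<^sub>2\<close> are the partial slopes of
\<open>f\<close> along the two curves, \<open>V\<close>, \<open>W\<close> their speeds and \<open>g\<close> is a weak upper gradient on the product
(\<open>flux_AE\<close>). Only averages pass to the limit, so the values of \<open>f\<close> on null sets do not matter.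
The right choice of direction turns this into \<open>t \<bar>d\<^sub>1\<bar> W + s \<bar>d\<^sub>2\<bar> V \<le> g V W\<close> whenever \<open>N(t, s) \<le> 1\<close>.

For a fixed first curve the last inequality says that \<open>(g - t \<bar>d\<^sub>1\<bar> / V)\<^sup>+ / s\<close> is a weak upper gradient
of a slice of \<open>f\<close>, hence dominates the minimal one, \<open>D\<^sub>Y\<close>. Reading the result as a bound for \<open>\<bar>d\<^sub>1\<bar>\<close>,
\<open>(g - s D\<^sub>Y)\<^sup>+ / t\<close> is a weak upper gradient of a slice in the other factor and dominates \<open>D\<^sub>X\<close>. So
\<open>t D\<^sub>X + s D\<^sub>Y \<le> g\<close> (\<open>gradient_sum_le\<close>), and the supremum over rational \<open>(t, s)\<close> is the claim.

Two facts make the passage to slices rigorous. Countably many test plans decide whether a function is a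
weak upper gradient (\<open>countable_test_plans\<close>), so exceptional sets can be united. And the minimal
gradients of all slices of a function form one jointly measurable function (\<open>minimal_slice_gradient\<close>):
it is the supremum, over these plans and rational \<open>c\<close>, of \<open>c\<close> times the indicator of the essential
image of the set where the slope exceeds \<open>c\<close> times the speed. Existence of minimal gradients, on the
product space too, is the case of a one-point parameter space.
\<close>

abbreviation (input) pair_product :: "'a measure => 'b measure => ('a \<times> 'b) measure" (infixr "><" 80) where "M >< M' == M \<Otimes>\<^sub>M M'"
abbreviation (input) "Borel == borel_measurable"
abbreviation (input) tends_to (infixr "---->" 60) where "x ----> l == x \<longlonglongrightarrow> l"
abbreviation (input) "separable Z == separable_space (mtopology_of Z)"
abbreviation (input) "curves Z == mspace (curve_space Z)"
abbreviation (input) "ac_curve == abs_continuous_curve"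

section \<open>Differentiation of indefinite integrals\<close>

text \<open>The measure with density \<open>k\<close> does not charge the zero set of \<open>k\<close>. By outer
regularity and the Vitali covering theorem, the points of this set at which the averages do not tend to zero
form a null set.\<close>
lemma AE_zero_density:
 fixes k :: "real => real"
 assumes k: "integrable lborel k" and pos: "!!x. 0 <= k x"
 shows "AE t in lborel. k t = 0 -->
  ((%r. (LINT x:{t-r..t+r}|lborel. k x) / r) \<longlongrightarrow> 0) (at_right 0)"
proof -
 let ?\<nu> = "density lborel (%x. ennreal (k x))"
 have km[measurable]: "k : Borel borel" using k by simp
 have si: "set_integrable lborel A k" if "A : sets borel" for A
  unfolding set_integrable_def using k that by (intro integrable_mult_indicator) auto
 have si_nonneg: "0 <= (LINT x:A|lborel. k x)" for A
  unfolding set_lebesgue_integral_def by (intro integral_nonneg_AE) (auto simp: pos)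
 have em: "emeasure ?\<nu> A = ennreal (LINT x:A|lborel. k x)" if A: "A : sets borel" for A
 proof -
  have "emeasure ?\<nu> A = (\<integral>\<^sup>+x. ennreal (indicator A x *\<^sub>R k x) \<partial>lborel)"
   using A by (subst emeasure_density) (auto intro!: nn_integral_cong simp: indicator_def)
  also have "... = ennreal (LINT x:A|lborel. k x)"
   unfolding set_lebesgue_integral_def
   using si[OF A] unfolding set_integrable_def
   by (intro nn_integral_eq_integral) (auto simp: pos)
  finally show ?thesis .
 qed
 define E where "E \<epsilon> = {t. k t = 0 & (ALL d>0. EX r. 0 < r & r < d & (LINT x:{t-r..t+r}|lborel. k x) > \<epsilon> * r)}" for \<epsilon> :: real
 have negE: "negligible (E \<epsilon>)" if \<epsilon>: "\<epsilon> > 0" for \<epsilon>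
 proof (clarsimp simp: negligible_outer_le)
  fix e :: real assume e: "e > 0"
  define \<delta> where "\<delta> = e * \<epsilon> / 2"
  have \<delta>: "\<delta> > 0" using e \<epsilon> by (simp add: \<delta>_def)
  \<comment> \<open>the zero set of k is null for the measure with density k, so it has small neighbourhoods\<close>
  have fin: "finite_measure ?\<nu>"
   using em[of UNIV] by (intro finite_measureI) (simp add: space_density)
  have Z: "{x. k x = 0} : sets borel" by measurable
  have Z0: "emeasure ?\<nu> {x. k x = 0} = 0"
   using Z by (subst emeasure_density) (auto intro!: nn_integral_zero' AE_I2 simp: indicator_def)
  obtain U where U: "open U" "{x. k x = 0} \<subseteq> U" "emeasure ?\<nu> U < ennreal \<delta>"
  proof -
   have "emeasure ?\<nu> {x. k x = 0} = (INF U\<in>{U. {x. k x = 0} \<subseteq> U & open U}. emeasure ?\<nu> U)"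
    by (rule outer_regular) (use Z em[of UNIV] in \<open>auto simp: space_density\<close>)
   then have "(INF U\<in>{U. {x. k x = 0} \<subseteq> U & open U}. emeasure ?\<nu> U) < ennreal \<delta>"
    using Z0 \<delta> by simp
   then show thesis using that unfolding INF_less_iff by auto
  qed
  define K where "K = {(t,r). 0 < r & {t-r..t+r} \<subseteq> U & (LINT x:{t-r..t+r}|lborel. k x) > \<epsilon> * r}"
  have cb: "cball (fst i) (snd i) = {fst i - snd i..fst i + snd i}" for i :: "real \<times> real"
   by (auto simp: cball_def dist_real_def)
  obtain C where C: "countable C" "C \<subseteq> K"
   and pw: "pairwise (%i j. disjnt (cball (fst i) (snd i)) (cball (fst j) (snd j))) C"
   and neg: "negligible (E \<epsilon> - (\<Union>i\<in>C. cball (fst i) (snd i)))"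
  proof (rule Vitali_covering_theorem_cballs[of K snd "E \<epsilon>" fst])
   show "0 < snd i" if "i : K" for i using that by (auto simp: K_def)
   show "EX i. i : K & x : cball (fst i) (snd i) & snd i < d" if x: "x : E \<epsilon>" "0 < d" for x d
   proof -
    have "x : U" using x U by (auto simp: E_def)
    then obtain \<rho> where \<rho>: "\<rho> > 0" "cball x \<rho> \<subseteq> U" using U(1) open_contains_cball by blast
    have "min d \<rho> > 0" using x \<rho> by simp
    then obtain r where r: "0 < r" "r < min d \<rho>" "(LINT y:{x-r..x+r}|lborel. k y) > \<epsilon> * r"
     using x unfolding E_def by blast
    have "{x-r..x+r} \<subseteq> U" using \<rho>(2) r(2) by (auto simp: cball_def dist_real_def subset_iff)
    then show ?thesis using r by (intro exI[of _ "(x,r)"]) (auto simp: K_def)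
   qed
  qed auto
  have djf: "disjoint_family_on (%i. {fst i - snd i..fst i + snd i}) C"
   using pw unfolding cb disjoint_family_on_def pairwise_def disjnt_def by blast
  have sub: "(\<Union>i\<in>C. {fst i - snd i..fst i + snd i}) \<subseteq> U"
  proof (rule UN_least)
   fix i assume "i : C"
   then have "i : K" using C(2) by blast
   then show "{fst i - snd i..fst i + snd i} \<subseteq> U" by (cases i) (simp add: K_def)
  qed
  have "emeasure lborel (\<Union>i\<in>C. {fst i - snd i..fst i + snd i}) =
    (\<integral>\<^sup>+i. emeasure lborel {fst i - snd i..fst i + snd i} \<partial>count_space C)"
   by (rule emeasure_UN_countable[OF _ C(1) djf]) auto
  also have "... <= (\<integral>\<^sup>+i. ennreal (2/\<epsilon>) * emeasure ?\<nu> {fst i - snd i..fst i + snd i} \<partial>count_space C)"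
  proof (rule nn_integral_mono)
   fix i assume "i : space (count_space C)"
   then have i: "i : K" using C by auto
   then have "0 < snd i" and *: "\<epsilon> * snd i < (LINT x:{fst i-snd i..fst i+snd i}|lborel. k x)"
    by (auto simp: K_def)
   have "2 * snd i <= 2/\<epsilon> * (LINT x:{fst i-snd i..fst i+snd i}|lborel. k x)"
    using * \<epsilon> by (simp add: field_simps)
   then show "emeasure lborel {fst i - snd i..fst i + snd i} <= ennreal (2/\<epsilon>) * emeasure ?\<nu> {fst i - snd i..fst i + snd i}"
    using \<open>0 < snd i\<close> \<epsilon> si_nonneg by (simp add: em ennreal_mult'[symmetric] ennreal_le_iff)
  qed
  also have "... = ennreal (2/\<epsilon>) * emeasure ?\<nu> (\<Union>i\<in>C. {fst i - snd i..fst i + snd i})"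
   by (subst emeasure_UN_countable[OF _ C(1) djf]) (auto simp: nn_integral_cmult)
  also have "... <= ennreal (2/\<epsilon>) * emeasure ?\<nu> U"
   using sub U(1) by (intro mult_left_mono emeasure_mono) auto
  also have "... <= ennreal (2/\<epsilon>) * ennreal \<delta>" using U(3) by (intro mult_left_mono) auto
  also have "... = ennreal e" using \<epsilon> \<delta> by (simp add: ennreal_mult'[symmetric] \<delta>_def)
  finally have le: "emeasure lborel (\<Union>i\<in>C. {fst i - snd i..fst i + snd i}) <= ennreal e" .
  let ?W = "\<Union>i\<in>C. {fst i - snd i..fst i + snd i}"
  have Wb: "?W : sets borel" using C(1) by (intro sets.countable_UN') auto
  have lw: "?W : lmeasurable"
   using le Wb by (intro fmeasurableI) (auto simp: emeasure_completion less_top top_unique dest: order_le_less_trans[OF _ ennreal_less_top])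
  have mW: "measure lebesgue ?W <= e"
   using le Wb e by (simp add: measure_def enn2real_leI)
  have N: "E \<epsilon> - ?W : lmeasurable" "measure lebesgue (E \<epsilon> - ?W) = 0"
   using neg unfolding cb by (auto simp: negligible_imp_measurable negligible_imp_measure0)
  show "EX T. E \<epsilon> \<subseteq> T & T : lmeasurable & measure lebesgue T <= e"
  proof (intro exI conjI)
   show "E \<epsilon> \<subseteq> ?W \<union> (E \<epsilon> - ?W)" by blast
   show "?W \<union> (E \<epsilon> - ?W) : lmeasurable" by (rule fmeasurable.Un[OF lw N(1)])
   have "measure lebesgue (?W \<union> (E \<epsilon> - ?W)) <= measure lebesgue ?W + measure lebesgue (E \<epsilon> - ?W)"
    by (intro measure_Un_le) (use lw N in auto)
   then show "measure lebesgue (?W \<union> (E \<epsilon> - ?W)) <= e" using mW N by simp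
  qed
 qed
 have "negligible (\<Union>n::nat. E (1 / Suc n))" by (intro negligible_countable_Union) (auto intro: negE)
 then have "AE t in lebesgue. t ~: (\<Union>n::nat. E (1 / Suc n))"
  by (intro AE_not_in) (simp add: negligible_iff_null_sets)
 then have "AE t in lborel. t ~: (\<Union>n::nat. E (1 / Suc n))" by (simp add: AE_completion_iff)
 then show ?thesis
 proof (eventually_elim, intro impI)
  fix t assume t: "t ~: (\<Union>n::nat. E (1 / Suc n))" and kt: "k t = 0"
  show "((%r. (LINT x:{t-r..t+r}|lborel. k x) / r) \<longlongrightarrow> 0) (at_right 0)"
  proof (rule tendstoI)
   fix e :: real assume "e > 0"
   then obtain n where n: "1 / Suc n < e" using nat_approx_posE by blast
   have "t ~: E (1 / Suc n)" using t by auto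
   then obtain d where d: "d > 0" "!!r. 0 < r ==> r < d ==> (LINT x:{t-r..t+r}|lborel. k x) <= (1/Suc n) * r"
    using kt unfolding E_def by force
   show "\<forall>\<^sub>F r in at_right 0. dist ((LINT x:{t-r..t+r}|lborel. k x) / r) 0 < e"
    unfolding eventually_at_right_field
   proof (intro exI[of _ d] conjI allI impI d(1))
    fix r assume r: "0 < r" "r < d"
    have "(LINT x:{t-r..t+r}|lborel. k x) / r <= 1/Suc n"
     using d(2)[OF r] r by (simp add: divide_le_eq)
    then show "dist ((LINT x:{t-r..t+r}|lborel. k x) / r) 0 < e"
     using n si_nonneg r by (simp add: dist_real_def)
   qed
  qed
 qed
qed

definition prim :: "(real => real) => real => real" where
 "prim h t = (LINT x:{..t}|lborel. h x)"

lemma integrable_indicator_mult: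
 fixes h :: "'a => real"
 assumes "integrable M h" "A : sets M"
 shows "integrable M (%x. indicator A x * h x)"
 using integrable_mult_indicator[OF assms(2,1)] by simp

lemma prim_diff:
 assumes h: "integrable lborel h" and st: "s <= t"
 shows "prim h t - prim h s = (LINT x:{s<..t}|lborel. h x)"
proof -
 have hm[measurable]: "h : Borel borel" using h by simp
 have si: "integrable lborel (%x. indicator {..u} x *\<^sub>R h x)" for u
  using h by (intro integrable_mult_indicator) auto
 have "prim h t - prim h s = (LINT x|lborel. indicator {..t} x *\<^sub>R h x - indicator {..s} x *\<^sub>R h x)"
  unfolding prim_def set_lebesgue_integral_def by (rule Bochner_Integration.integral_diff[OF si si, symmetric])
 also have "... = (LINT x:{s<..t}|lborel. h x)"
  unfolding set_lebesgue_integral_def using st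
  by (intro Bochner_Integration.integral_cong) (auto simp: indicator_def)
 finally show ?thesis .
qed

lemma prim_diff_nn:
 assumes h: "integrable lborel h" and pos: "!!x. 0 <= h x" and st: "s <= t"
 shows "ennreal (prim h t - prim h s) = (\<integral>\<^sup>+x\<in>{s..t}. ennreal (h x) \<partial>lborel)"
proof -
 have hm[measurable]: "h : Borel borel" using h by simp
 have "(\<integral>\<^sup>+x\<in>{s..t}. ennreal (h x) \<partial>lborel) = (\<integral>\<^sup>+x. ennreal (indicator {s<..t} x *\<^sub>R h x) \<partial>lborel)"
 proof (rule nn_integral_cong_AE)
  have "AE x in lborel. x ~= s" by (rule AE_lborel_singleton)
  then show "AE x in lborel. ennreal (h x) * indicator {s..t} x = ennreal (indicator {s<..t} x *\<^sub>R h x)"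
   by eventually_elim (auto simp: indicator_def)
 qed
 also have "... = ennreal (LINT x:{s<..t}|lborel. h x)"
  unfolding set_lebesgue_integral_def
  by (rule nn_integral_eq_integral) (use h pos in \<open>auto intro!: integrable_indicator_mult\<close>)
 finally show ?thesis using prim_diff[OF h st] by simp
qed

lemma prim_mono:
 assumes h: "integrable lborel h" and pos: "!!x. 0 <= h x" and st: "s <= t"
 shows "prim h s <= prim h t"
proof -
 have "0 <= (LINT x:{s<..t}|lborel. h x)" unfolding set_lebesgue_integral_def using pos by (intro Bochner_Integration.integral_nonneg) simp
 then show ?thesis using prim_diff[OF h st] by simp
qed

lemma prim_add:
 assumes "integrable lborel f" "integrable lborel g"
 shows "prim (%x. f x + g x) t = prim f t + prim g t"
 unfolding prim_def
 by (rule set_integral_add) (use assms in \<open>auto simp: set_integrable_def intro!: integrable_indicator_mult\<close>)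

lemma prim_diff_fun:
 assumes "integrable lborel f" "integrable lborel g"
 shows "prim (%x. f x - g x) t = prim f t - prim g t"
 unfolding prim_def
 by (rule set_integral_diff) (use assms in \<open>auto simp: set_integrable_def intro!: integrable_indicator_mult\<close>)

lemma prim_uminus: "prim (%x. - f x) t = - prim f t"
 unfolding prim_def set_lebesgue_integral_def by simp

lemma isCont_prim:
 assumes h: "integrable lborel h"
 shows "isCont (prim h) t"
proof -
 have hm[measurable]: "h : Borel borel" using h by simp
 show ?thesis unfolding continuous_at_sequentially comp_def
 proof (intro allI impI)
  fix x :: "nat => real" assume x: "x ----> t"
  show "(%n. prim h (x n)) ----> prim h t"
   unfolding prim_def set_lebesgue_integral_def
  proof (rule integral_dominated_convergence[where w="%x. norm (h x)"])
   have "AE y in lborel. y ~= t" by (rule AE_lborel_singleton)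
   then show "AE y in lborel. (%i. indicator {..x i} y *\<^sub>R h y) ----> indicator {..t} y *\<^sub>R h y"
   proof eventually_elim
    case (elim y)
    then consider "y < t" | "t < y" by linarith
    then have "\<forall>\<^sub>F i in sequentially. indicator {..x i} y *\<^sub>R h y = indicator {..t} y *\<^sub>R h y"
    proof cases
     case 1
     from order_tendstoD(1)[OF x 1] show ?thesis by eventually_elim (use 1 in \<open>auto simp: indicator_def\<close>)
    next
     case 2
     from order_tendstoD(2)[OF x 2] show ?thesis by eventually_elim (use 2 in \<open>auto simp: indicator_def\<close>)
    qed
    then show ?case
     by (rule tendsto_eventually)
   qed
  qed (use h in \<open>auto simp: indicator_def\<close>)
 qed
qed

text \<open>Lebesgue differentiation: apply the preceding lemma to the truncated excess of \<open>h\<close> over each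
rational level, and likewise for \<open>- h\<close>.\<close>
theorem AE_prim_has_derivative:
 assumes h: "integrable lborel h"
 shows "AE t in lborel. (prim h has_real_derivative h t) (at t)"
proof -
 have hm[measurable]: "h : Borel borel" using h by simp
 define kk where "kk \<psi> c n x = indicator {-real n<..<real n} x * max 0 (\<psi> x - c)" for \<psi> :: "real => real" and c n x
 have ki: "integrable lborel (kk \<psi> c n)" if \<psi>: "integrable lborel \<psi>" for \<psi> c n
 proof (rule Bochner_Integration.integrable_bound)
  have \<psi>m[measurable]: "\<psi> : Borel borel" using \<psi> by simp
  show "integrable lborel (%x. \<bar>\<psi> x\<bar> + indicator {-real n<..<real n} x *\<^sub>R \<bar>c\<bar>)"
   using \<psi> by (auto intro!: integrable_indicator)
  show "kk \<psi> c n : Borel lborel" unfolding kk_def[abs_def] by measurable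
  show "AE x in lborel. norm (kk \<psi> c n x) <= norm (\<bar>\<psi> x\<bar> + indicator {-real n<..<real n} x *\<^sub>R \<bar>c\<bar>)"
   unfolding kk_def by (auto simp: indicator_def max_def)
 qed
 have dens: "AE t in lborel. ALL c:\<rat>. ALL n. kk \<psi> c n t = 0 -->
   ((%r. (LINT x:{t-r..t+r}|lborel. kk \<psi> c n x) / r) \<longlongrightarrow> 0) (at_right 0)"
  if \<psi>: "integrable lborel \<psi>" for \<psi>
  unfolding AE_ball_countable[OF countable_rat] AE_all_countable
  by (intro ballI allI AE_zero_density ki \<psi>) (simp add: kk_def)
 have upper: "AE t in lborel. ALL e>0. EX d>0. ALL a b. a < b & a <= t & t <= b & b - a < d & (a = t \<or> b = t) -->
   prim \<psi> b - prim \<psi> a <= (\<psi> t + e) * (b - a)"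
  if \<psi>: "integrable lborel \<psi>" for \<psi>
  using dens[OF \<psi>]
 proof eventually_elim
  case (elim t)
  note D = elim(1)
  show ?case
  proof (intro allI impI)
   fix e :: real assume e: "e > 0"
   obtain c where c: "c : \<rat>" "\<psi> t < c" "c < \<psi> t + e / 2" using Rats_dense_in_real[of "\<psi> t" "\<psi> t + e/2"] e by auto
   obtain n :: nat where n: "\<bar>t\<bar> < real n" using reals_Archimedean2 by blast
   have "kk \<psi> c n t = 0" using c by (simp add: kk_def)
   then have "((%r. (LINT x:{t-r..t+r}|lborel. kk \<psi> c n x) / r) \<longlongrightarrow> 0) (at_right 0)" using D c by blast
   then have "\<forall>\<^sub>F r in at_right 0. (LINT x:{t-r..t+r}|lborel. kk \<psi> c n x) / r < e/2"
    by (rule order_tendstoD) (use e in simp)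
   then obtain d where d: "d > 0" "!!r. 0 < r ==> r < d ==> (LINT x:{t-r..t+r}|lborel. kk \<psi> c n x) / r < e/2"
    unfolding eventually_at_right_field by auto
   show "EX d>0. ALL a b. a < b & a <= t & t <= b & b - a < d & (a = t \<or> b = t) -->
    prim \<psi> b - prim \<psi> a <= (\<psi> t + e) * (b - a)"
   proof (intro exI[of _ "min d (real n - \<bar>t\<bar>)"] conjI allI impI)
    show "0 < min d (real n - \<bar>t\<bar>)" using d n by simp
    fix a b assume ab: "a < b & a <= t & t <= b & b - a < min d (real n - \<bar>t\<bar>) & (a = t \<or> b = t)"
    define r where "r = b - a"
    have r: "0 < r" "r < d" "r < real n - \<bar>t\<bar>" and ab': "a < b" "t - r <= a" "b <= t + r" using ab by (auto simp: r_def)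
    have sik: "set_integrable lborel A (kk \<psi> c n)" if "A : sets borel" for A
     using ki[OF \<psi>] that unfolding set_integrable_def by (intro integrable_mult_indicator) auto
    have "prim \<psi> b - prim \<psi> a = (LINT x:{a<..b}|lborel. \<psi> x)" using ab' by (intro prim_diff[OF \<psi>]) simp
    also have "... <= (LINT x:{a<..b}|lborel. c + kk \<psi> c n x)"
    proof (rule set_integral_mono)
     show "set_integrable lborel {a<..b} \<psi>" using \<psi> unfolding set_integrable_def by (intro integrable_mult_indicator) auto
     show "set_integrable lborel {a<..b} (%x. c + kk \<psi> c n x)"
      by (intro set_integral_add sik) (use ab' in \<open>auto simp: set_integrable_def intro!: integrable_mult_left integrable_real_indicator\<close>)
     fix x assume "x : {a<..b}"
     then have "x : {-real n<..<real n}" using ab' r by auto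
     then show "\<psi> x <= c + kk \<psi> c n x" by (simp add: kk_def)
    qed
    also have "... = c * (b - a) + (LINT x:{a<..b}|lborel. kk \<psi> c n x)"
    proof -
     have "integrable lborel (indicat_real {a<..b})" using ab' by (intro integrable_real_indicator) auto
     then show ?thesis using ab'
      by (subst set_integral_add(2)[OF _ sik]) (auto simp: set_integrable_def set_lebesgue_integral_def)
    qed
    also have "(LINT x:{a<..b}|lborel. kk \<psi> c n x) <= (LINT x:{t-r..t+r}|lborel. kk \<psi> c n x)"
     unfolding set_lebesgue_integral_def
    proof (rule integral_mono)
     show "integrable lborel (%x. indicat_real {a<..b} x *\<^sub>R kk \<psi> c n x)"
      "integrable lborel (%x. indicat_real {t - r..t + r} x *\<^sub>R kk \<psi> c n x)"
      using sik unfolding set_integrable_def by auto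
    qed (use ab' in \<open>auto simp: indicator_def kk_def\<close>)
    also have "... <= e/2 * (b - a)" using d(2)[OF r(1,2)] r unfolding r_def by (simp add: divide_less_eq)
    also have "c * (b - a) + e/2 * (b - a) <= (\<psi> t + e) * (b - a)"
    proof -
     have "(c + e/2) * (b - a) <= (\<psi> t + e) * (b - a)" using c ab' by (intro mult_right_mono) auto
     then show ?thesis by (simp add: distrib_right)
    qed
    finally show "prim \<psi> b - prim \<psi> a <= (\<psi> t + e) * (b - a)" by simp
   qed
  qed
 qed
 have h': "integrable lborel (%x. - h x)" using h by simp
 show ?thesis using upper[OF h] upper[OF h']
 proof eventually_elim
  case (elim t)
  note U1 = elim(1) and U2 = elim(2)
  show ?case
   unfolding has_field_derivative_iff
  proof (rule tendstoI)
   fix e :: real assume e: "e > 0"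
   then have "e/2 > 0" by simp
   from U1[rule_format, OF this] obtain d1 where d1: "d1 > 0" "!!a b. a < b ==> a <= t ==> t <= b ==> b - a < d1 ==> a = t \<or> b = t ==>
    prim h b - prim h a <= (h t + e/2) * (b - a)" by blast
   from U2[rule_format, OF \<open>e/2 > 0\<close>] obtain d2 where d2: "d2 > 0" "!!a b. a < b ==> a <= t ==> t <= b ==> b - a < d2 ==> a = t \<or> b = t ==>
    prim (%x. - h x) b - prim (%x. - h x) a <= (- h t + e/2) * (b - a)" by blast
   show "\<forall>\<^sub>F y in at t. dist ((prim h y - prim h t) / (y - t)) (h t) < e"
    unfolding eventually_at
   proof (intro exI[of _ "min d1 d2"] conjI ballI impI)
    show "0 < min d1 d2" using d1 d2 by simp
    fix y assume y: "y ~= t & dist y t < min d1 d2"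
    define a where "a = min y t" define b where "b = max y t"
    have ab: "a < b" "a <= t" "t <= b" "b - a < d1" "b - a < d2" "a = t \<or> b = t"
     using y by (auto simp: a_def b_def dist_real_def)
    have q: "(prim h y - prim h t) / (y - t) = (prim h b - prim h a) / (b - a)"
     using y by (auto simp: a_def b_def min_def max_def field_simps)
    have "(prim h b - prim h a) / (b - a) <= h t + e/2"
     using d1(2)[OF ab(1,2,3,4,6)] ab(1) by (simp add: divide_le_eq)
    moreover have "(prim h b - prim h a) / (b - a) \<ge> h t - e/2"
     using d2(2)[OF ab(1,2,3,5,6)] ab(1) by (simp add: le_divide_eq prim_uminus algebra_simps)
    ultimately show "dist ((prim h y - prim h t) / (y - t)) (h t) < e"
     using e unfolding q dist_real_def by linarith
   qed
  qed
 qed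
qed

lemma AE_nonneg_if_prim_mono:
 assumes k: "integrable lborel k" and S: "open S"
  and mono: "!!s t. s : \<rat> ==> t : \<rat> ==> s < t ==> {s..t} \<subseteq> S ==> prim k s <= prim k t"
 shows "AE t in lborel. t : S --> 0 <= k t"
 using AE_prim_has_derivative[OF k]
proof (eventually_elim, intro impI)
 fix t assume D: "(prim k has_real_derivative k t) (at t)" and t: "t : S"
 show "0 <= k t"
 proof (rule ccontr)
  assume "\<not> 0 <= k t"
  then have neg: "k t < 0" by simp
  obtain d where d: "d > 0" "!!x. \<bar>x - t\<bar> < d ==> x : S" using S t by (auto simp: open_dist dist_real_def)
  obtain d1 where d1: "d1 > 0" "!!h. h > 0 ==> h < d1 ==> prim k (t + h) < prim k t"
   using DERIV_neg_dec_right[OF D neg] by blast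
  obtain d2 where d2: "d2 > 0" "!!h. h > 0 ==> h < d2 ==> prim k (t - h) > prim k t"
   using DERIV_neg_dec_left[OF D neg] by blast
  obtain v where v: "v : \<rat>" "t < v" "v < t + min d d1" using Rats_dense_in_real[of t "t + min d d1"] d d1 by auto
  obtain u where u: "u : \<rat>" "t - min d d2 < u" "u < t" using Rats_dense_in_real[of "t - min d d2" t] d d2 by auto
  have "prim k u <= prim k v"
  proof (rule mono[OF u(1) v(1)])
   show "{u..v} \<subseteq> S" using u v by (auto intro!: d(2))
  qed (use u v in simp)
  moreover have "prim k v < prim k t" using d1(2)[of "v - t"] v by simp
  moreover have "prim k u > prim k t" using d2(2)[of "t - u"] u by simp
  ultimately show False by simp
 qed
qed

lemma AE_abs_le_if_prim:
 assumes d: "integrable lborel d" and h: "integrable lborel h"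
  and le: "!!s t. s : \<rat> ==> t : \<rat> ==> s < t ==> \<bar>prim d t - prim d s\<bar> <= prim h t - prim h s"
 shows "AE t in lborel. \<bar>d t\<bar> <= h t"
proof -
 have "AE t in lborel. t : UNIV --> 0 <= h t - d t"
 proof (rule AE_nonneg_if_prim_mono)
  show "prim (%x. h x - d x) s <= prim (%x. h x - d x) t" if "s : \<rat>" "t : \<rat>" "s < t" for s t
   using le[OF that] unfolding prim_diff_fun[OF h d] by linarith
 qed (use d h in auto)
 moreover have "AE t in lborel. t : UNIV --> 0 <= h t + d t"
 proof (rule AE_nonneg_if_prim_mono)
  show "prim (%x. h x + d x) s <= prim (%x. h x + d x) t" if "s : \<rat>" "t : \<rat>" "s < t" for s t
   using le[OF that] unfolding prim_add[OF h d] by linarith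
 qed (use d h in auto)
 ultimately show ?thesis by eventually_elim auto
qed

text \<open>Adding \<open>F\<close> to the primitive of \<open>h\<close>, and subtracting it, gives two monotone
continuous functions. Their Stieltjes measures add up to the measure with density \<open>2 h\<close>, so
each of them has a density.\<close>
lemma ac_imp_prim:
 assumes h: "integrable lborel h" and pos: "!!x. 0 <= h x"
  and F: "!!s t. s <= t ==> \<bar>F t - F s\<bar> <= prim h t - prim h s"
 obtains d where "integrable lborel d" "AE t in lborel. \<bar>d t\<bar> <= h t"
  "!!s t. F t - F s = prim d t - prim d s"
proof -
 have hm[measurable]: "h : Borel borel" using h by simp
 define G where "G b t = prim h t + (if b then F t else - F t)" for b :: bool and t
 have G_mono: "G b s <= G b t" if "s <= t" for b s t
  using F[OF that] by (auto simp: G_def)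
 have G_cont: "isCont (G b) t" for b t
 proof -
  have cF: "isCont F t" unfolding isCont_def LIM_def
  proof (intro allI impI)
   fix e :: real assume "0 < e"
   then obtain d where d: "d > 0" "!!x. dist x t < d ==> dist (prim h x) (prim h t) < e"
    using isCont_prim[OF h, of t] unfolding continuous_at_eps_delta by (auto simp: dist_real_def)
   have "dist (F x) (F t) <= dist (prim h x) (prim h t)" for x
    using F[of x t] F[of t x] by (cases "x <= t") (auto simp: dist_real_def)
   then show "EX s>0. ALL x. x ~= t & dist x t < s --> dist (F x) (F t) < e"
    using d by (meson le_less_trans)
  qed
  show ?thesis unfolding G_def[abs_def] using isCont_prim[OF h] cF by (cases b) (auto intro!: continuous_intros)
 qed
 have em: "emeasure (interval_measure (G b)) {x<..y} = ennreal (G b y - G b x)" if "x <= y" for b x y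
  using that by (intro emeasure_interval_measure_Ioc G_mono) (auto intro: continuous_at_imp_continuous_within G_cont)
 define M where "M = measure_of UNIV (sets borel) (%A. emeasure (interval_measure (G True)) A + emeasure (interval_measure (G False)) A)"
 have sM: "sets M = sets borel" unfolding M_def by (simp add: sets.sigma_sets_eq[of borel, simplified] flip: space_borel)
 have eM: "emeasure M A = emeasure (interval_measure (G True)) A + emeasure (interval_measure (G False)) A" if "A : sets borel" for A
  unfolding M_def
 proof (rule emeasure_measure_of_sigma)
  show "sigma_algebra UNIV (sets borel)" using sets.sigma_algebra_axioms[of borel] by simp
  show "positive (sets borel) (%A. emeasure (interval_measure (G True)) A + emeasure (interval_measure (G False)) A)"
   by (auto simp: positive_def)
  show "countably_additive (sets borel) (%A. emeasure (interval_measure (G True)) A + emeasure (interval_measure (G False)) A)"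
   by (auto intro!: countably_additiveI simp: suminf_add[symmetric] suminf_emeasure)
 qed fact
 have M_eq: "M = density lborel (%x. ennreal (2 * h x))"
 proof (rule measure_eqI_generator_eq[where \<Omega>=UNIV and E="range (%(a, b). {a<..b::real})" and A="%i::nat. {- real i<..real i}"])
  show "Int_stable (range (%(a, b). {a<..b::real}))"
  proof (rule Int_stableI)
   fix a b assume "a : range (%(a, b). {a<..b::real})" "b : range (%(a, b). {a<..b::real})"
   then obtain x y u v where "a = {x<..y}" "b = {u<..v}" by auto
   then have "a \<inter> b = {max x u<..min y v}" by auto
   then show "a \<inter> b : range (%(a, b). {a<..b::real})" by auto
  qed
  have b1: "borel = sigma UNIV (range (%(a, b). {a<..b::real}))" by (rule borel_sigma_sets_Ioc)
  have "sets (borel::real measure) = sigma_sets UNIV (range (%(a, b). {a<..b::real}))"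
   by (subst b1) simp
  then show "sets M = sigma_sets UNIV (range (%(a, b). {a<..b::real}))"
   "sets (density lborel (%x. ennreal (2 * h x))) = sigma_sets UNIV (range (%(a, b). {a<..b::real}))"
   using sM by auto
  have eqI: "emeasure M {x<..y} = emeasure (density lborel (%x. ennreal (2 * h x))) {x<..y}" for x y
  proof (cases "x <= y")
   case True
   have "emeasure M {x<..y} = ennreal (G True y - G True x) + ennreal (G False y - G False x)"
    by (subst eM) (auto simp: em[OF True])
   also have "... = ennreal 2 * ennreal (prim h y - prim h x)"
    using G_mono[OF True, of True] G_mono[OF True, of False] prim_mono[OF h pos True]
    by (subst ennreal_plus[symmetric], simp, simp, subst ennreal_mult'[symmetric])
     (simp_all add: G_def del: ennreal_plus ennreal_numeral)
   also have "ennreal (prim h y - prim h x) = (\<integral>\<^sup>+z. ennreal (indicator {x<..y} z *\<^sub>R h z) \<partial>lborel)"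
    unfolding prim_diff[OF h True] set_lebesgue_integral_def
    by (rule nn_integral_eq_integral[symmetric]) (use h pos in \<open>auto intro!: integrable_indicator_mult\<close>)
   also have "ennreal 2 * ... = (\<integral>\<^sup>+z. ennreal 2 * ennreal (indicator {x<..y} z *\<^sub>R h z) \<partial>lborel)"
    by (rule nn_integral_cmult[symmetric]) auto
   also have "... = emeasure (density lborel (%x. ennreal (2 * h x))) {x<..y}"
    by (subst emeasure_density) (auto intro!: nn_integral_cong simp: indicator_def ennreal_mult')
   finally show ?thesis .
  qed simp
  show "!!X. X : range (%(a, b). {a<..b}) ==> emeasure M X = emeasure (density lborel (%x. ennreal (2 * h x))) X"
   using eqI by auto
  show "(\<Union>i::nat. {- real i<..real i}) = UNIV"
  proof (intro set_eqI iffI UNIV_I)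
   fix x :: real
   obtain n :: nat where "\<bar>x\<bar> < real n" using reals_Archimedean2 by blast
   then show "x : (\<Union>i::nat. {- real i<..real i})" by (auto intro!: exI[of _ n])
  qed
  show "emeasure M {- real i<..real i} ~= \<infinity>" for i
   by (subst eM) (auto simp: em)
 qed auto
 let ?M = "interval_measure (G True)"
 have le: "emeasure ?M A <= emeasure (density lborel (%x. ennreal (2 * h x))) A" if "A : sets borel" for A
  using eM[OF that] by (simp add: M_eq)
 have "absolutely_continuous lborel ?M"
  unfolding absolutely_continuous_def
 proof
  fix A :: "real set" assume "A : null_sets lborel"
  then have "A : sets borel" "emeasure (density lborel (%x. ennreal (2 * h x))) A = 0"
   using absolutely_continuousI_density[of "%x. ennreal (2 * h x)" lborel] by (auto simp: absolutely_continuous_def)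
  then show "A : null_sets ?M" using le[of A] by (auto simp: null_sets_def)
 qed
 then obtain f where f[measurable]: "f : Borel lborel" and fM: "density lborel f = ?M"
  using sigma_finite_measure.Radon_Nikodym[OF sigma_finite_lborel, of ?M] by auto
 have "(\<integral>\<^sup>+x. ennreal (2 * h x) \<partial>lborel) < \<infinity>"
  using nn_integral_eq_integral[of lborel "%x. 2 * h x"] h pos by simp
 then have ffin: "(\<integral>\<^sup>+x. f x \<partial>lborel) < \<infinity>"
  using le[of UNIV] by (auto simp: fM[symmetric] emeasure_density order_le_less_trans)
 then have fAE: "AE x in lborel. f x ~= \<infinity>" by (intro nn_integral_PInf_AE) auto
 define f' where "f' x = enn2real (f x)" for x
 have f'm[measurable]: "f' : Borel borel" unfolding f'_def[abs_def] using f by simp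
 have f'AE: "AE x in lborel. ennreal (f' x) = f x"
  using fAE by eventually_elim (auto simp: f'_def less_top)
 have f'i: "integrable lborel f'"
 proof (rule integrableI_nonneg)
  have "(\<integral>\<^sup>+x. ennreal (f' x) \<partial>lborel) = (\<integral>\<^sup>+x. f x \<partial>lborel)" by (rule nn_integral_cong_AE[OF f'AE])
  then show "(\<integral>\<^sup>+x. ennreal (f' x) \<partial>lborel) < \<infinity>" using ffin by simp
 qed (auto simp: f'_def)
 have Gp: "G True t - G True s = prim f' t - prim f' s" if "s <= t" for s t
 proof -
  have p0: "0 <= prim f' t - prim f' s" using prim_mono[OF f'i _ that] by (simp add: f'_def)
  have "ennreal (G True t - G True s) = emeasure (density lborel f) {s<..t}" by (simp add: fM em[OF that])
  also have "... = (\<integral>\<^sup>+x. ennreal (indicator {s<..t} x *\<^sub>R f' x) \<partial>lborel)"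
   using f'AE by (subst emeasure_density) (auto intro!: nn_integral_cong_AE simp: indicator_def)
  also have "... = ennreal (LINT x:{s<..t}|lborel. f' x)"
   unfolding set_lebesgue_integral_def
   by (rule nn_integral_eq_integral) (use integrable_mult_indicator[OF _ f'i, of "{s<..t}"] in \<open>auto simp: f'_def\<close>)
  also have "... = ennreal (prim f' t - prim f' s)" by (simp add: prim_diff[OF f'i that])
  finally show ?thesis using p0 G_mono[OF that, of True] by simp
 qed
 define d where "d x = f' x - h x" for x
 have di: "integrable lborel d" unfolding d_def[abs_def] using f'i h by simp
 have Fd': "F t - F s = prim d t - prim d s" if "s <= t" for s t
  using Gp[OF that] by (simp add: d_def[abs_def] prim_diff_fun[OF f'i h] G_def)
 have Fd: "F t - F s = prim d t - prim d s" for s t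
  using Fd'[of s t] Fd'[of t s] by (cases "s <= t") auto
 have "AE t in lborel. \<bar>d t\<bar> <= h t"
  by (rule AE_abs_le_if_prim[OF di h]) (use F in \<open>simp add: Fd[symmetric]\<close>)
 then show thesis using that di Fd by blast
qed

section \<open>Increments on rectangles\<close>

lemma AE_lborel_shift:
 fixes c :: "'a::euclidean_space"
 assumes "AE x in lborel. P x"
 shows "AE x in lborel. P (x + c)"
proof -
 have "AE x in distr lborel borel ((+) c). P x" unfolding lborel_distr_plus by (rule assms)
 then have "AE x in lborel. P (c + x)" by (rule AE_distrD[rotated]) simp
 then show ?thesis by (simp add: add.commute)
qed

lemma AE_lborel_affine:
 assumes "AE x in lborel. P x" and a: "a ~= (0::real)"
 shows "AE x in lborel. P (r + a * x)"
proof -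
 have "AE x in density (distr lborel borel (%x. r + a * x)) (%_. ennreal \<bar>a\<bar>). P x"
  using assms(1) unfolding lborel_real_affine[OF a, of r, symmetric] .
 then have "AE x in distr lborel borel (%x. r + a * x). P x"
  by (subst (asm) AE_density) (use a in auto)
 then show ?thesis by (rule AE_distrD[rotated]) simp
qed

lemma integrable_lborel_shift:
 fixes c :: "'a::euclidean_space" and f :: "'a => real"
 assumes f: "integrable lborel f"
 shows "integrable lborel (%x. f (x + c))" "(LINT x|lborel. f (x + c)) = (LINT x|lborel. f x)"
proof -
 have fm: "f : Borel borel" using f by simp
 have "integrable (distr lborel borel ((+) c)) f" using f by (simp add: lborel_distr_plus)
 then show "integrable lborel (%x. f (x + c))"
  by (subst (asm) integrable_distr_eq) (use fm in \<open>auto simp: add.commute\<close>)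
 have "(LINT x|distr lborel borel ((+) c). f x) = (LINT x|lborel. f (c + x))"
  by (rule integral_distr) (use fm in auto)
 then show "(LINT x|lborel. f (x + c)) = (LINT x|lborel. f x)" by (simp add: lborel_distr_plus add.commute)
qed

lemma prim_affine:
 assumes d: "integrable lborel d"
 shows "prim d (r + \<alpha>) - prim d r = \<alpha> * (LINT l:{0..1}|lborel. d (r + \<alpha> * l))"
proof -
 have ae01: "AE l::real in lborel. l ~= 0 & l ~= 1"
  using AE_lborel_singleton[of "0::real"] AE_lborel_singleton[of "1::real"] by eventually_elim simp
 have dm[measurable]: "d : Borel borel" using d by simp
 consider "\<alpha> = 0" | "\<alpha> > 0" | "\<alpha> < 0" by linarith
 then show ?thesis
 proof cases
  case 2
  have "prim d (r + \<alpha>) - prim d r = (LINT x|lborel. indicator {r<..r+\<alpha>} x * d x)"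
   using 2 by (subst prim_diff[OF d]) (auto simp: set_lebesgue_integral_def)
  also have "... = \<bar>\<alpha>\<bar> * (LINT l|lborel. indicator {r<..r+\<alpha>} (r + \<alpha> * l) * d (r + \<alpha> * l))"
   using 2 by (subst lborel_integral_real_affine[where c=\<alpha> and t=r]) auto
  also have "(LINT l|lborel. indicator {r<..r+\<alpha>} (r + \<alpha> * l) * d (r + \<alpha> * l)) = (LINT l:{0..1}|lborel. d (r + \<alpha> * l))"
   unfolding set_lebesgue_integral_def
   by (rule integral_cong_AE, measurable, use ae01 in eventually_elim) (use 2 in \<open>auto simp: indicator_def zero_less_mult_iff\<close>)
  finally show ?thesis using 2 by simp
 next
  case 3
  have "prim d r - prim d (r + \<alpha>) = (LINT x|lborel. indicator {r+\<alpha><..r} x * d x)"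
   using 3 by (subst prim_diff[OF d]) (auto simp: set_lebesgue_integral_def)
  also have "... = \<bar>\<alpha>\<bar> * (LINT l|lborel. indicator {r+\<alpha><..r} (r + \<alpha> * l) * d (r + \<alpha> * l))"
   using 3 by (subst lborel_integral_real_affine[where c=\<alpha> and t=r]) auto
  also have "(LINT l|lborel. indicator {r+\<alpha><..r} (r + \<alpha> * l) * d (r + \<alpha> * l)) = (LINT l:{0..1}|lborel. d (r + \<alpha> * l))"
   unfolding set_lebesgue_integral_def
   by (rule integral_cong_AE, measurable, use ae01 in eventually_elim) (use 3 in \<open>auto simp: indicator_def mult_le_0_iff\<close>)
  finally show ?thesis using 3 by (simp add: algebra_simps)
 qed simp
qed

text \<open>McShane extension with the pseudometric given by \<open>H\<close>: the infimum formula preserves the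
modulus.\<close>
lemma ac_extend:
 fixes F H :: "real => real"
 assumes S: "S ~= {}" and F: "!!s t. s : S ==> t : S ==> \<bar>F t - F s\<bar> <= \<bar>H t - H s\<bar>"
 obtains F' where "!!s t. \<bar>F' t - F' s\<bar> <= \<bar>H t - H s\<bar>" "!!t. t : S ==> F' t = F t"
proof
 define F' where "F' t = (INF s\<in>S. F s + \<bar>H t - H s\<bar>)" for t
 obtain s0 where s0: "s0 : S" using S by blast
 have bd: "bdd_below ((%s. F s + \<bar>H t - H s\<bar>) ` S)" for t
 proof (rule bdd_belowI2)
  fix s assume "s : S"
  then show "F s0 - \<bar>H s0 - H t\<bar> <= F s + \<bar>H t - H s\<bar>" using F[OF _ s0, of s] by linarith
 qed
 have le: "F' t <= F' s + \<bar>H t - H s\<bar>" for s t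
 proof -
  have "F' t - \<bar>H t - H s\<bar> <= F' s" unfolding F'_def[of s]
  proof (rule cINF_greatest[OF S])
   fix u assume "u : S"
   then have "F' t <= F u + \<bar>H t - H u\<bar>" unfolding F'_def by (rule cINF_lower[OF bd])
   then show "F' t - \<bar>H t - H s\<bar> <= F u + \<bar>H s - H u\<bar>" by linarith
  qed
  then show ?thesis by simp
 qed
 show "\<bar>F' t - F' s\<bar> <= \<bar>H t - H s\<bar>" for s t using le[of s t] le[of t s] by linarith
 show "F' t = F t" if "t : S" for t
 proof (rule antisym)
  have "F' t <= F t + \<bar>H t - H t\<bar>" unfolding F'_def by (rule cINF_lower[OF bd that])
  then show "F' t <= F t" by simp
  show "F t <= F' t" unfolding F'_def
  proof (rule cINF_greatest[OF S])
   fix u assume "u : S" then show "F t <= F u + \<bar>H t - H u\<bar>" using F[OF \<open>u : S\<close> that] by linarith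
  qed
 qed
qed

text \<open>A Sobolev function along a curve is controlled only at rational and at almost all times. Extending it from
these times gives a genuine primitive; its difference quotients converge almost everywhere for the given
\<open>F\<close> too, because almost every time is good together with all its translates by
\<open>1/(k+1)\<close>.\<close>
lemma ac_imp_prim_AE:
 fixes F :: "real => real"
 assumes h: "integrable lborel h" and pos: "!!x. 0 <= h x"
  and FQ: "!!s t. s : \<rat> ==> t : \<rat> ==> \<bar>F t - F s\<bar> <= \<bar>prim h t - prim h s\<bar>"
  and FAE: "AE t in lborel. ALL s:\<rat>. \<bar>F t - F s\<bar> <= \<bar>prim h t - prim h s\<bar>"
 obtains d c where "integrable lborel d" "AE t in lborel. \<bar>d t\<bar> <= h t"
  "!!t. t : \<rat> ==> F t = c + prim d t" "AE t in lborel. F t = c + prim d t"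
  "AE t in lborel. (%k. (F (t + 1 / real (Suc k)) - F t) * real (Suc k)) ----> d t"
proof -
 define S where "S = {t. ALL s:\<rat>. \<bar>F t - F s\<bar> <= \<bar>prim h t - prim h s\<bar>}"
 have QS: "\<rat> \<subseteq> S" using FQ by (auto simp: S_def)
 have SAE: "AE t in lborel. t : S" using FAE by (simp add: S_def)
 have S': "\<bar>F t - F s\<bar> <= \<bar>prim h t - prim h s\<bar>" if st: "s : S" "t : S" "s < t" for s t
 proof -
  obtain r where r: "r : \<rat>" "s < r" "r < t" using Rats_dense_in_real[OF st(3)] by blast
  have "\<bar>F t - F r\<bar> <= \<bar>prim h t - prim h r\<bar>" "\<bar>F s - F r\<bar> <= \<bar>prim h s - prim h r\<bar>"
   using st r by (auto simp: S_def)
  moreover have "prim h s <= prim h r" "prim h r <= prim h t" using r by (auto intro!: prim_mono h pos)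
  ultimately show ?thesis by linarith
 qed
 have S: "\<bar>F t - F s\<bar> <= \<bar>prim h t - prim h s\<bar>" if "s : S" "t : S" for s t
  using S'[of s t] S'[of t s] that by (cases s t rule: linorder_cases) (auto simp: abs_minus_commute)
 have "S ~= {}" using QS Rats_0 by blast
 obtain F' where F': "!!s t. \<bar>F' t - F' s\<bar> <= \<bar>prim h t - prim h s\<bar>" "!!t. t : S ==> F' t = F t"
  using ac_extend[OF \<open>S ~= {}\<close>, of F "prim h"] S by blast
 have "\<bar>F' t - F' s\<bar> <= prim h t - prim h s" if "s <= t" for s t
  using F'(1)[of t s] prim_mono[OF h pos that] by simp
 from ac_imp_prim[OF h pos this] obtain d where d: "integrable lborel d" "AE t in lborel. \<bar>d t\<bar> <= h t"
  and Fd: "!!s t. F' t - F' s = prim d t - prim d s" by blast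
 define c where "c = F' 0 - prim d 0"
 have Fc: "F' t = c + prim d t" for t using Fd[of t 0] by (simp add: c_def)
 have "AE t in lborel. ALL k. t + 1 / real (Suc k) : S"
  unfolding AE_all_countable by (intro allI AE_lborel_shift SAE)
 then have "AE t in lborel. (%k. (F (t + 1 / real (Suc k)) - F t) * real (Suc k)) ----> d t"
  using SAE AE_prim_has_derivative[OF d(1)]
 proof eventually_elim
  case (elim t)
  note tk = elim(1) and t = elim(2) and D = elim(3)
  have "((%h. (prim d (t + h) - prim d t) / h) \<longlongrightarrow> d t) (at 0)" using D by (simp add: DERIV_def)
  then have "(%k. (prim d (t + 1 / real (Suc k)) - prim d t) / (1 / real (Suc k))) ----> d t"
   by (rule filterlim_compose) (auto simp: filterlim_at simp del: of_nat_Suc intro!: LIMSEQ_Suc[OF lim_1_over_n] eventually_sequentiallyI)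
  then show ?case
   using F'(2)[OF tk[rule_format]] F'(2)[OF t] by (simp add: Fc[symmetric] Fd[symmetric])
 qed
 moreover have "AE t in lborel. F t = c + prim d t" using SAE by eventually_elim (use F'(2) Fc in metis)
 moreover have "F t = c + prim d t" if "t : \<rat>" for t using that QS F'(2) Fc by (metis subsetD)
 ultimately show thesis using that d by blast
qed

lemma AE_lborel_fst_neq: "AE z::real\<times>real in lborel. fst z ~= c"
 and AE_lborel_snd_neq: "AE z::real\<times>real in lborel. snd z ~= c"
proof -
 have "emeasure (lborel >< lborel) ({c} \<times> (UNIV::real set)) = 0"
  by (subst lborel.emeasure_pair_measure_Times) auto
 then have "{c} \<times> (UNIV::real set) : null_sets lborel" by (auto simp: lborel_prod null_sets_def borel_closed closed_Times)
 then show "AE z::real\<times>real in lborel. fst z ~= c" by (rule AE_I') auto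
 have "emeasure (lborel >< lborel) ((UNIV::real set) \<times> {c}) = 0"
  by (subst lborel.emeasure_pair_measure_Times) auto
 then have "(UNIV::real set) \<times> {c} : null_sets lborel" by (auto simp: lborel_prod null_sets_def borel_closed closed_Times)
 then show "AE z::real\<times>real in lborel. snd z ~= c" by (rule AE_I') auto
qed

text \<open>One variable at a time: the integral over a fixed rational interval of the second variable has monotone
primitives in the first, hence is nonnegative at almost every point; there the same argument applies to the
second variable.\<close>
lemma AE_nonneg_if_box:
 fixes K :: "real \<times> real => real"
 assumes K: "integrable lborel K"
  and box: "!!r0 r1 s0 s1. 0 < r0 ==> r0 < r1 ==> r1 < 1 ==> 0 < s0 ==> s0 < s1 ==> s1 < 1 ==>
    0 <= (LINT z:{r0<..r1}\<times>{s0<..s1}|lborel. K z)"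
 shows "AE z in lborel. 0 < fst z --> fst z < 1 --> 0 < snd z --> snd z < 1 --> 0 <= K z"
proof -
 have Km[measurable]: "K : Borel borel" using K by simp
 have Kp: "integrable (lborel >< lborel) K" using K by (simp add: lborel_prod)
 have ms[measurable]: "{a<..b} \<times> {c<..d} : sets (borel::(real\<times>real) measure)" for a b c d :: real
  by (simp add: borel_prod[symmetric])
 have Kr: "AE r in lborel. integrable lborel (%s. K (r, s))" by (rule lborel_pair.AE_integrable_fst'[OF Kp])
 have st: "AE r in lborel. r : {0<..<1} --> 0 <= (LINT s:{s0<..s1}|lborel. K (r, s))"
  if s: "0 < s0" "s0 < s1" "s1 < 1" for s0 s1
 proof -
  have i: "integrable (lborel >< lborel) (%z. indicator ({a<..b} \<times> {s0<..s1}) z * K z)" for a b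
   by (rule integrable_indicator_mult[OF Kp]) simp
  have i': "integrable (lborel >< lborel) (%z. indicator (UNIV \<times> {s0<..s1}) z * K z)"
   by (rule integrable_indicator_mult[OF Kp]) simp
  have e: "(LINT s:{s0<..s1}|lborel. K (r, s)) = (LINT s|lborel. indicator (UNIV \<times> {s0<..s1}) (r,s) * K (r,s))" for r
   unfolding set_lebesgue_integral_def by (intro Bochner_Integration.integral_cong) (auto simp: indicator_def)
  show ?thesis
  proof (rule AE_nonneg_if_prim_mono)
   show ik: "integrable lborel (%r. LINT s:{s0<..s1}|lborel. K (r, s))"
    unfolding e by (rule lborel_pair.integrable_fst'[OF i'])
   fix u v :: real assume uv: "u < v" "{u..v} \<subseteq> {0<..<1}"
   then have uv': "0 < u" "v < 1" by (simp_all add: subset_iff)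
   have "prim (%r. LINT s:{s0<..s1}|lborel. K (r, s)) v - prim (%r. LINT s:{s0<..s1}|lborel. K (r, s)) u
    = (LINT r|lborel. indicator {u<..v} r * (LINT s:{s0<..s1}|lborel. K (r, s)))"
    using uv by (subst prim_diff[OF ik]) (auto simp: set_lebesgue_integral_def)
   also have "... = (LINT r|lborel. LINT s|lborel. indicator ({u<..v} \<times> {s0<..s1}) (r,s) * K (r,s))"
    unfolding set_lebesgue_integral_def
    by (simp flip: integral_mult_right_zero) (auto intro!: Bochner_Integration.integral_cong simp: indicator_def)
   also have "... = (LINT z|lborel. indicator ({u<..v} \<times> {s0<..s1}) z * K z)"
    by (subst lborel_pair.integral_fst'[OF i]) (simp add: lborel_prod)
   also have "... \<ge> 0" using box[OF uv'(1) uv(1) uv'(2) s] by (simp add: set_lebesgue_integral_def)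
   finally show "prim (%r. LINT s:{s0<..s1}|lborel. K (r, s)) u <= prim (%r. LINT s:{s0<..s1}|lborel. K (r, s)) v"
    by simp
  qed auto
 qed
 have "AE r in lborel. ALL s0:\<rat>. ALL s1:\<rat>. r : {0<..<1} --> 0 < s0 --> s0 < s1 --> s1 < 1 --> 0 <= (LINT s:{s0<..s1}|lborel. K (r, s))"
  unfolding AE_ball_countable[OF countable_rat]
 proof (intro ballI)
  fix s0 s1 :: real
  show "AE r in lborel. r : {0<..<1} --> 0 < s0 --> s0 < s1 --> s1 < 1 --> 0 <= (LINT s:{s0<..s1}|lborel. K (r, s))"
  proof (cases "0 < s0 & s0 < s1 & s1 < 1")
   case True with st[of s0 s1] show ?thesis by auto
  qed auto
 qed
 then have "AE r in lborel. AE s in lborel. 0 < r --> r < 1 --> 0 < s --> s < 1 --> 0 <= K (r, s)"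
  using Kr
 proof eventually_elim
  case (elim r)
  note nn = elim(1) and ir = elim(2)
  show ?case
  proof (cases "0 < r & r < 1")
   case True
   have "AE s in lborel. s : {0<..<1} --> 0 <= K (r, s)"
   proof (rule AE_nonneg_if_prim_mono[OF ir])
    fix s t :: real assume st: "s : \<rat>" "t : \<rat>" "s < t" "{s..t} \<subseteq> {0<..<1}"
    then have "0 < s" "t < 1" by (simp_all add: subset_iff)
    then have "0 <= (LINT x:{s<..t}|lborel. K (r, x))" using nn True st by auto
    then show "prim (%s. K (r, s)) s <= prim (%s. K (r, s)) t"
     using prim_diff[OF ir, of s t] st(3) by simp
   qed simp
   then show ?thesis by eventually_elim auto
  qed auto
 qed
 then have "AE z in lborel >< lborel. 0 < fst z --> fst z < 1 --> 0 < snd z --> snd z < 1 --> 0 <= K z"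
 proof (intro lborel_pair.AE_pair_measure)
  have Km'[measurable]: "K : Borel (lborel >< lborel)" by (simp add: lborel_prod)
  show "{z : space (lborel >< lborel). 0 < fst z --> fst z < 1 --> 0 < snd z --> snd z < 1 --> 0 <= K z} : sets (lborel >< lborel)"
   by measurable
 qed simp
 then show ?thesis unfolding lborel_prod .
qed

definition box_avg :: "(real \<times> real => real) => (real => real \<times> real) => real \<times> real => real" where
 "box_avg d v z = (LINT l:{0..1}|lborel. d (z + v l))"

text \<open>Fubini moves the translation from the function to the box, whose translated indicators converge off a null
boundary.\<close>
lemma box_avg:
 fixes d :: "real \<times> real => real" and v :: "nat => real => real \<times> real"
 assumes d: "integrable lborel d" and v[measurable]: "!!k. v k : Borel borel"
  and v0: "!!l. (%k. v k l) ----> 0"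
 shows "AE z in lborel. set_integrable lborel {0..1} (%l. d (z + v k l))"
  and "integrable lborel (box_avg d (v k))"
  and "(%k. LINT z:{r0<..r1}\<times>{s0<..s1}|lborel. box_avg d (v k) z) ----> (LINT z:{r0<..r1}\<times>{s0<..s1}|lborel. d z)"
proof -
 have dm[measurable]: "d : Borel borel" using d by simp
 let ?Q = "{r0<..r1}\<times>{s0<..s1}"
 have Q[measurable]: "?Q : sets borel" by (simp add: borel_prod[symmetric])
 define G where "G k = (%(l, z). indicator {0..1} l * d (z + v k l))" for k
 have Gm[measurable]: "G k : Borel (lborel >< lborel)" for k unfolding G_def by measurable
 have Gi: "integrable (lborel >< lborel) (G k)" for k
 proof (rule lborel_pair.Fubini_integrable[OF Gm])
  have "(LINT z|lborel. norm (G k (l, z))) = indicator {0..1} l *\<^sub>R (LINT z|lborel. \<bar>d z\<bar>)" for l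
   unfolding G_def using integrable_lborel_shift(2)[of "%z. \<bar>d z\<bar>" "v k l"] d
   by (simp add: abs_mult)
  then show "integrable lborel (%l. LINT z|lborel. norm (G k (l, z)))"
   by (auto intro!: integrable_real_indicator)
  show "AE l in lborel. integrable lborel (%z. G k (l, z))"
   unfolding G_def using integrable_lborel_shift(1)[OF d] by auto
 qed
 have G_eq: "(%l. G k (l, z)) = (%l. indicator {0..1} l *\<^sub>R d (z + v k l))" for k z by (auto simp: G_def)
 show "AE z in lborel. set_integrable lborel {0..1} (%l. d (z + v k l))"
  using lborel_pair.AE_integrable_snd[of "%l z. G k (l, z)"] Gi[of k] by (simp add: set_integrable_def G_eq split_beta')
 have ba: "box_avg d (v k) z = (LINT l|lborel. G k (l, z))" for k z by (simp add: box_avg_def set_lebesgue_integral_def G_eq)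
 show "integrable lborel (box_avg d (v k))"
  using lborel_pair.integrable_snd[of "%l z. G k (l, z)"] Gi[of k] by (simp add: ba[abs_def] split_beta')
 define J where "J k l = (LINT z|lborel. indicator ?Q (z - v k l) * d z)" for k l
 have intJ: "integrable lborel (%z. indicator ?Q (z - c) * d z)" for c
  using integrable_indicator_mult[OF integrable_lborel_shift(1)[OF d, of c] , of ?Q, THEN integrable_lborel_shift(1), of "-c"] by simp
 have eq: "(LINT z:?Q|lborel. box_avg d (v k) z) = (LINT l|lborel. indicator {0..1} l * J k l)" for k
 proof -
  have "integrable (lborel >< lborel) (%x. indicator (UNIV \<times> ?Q) x * G k x)"
   by (rule integrable_indicator_mult[OF Gi]) simp
  then have i: "integrable (lborel >< lborel) (%(l,z). indicator ?Q z * G k (l,z))"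
   by (rule Bochner_Integration.integrable_cong[OF refl, THEN iffD1, rotated]) (auto simp: indicator_def)
  have "(LINT z:?Q|lborel. box_avg d (v k) z) = (LINT z|lborel. LINT l|lborel. indicator ?Q z * G k (l,z))"
   by (simp add: set_lebesgue_integral_def ba)
  also have "... = (LINT l|lborel. LINT z|lborel. indicator ?Q z * G k (l,z))" by (rule lborel_pair.Fubini_integral[OF i])
  also have "... = (LINT l|lborel. indicator {0..1} l * J k l)"
  proof (rule Bochner_Integration.integral_cong[OF refl])
   fix l
   have "(LINT z|lborel. indicator ?Q z * G k (l,z)) = indicator {0..1} l * (LINT z|lborel. indicator ?Q z * d (z + v k l))"
    by (simp add: G_def mult.left_commute)
   also have "(LINT z|lborel. indicator ?Q z * d (z + v k l)) = J k l"
    unfolding J_def using integrable_lborel_shift(2)[OF intJ, of "v k l" "v k l"] by simp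
   finally show "(LINT z|lborel. indicator ?Q z * G k (l,z)) = indicator {0..1} l * J k l" .
  qed
  finally show ?thesis .
 qed
 have Jlim: "(%k. J k l) ----> (LINT z:?Q|lborel. d z)" for l
  unfolding J_def set_lebesgue_integral_def
 proof (rule integral_dominated_convergence[where w="%z. \<bar>d z\<bar>"])
  show "AE z in lborel. (%k. indicat_real ?Q (z - v k l) * d z) ----> indicat_real ?Q z *\<^sub>R d z"
   using AE_lborel_fst_neq[of r0] AE_lborel_fst_neq[of r1] AE_lborel_snd_neq[of s0] AE_lborel_snd_neq[of s1]
  proof eventually_elim
   case (elim z)
   note ne = elim(1-4)
   have "(%k. z - v k l) ----> z - 0" by (intro tendsto_intros v0)
   then have l: "(%k. fst (z - v k l)) ----> fst z" "(%k. snd (z - v k l)) ----> snd z"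
    by (auto dest: tendsto_fst tendsto_snd)
   have ev: "\<forall>\<^sub>F k in sequentially. (x k < c) = (y < c)" if "x ----> y" "y ~= c" for x and y c :: real
   proof (cases "y < c")
    case True from order_tendstoD(2)[OF that(1) True] show ?thesis by eventually_elim (use True in simp)
   next
    case False then have "c < y" using that(2) by simp
    from order_tendstoD(1)[OF that(1) this] show ?thesis by eventually_elim (use False in simp)
   qed
   have ev': "\<forall>\<^sub>F k in sequentially. (c < x k) = (c < y)" if "x ----> y" "y ~= c" for x and y c :: real
    using ev[of "%k. - x k" "-y" "-c"] that by (simp add: tendsto_minus_cancel_left)
   have "\<forall>\<^sub>F k in sequentially. indicat_real ?Q (z - v k l) = indicator ?Q z"
    using ev'[OF l(1) ne(1)] ev'[OF l(1) ne(2)] ev'[OF l(2) ne(3)] ev'[OF l(2) ne(4)]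
    by eventually_elim (auto simp: indicator_def mem_Times_iff not_less[symmetric])
   then have "\<forall>\<^sub>F k in sequentially. indicat_real ?Q (z - v k l) * d z = indicator ?Q z *\<^sub>R d z"
    by eventually_elim simp
   then show ?case
    by (rule tendsto_eventually)
  qed
 qed (use d in \<open>auto simp: indicator_def\<close>)
 have Jb: "\<bar>J k l\<bar> <= (LINT z|lborel. \<bar>d z\<bar>)" for k l
  unfolding J_def by (rule order_trans[OF integral_abs_bound])
   (intro integral_mono integrable_abs intJ d, auto simp: indicator_def)
 have Jm: "J k : Borel lborel" for k unfolding J_def[abs_def] by measurable
 have "(%k. LINT l|lborel. indicator {0..1} l * J k l) ----> (LINT l|lborel. indicator {0..1::real} l * (LINT z:?Q|lborel. d z))"
 proof (rule integral_dominated_convergence[where w="%l. indicator {0..1} l * (LINT z|lborel. \<bar>d z\<bar>)"])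
  show "AE l in lborel. (%k. indicat_real {0..1} l * J k l) ----> indicat_real {0..1} l * (LINT z:?Q|lborel. d z)"
   by (intro AE_I2 tendsto_mult_left Jlim)
  show "AE l in lborel. norm (indicat_real {0..1} l * J k l) <= indicat_real {0..1} l * (LINT z|lborel. \<bar>d z\<bar>)" for k
   using Jb[of k] by (auto simp: indicator_def)
 qed (use Jm in \<open>auto intro!: integrable_mult_left integrable_real_indicator\<close>)
 then show "(%k. LINT z:?Q|lborel. box_avg d (v k) z) ----> (LINT z:?Q|lborel. d z)"
  unfolding eq by simp
qed

lemma AE_fstI:
 assumes "sigma_finite_measure N" "AE x in M. P x"
 shows "AE z in M >< N. P (fst z)"
proof -
 interpret N: sigma_finite_measure N by fact
 obtain A where A: "A : null_sets M" "{x\<in>space M. \<not> P x} \<subseteq> A" using assms(2) by (auto simp: eventually_ae_filter)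
 have "A \<times> space N : null_sets (M >< N)"
  using A(1) by (auto simp: null_sets_def N.emeasure_pair_measure_Times)
 then show ?thesis by (rule AE_I') (use A(2) in \<open>auto simp: space_pair_measure\<close>)
qed

lemma AE_sndI:
 assumes "sigma_finite_measure N" "AE x in N. P x"
 shows "AE z in M >< N. P (snd z)"
proof -
 interpret N: sigma_finite_measure N by fact
 obtain A where A: "A : null_sets N" "{x\<in>space N. \<not> P x} \<subseteq> A" using assms(2) by (auto simp: eventually_ae_filter)
 have "space M \<times> A : null_sets (M >< N)"
  using A(1) by (auto simp: null_sets_def N.emeasure_pair_measure_Times)
 then show ?thesis by (rule AE_I') (use A(2) in \<open>auto simp: space_pair_measure\<close>)
qed

text \<open>An increment in the direction \<open>(a, b)\<close> is a step in the first variable after a step in the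
second. Both are averages of the partial derivatives; divided by the step size and integrated over a box,
they converge to the integrals of \<open>d1\<close> and \<open>d2\<close>, and the bound converges to the
integral of \<open>H\<close>. Only integrated quantities pass to the limit, so no differentiability of
\<open>F\<close> in two variables is used.\<close>
lemma AE_box_flux:
 fixes F :: "real => real => real" and d1 d2 H :: "real \<times> real => real"
 assumes d1: "integrable lborel d1" and d2: "integrable lborel d2" and H: "integrable lborel H" and Hpos: "!!z. 0 <= H z"
  and F1: "!!k. AE z in lborel. 0 < fst z & fst z < 1 & 0 < snd z & snd z < 1 & 0 < fst z + a / real (Suc k) & fst z + a / real (Suc k) < 1 -->
   F (fst z + a / real (Suc k)) (snd z) - F (fst z) (snd z) = prim (%x. d1 (x, snd z)) (fst z + a / real (Suc k)) - prim (%x. d1 (x, snd z)) (fst z)"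
  and F2: "!!k. AE z in lborel. 0 < fst z & fst z < 1 & 0 < snd z & snd z < 1 & 0 < snd z + b / real (Suc k) & snd z + b / real (Suc k) < 1 -->
   F (fst z) (snd z + b / real (Suc k)) - F (fst z) (snd z) = prim (%y. d2 (fst z, y)) (snd z + b / real (Suc k)) - prim (%y. d2 (fst z, y)) (snd z)"
  and D: "!!k. AE z in lborel. 0 < fst z & fst z < 1 & 0 < snd z & snd z < 1 &
    0 < fst z + a / real (Suc k) & fst z + a / real (Suc k) < 1 & 0 < snd z + b / real (Suc k) & snd z + b / real (Suc k) < 1 -->
   ennreal \<bar>F (fst z + a / real (Suc k)) (snd z + b / real (Suc k)) - F (fst z) (snd z)\<bar> <=
    (\<integral>\<^sup>+l\<in>{0..1}. ennreal (H (fst z + a / real (Suc k) * l, snd z + b / real (Suc k) * l) / real (Suc k)) \<partial>lborel)"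
 shows "AE z in lborel. 0 < fst z --> fst z < 1 --> 0 < snd z --> snd z < 1 --> \<bar>a * d1 z + b * d2 z\<bar> <= H z"
proof -
 define v1 where "v1 k l = (a / real (Suc k) * l, b / real (Suc k))" for k l
 define v2 where "v2 k l = (0::real, b / real (Suc k) * l)" for k l
 define vH where "vH k l = (a / real (Suc k) * l, b / real (Suc k) * l)" for k l
 have lim: "(%k. c / real (Suc k)) ----> 0" for c :: real
  using tendsto_mult_right_zero[OF LIMSEQ_Suc[OF lim_1_over_n], of c] by simp
 have lim': "(%k. c / real (Suc k) * l) ----> 0" for c l :: real
  using lim[of "c * l"] by simp
 have vm: "v1 k : Borel borel" "v2 k : Borel borel" "vH k : Borel borel" for k
  unfolding v1_def[abs_def] v2_def[abs_def] vH_def[abs_def] borel_prod[symmetric] by measurable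
 have vl: "(%k. v1 k l) ----> 0" "(%k. v2 k l) ----> 0" "(%k. vH k l) ----> 0" for l
  unfolding v1_def v2_def vH_def zero_prod_def by (intro tendsto_Pair lim lim' tendsto_const)+
 note B1 = box_avg[OF d1 vm(1) vl(1)] and B2 = box_avg[OF d2 vm(2) vl(2)] and BH = box_avg[OF H vm(3) vl(3)]
 have sl1: "AE z::real\<times>real in lborel. integrable lborel (%x. d1 (x, snd z))"
 proof -
  have "AE y in lborel. integrable lborel (%x. d1 (x, y))"
   using lborel_pair.AE_integrable_snd[of "%x y. d1 (x, y)"] d1 by (simp add: lborel_prod)
  from AE_sndI[OF sigma_finite_lborel this, of "lborel :: real measure", unfolded lborel_prod] show ?thesis .
 qed
 have sl2: "AE z::real\<times>real in lborel. integrable lborel (%y. d2 (fst z, y))"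
 proof -
  have "AE x in lborel. integrable lborel (%y. d2 (x, y))"
   using lborel_pair.AE_integrable_fst[of "%x y. d2 (x, y)"] d2 by (simp add: lborel_prod)
  from AE_fstI[OF sigma_finite_lborel this, unfolded lborel_prod] show ?thesis .
 qed
 define I where "I z \<longleftrightarrow> 0 < fst z & fst z < 1 & 0 < snd z & snd z < 1" for z :: "real \<times> real"
 have key: "AE z in lborel. I z & I (z + (0, b / real (Suc k))) & I (z + (a / real (Suc k), b / real (Suc k))) -->
   \<bar>a * box_avg d1 (v1 k) z + b * box_avg d2 (v2 k) z\<bar> <= box_avg H (vH k) z" for k
 proof -
 define P where "P z \<longleftrightarrow> 0 < fst z & fst z < 1 & 0 < snd z & snd z < 1 & 0 < fst z + a / real (Suc k) & fst z + a / real (Suc k) < 1 -->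
   F (fst z + a / real (Suc k)) (snd z) - F (fst z) (snd z) = prim (%x. d1 (x, snd z)) (fst z + a / real (Suc k)) - prim (%x. d1 (x, snd z)) (fst z)" for z
 have "AE z in lborel. P z" unfolding P_def by (rule F1)
 then have P: "AE z in lborel. P (z + (0, b / real (Suc k)))" by (rule AE_lborel_shift)
 show ?thesis
  using P F2[of k] D[of k]
   AE_lborel_shift[OF sl1, of "(0, b / real (Suc k))"] sl2 BH(1)[of k]
 proof (eventually_elim, intro impI, goal_cases)
  case (1 z)
  obtain r s where z: "z = (r, s)" by force
  let ?n = "real (Suc k)"
  have n: "?n > 0" by simp
  have I: "I z" "I (z + (0, b / ?n))" "I (z + (a / ?n, b / ?n))" using 1(13) by auto
  have e1: "F (r + a / ?n) (s + b / ?n) - F r (s + b / ?n) = a / ?n * box_avg d1 (v1 k) z"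
  proof -
   have "F (r + a / ?n) (s + b / ?n) - F r (s + b / ?n) = prim (%x. d1 (x, s + b / ?n)) (r + a / ?n) - prim (%x. d1 (x, s + b / ?n)) r"
    using 1(1) I by (simp add: I_def P_def z del: of_nat_Suc)
   also have "... = a / ?n * (LINT l:{0..1}|lborel. d1 (r + a / ?n * l, s + b / ?n))"
    using 1(4) by (intro prim_affine) (simp add: z del: of_nat_Suc)
   finally show ?thesis by (simp add: box_avg_def v1_def z del: of_nat_Suc)
  qed
  have e2: "F r (s + b / ?n) - F r s = b / ?n * box_avg d2 (v2 k) z"
  proof -
   have "F r (s + b / ?n) - F r s = prim (%y. d2 (r, y)) (s + b / ?n) - prim (%y. d2 (r, y)) s"
    using 1(2) I by (simp add: I_def z del: of_nat_Suc)
   also have "... = b / ?n * (LINT l:{0..1}|lborel. d2 (r, s + b / ?n * l))"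
    using 1(5) by (intro prim_affine) (simp add: z del: of_nat_Suc)
   finally show ?thesis by (simp add: box_avg_def v2_def z del: of_nat_Suc)
  qed
  have Hi: "set_integrable lborel {0..1} (%l. H (r + a / ?n * l, s + b / ?n * l) / ?n)"
   using 1(6) by (simp add: vH_def z del: of_nat_Suc)
  have "ennreal \<bar>F (r + a / ?n) (s + b / ?n) - F r s\<bar> <= (\<integral>\<^sup>+l\<in>{0..1}. ennreal (H (r + a / ?n * l, s + b / ?n * l) / ?n) \<partial>lborel)"
   using 1(3) I by (simp add: I_def z del: of_nat_Suc)
  also have "... = (\<integral>\<^sup>+l. ennreal (indicator {0..1} l *\<^sub>R (H (r + a / ?n * l, s + b / ?n * l) / ?n)) \<partial>lborel)"
   by (intro nn_integral_cong) (auto simp: indicator_def)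
  also have "... = ennreal (LINT l:{0..1}|lborel. H (r + a / ?n * l, s + b / ?n * l) / ?n)"
   unfolding set_lebesgue_integral_def
   by (rule nn_integral_eq_integral) (use Hi Hpos n in \<open>auto simp: set_integrable_def simp del: of_nat_Suc\<close>)
  finally have "\<bar>F (r + a / ?n) (s + b / ?n) - F r s\<bar> <= (LINT l:{0..1}|lborel. H (r + a / ?n * l, s + b / ?n * l) / ?n)"
   by (subst (asm) ennreal_le_iff) (auto simp: set_lebesgue_integral_def Hpos intro!: Bochner_Integration.integral_nonneg)
  also have "... = box_avg H (vH k) z / ?n" by (simp add: box_avg_def vH_def z del: of_nat_Suc)
  finally have "\<bar>a / ?n * box_avg d1 (v1 k) z + b / ?n * box_avg d2 (v2 k) z\<bar> <= box_avg H (vH k) z / ?n"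
   using e1 e2 by linarith
  then have "\<bar>(a * box_avg d1 (v1 k) z + b * box_avg d2 (v2 k) z) / ?n\<bar> <= box_avg H (vH k) z / ?n"
   by (simp add: add_divide_distrib del: of_nat_Suc)
  then show ?case using n by (simp add: abs_divide divide_le_cancel del: of_nat_Suc)
 qed
 qed
 have box: "\<bar>a * (LINT z:{r0<..r1}\<times>{s0<..s1}|lborel. d1 z) + b * (LINT z:{r0<..r1}\<times>{s0<..s1}|lborel. d2 z)\<bar> <= (LINT z:{r0<..r1}\<times>{s0<..s1}|lborel. H z)"
  if rs: "0 < r0" "r0 < r1" "r1 < 1" "0 < s0" "s0 < s1" "s1 < 1" for r0 r1 s0 s1
 proof (rule tendsto_le[OF sequentially_bot])
  let ?Q = "{r0<..r1}\<times>{s0<..s1}"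
  have Q[measurable]: "?Q : sets borel" by (simp add: borel_prod[symmetric])
  show "(%k. LINT z:?Q|lborel. box_avg H (vH k) z) ----> (LINT z:?Q|lborel. H z)" by (rule BH)
  show "(%k. \<bar>a * (LINT z:?Q|lborel. box_avg d1 (v1 k) z) + b * (LINT z:?Q|lborel. box_avg d2 (v2 k) z)\<bar>)
    ----> \<bar>a * (LINT z:?Q|lborel. d1 z) + b * (LINT z:?Q|lborel. d2 z)\<bar>"
   by (intro tendsto_intros B1 B2)
  have "\<forall>\<^sub>F k in sequentially. \<bar>a / real (Suc k)\<bar> < min r0 (1 - r1)" "\<forall>\<^sub>F k in sequentially. \<bar>b / real (Suc k)\<bar> < min s0 (1 - s1)"
   by (rule order_tendstoD[OF tendsto_rabs_zero[OF lim]]; use rs in simp)+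
  then show "\<forall>\<^sub>F k in sequentially. \<bar>a * (LINT z:?Q|lborel. box_avg d1 (v1 k) z) + b * (LINT z:?Q|lborel. box_avg d2 (v2 k) z)\<bar> <= (LINT z:?Q|lborel. box_avg H (vH k) z)"
  proof eventually_elim
   case (elim k)
   note sm = elim(1-2)
   let ?A = "%z. a * box_avg d1 (v1 k) z + b * box_avg d2 (v2 k) z"
   have i: "integrable lborel (%z. indicator ?Q z * box_avg d1 (v1 k) z)" "integrable lborel (%z. indicator ?Q z * box_avg d2 (v2 k) z)"
    "integrable lborel (%z. indicator ?Q z * box_avg H (vH k) z)"
    by (intro integrable_indicator_mult B1 B2 BH; simp)+
   have iA: "integrable lborel (%z. indicator ?Q z * ?A z)"
    using Bochner_Integration.integrable_add[OF integrable_mult_right[OF i(1), of a] integrable_mult_right[OF i(2), of b]] by (simp add: algebra_simps)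
   have eqA: "a * (LINT z:?Q|lborel. box_avg d1 (v1 k) z) + b * (LINT z:?Q|lborel. box_avg d2 (v2 k) z) = (LINT z|lborel. indicator ?Q z * ?A z)"
   proof -
    have "(LINT z|lborel. indicator ?Q z * ?A z) = (LINT z|lborel. a * (indicator ?Q z * box_avg d1 (v1 k) z) + b * (indicator ?Q z * box_avg d2 (v2 k) z))"
     by (intro Bochner_Integration.integral_cong) (auto simp: algebra_simps)
    also have "... = a * (LINT z|lborel. indicator ?Q z * box_avg d1 (v1 k) z) + b * (LINT z|lborel. indicator ?Q z * box_avg d2 (v2 k) z)"
     by (subst Bochner_Integration.integral_add[OF integrable_mult_right[OF i(1)] integrable_mult_right[OF i(2)]]) simp
    finally show ?thesis by (simp add: set_lebesgue_integral_def)
   qed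
   have "\<bar>a * (LINT z:?Q|lborel. box_avg d1 (v1 k) z) + b * (LINT z:?Q|lborel. box_avg d2 (v2 k) z)\<bar> <= (LINT z|lborel. \<bar>indicator ?Q z * ?A z\<bar>)"
    unfolding eqA by (rule integral_abs_bound)
   also have "... <= (LINT z|lborel. indicator ?Q z * box_avg H (vH k) z)"
   proof (rule integral_mono_AE)
    show "AE z in lborel. \<bar>indicator ?Q z * ?A z\<bar> <= indicator ?Q z * box_avg H (vH k) z"
     using key[of k]
    proof eventually_elim
     case (elim z)
     show ?case
     proof (cases "z : ?Q")
      case True
      have "I z" using True rs by (auto simp: I_def)
      moreover have "- r0 < a / real (Suc k)" "a / real (Suc k) < 1 - r1" "- s0 < b / real (Suc k)" "b / real (Suc k) < 1 - s1"
      using sm by linarith+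
      then have "I (z + (0, b / real (Suc k)))" "I (z + (a / real (Suc k), b / real (Suc k)))"
      using True rs unfolding I_def by (auto simp del: of_nat_Suc)
      ultimately show ?thesis using elim True by simp
     qed simp
    qed
   qed (use i iA in auto)
   finally show "\<bar>a * (LINT z:?Q|lborel. box_avg d1 (v1 k) z) + b * (LINT z:?Q|lborel. box_avg d2 (v2 k) z)\<bar> <= (LINT z:?Q|lborel. box_avg H (vH k) z)"
    by (simp add: set_lebesgue_integral_def)
  qed
 qed
 have *: "AE z in lborel. 0 < fst z --> fst z < 1 --> 0 < snd z --> snd z < 1 --> 0 <= H z - (c * a * d1 z + c * b * d2 z)"
  if c: "\<bar>c\<bar> = 1" for c
 proof (rule AE_nonneg_if_box)
  show "integrable lborel (%z. H z - (c * a * d1 z + c * b * d2 z))" using d1 d2 H by auto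
  fix r0 r1 s0 s1 :: real assume rs: "0 < r0" "r0 < r1" "r1 < 1" "0 < s0" "s0 < s1" "s1 < 1"
  let ?Q = "{r0<..r1}\<times>{s0<..s1}"
  have Q[measurable]: "?Q : sets borel" by (simp add: borel_prod[symmetric])
  have i: "set_integrable lborel ?Q d1" "set_integrable lborel ?Q d2" "set_integrable lborel ?Q H"
   unfolding set_integrable_def using d1 d2 H by (auto intro!: integrable_indicator_mult)
  have "(LINT z:?Q|lborel. H z - (c * a * d1 z + c * b * d2 z)) = (LINT z:?Q|lborel. H z) - c * (a * (LINT z:?Q|lborel. d1 z) + b * (LINT z:?Q|lborel. d2 z))"
   using i by (simp add: set_integral_diff set_integral_add algebra_simps)
  moreover have "c * (a * (LINT z:?Q|lborel. d1 z) + b * (LINT z:?Q|lborel. d2 z)) <= (LINT z:?Q|lborel. H z)"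
   using box[OF rs] c by (auto simp: abs_if split: if_splits)
  ultimately show "0 <= (LINT z:?Q|lborel. H z - (c * a * d1 z + c * b * d2 z))" by simp
 qed
 show ?thesis using *[of 1] *[of "-1"] by auto
qed

section \<open>Borel sets of separable metric spaces\<close>

lemma openin_mtopology_of_Pow: "{U. openin (mtopology_of Z) U} \<subseteq> Pow (mspace Z)"
proof
 fix U assume "U : {U. openin (mtopology_of Z) U}"
 then show "U : Pow (mspace Z)" using openin_subset[of "mtopology_of Z" U] by simp
qed

lemma sets_borel_of_metric: "sets (borel_of_metric Z) = sigma_sets (mspace Z) {U. openin (mtopology_of Z) U}"
 unfolding borel_of_metric_def by (rule sets_measure_of[OF openin_mtopology_of_Pow])

lemma space_borel_of_metric [simp]: "space (borel_of_metric Z) = mspace Z"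
 unfolding borel_of_metric_def by (rule space_measure_of[OF openin_mtopology_of_Pow])

lemma openin_borel_of_metric: "openin (mtopology_of Z) U ==> U : sets (borel_of_metric Z)"
 by (auto simp: sets_borel_of_metric)

lemma openin_mtopology_of_iff:
 "openin (mtopology_of Z) U \<longleftrightarrow> U \<subseteq> mspace Z & (ALL x:U. EX r>0. ALL y:mspace Z. mdist Z x y < r --> y : U)"
proof -
 interpret Z: Metric_space "mspace Z" "mdist Z" by (rule Metric_space_mspace_mdist)
 have eq: "Z.mball x r \<subseteq> U \<longleftrightarrow> (ALL y:mspace Z. mdist Z x y < r --> y : U)" if "x : mspace Z" for x r
  unfolding subset_iff Z.in_mball using that by blast
 show ?thesis
  unfolding mtopology_of_def Z.openin_mtopology using eq by (metis subsetD)
qed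

lemma separable_dense_set:
 assumes "separable Z"
 obtains D where "countable D" "D \<subseteq> mspace Z" "!!x e. x : mspace Z ==> 0 < e ==> EX a:D. mdist Z x a < e"
proof -
 interpret Z: Metric_space "mspace Z" "mdist Z" by (rule Metric_space_mspace_mdist)
 obtain D where D: "countable D" "D \<subseteq> mspace Z" "mtopology_of Z closure_of D = mspace Z"
  using assms unfolding separable_space_def topspace_mtopology_of by blast
 have "EX a:D. mdist Z x a < e" if "x : mspace Z" "0 < e" for x e
 proof -
  have "x : Z.mtopology closure_of D" using D that unfolding mtopology_of_def by simp
  then show ?thesis
   unfolding Z.metric_closure_of using that unfolding mem_Collect_eq Z.in_mball by blast
 qed
 with D show thesis using that by blast
qed

lemma separable_spaceI:
 assumes "countable D" "D \<subseteq> mspace Z" "!!x e. x : mspace Z ==> 0 < e ==> EX a:D. mdist Z x a < e"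
 shows "separable Z"
proof -
 interpret Z: Metric_space "mspace Z" "mdist Z" by (rule Metric_space_mspace_mdist)
 have "mspace Z \<subseteq> Z.mtopology closure_of D"
 proof
  fix x assume x: "x : mspace Z"
  have "EX y:D. y : Z.mball x r" if "r > 0" for r
   using assms(3)[OF x that] assms(2) x unfolding Z.in_mball by blast
  then show "x : Z.mtopology closure_of D" unfolding Z.metric_closure_of using x by blast
 qed
 then have "Z.mtopology closure_of D = mspace Z" using closure_of_subset_topspace[of Z.mtopology D] by auto
 then show ?thesis unfolding separable_space_def using assms(1,2) by (auto simp: mtopology_of_def intro!: exI[of _ D])
qed

lemma measurable_mdist:
 assumes a: "a : mspace Z"
 shows "(%z. mdist Z z a) : Borel (borel_of_metric Z)"
proof (rule borel_measurableI)
 fix S :: "real set" assume S: "open S"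
 have "(%z. mdist Z z a) -` S \<inter> mspace Z : sets (borel_of_metric Z)"
 proof (rule openin_borel_of_metric, unfold openin_mtopology_of_iff, intro conjI ballI)
  fix x assume x: "x : (%z. mdist Z z a) -` S \<inter> mspace Z"
  then obtain e where e: "e > 0" "!!y. dist y (mdist Z x a) < e ==> y : S" using S unfolding open_dist by auto
  show "EX r>0. ALL y:mspace Z. mdist Z x y < r --> y : (%z. mdist Z z a) -` S \<inter> mspace Z"
  proof (intro exI conjI ballI impI)
   fix y assume y: "y : mspace Z" "mdist Z x y < e"
   have "mdist Z x a <= mdist Z x y + mdist Z y a" "mdist Z y a <= mdist Z y x + mdist Z x a"
    using x y a by (auto intro!: mdist_triangle)
   then show "y : (%z. mdist Z z a) -` S \<inter> mspace Z" using y e(2) by (simp add: dist_real_def mdist_commute abs_less_iff)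
  qed (use e in simp)
 qed simp
 then show "(%z. mdist Z z a) -` S \<inter> space (borel_of_metric Z) : sets (borel_of_metric Z)" by simp
qed

text \<open>In a separable space every open set is a countable union of balls, so distances to fixed points detect
measurability.\<close>
lemma measurable_borel_of_metricI:
 assumes sep: "separable Z"
  and sp: "!!w. w : space M ==> \<phi> w : mspace Z"
  and di: "!!a. a : mspace Z ==> (%w. mdist Z (\<phi> w) a) : Borel M"
 shows "\<phi> : measurable M (borel_of_metric Z)"
proof (rule measurable_sigma_sets[OF sets_borel_of_metric openin_mtopology_of_Pow])
 obtain D where D: "countable D" "D \<subseteq> mspace Z" "!!x e. x : mspace Z ==> 0 < e ==> EX a:D. mdist Z x a < e"
  using separable_dense_set[OF sep] by blast
 fix U assume "U : {U. openin (mtopology_of Z) U}"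
 then have U: "U \<subseteq> mspace Z" "!!x. x : U ==> EX r>0. ALL y:mspace Z. mdist Z x y < r --> y : U"
  by (auto simp: openin_mtopology_of_iff)
 define I where "I = {(a, n::nat). a : D & (ALL y:mspace Z. mdist Z y a < 1 / Suc n --> y : U)}"
 have cI: "countable I" by (rule countable_subset[of _ "D \<times> UNIV"]) (use D(1) in \<open>auto simp: I_def\<close>)
 have eq: "\<phi> -` U \<inter> space M = (\<Union>(a,n)\<in>I. {w : space M. mdist Z (\<phi> w) a < 1 / Suc n})"
 proof (intro equalityI subsetI)
  fix w assume w: "w : \<phi> -` U \<inter> space M"
  then obtain r where r: "r > 0" "!!y. y : mspace Z ==> mdist Z (\<phi> w) y < r ==> y : U" using U(2) by blast
  obtain n where n: "1 / Suc n < r / 2" using nat_approx_posE[of "r/2"] r(1) by auto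
  obtain a where a: "a : D" "mdist Z (\<phi> w) a < 1 / Suc n" using D(3)[of "\<phi> w" "1 / Suc n"] sp w by auto
  have "(a, n) : I" unfolding I_def
  proof (clarsimp simp: a(1), rule r(2))
   fix y assume y: "y : mspace Z" "mdist Z y a < 1 / (1 + real n)"
   have "mdist Z (\<phi> w) y <= mdist Z (\<phi> w) a + mdist Z a y" using y a D(2) sp w by (intro mdist_triangle) auto
   then show "mdist Z (\<phi> w) y < r" using y a n by (simp add: mdist_commute)
  qed
  then show "w : (\<Union>(a,n)\<in>I. {w : space M. mdist Z (\<phi> w) a < 1 / Suc n})" using w a by auto
 next
  fix w assume "w : (\<Union>(a,n)\<in>I. {w : space M. mdist Z (\<phi> w) a < 1 / Suc n})"
  then show "w : \<phi> -` U \<inter> space M" using sp by (auto simp: I_def)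
 qed
 show "\<phi> -` U \<inter> space M : sets M" unfolding eq
 proof (rule sets.countable_UN''[OF cI])
  fix i assume "i : I"
  then obtain a n where i: "i = (a, n)" "a : mspace Z" using D(2) by (auto simp: I_def)
  have [measurable]: "(%w. mdist Z (\<phi> w) a) : Borel M" using di i by simp
  show "(case i of (a, n) => {w : space M. mdist Z (\<phi> w) a < 1 / real (Suc n)}) : sets M" unfolding i by simp
 qed
qed (use sp in auto)

lemma measurable_mdist2:
 assumes sep: "separable Z"
  and \<phi>: "\<phi> : measurable M (borel_of_metric Z)" and \<psi>: "\<psi> : measurable M (borel_of_metric Z)"
 shows "(%w. mdist Z (\<phi> w) (\<psi> w)) : Borel M"
proof (rule borel_measurableI_less)
 obtain D where D: "countable D" "D \<subseteq> mspace Z" "!!x e. x : mspace Z ==> 0 < e ==> EX a:D. mdist Z x a < e"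
  using separable_dense_set[OF sep] by blast
 fix c :: real
 have sp: "\<phi> w : mspace Z" "\<psi> w : mspace Z" if "w : space M" for w
  using \<phi> \<psi> that by (auto dest: measurable_space)
 have "{w : space M. mdist Z (\<phi> w) (\<psi> w) < c} = (\<Union>(a,q)\<in>D\<times>\<rat>. {w : space M. mdist Z (\<phi> w) a < q & mdist Z (\<psi> w) a < c - q})"
 proof (intro equalityI subsetI)
  fix w assume w: "w : {w : space M. mdist Z (\<phi> w) (\<psi> w) < c}"
  define e where "e = (c - mdist Z (\<phi> w) (\<psi> w)) / 3"
  have e: "e > 0" using w by (simp add: e_def)
  obtain a where a: "a : D" "mdist Z (\<psi> w) a < e" using D(3) sp w e by blast
  have "mdist Z (\<phi> w) a <= mdist Z (\<phi> w) (\<psi> w) + mdist Z (\<psi> w) a" using a w sp D(2) by (intro mdist_triangle) auto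
  moreover have "3 * e = c - mdist Z (\<phi> w) (\<psi> w)" by (simp add: e_def)
  ultimately have "mdist Z (\<phi> w) a < c - e" using a e by linarith
  then obtain q where q: "q : \<rat>" "mdist Z (\<phi> w) a < q" "q < c - e" using Rats_dense_in_real by blast
  then show "w : (\<Union>(a,q)\<in>D\<times>\<rat>. {w : space M. mdist Z (\<phi> w) a < q & mdist Z (\<psi> w) a < c - q})"
   using a w by (intro UN_I[of "(a,q)"]) auto
 next
  fix w assume "w : (\<Union>(a,q)\<in>D\<times>\<rat>. {w : space M. mdist Z (\<phi> w) a < q & mdist Z (\<psi> w) a < c - q})"
  then obtain a q where w: "w : space M" "a : D" "mdist Z (\<phi> w) a < q" "mdist Z (\<psi> w) a < c - q" by auto
  have "mdist Z (\<phi> w) (\<psi> w) <= mdist Z (\<phi> w) a + mdist Z a (\<psi> w)" using w sp D(2) by (intro mdist_triangle) auto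
  then show "w : {w : space M. mdist Z (\<phi> w) (\<psi> w) < c}" using w by (simp add: mdist_commute)
 qed
 also have "... : sets M"
 proof (rule sets.countable_UN'')
  show "countable (D \<times> (\<rat>::real set))" using D(1) countable_rat by auto
  fix i assume "i : D \<times> (\<rat>::real set)"
  then obtain a q where i: "i = (a, q)" "a : mspace Z" using D(2) by auto
  have [measurable]: "(%w. mdist Z (\<phi> w) a) : Borel M" "(%w. mdist Z (\<psi> w) a) : Borel M"
   using measurable_compose[OF \<phi> measurable_mdist[OF i(2)]] measurable_compose[OF \<psi> measurable_mdist[OF i(2)]] by auto
  show "(case i of (a, q) => {w : space M. mdist Z (\<phi> w) a < q & mdist Z (\<psi> w) a < c - q}) : sets M" unfolding i by simp
 qed
 finally show "{w : space M. mdist Z (\<phi> w) (\<psi> w) < c} : sets M" .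
qed

text \<open>One point from each covering set suffices; unlike with balls, no centres have to be found.\<close>
lemma separable_spaceI_cover:
 assumes "!!e. e > 0 ==> EX \<U>. countable \<U> & mspace Z \<subseteq> \<Union>\<U> & (ALL U:\<U>. ALL x:U \<inter> mspace Z. ALL y:U \<inter> mspace Z. mdist Z x y < e)"
 shows "separable Z"
proof -
 have "EX \<U>. countable \<U> & mspace Z \<subseteq> \<Union>\<U> & (ALL U:\<U>. ALL x:U \<inter> mspace Z. ALL y:U \<inter> mspace Z. mdist Z x y < 1 / Suc n)" for n
  by (rule assms) simp
 then obtain \<U> where \<U>: "!!n. countable (\<U> n)" "!!n. mspace Z \<subseteq> \<Union>(\<U> n)"
  "!!n U x y. U : \<U> n ==> x : U \<inter> mspace Z ==> y : U \<inter> mspace Z ==> mdist Z x y < 1 / Suc n"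
  by metis
 define D where "D = (\<Union>n::nat. (%U. SOME x. x : U \<inter> mspace Z) ` {U : \<U> n. U \<inter> mspace Z ~= {}})"
 have some: "(SOME x. x : U \<inter> mspace Z) : U \<inter> mspace Z" if "U \<inter> mspace Z ~= {}" for U
  using that by (rule someI_ex[of "%x. x : U \<inter> mspace Z", OF ex_in_conv[THEN iffD2]])
 show ?thesis
 proof (rule separable_spaceI)
  show "countable D" unfolding D_def using \<U>(1) by (intro countable_UN countable_image countable_subset[OF _ \<U>(1)]) auto
  show "D \<subseteq> mspace Z" unfolding D_def using some by blast
  fix x and e :: real assume x: "x : mspace Z" "0 < e"
  obtain n where n: "1 / Suc n < e" using nat_approx_posE x by blast
  obtain U where U: "U : \<U> n" "x : U" using \<U>(2)[of n] x by blast
  then have ne: "U \<inter> mspace Z ~= {}" using x by blast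
  let ?a = "SOME x. x : U \<inter> mspace Z"
  have "?a : D" unfolding D_def using U ne by blast
  moreover have "mdist Z x ?a < e" using \<U>(3)[OF U(1), of x ?a] some[OF ne] U x n by auto
  ultimately show "EX a:D. mdist Z x a < e" by blast
 qed
qed

section \<open>The space of curves\<close>

text \<open>Nearest point of \<open>[0,1]\<close>. Composing with it continues a curve to the whole line by its
endpoints, so that difference quotients and changes of time need no boundary cases.\<close>
definition cl :: "real => real" where "cl t = max 0 (min 1 t)"

abbreviation (input) "pos u == fst u (cl (snd u))"
abbreviation (input) "pt w z == (fst w (cl (fst z)), snd w (cl (snd z)))"

lemma cl_in [simp]: "cl t : {0..1}" "0 <= cl t" "cl t <= 1" by (auto simp: cl_def)
lemma cl_id: "0 <= t ==> t <= 1 ==> cl t = t" by (auto simp: cl_def)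
lemma cl_lipschitz: "\<bar>cl s - cl t\<bar> <= \<bar>s - t\<bar>" by (auto simp: cl_def)
lemma cl_measurable [measurable]: "cl : Borel borel" unfolding cl_def[abs_def] by measurable

lemma continuous_map_real_metric:
 "continuous_map (top_of_set (S::real set)) (mtopology_of Z) f \<longleftrightarrow>
  (ALL t:S. f t : mspace Z) & (ALL t:S. ALL e>0. EX d>0. ALL s:S. \<bar>s - t\<bar> < d --> mdist Z (f t) (f s) < e)"
proof -
 interpret Z: Metric_space "mspace Z" "mdist Z" by (rule Metric_space_mspace_mdist)
 have "continuous_map (top_of_set S) (mtopology_of Z) f \<longleftrightarrow>
  (ALL t:S. f t : mspace Z) & continuous_map (top_of_set S) (mtopology_of Z) f"
  using continuous_map_funspace[of "top_of_set S" "mtopology_of Z" f] by (auto simp: Pi_iff)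
 also have "... \<longleftrightarrow> (ALL t:S. f t : mspace Z) & (ALL t:S. ALL e>0. EX U. openin (top_of_set S) U & t : U & (ALL s:U. f s : mspace Z & mdist Z (f t) (f s) < e))"
  unfolding mtopology_of_def Z.continuous_map_to_metric Z.in_mball topspace_euclidean_subtopology by blast
 also have "... \<longleftrightarrow> (ALL t:S. f t : mspace Z) & (ALL t:S. ALL e>0. EX d>0. ALL s:S. \<bar>s - t\<bar> < d --> mdist Z (f t) (f s) < e)"
 proof (intro conj_cong refl ball_cong all_cong1 imp_cong iffI)
  fix t e :: real assume f: "ALL t:S. f t : mspace Z" and t: "t : S"
  assume "EX U. openin (top_of_set S) U & t : U & (ALL s:U. f s : mspace Z & mdist Z (f t) (f s) < e)"
  then obtain U where U: "openin (top_of_set S) U" "t : U" "ALL s:U. f s : mspace Z & mdist Z (f t) (f s) < e" by blast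
  then obtain d where "d > 0" "ALL s:S. dist s t < d --> s : U" unfolding openin_euclidean_subtopology_iff by blast
  then show "EX d>0. ALL s:S. \<bar>s - t\<bar> < d --> mdist Z (f t) (f s) < e" using U by (intro exI[of _ d]) (auto simp: dist_real_def)
 next
  fix t e :: real assume f: "ALL t:S. f t : mspace Z" and t: "t : S"
  assume "EX d>0. ALL s:S. \<bar>s - t\<bar> < d --> mdist Z (f t) (f s) < e"
  then obtain d where d: "d > 0" "!!s. s : S ==> \<bar>s - t\<bar> < d ==> mdist Z (f t) (f s) < e" by blast
  show "EX U. openin (top_of_set S) U & t : U & (ALL s:U. f s : mspace Z & mdist Z (f t) (f s) < e)"
   by (rule exI[of _ "S \<inter> ball t d"]) (use d f t in \<open>auto simp: openin_open_Int dist_real_def abs_minus_commute\<close>)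
 qed
 finally show ?thesis .
qed

lemma mspace_curve_space: "curves Z = {\<gamma>. (ALL t:{0..1}. \<gamma> t : mspace Z) & \<gamma> : extensional {0..1} &
  (ALL t:{0..1}. ALL e>0. EX d>0. ALL s:{0..1}. \<bar>s - t\<bar> < d --> mdist Z (\<gamma> t) (\<gamma> s) < e)}"
proof -
 have c: "compactin (top_of_set {0..1::real}) (topspace (top_of_set {0..1}))" by (simp add: compactin_subtopology)
 have *: "(A & B & (A & C)) = (A & B & C)" for A B C by blast
 show ?thesis
  unfolding curve_space_def compactin_mspace_cfunspace[OF c] continuous_map_real_metric topspace_euclidean_subtopology * ..
qed

lemma curve_in: "c : curves Z ==> c (cl t) : mspace Z"
 using cl_in(1)[of t] unfolding mspace_curve_space by blast

lemma mdist_curve_le: "\<gamma> : curves Z ==> \<omega> : curves Z ==>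
 mdist (curve_space Z) \<gamma> \<omega> <= c \<longleftrightarrow> (ALL t:{0..1}. mdist Z (\<gamma> t) (\<omega> t) <= c)"
 unfolding curve_space_def using cfunspace_mdist_le[of \<gamma> "top_of_set {0..1}" Z \<omega> c] by simp

lemma curve_continuous:
 assumes "c : curves Z" "x ----> t" "a : mspace Z"
 shows "(%k. mdist Z (c (cl (x k))) a) ----> mdist Z (c (cl t)) a"
proof (rule tendstoI)
 fix e :: real assume "e > 0"
 then obtain d where d: "d > 0" "!!s. s : {0..1} ==> \<bar>s - cl t\<bar> < d ==> mdist Z (c (cl t)) (c s) < e"
  using assms(1) cl_in(1)[of t] unfolding mspace_curve_space mem_Collect_eq by blast
 have "\<forall>\<^sub>F k in sequentially. \<bar>x k - t\<bar> < d" using assms(2) d(1) by (auto simp: tendsto_iff dist_real_def)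
 then show "\<forall>\<^sub>F k in sequentially. dist (mdist Z (c (cl (x k))) a) (mdist Z (c (cl t)) a) < e"
 proof eventually_elim
  case (elim k)
  then have "mdist Z (c (cl t)) (c (cl (x k))) < e" using cl_lipschitz[of "x k" t] by (intro d) auto
  moreover have "mdist Z (c (cl t)) a <= mdist Z (c (cl t)) (c (cl (x k))) + mdist Z (c (cl (x k))) a"
   "mdist Z (c (cl (x k))) a <= mdist Z (c (cl (x k))) (c (cl t)) + mdist Z (c (cl t)) a"
   using assms curve_in by (auto intro!: mdist_triangle)
  ultimately show "dist (mdist Z (c (cl (x k))) a) (mdist Z (c (cl t)) a) < e"
   by (simp add: dist_real_def mdist_commute abs_less_iff)
 qed
qed

text \<open>A cover by countably many sets of small diameter: curves are grouped by a modulus of continuity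
\<open>1/n\<close> and by the nearest dense points on a grid.\<close>
lemma separable_curve_space:
 assumes sep: "separable Z"
 shows "separable_space (mtopology_of (curve_space Z))"
proof (rule separable_spaceI_cover)
 fix e :: real assume e: "e > 0"
 define \<epsilon> where "\<epsilon> = e / 6"
 have \<epsilon>: "\<epsilon> > 0" using e by (simp add: \<epsilon>_def)
 obtain D where D: "countable D" "D \<subseteq> mspace Z" "!!x e. x : mspace Z ==> 0 < e ==> EX a:D. mdist Z x a < e"
  using separable_dense_set[OF sep] by blast
 define U where "U = (%(n, zs). {\<gamma>. (ALL s:{0..1}. ALL t:{0..1}. \<bar>s - t\<bar> < 1 / Suc n --> mdist Z (\<gamma> s) (\<gamma> t) < \<epsilon>) &
   (ALL i<=2 * Suc n. i < length zs & mdist Z (\<gamma> (real i / (2 * Suc n))) (zs ! i) < \<epsilon>)})"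
 define \<U> where "\<U> = U ` (UNIV \<times> {zs. set zs \<subseteq> D})"
 have c\<U>: "countable \<U>"
  unfolding \<U>_def using D(1) by (intro countable_image countable_SIGMA) (auto simp: lists_eq_set[symmetric])
 have cov: "curves Z \<subseteq> \<Union>\<U>"
 proof
  fix \<gamma> assume \<gamma>: "\<gamma> : curves Z"
  have "uniformly_continuous_map (submetric euclidean_metric {0..1}) Z \<gamma>"
  proof (rule continuous_imp_uniformly_continuous_map, rule conjI)
   have "compact {0..1::real}" by simp
   then show "compact_space (mtopology_of (submetric euclidean_metric {0..1::real}))"
    by (simp add: mtopology_of_submetric mtopology_of_euclidean compact_space_subtopology)
   show "continuous_map (mtopology_of (submetric euclidean_metric {0..1})) (mtopology_of Z) \<gamma>"

   proof -
    have "continuous_map (top_of_set {0..1}) (mtopology_of Z) \<gamma>"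
     using \<gamma> unfolding continuous_map_real_metric mspace_curve_space by simp
    then show ?thesis by (simp add: mtopology_of_submetric)
   qed
  qed
  then obtain d where d: "d > 0" "!!s t. s : {0..1} ==> t : {0..1} ==> \<bar>s - t\<bar> < d ==> mdist Z (\<gamma> s) (\<gamma> t) < \<epsilon>"
   using \<epsilon> unfolding uniformly_continuous_map_def by (force simp: dist_real_def)
  obtain n where n: "1 / Suc n < d" using nat_approx_posE d(1) by blast
  have "ALL i. EX a:D. i <= 2 * Suc n --> mdist Z (\<gamma> (real i / (2 * Suc n))) a < \<epsilon>"
  proof
   fix i
   show "EX a:D. i <= 2 * Suc n --> mdist Z (\<gamma> (real i / (2 * Suc n))) a < \<epsilon>"
   proof (cases "i <= 2 * Suc n")
    case True
    then have "real i <= real (2 * Suc n)" by (simp only: of_nat_le_iff)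
    then have "real i / (2 * Suc n) : {0..1}" by (simp add: divide_le_eq)
    then have "\<gamma> (real i / (2 * Suc n)) : mspace Z" using \<gamma> unfolding mspace_curve_space by blast
    from D(3)[OF this \<epsilon>] show ?thesis by blast
   next
    case False
    have "\<gamma> 0 : mspace Z" using \<gamma> by (auto simp: mspace_curve_space)
    then show ?thesis using D(3)[OF _ \<epsilon>] False by blast
   qed
  qed
  then obtain a where a: "!!i. a i : D" "!!i. i <= 2 * Suc n ==> mdist Z (\<gamma> (real i / (2 * Suc n))) (a i) < \<epsilon>" by metis
  have "\<gamma> : U (n, map a [0..<Suc (2 * Suc n)])"
   unfolding U_def using d(2) n a(2) by (auto simp del: upt_Suc of_nat_Suc mult_Suc_right simp: less_Suc_eq_le)
  then show "\<gamma> : \<Union>\<U>" unfolding \<U>_def using a(1) by (intro UnionI[OF imageI]) auto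
 qed
 have diam: "mdist (curve_space Z) \<gamma> \<omega> < e" if "V : \<U>" "\<gamma> : V \<inter> curves Z" "\<omega> : V \<inter> curves Z" for V \<gamma> \<omega>
 proof -
  obtain n zs where V: "V = U (n, zs)" "set zs \<subseteq> D" using \<open>V : \<U>\<close> by (auto simp: \<U>_def)
  have "mdist (curve_space Z) \<gamma> \<omega> <= 4 * \<epsilon>"
  proof (subst mdist_curve_le, use that in blast, use that in blast, intro ballI)
   fix t :: real assume t: "t : {0..1}"
   define i where "i = nat \<lfloor>t * (2 * Suc n)\<rfloor>"
   have i: "real i <= t * (2 * Suc n)" "t * (2 * Suc n) < real i + 1" using t by (auto simp: i_def)
   have "real i <= real (2 * Suc n)" using i(1) t by (smt (verit) atLeastAtMost_iff mult_left_le_one_le of_nat_0_le_iff of_nat_mult of_nat_numeral)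
   then have i2: "i <= 2 * Suc n" by (simp only: of_nat_le_iff)
   define u where "u = real i / (2 * Suc n)"
   have u: "u : {0..1}" using \<open>real i <= real (2 * Suc n)\<close> by (simp add: u_def divide_le_eq)
   define m where "m = real (2 * Suc n)"
   have m: "m > 0" by (simp add: m_def)
   have "u - t = (real i - t * m) / m" using m unfolding u_def m_def[symmetric] by (simp add: diff_divide_distrib)
   moreover have "\<bar>real i - t * m\<bar> <= 1" using i unfolding m_def[symmetric] by linarith
   ultimately have "\<bar>u - t\<bar> <= 1 / m" using m by (simp add: abs_divide divide_right_mono)
   then have "\<bar>u - t\<bar> <= 1 / (2 * Suc n)" unfolding m_def .
   also have "... < 1 / Suc n" by (simp add: field_simps)
   finally have ut: "\<bar>u - t\<bar> < 1 / Suc n" "\<bar>t - u\<bar> < 1 / Suc n" by (auto simp: abs_minus_commute)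
   have g: "\<gamma> t : mspace Z" "\<gamma> u : mspace Z" "\<omega> t : mspace Z" "\<omega> u : mspace Z"
    using that t u by (auto simp: mspace_curve_space)
   have M: "!!\<gamma>. \<gamma> : V ==> mdist Z (\<gamma> t) (\<gamma> u) < \<epsilon>" "!!\<gamma>. \<gamma> : V ==> mdist Z (\<gamma> u) (\<gamma> t) < \<epsilon>" "!!\<gamma>. \<gamma> : V ==> mdist Z (\<gamma> u) (zs ! i) < \<epsilon>"
    unfolding V U_def using t u ut i2 unfolding u_def by blast+
   have "i < length zs" using that(2) i2 unfolding V U_def by blast
   then have z: "zs ! i : mspace Z" using V(2) D(2) nth_mem by blast
   have "mdist Z (\<gamma> t) (\<omega> t) <= mdist Z (\<gamma> t) (\<gamma> u) + mdist Z (\<gamma> u) (\<omega> t)"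
    "mdist Z (\<gamma> u) (\<omega> t) <= mdist Z (\<gamma> u) (zs ! i) + mdist Z (zs ! i) (\<omega> t)"
    "mdist Z (zs ! i) (\<omega> t) <= mdist Z (zs ! i) (\<omega> u) + mdist Z (\<omega> u) (\<omega> t)"
    using g z by (auto intro!: mdist_triangle)
   then show "mdist Z (\<gamma> t) (\<omega> t) <= 4 * \<epsilon>" using M(1)[of \<gamma>] M(3)[of \<gamma>] M(2)[of \<omega>] M(3)[of \<omega>] that by (simp add: mdist_commute)
  qed
  also have "... < e" using e by (simp add: \<epsilon>_def)
  finally show ?thesis .
 qed
 show "EX \<U>. countable \<U> & curves Z \<subseteq> \<Union>\<U> & (ALL U:\<U>. ALL x:U \<inter> curves Z. ALL y:U \<inter> curves Z. mdist (curve_space Z) x y < e)"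
  using c\<U> cov diam by (intro exI[of _ \<U>]) blast
qed

lemma measurable_lipschitz:
 assumes "!!x y. x : mspace W ==> y : mspace W ==> \<bar>\<phi> x - \<phi> y\<bar> <= c * mdist W x y"
 shows "(\<phi> :: _ => real) : Borel (borel_of_metric W)"
proof (rule borel_measurableI)
 fix S :: "real set" assume S: "open S"
 have "\<phi> -` S \<inter> mspace W : sets (borel_of_metric W)"
 proof (rule openin_borel_of_metric, unfold openin_mtopology_of_iff, intro conjI ballI)
  fix x assume x: "x : \<phi> -` S \<inter> mspace W"
  then obtain e where e: "e > 0" "!!y. dist y (\<phi> x) < e ==> y : S" using S unfolding open_dist by auto
  define d where "d = e / (\<bar>c\<bar> + 1)"
  have d: "d > 0" using e by (simp add: d_def)
  show "EX r>0. ALL y:mspace W. mdist W x y < r --> y : \<phi> -` S \<inter> mspace W"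
  proof (intro exI[of _ d] conjI ballI impI d)
   fix y assume y: "y : mspace W" "mdist W x y < d"
   have "\<bar>\<phi> x - \<phi> y\<bar> <= c * mdist W x y" using assms x y by blast
   also have "... <= \<bar>c\<bar> * mdist W x y" by (intro mult_right_mono) auto
   also have "... <= \<bar>c\<bar> * d" using y by (intro mult_left_mono) auto
   also have "... < e" using e by (simp add: d_def field_simps)
   finally show "y : \<phi> -` S \<inter> mspace W" using y e(2) by (simp add: dist_real_def abs_minus_commute)
  qed
 qed simp
 then show "\<phi> -` S \<inter> space (borel_of_metric W) : sets (borel_of_metric W)" by simp
qed

abbreviation "\<Omega> Z \<equiv> borel_of_metric (curve_space Z)"

lemma mdist_triangle_abs:
 assumes "x : mspace Z" "y : mspace Z" "a : mspace Z"
 shows "\<bar>mdist Z x a - mdist Z y a\<bar> <= mdist Z x y"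
 using mdist_triangle[OF assms(1,2,3)] mdist_triangle[OF assms(2,1,3)] by (simp add: mdist_commute abs_le_iff)

lemma measurable_eval_at:
 assumes sep: "separable Z"
 shows "(%\<gamma>. \<gamma> (cl t)) : measurable (\<Omega> Z) (borel_of_metric Z)"
proof (rule measurable_borel_of_metricI[OF sep])
 show "\<gamma> (cl t) : mspace Z" if "\<gamma> : space (\<Omega> Z)" for \<gamma> using that curve_in by simp
 fix a assume a: "a : mspace Z"
 show "(%\<gamma>. mdist Z (\<gamma> (cl t)) a) : Borel (\<Omega> Z)"
 proof (rule measurable_lipschitz[where c=1])
  fix x y assume xy: "x : curves Z" "y : curves Z"
  have "\<bar>mdist Z (x (cl t)) a - mdist Z (y (cl t)) a\<bar> <= mdist Z (x (cl t)) (y (cl t))"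
   using xy a curve_in by (intro mdist_triangle_abs) auto
  also have "... <= mdist (curve_space Z) x y"
   using mdist_curve_le[OF xy, of "mdist (curve_space Z) x y"] cl_in(1)[of t] by blast
  finally show "\<bar>mdist Z (x (cl t)) a - mdist Z (y (cl t)) a\<bar> <= 1 * mdist (curve_space Z) x y" by simp
 qed
qed

text \<open>Joint measurability by approximation of the time with a grid from below, using continuity of the curve.\<close>
lemma measurable_eval:
 assumes sep: "separable Z"
 shows "(%p. pos p) : measurable (\<Omega> Z >< borel) (borel_of_metric Z)"
proof (rule measurable_borel_of_metricI[OF sep])
 fix p :: "(real => 'a) \<times> real" assume "p : space (\<Omega> Z >< borel)"
 then show "pos p : mspace Z" using curve_in by (auto simp: space_pair_measure)
next
 fix a assume a: "a : mspace Z"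
 define r where "r k t = of_int \<lfloor>real (Suc k) * t\<rfloor> / real (Suc k)" for k and t :: real
 have r: "(%k. r k t) ----> t" for t
 proof (rule real_tendsto_sandwich)
  have "t - 1 / real (Suc k) <= r k t" for k
  proof -
   have "real (Suc k) * t - 1 <= of_int \<lfloor>real (Suc k) * t\<rfloor>" by linarith
   then have "(real (Suc k) * t - 1) / real (Suc k) <= r k t" unfolding r_def by (intro divide_right_mono) auto
   then show ?thesis by (simp add: diff_divide_distrib del: of_nat_Suc)
  qed
  then show "\<forall>\<^sub>F k in sequentially. t - 1 / real (Suc k) <= r k t" by simp
  have "r k t <= t" for k unfolding r_def
   by (simp add: divide_le_eq mult.commute del: of_nat_Suc)
  then show "\<forall>\<^sub>F k in sequentially. r k t <= t" by simp
  show "(%k. t - 1 / real (Suc k)) ----> t"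
   using tendsto_diff[OF tendsto_const LIMSEQ_Suc[OF lim_1_over_n], of t] by simp
 qed simp
 show "(%p. mdist Z (pos p) a) : Borel (\<Omega> Z >< borel)"
 proof (rule borel_measurable_LIMSEQ_real[where u="%k p. mdist Z (fst p (cl (r k (snd p)))) a"])
  show "(%k. mdist Z (fst p (cl (r k (snd p)))) a) ----> mdist Z (pos p) a" if "p : space (\<Omega> Z >< borel)" for p
   using that a r by (intro curve_continuous) (auto simp: space_pair_measure)
  fix k
  have "(%p. (%i p. mdist Z (fst p (cl (of_int i / real (Suc k)))) a) \<lfloor>real (Suc k) * snd p\<rfloor> p) : Borel (\<Omega> Z >< borel)"
  proof (rule measurable_compose_countable[where f="%i p. mdist Z (fst p (cl (of_int i / real (Suc k)))) a" and g="%p. \<lfloor>real (Suc k) * snd p\<rfloor>"])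
   show "(%p. \<lfloor>real (Suc k) * snd p\<rfloor>) : measurable (\<Omega> Z >< borel) (count_space UNIV)" by measurable
   fix i :: int
   show "(%p. mdist Z (fst p (cl (of_int i / real (Suc k)))) a) : Borel (\<Omega> Z >< borel)"
   proof -
    have "(%c. mdist Z (c (cl (of_int i / real (Suc k)))) a) : Borel (\<Omega> Z)"
     using measurable_compose[OF measurable_eval_at[OF sep, of "of_int i / real (Suc k)"] measurable_mdist[OF a]] .
    from measurable_compose[OF measurable_fst this] show ?thesis .
   qed
  qed
  then show "(%p. mdist Z (fst p (cl (r k (snd p)))) a) : Borel (\<Omega> Z >< borel)"
   by (simp add: r_def)
 qed
qed

lemma measurable_eval':
 assumes sep: "separable Z"
  and [measurable]: "\<phi> : measurable M (\<Omega> Z)" "\<tau> : Borel M"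
 shows "(%w. \<phi> w (cl (\<tau> w))) : measurable M (borel_of_metric Z)"
proof -
 have "(%w. (\<phi> w, \<tau> w)) : measurable M (\<Omega> Z >< borel)" by measurable
 from measurable_compose[OF this measurable_eval[OF sep]] show ?thesis by simp
qed

lemma curve_in': "c : curves Z ==> t : {0..1} ==> c t : mspace Z"
 unfolding mspace_curve_space mem_Collect_eq by blast

lemma curve_continuous_at:
 assumes "c : curves Z" "t : {0..1}" "0 < e"
 shows "EX d>0. ALL s:{0..1}. \<bar>s - t\<bar> < d --> mdist Z (c t) (c s) < e"
 using assms unfolding mspace_curve_space mem_Collect_eq by blast

lemma (in sigma_algebra) sets_Collect_countable_Ball':
 assumes "countable I" "!!i. i : I ==> {x\<in>\<Omega>. P i x} : M"
 shows "{x\<in>\<Omega>. ALL i:I. P i x} : M"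
proof (cases "I = {}")
 case False
 have "{x\<in>\<Omega>. ALL i:I. P i x} = (\<Inter>i\<in>I. {x\<in>\<Omega>. P i x})" using False by auto
 also have "... : M" by (rule countable_INT'[OF assms(1) False]) (use assms(2) in auto)
 finally show ?thesis .
qed auto

text \<open>The uniform distance to a fixed curve is a supremum over rational times.\<close>
lemma measurable_into_curve_space:
 assumes sep: "separable Z"
  and sp: "!!w. w : space M ==> \<phi> w : curves Z"
  and ev: "!!t. t : {0..1} ==> (%w. \<phi> w t) : measurable M (borel_of_metric Z)"
 shows "\<phi> : measurable M (\<Omega> Z)"
proof (rule measurable_borel_of_metricI[OF separable_curve_space[OF sep] sp])
 fix \<omega> assume \<omega>: "\<omega> : curves Z"
 show "(%w. mdist (curve_space Z) (\<phi> w) \<omega>) : Borel M"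
 proof (rule borel_measurableI_le)
  fix c :: real
  have "{w : space M. mdist (curve_space Z) (\<phi> w) \<omega> <= c} = {w : space M. ALL t:\<rat>\<inter>{0..1}. mdist Z (\<phi> w t) (\<omega> t) <= c}"
  proof (intro Collect_cong conj_cong refl iffI)
   fix w assume w: "w : space M" and "mdist (curve_space Z) (\<phi> w) \<omega> <= c"
   then show "ALL t:\<rat>\<inter>{0..1}. mdist Z (\<phi> w t) (\<omega> t) <= c"
    using mdist_curve_le[OF sp[OF w] \<omega>] by blast
  next
   fix w assume w: "w : space M" and le: "ALL t:\<rat>\<inter>{0..1}. mdist Z (\<phi> w t) (\<omega> t) <= c"
   show "mdist (curve_space Z) (\<phi> w) \<omega> <= c"
    unfolding mdist_curve_le[OF sp[OF w] \<omega>]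
   proof (rule ballI, rule field_le_epsilon)
    fix t e :: real assume t: "t : {0..1}" and "0 < e"
    then have e: "0 < e / 2" by simp
    obtain d1 where d1: "d1 > 0" "!!s. s : {0..1} ==> \<bar>s - t\<bar> < d1 ==> mdist Z (\<phi> w t) (\<phi> w s) < e/2"
     using curve_continuous_at[OF sp[OF w] t e] by blast
    obtain d2 where d2: "d2 > 0" "!!s. s : {0..1} ==> \<bar>s - t\<bar> < d2 ==> mdist Z (\<omega> t) (\<omega> s) < e/2"
     using curve_continuous_at[OF \<omega> t e] by blast
    define d where "d = min d1 d2"
    have "max 0 (t - d) < min 1 (t + d)" using t d1 d2 by (auto simp: d_def)
    then obtain s where s: "s : \<rat>" "max 0 (t - d) < s" "s < min 1 (t + d)" using Rats_dense_in_real by blast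
    then have s': "s : {0..1}" "\<bar>s - t\<bar> < d1" "\<bar>s - t\<bar> < d2" by (auto simp: d_def)
    have in_Z: "\<phi> w t : mspace Z" "\<phi> w s : mspace Z" "\<omega> t : mspace Z" "\<omega> s : mspace Z"
     using curve_in'[OF sp[OF w]] curve_in'[OF \<omega>] t s'(1) by simp_all
    have "mdist Z (\<phi> w t) (\<omega> t) <= mdist Z (\<phi> w t) (\<phi> w s) + mdist Z (\<phi> w s) (\<omega> t)"
     "mdist Z (\<phi> w s) (\<omega> t) <= mdist Z (\<phi> w s) (\<omega> s) + mdist Z (\<omega> s) (\<omega> t)"
     using in_Z by (auto intro!: mdist_triangle)
    moreover have "mdist Z (\<phi> w s) (\<omega> s) <= c" using le s s' by blast
    ultimately show "mdist Z (\<phi> w t) (\<omega> t) <= c + e"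
     using d1(2)[OF s'(1,2)] d2(2)[OF s'(1,3)] by (simp add: mdist_commute)
   qed
  qed
  also have "... : sets M"
  proof (rule sets.sets_Collect_countable_Ball')
   show "countable (\<rat> \<inter> {0..1::real})" using countable_rat by (rule countable_subset[rotated]) auto
   fix t :: real assume t: "t : \<rat> \<inter> {0..1}"
   then have "\<omega> t : mspace Z" using curve_in'[OF \<omega>] by blast
   then have "(%w. mdist Z (\<phi> w t) (\<omega> t)) : Borel M"
    using t by (intro measurable_compose[OF ev measurable_mdist]) auto
   then show "{w : space M. mdist Z (\<phi> w t) (\<omega> t) <= c} : sets M" by simp
  qed
  finally show "{w : space M. mdist (curve_space Z) (\<phi> w) \<omega> <= c} : sets M" .
 qed
qed

section \<open>Speed of absolutely continuous curves\<close>

text \<open>A measurable version of the metric speed for the continued curve. One-sided quotients along a sequence make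
it a limit of measurable functions; the absolute value makes it nonnegative where the limit fails to exist.\<close>
definition speed :: "'z metric => (real => 'z) => real => real" where
 "speed Z c t = \<bar>lim (%k. mdist Z (c (cl (t + 1 / real (Suc k)))) (c (cl t)) * real (Suc k))\<bar>"

definition slope :: "('z => real) => (real => 'z) => real => real" where
 "slope u c t = lim (%k. (u (c (cl (t + 1 / real (Suc k)))) - u (c (cl t))) * real (Suc k))"

lemma speed_nonneg [simp]: "0 <= speed Z c t" by (simp add: speed_def)

lemma measurable_speed:
 assumes sep: "separable Z"
  and [measurable]: "\<phi> : measurable M (\<Omega> Z)" "\<tau> : Borel M"
 shows "(%w. speed Z (\<phi> w) (\<tau> w)) : Borel M"
proof -
 have [measurable]: "(%w. mdist Z (\<phi> w (cl (\<tau> w + 1 / real (Suc k)))) (\<phi> w (cl (\<tau> w)))) : Borel M" for k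
  by (intro measurable_mdist2[OF sep] measurable_eval'[OF sep]) auto
 show ?thesis unfolding speed_def by measurable
qed

text \<open>The parameter \<open>P\<close> allows a whole family of functions to be differentiated along curves at once.\<close>
lemma measurable_slope:
 assumes sep: "separable Z"
  and [measurable]: "\<phi> : measurable M (\<Omega> Z)" "\<tau> : Borel M"
  and f: "(%p. f (snd p) (fst p)) : Borel (borel_of_metric Z >< P)" and [measurable]: "\<psi> : measurable M P"
 shows "(%w. slope (f (\<psi> w)) (\<phi> w) (\<tau> w)) : Borel M"
proof -
 have *: "(%w. f (\<psi> w) (\<phi> w (cl (\<tau>' w)))) : Borel M" if [measurable]: "\<tau>' : Borel M" for \<tau>'
 proof -
  have [measurable]: "(%w. \<phi> w (cl (\<tau>' w))) : measurable M (borel_of_metric Z)" by (intro measurable_eval'[OF sep]) auto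
  have "(%w. (\<phi> w (cl (\<tau>' w)), \<psi> w)) : measurable M (borel_of_metric Z >< P)" by measurable
  from measurable_compose[OF this f] show ?thesis by simp
 qed
 have [measurable]: "(%w. f (\<psi> w) (\<phi> w (cl (\<tau> w + 1 / real (Suc k))))) : Borel M" for k by (rule *) simp
 have [measurable]: "(%w. f (\<psi> w) (\<phi> w (cl (\<tau> w)))) : Borel M" by (rule *) simp
 show ?thesis unfolding slope_def by measurable
qed

lemma abs_continuous_curve_prim:
 assumes ac: "ac_curve Z c"
 obtains h where "integrable lborel h" "!!t. 0 <= h t"
  "!!s t. s <= t ==> mdist Z (c (cl s)) (c (cl t)) <= prim h t - prim h s"
proof -
 obtain h where h: "set_integrable lborel {0..1} h" and
  le: "!!s t. 0 <= s ==> s <= t ==> t <= 1 ==> mdist Z (c s) (c t) <= (LINT r:{s..t}|lborel. h r)"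
  using ac unfolding abs_continuous_curve_def by blast
 define h0 where "h0 x = \<bar>indicator {0..1} x *\<^sub>R h x\<bar>" for x
 have h0: "integrable lborel h0" unfolding h0_def[abs_def] by (rule integrable_abs[OF h[unfolded set_integrable_def]])
 have pos: "0 <= h0 t" for t by (simp add: h0_def)
 have "mdist Z (c (cl s)) (c (cl t)) <= prim h0 t - prim h0 s" if st: "s <= t" for s t
 proof (cases "s < 1 & 0 < t")
  case False
  then have "cl s = cl t" using st by (auto simp: cl_def)
  then have "mdist Z (c (cl s)) (c (cl t)) <= (LINT r:{cl t..cl t}|lborel. h r)" using le[of "cl t" "cl t"] by simp
  also have "... = 0"
   unfolding set_lebesgue_integral_def
   by (rule integral_eq_zero_AE) (use AE_lborel_singleton[of "cl t"] in eventually_elim, auto simp: indicator_def)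
  finally show ?thesis using prim_mono[OF h0 pos st] by simp
 next
  case True
  then have st': "s <= cl s" "cl s <= cl t" "cl t <= t" using st by (auto simp: cl_def)
  have i: "integrable lborel (%r. indicator {cl s..cl t} r * h r)"
  proof -
   have "integrable lborel (%r. indicator {cl s..cl t} r * (indicator {0..1} r * h r))"
    by (rule integrable_indicator_mult) (use h in \<open>auto simp: set_integrable_def\<close>)
   moreover have "(%r. indicator {cl s..cl t} r * (indicator {0..1} r * h r)) = (%r. indicator {cl s..cl t} r * h r)"
    using cl_in(2)[of s] cl_in(3)[of t] by (auto simp: indicator_def fun_eq_iff simp del: cl_in)
   ultimately show ?thesis by simp
  qed
  have "mdist Z (c (cl s)) (c (cl t)) <= (LINT r:{cl s..cl t}|lborel. h r)" using st' by (intro le) auto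
  also have "... <= (LINT r:{s..t}|lborel. h0 r)"
   unfolding set_lebesgue_integral_def real_scaleR_def
  proof (rule integral_mono[OF i])
   show "integrable lborel (%r. indicator {s..t} r * h0 r)" using h0 by (intro integrable_indicator_mult) auto
   fix r show "indicator {cl s..cl t} r * h r <= indicator {s..t} r * h0 r"
    using st' cl_in(2)[of s] cl_in(3)[of t] by (auto simp: indicator_def h0_def simp del: cl_in)
  qed
  also have "... = (LINT r:{s<..t}|lborel. h0 r)"
  proof (rule set_integral_cong_set)
   show "AE x in lborel. (x : {s<..t}) = (x : {s..t})"
    using AE_lborel_singleton[of s] by eventually_elim auto
  qed (use h0 in \<open>auto simp: set_borel_measurable_def\<close>)
  also have "... = prim h0 t - prim h0 s" by (rule prim_diff[OF h0 st, symmetric])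
  finally show ?thesis .
 qed
 with h0 pos show thesis using that by blast
qed

lemma abs_continuous_curveI:
 assumes h: "integrable lborel h" and le: "!!s t. 0 <= s ==> s <= t ==> t <= 1 ==> mdist Z (c s) (c t) <= prim h t - prim h s"
 shows "ac_curve Z c"
 unfolding abs_continuous_curve_def
proof (intro exI[of _ h] conjI allI impI)
 show "set_integrable lborel {0..1} h" unfolding set_integrable_def using h by (intro integrable_mult_indicator) auto
 fix s t :: real assume st: "0 <= s & s <= t & t <= 1"
 have "prim h t - prim h s = (LINT r:{s<..t}|lborel. h r)" using st by (intro prim_diff[OF h]) auto
 also have "... = (LINT r:{s..t}|lborel. h r)"
 proof (rule set_integral_cong_set)
  show "AE x in lborel. (x : {s..t}) = (x : {s<..t})"
   using AE_lborel_singleton[of s] by eventually_elim auto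
 qed (use h in \<open>auto simp: set_borel_measurable_def\<close>)
 finally show "mdist Z (c s) (c t) <= (LINT r:{s..t}|lborel. h r)" using le[of s t] st by simp
qed

lemma prim_cong_AE:
 assumes "AE x in lborel. f x = g x" "f : Borel lborel" "g : Borel lborel"
 shows "prim f t = prim g t"
 unfolding prim_def by (rule set_lebesgue_integral_cong_AE) (use assms in auto)

lemma abs_prim_diff_le:
 assumes f: "integrable lborel f" and g: "integrable lborel g" and le: "!!x. \<bar>f x\<bar> <= g x"
 shows "\<bar>prim f t - prim f s\<bar> <= \<bar>prim g t - prim g s\<bar>"
proof -
 have a: "\<bar>prim f t - prim f s\<bar> <= prim g t - prim g s" if "s <= t" for s t
 proof -
  have n: "0 <= g x + f x" "0 <= g x - f x" for x using le[of x] by linarith+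
  have "prim (%x. g x + f x) s <= prim (%x. g x + f x) t" "prim (%x. g x - f x) s <= prim (%x. g x - f x) t"
   using that f g n by (auto intro!: prim_mono)
  then show ?thesis unfolding prim_add[OF g f] prim_diff_fun[OF g f] by linarith
 qed
 show ?thesis using a[of s t] a[of t s] by (cases "s <= t") auto
qed

text \<open>The speed is the supremum of the absolute derivatives of the distances to a countable dense set of points.
Its integral dominates the distances along the curve, and the difference quotients are bounded below by
those of each distance function; differentiation squeezes them to the supremum.\<close>
lemma ac_speed_aux:
 assumes sep: "separable Z" and \<gamma>: "\<gamma> : curves Z" and ac: "ac_curve Z \<gamma>"
 obtains v where "integrable lborel v" "!!t. 0 <= v t"
  "!!s t. s <= t ==> mdist Z (\<gamma> (cl s)) (\<gamma> (cl t)) <= prim v t - prim v s"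
  "AE t in lborel. ((%s. mdist Z (\<gamma> (cl s)) (\<gamma> (cl t)) / \<bar>s - t\<bar>) \<longlongrightarrow> v t) (at t)"
proof -
 obtain h where h: "integrable lborel h" "!!t. 0 <= h t"
  and hd: "!!s t. s <= t ==> mdist Z (\<gamma> (cl s)) (\<gamma> (cl t)) <= prim h t - prim h s"
  using abs_continuous_curve_prim[OF ac] by blast
 obtain D where D: "countable D" "D \<subseteq> mspace Z" "!!x e. x : mspace Z ==> 0 < e ==> EX a:D. mdist Z x a < e"
  using separable_dense_set[OF sep] by blast
 have D0: "D ~= {}" using D(3)[OF curve_in[OF \<gamma>, of 0], of 1] by auto
 have in_Z: "\<gamma> (cl t) : mspace Z" for t by (rule curve_in[OF \<gamma>])
 have "EX d. integrable lborel d & (ALL t. \<bar>d t\<bar> <= h t) & (ALL s t. mdist Z (\<gamma> (cl t)) a - mdist Z (\<gamma> (cl s)) a = prim d t - prim d s)" if a: "a : D" for a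
 proof -
  have "\<bar>mdist Z (\<gamma> (cl t)) a - mdist Z (\<gamma> (cl s)) a\<bar> <= prim h t - prim h s" if "s <= t" for s t
   using mdist_triangle_abs[OF in_Z in_Z, of a t s] a D(2) hd[OF that] by (auto simp: mdist_commute)
  from ac_imp_prim[OF h this] obtain d where d: "integrable lborel d" "AE t in lborel. \<bar>d t\<bar> <= h t"
   "!!s t. mdist Z (\<gamma> (cl t)) a - mdist Z (\<gamma> (cl s)) a = prim d t - prim d s" by blast
  define d' where "d' t = (if \<bar>d t\<bar> <= h t then d t else 0)" for t
  have m[measurable]: "d : Borel borel" "h : Borel borel" using d h by auto
  have eq: "AE t in lborel. d t = d' t" using d(2) by eventually_elim (simp add: d'_def)
  have m': "d' : Borel borel" unfolding d'_def[abs_def] by measurable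
  have "integrable lborel d'" using integrable_cong_AE_imp[OF d(1) _ eq] m' by simp
  moreover have "prim d t = prim d' t" for t by (rule prim_cong_AE[OF eq]) (use m' in auto)
  moreover have "\<bar>d' t\<bar> <= h t" for t using h(2) by (simp add: d'_def)
  ultimately show ?thesis using d(3) by (intro exI[of _ d']) auto
 qed
 then have "ALL a:D. EX d. integrable lborel d & (ALL t. \<bar>d t\<bar> <= h t) & (ALL s t. mdist Z (\<gamma> (cl t)) a - mdist Z (\<gamma> (cl s)) a = prim d t - prim d s)"
  by (rule ballI)
 from bchoice[OF this] obtain d where d: "!!a. a : D ==> integrable lborel (d a)" "!!a t. a : D ==> \<bar>d a t\<bar> <= h t"
  "!!a s t. a : D ==> mdist Z (\<gamma> (cl t)) a - mdist Z (\<gamma> (cl s)) a = prim (d a) t - prim (d a) s" by blast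
 define v where "v t = (SUP a\<in>D. \<bar>d a t\<bar>)" for t
 have bdd: "bdd_above ((%a. \<bar>d a t\<bar>) ` D)" for t using d(2) by (intro bdd_aboveI2) auto
 have dv: "\<bar>d a t\<bar> <= v t" if "a : D" for a t unfolding v_def by (rule cSUP_upper[OF that bdd])
 have v0: "0 <= v t" for t using D0 dv[of _ t] by (meson abs_ge_zero ex_in_conv order_trans)
 have vh: "v t <= h t" for t unfolding v_def by (rule cSUP_least[OF D0]) (use d in auto)
 have vm: "v : Borel lborel" unfolding v_def[abs_def]
  by (rule borel_measurable_cSUP[OF D(1)]) (use d bdd in auto)
 have vi: "integrable lborel v"
  by (rule Bochner_Integration.integrable_bound[OF h(1) vm]) (use v0 vh h in \<open>auto intro: order_trans\<close>)
 have md: "mdist Z (\<gamma> (cl s)) (\<gamma> (cl t)) <= prim v t - prim v s" if st: "s <= t" for s t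
 proof (rule field_le_epsilon)
  fix e :: real assume "0 < e"
  then obtain a where a: "a : D" "mdist Z (\<gamma> (cl s)) a < e / 2" using D(3)[OF in_Z, of "e/2" s] by auto
  have "mdist Z (\<gamma> (cl s)) (\<gamma> (cl t)) <= mdist Z (\<gamma> (cl s)) a + mdist Z a (\<gamma> (cl t))"
   using a D in_Z by (intro mdist_triangle) auto
  also have "... = (mdist Z (\<gamma> (cl t)) a - mdist Z (\<gamma> (cl s)) a) + 2 * mdist Z (\<gamma> (cl s)) a" by (simp add: mdist_commute)
  also have "... <= \<bar>prim (d a) t - prim (d a) s\<bar> + e" using a d(3)[OF a(1)] by simp
  also have "\<bar>prim (d a) t - prim (d a) s\<bar> <= prim v t - prim v s"
   using abs_prim_diff_le[OF d(1)[OF a(1)] vi dv[OF a(1)], of t s] prim_mono[OF vi v0 st] by simp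
  finally show "mdist Z (\<gamma> (cl s)) (\<gamma> (cl t)) <= prim v t - prim v s + e" by simp
 qed
 have "AE t in lborel. ALL a:D. (prim (d a) has_real_derivative d a t) (at t)"
  unfolding AE_ball_countable[OF D(1)] by (intro ballI AE_prim_has_derivative d)
 then have "AE t in lborel. ((%s. mdist Z (\<gamma> (cl s)) (\<gamma> (cl t)) / \<bar>s - t\<bar>) \<longlongrightarrow> v t) (at t)"
  using AE_prim_has_derivative[OF vi]
 proof eventually_elim
  case (elim t)
  note dd = elim(1) and vd = elim(2)
  let ?q = "%s. mdist Z (\<gamma> (cl s)) (\<gamma> (cl t)) / \<bar>s - t\<bar>"
  have up: "?q s <= (prim v s - prim v t) / (s - t)" if "s ~= t" for s
  proof -
   have "?q s <= \<bar>prim v s - prim v t\<bar> / \<bar>s - t\<bar>"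
   proof (rule divide_right_mono)
    show "mdist Z (\<gamma> (cl s)) (\<gamma> (cl t)) <= \<bar>prim v s - prim v t\<bar>"
     using md[of s t] md[of t s] mdist_commute[of Z "\<gamma> (cl s)" "\<gamma> (cl t)"] by (cases "s <= t") auto
   qed simp
   also have "... = (prim v s - prim v t) / (s - t)"
    using prim_mono[OF vi v0, of s t] prim_mono[OF vi v0, of t s] that by (cases "s < t") (auto simp: abs_if field_simps)
   finally show ?thesis .
  qed
  have lo: "\<bar>(prim (d a) s - prim (d a) t) / (s - t)\<bar> <= ?q s" if "a : D" for a s
   using mdist_triangle_abs[OF in_Z in_Z, of a s t] that D(2) d(3)[OF that, of s t]
   unfolding abs_divide by (intro divide_right_mono) auto
  show ?case
  proof (rule order_tendstoI)
   fix c assume "v t < c"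
   with vd[unfolded has_field_derivative_iff] have "\<forall>\<^sub>F s in at t. (prim v s - prim v t) / (s - t) < c" by (rule order_tendstoD)
   then have "\<forall>\<^sub>F s in at t. s ~= t --> ?q s < c" by eventually_elim (use up in fastforce)
   then show "\<forall>\<^sub>F s in at t. ?q s < c" by (simp add: eventually_at_filter)
  next
   fix c assume c: "c < v t"
   then obtain a where a: "a : D" "c < \<bar>d a t\<bar>" unfolding v_def less_cSUP_iff[OF D0 bdd] by blast
   have "((%s. \<bar>(prim (d a) s - prim (d a) t) / (s - t)\<bar>) \<longlongrightarrow> \<bar>d a t\<bar>) (at t)"
    using dd a(1) unfolding has_field_derivative_iff by (intro tendsto_rabs) blast
   then have "\<forall>\<^sub>F s in at t. c < \<bar>(prim (d a) s - prim (d a) t) / (s - t)\<bar>" using a(2) by (rule order_tendstoD)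
   then show "\<forall>\<^sub>F s in at t. c < ?q s" by eventually_elim (use lo[OF a(1)] in \<open>auto intro: less_le_trans\<close>)
  qed
 qed
 with vi v0 md show thesis using that by blast
qed

lemma ac_speed:
 assumes sep: "separable Z" and c: "c : curves Z" and ac: "ac_curve Z c"
 shows "integrable lborel (speed Z c)"
  and "s <= t ==> mdist Z (c (cl s)) (c (cl t)) <= prim (speed Z c) t - prim (speed Z c) s"
  and "AE t in lborel. ((%s. mdist Z (c (cl s)) (c (cl t)) / \<bar>s - t\<bar>) \<longlongrightarrow> speed Z c t) (at t)"
  and "AE t in lborel. t : {0..1} --> metric_speed Z c t = speed Z c t"
  and "AE t in lborel. t ~: {0..1} --> speed Z c t = 0"
proof -
 obtain v where v: "integrable lborel v" "!!t. 0 <= v t"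
  and md: "!!s t. s <= t ==> mdist Z (c (cl s)) (c (cl t)) <= prim v t - prim v s"
  and lim: "AE t in lborel. ((%s. mdist Z (c (cl s)) (c (cl t)) / \<bar>s - t\<bar>) \<longlongrightarrow> v t) (at t)"
  using ac_speed_aux[OF assms] by blast
 have sm: "speed Z c : Borel lborel"
  using measurable_speed[OF sep, of "%_. c" borel "%x. x"] c by simp
 have eq: "AE t in lborel. v t = speed Z c t" using lim
 proof eventually_elim
  case (elim t)
  note l = elim(1)
  have f: "filterlim (%k. t + 1 / real (Suc k)) (at t) sequentially"
   unfolding filterlim_at using tendsto_add[OF tendsto_const LIMSEQ_Suc[OF lim_1_over_n], of t] by (auto simp del: of_nat_Suc)
  from filterlim_compose[OF l f] have "(%k. mdist Z (c (cl (t + 1 / real (Suc k)))) (c (cl t)) * real (Suc k)) ----> v t"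
   by (simp del: of_nat_Suc)
  then have "lim (%k. mdist Z (c (cl (t + 1 / real (Suc k)))) (c (cl t)) * real (Suc k)) = v t" by (rule limI)
  then show ?case unfolding speed_def using v(2)[of t] by simp
 qed
 show si: "integrable lborel (speed Z c)" using integrable_cong_AE_imp[OF v(1) sm eq] .
 have "prim v t = prim (speed Z c) t" for t by (rule prim_cong_AE[OF eq]) (use v sm in auto)
 then show "s <= t ==> mdist Z (c (cl s)) (c (cl t)) <= prim (speed Z c) t - prim (speed Z c) s" using md by simp
 show lim': "AE t in lborel. ((%s. mdist Z (c (cl s)) (c (cl t)) / \<bar>s - t\<bar>) \<longlongrightarrow> speed Z c t) (at t)"
  using lim eq by eventually_elim simp
 show "AE t in lborel. t : {0..1} --> metric_speed Z c t = speed Z c t"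
  using lim'
 proof (eventually_elim, intro impI)
  fix t :: real assume l: "((%s. mdist Z (c (cl s)) (c (cl t)) / \<bar>s - t\<bar>) \<longlongrightarrow> speed Z c t) (at t)" and t: "t : {0..1}"
  have "((%s. mdist Z (c (cl s)) (c (cl t)) / \<bar>s - t\<bar>) \<longlongrightarrow> speed Z c t) (at t within {0..1})"
   using l by (rule tendsto_within_subset) simp
  then have l': "((%s. mdist Z (c s) (c t) / \<bar>s - t\<bar>) \<longlongrightarrow> speed Z c t) (at t within {0..1})"
   by (rule Lim_transform_eventually) (use t in \<open>auto simp: eventually_at_filter cl_id intro!: always_eventually\<close>)
  have "at t within {0..1} ~= bot" using t by (simp add: trivial_limit_within islimpt_Icc)
  then show "metric_speed Z c t = speed Z c t" unfolding metric_speed_def using l' tendsto_Lim[OF _ l'] by auto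
 qed
 show "AE t in lborel. t ~: {0..1} --> speed Z c t = 0"
  using lim'
 proof (eventually_elim, intro impI)
  fix t :: real assume l: "((%s. mdist Z (c (cl s)) (c (cl t)) / \<bar>s - t\<bar>) \<longlongrightarrow> speed Z c t) (at t)" and t: "t ~: {0..1}"
  have "open (- {0..1::real})" by (rule open_Compl[OF closed_atLeastAtMost])
  then have "\<forall>\<^sub>F s in at t. s : - {0..1}" using t by (intro eventually_at_in_open') auto
  moreover have "\<forall>\<^sub>F s in at t. \<bar>s - t\<bar> < 1" unfolding eventually_at by (intro exI[of _ 1]) (auto simp: dist_real_def)
  ultimately have "\<forall>\<^sub>F s in at t. mdist Z (c (cl s)) (c (cl t)) / \<bar>s - t\<bar> = 0"
  proof eventually_elim
   case (elim s)
   note s = elim(1-2)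
   then have "cl s = cl t" using t by (auto simp: cl_def abs_if split: if_splits)
   then show ?case using mdist_zero[OF curve_in[OF c] curve_in[OF c], of t t] by simp
  qed
  then have "((%s. mdist Z (c (cl s)) (c (cl t)) / \<bar>s - t\<bar>) \<longlongrightarrow> 0) (at t)" by (rule tendsto_eventually)
  then show "speed Z c t = 0" using l tendsto_unique[of "at t"] by (metis trivial_limit_at)
 qed
qed

lemma ac_speed_affine:
 assumes sep: "separable Z" and c: "c : curves Z" and ac: "ac_curve Z c"
 shows "AE t in lborel. ((%s. mdist Z (c (cl (r + a * s))) (c (cl (r + a * t))) / \<bar>s - t\<bar>) \<longlongrightarrow> \<bar>a\<bar> * speed Z c (r + a * t)) (at t)"
proof (cases "a = 0")
 case True
 have "mdist Z (c (cl r)) (c (cl r)) = 0" using mdist_zero[OF curve_in[OF c] curve_in[OF c], of r r] by simp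
 then show ?thesis using True by simp
next
 case False
 show ?thesis using AE_lborel_affine[OF ac_speed(3)[OF assms] False, of r]
 proof eventually_elim
  case (elim t)
  note l = elim(1)
  have f: "filterlim (%s. r + a * s) (at (r + a * t)) (at t)"
   unfolding filterlim_at using False by (auto simp: eventually_at_filter intro!: tendsto_intros)
  have "((%s. \<bar>a\<bar> * (mdist Z (c (cl (r + a * s))) (c (cl (r + a * t))) / \<bar>(r + a * s) - (r + a * t)\<bar>)) \<longlongrightarrow> \<bar>a\<bar> * speed Z c (r + a * t)) (at t)"
   by (intro tendsto_mult_left filterlim_compose[OF l f])
  moreover have "\<bar>a\<bar> * (mdist Z (c (cl (r + a * s))) (c (cl (r + a * t))) / \<bar>(r + a * s) - (r + a * t)\<bar>) = mdist Z (c (cl (r + a * s))) (c (cl (r + a * t))) / \<bar>s - t\<bar>" for s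
  proof -
   have "\<bar>(r + a * s) - (r + a * t)\<bar> = \<bar>a\<bar> * \<bar>s - t\<bar>" by (simp add: abs_mult[symmetric] right_diff_distrib)
   then show ?thesis using False by simp
  qed
  ultimately show "((%s. mdist Z (c (cl (r + a * s))) (c (cl (r + a * t))) / \<bar>s - t\<bar>) \<longlongrightarrow> \<bar>a\<bar> * speed Z c (r + a * t)) (at t)"
   by simp
 qed
qed

section \<open>A countable dense set of integrable functions\<close>

text \<open>Finite intersections of balls with rational radii around dense points.\<close>
lemma borel_of_metric_countable_generator:
 assumes sep: "separable Z"
 shows "EX E :: nat => 'z set. range E \<subseteq> Pow (mspace Z) & Int_stable (range E) &
  sets (borel_of_metric Z) = sigma_sets (mspace Z) (range E) & mspace Z : range E"
proof -
 obtain D where D: "countable D" "D \<subseteq> mspace Z" "!!x e. x : mspace Z ==> 0 < e ==> EX a:D. mdist Z x a < e"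
  using separable_dense_set[OF sep] by blast
 define b where "b = (%(a, n::nat). {z : mspace Z. mdist Z z a < 1 / Suc n})"
 define B where "B = b ` (D \<times> UNIV)"
 have cB: "countable B" unfolding B_def using D(1) by simp
 define \<E> where "\<E> = (%F. mspace Z \<inter> \<Inter>F) ` {F. finite F & F \<subseteq> B}"
 have c\<E>: "countable \<E>" unfolding \<E>_def by (intro countable_image countable_Collect_finite_subset cB)
 have top: "mspace Z : \<E>" unfolding \<E>_def by (rule image_eqI[of _ _ "{}"]) auto
 have r: "range (from_nat_into \<E>) = \<E>" using c\<E> top by (intro range_from_nat_into) auto
 have Bsets: "A : sets (borel_of_metric Z)" if A: "A : B" for A
 proof -
  obtain an where an: "an : D \<times> UNIV" "A = b an" using A unfolding B_def by (rule imageE)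
  obtain a n where "an = (a, n)" by (cases an)
  with an have a: "a : D" "A = {z : mspace Z. mdist Z z a < 1 / Suc n}" by (simp_all add: b_def)
  have "a : mspace Z" using a(1) D(2) by (rule rev_subsetD)
  note [measurable] = measurable_mdist[OF this]
  have "{z : space (borel_of_metric Z). mdist Z z a < 1 / Suc n} : sets (borel_of_metric Z)" by measurable
  then show ?thesis using a by simp
 qed
 have stable: "Int_stable \<E>"
 proof (rule Int_stableI)
  fix a b assume "a : \<E>" "b : \<E>"
  then obtain F G where F: "finite F" "F \<subseteq> B" "a = mspace Z \<inter> \<Inter>F" and G: "finite G" "G \<subseteq> B" "b = mspace Z \<inter> \<Inter>G"
   unfolding \<E>_def by blast
  then have "a \<inter> b = mspace Z \<inter> \<Inter>(F \<union> G)" unfolding F(3) G(3) by blast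
  moreover have "F \<union> G : {F. finite F & F \<subseteq> B}" using F(1,2) G(1,2) by simp
  ultimately show "a \<inter> b : \<E>" unfolding \<E>_def by (rule image_eqI)
 qed
 have sub: "\<E> \<subseteq> sets (borel_of_metric Z)"
 proof
  fix A assume "A : \<E>"
  then obtain F where F: "finite F" "F \<subseteq> B" "A = mspace Z \<inter> \<Inter>F" unfolding \<E>_def by blast
  have "space (borel_of_metric Z) : sets (borel_of_metric Z)" by (rule sets.top)
  then have m: "mspace Z : sets (borel_of_metric Z)" by simp
  show "A : sets (borel_of_metric Z)"
  proof (cases "F = {}")
   case True then show ?thesis using F m by simp
  next
   case False
   have "\<Inter>((%x. x) ` F) : sets (borel_of_metric Z)" using F(1) False
   proof (rule sets.finite_INT)
    fix x assume "x : F" then show "x : sets (borel_of_metric Z)" using F(2) Bsets by blast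
   qed
   then show ?thesis using m F(3) by (simp add: sets.Int)
  qed
 qed
 have "sets (borel_of_metric Z) = sigma_sets (mspace Z) \<E>"
 proof
  show "sigma_sets (mspace Z) \<E> \<subseteq> sets (borel_of_metric Z)"
   using sets.sigma_sets_subset[OF sub] by simp
  show "sets (borel_of_metric Z) \<subseteq> sigma_sets (mspace Z) \<E>" unfolding sets_borel_of_metric
  proof (rule sigma_sets_mono, rule subsetI)
   fix U assume "U : {U. openin (mtopology_of Z) U}"
   then have U: "U \<subseteq> mspace Z" "!!x. x : U ==> EX r>0. ALL y:mspace Z. mdist Z x y < r --> y : U"
    by (auto simp: openin_mtopology_of_iff)
   have "U = \<Union>{A : B. A \<subseteq> U}"
   proof (intro equalityI subsetI)
    fix x assume x: "x : U"
    then obtain r where r: "r > 0" "!!y. y : mspace Z ==> mdist Z x y < r ==> y : U" using U(2) by blast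
    obtain n where n: "1 / Suc n < r / 2" using nat_approx_posE[of "r/2"] r(1) by auto
    have xm: "x : mspace Z" using x U by blast
    have "(0::real) < 1 / Suc n" by simp
    from D(3)[OF xm this] obtain a where a: "a : D" "mdist Z x a < 1 / Suc n" by blast
    have "b (a, n) \<subseteq> U"
    proof
     fix y assume "y : b (a, n)"
     then have y: "y : mspace Z" "mdist Z y a < 1 / Suc n" by (auto simp: b_def)
     have "mdist Z x y <= mdist Z x a + mdist Z a y" using xm y a D(2) by (intro mdist_triangle) auto
     then have "mdist Z x y < r" using a y n mdist_commute[of Z a y] by linarith
     then show "y : U" using r(2) y by blast
    qed
    moreover have "b (a, n) : B" unfolding B_def using a by blast
    moreover have "x : b (a, n)" using a xm by (simp add: b_def)
    ultimately show "x : \<Union>{A : B. A \<subseteq> U}" by blast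
   qed blast
   moreover have "\<Union>{A : B. A \<subseteq> U} : sigma_sets (mspace Z) \<E>"
   proof (rule sigma_sets_UNION)
    show "countable {A : B. A \<subseteq> U}" using cB by (rule countable_subset[rotated]) blast
    fix A assume A: "A : {A : B. A \<subseteq> U}"
    then have "A = mspace Z \<inter> \<Inter>{A}" using U by blast
    then have "A : \<E>" unfolding \<E>_def using A by (intro image_eqI[of _ _ "{A}"]) auto
    then show "A : sigma_sets (mspace Z) \<E>" by (rule sigma_sets.Basic)
   qed
   ultimately show "U : sigma_sets (mspace Z) \<E>" by simp
  qed
 qed
 moreover have "\<E> \<subseteq> Pow (mspace Z)" unfolding \<E>_def by blast
 ultimately show ?thesis using stable top by (intro exI[of _ "from_nat_into \<E>"]) (simp add: r)
qed

locale smm = sigma_finite_measure m for m :: "'z measure" +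
 fixes Z :: "'z metric" and p :: real
 assumes sep: "separable Z" and sets_m: "sets m = sets (borel_of_metric Z)" and p: "1 < p"
begin

lemma space_m: "space m = mspace Z"
 using sets_eq_imp_space_eq[OF sets_m] by simp

abbreviation "q \<equiv> p / (p - 1)"

lemma q: "1 < q" using p by (simp add: less_divide_eq)

definition lp :: "('z => real) => ennreal" where "lp u = (\<integral>\<^sup>+z. ennreal (\<bar>u z\<bar> powr p) \<partial>m)"

lemma Lp_space_iff: "u : Lp_space p m \<longleftrightarrow> u : Borel m & lp u < \<infinity>"
proof (cases "u : Borel m")
 case True
 then have "(%z. \<bar>u z\<bar> powr p) : Borel m" by measurable
 then show ?thesis using True by (auto simp: Lp_space_def lp_def integrable_iff_bounded)
qed (auto simp: Lp_space_def)

lemma powr_add_le: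
 assumes "0 <= a" "0 <= b" shows "(a + b) powr p <= 2 powr p * a powr p + 2 powr p * b powr p"
proof -
 have "(a + b) powr p <= (2 * max a b) powr p" using assms p by (intro powr_mono2) auto
 also have "... = 2 powr p * (max a b) powr p" using assms by (intro powr_mult)
 also have "... <= 2 powr p * a powr p + 2 powr p * b powr p" by (auto simp: max_def)
 finally show ?thesis .
qed

lemma lp_add_le:
 assumes [measurable]: "u : Borel m" "v : Borel m" and w: "!!z. z : space m ==> \<bar>w z\<bar> <= \<bar>u z\<bar> + \<bar>v z\<bar>"
 shows "lp w <= ennreal (2 powr p) * lp u + ennreal (2 powr p) * lp v"
proof -
 have "lp w <= (\<integral>\<^sup>+z. ennreal (2 powr p) * ennreal (\<bar>u z\<bar> powr p) + ennreal (2 powr p) * ennreal (\<bar>v z\<bar> powr p) \<partial>m)"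
  unfolding lp_def
 proof (rule nn_integral_mono)
  fix z assume "z : space m"
  then have "\<bar>w z\<bar> powr p <= (\<bar>u z\<bar> + \<bar>v z\<bar>) powr p" using w p by (intro powr_mono2) auto
  also have "... <= 2 powr p * \<bar>u z\<bar> powr p + 2 powr p * \<bar>v z\<bar> powr p" by (rule powr_add_le) auto
  finally show "ennreal (\<bar>w z\<bar> powr p) <= ennreal (2 powr p) * ennreal (\<bar>u z\<bar> powr p) + ennreal (2 powr p) * ennreal (\<bar>v z\<bar> powr p)"
   by (simp add: ennreal_mult'[symmetric] ennreal_plus[symmetric] ennreal_leI del: ennreal_plus)
 qed
 also have "... = ennreal (2 powr p) * lp u + ennreal (2 powr p) * lp v"
  unfolding lp_def by (subst nn_integral_add) (auto simp: nn_integral_cmult)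
 finally show ?thesis .
qed

lemma lp_mult:
 assumes [measurable]: "u : Borel m"
 shows "lp (%z. c * u z) = ennreal (\<bar>c\<bar> powr p) * lp u"
 unfolding lp_def by (subst nn_integral_cmult[symmetric]) (auto simp: abs_mult powr_mult ennreal_mult')

lemma lp_mono: "(!!z. z : space m ==> \<bar>u z\<bar> <= \<bar>v z\<bar>) ==> lp u <= lp v"
 unfolding lp_def using p by (intro nn_integral_mono ennreal_leI powr_mono2) auto

lemma lp_indicator: "A : sets m ==> lp (indicator A) = emeasure m A"
proof -
 assume A: "A : sets m"
 have "lp (indicator A) = (\<integral>\<^sup>+z. indicator A z \<partial>m)"
  unfolding lp_def by (intro nn_integral_cong) (auto simp: indicator_def)
 then show ?thesis using A by simp
qed

text \<open>Rational combinations of indicators of generators, cut off to sets of finite measure. Their closure contains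
indicators of measurable sets by a Dynkin argument, then simple functions, then all functions by dominated
convergence.\<close>
lemma Lp_countable_dense:
 obtains \<Phi> where "countable \<Phi>" "!!\<phi>. \<phi> : \<Phi> ==> \<phi> : Borel m" "!!\<phi>. \<phi> : \<Phi> ==> lp \<phi> < \<infinity>"
  "!!u \<epsilon>. u : Borel m ==> lp u < \<infinity> ==> 0 < \<epsilon> ==> EX \<phi>:\<Phi>. lp (%z. u z - \<phi> z) < ennreal \<epsilon>"
proof -
 obtain E :: "nat => 'z set" where E': "range E \<subseteq> Pow (mspace Z) & Int_stable (range E) &
  sets (borel_of_metric Z) = sigma_sets (mspace Z) (range E) & mspace Z : range E"
  using borel_of_metric_countable_generator[OF sep] by (rule exE)
 note E = E'[THEN conjunct1] E'[THEN conjunct2, THEN conjunct1] E'[THEN conjunct2, THEN conjunct2, THEN conjunct1]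
  E'[THEN conjunct2, THEN conjunct2, THEN conjunct2]
 have Em: "E i : sets m" for i unfolding sets_m E(3) by (rule sigma_sets.Basic[OF rangeI])
 obtain A :: "nat => 'z set" where A: "range A \<subseteq> sets m" "(\<Union>i. A i) = space m" "!!i. emeasure m (A i) ~= \<infinity>" "incseq A"
  by (rule sigma_finite_incseq) blast
 have Am[measurable]: "A n : sets m" for n using A(1) by blast
 note Em[measurable]
 define G :: "(nat \<times> nat \<times> rat) list => 'z => real" where "G l z = (\<Sum>(i,n,c)\<leftarrow>l. of_rat c * indicator (E i \<inter> A n) z)" for l z
 have G_Nil: "G [] = (%z. 0)" by (simp add: G_def fun_eq_iff)
 have G_app: "G (l @ l') z = G l z + G l' z" for l l' z by (simp add: G_def)
 have G_Cons: "G ((i,n,c) # l) z = of_rat c * indicator (E i \<inter> A n) z + G l z" for i n c l z by (simp add: G_def)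
 have G_scale: "G (map (%(i,n,c). (i,n,r * c)) l) z = of_rat r * G l z" for r l z
  by (induction l) (auto simp: G_Nil G_Cons of_rat_mult algebra_simps)
 have Gm[measurable]: "G l : Borel m" for l
 proof (induction l)
  case (Cons a l)
  obtain i n c where a: "a = (i,n,c)" by (cases a)
  have "(%z. of_rat c * indicator (E i \<inter> A n) z + G l z) : Borel m" using Cons.IH by measurable
  then show ?case unfolding a by (simp add: G_Cons cong: measurable_cong)
 qed (simp add: G_Nil)
 have pp: "ennreal (2 powr p) * x < \<infinity>" if "x < \<infinity>" for x using that by (simp add: ennreal_mult_less_top)
 have G_fin: "lp (G l) < \<infinity>" for l
 proof (induction l)
  case Nil then show ?case using p by (simp add: G_Nil lp_def)
 next
  case (Cons a l)
  obtain i n c where a: "a = (i,n,c)" by (cases a)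
  have 1: "lp (%z. of_rat c * indicator (E i \<inter> A n) z) < \<infinity>"
  proof -
   have "emeasure m (E i \<inter> A n) <= emeasure m (A n)" by (intro emeasure_mono) auto
   then have "emeasure m (E i \<inter> A n) < \<infinity>" using A(3)[of n] by (simp add: less_top order_le_less_trans)
   then show ?thesis by (subst lp_mult) (auto simp: lp_indicator ennreal_mult_less_top)
  qed
  have "lp (G (a # l)) <= ennreal (2 powr p) * lp (%z. of_rat c * indicator (E i \<inter> A n) z) + ennreal (2 powr p) * lp (G l)"
   by (rule lp_add_le) (auto simp: a G_Cons abs_triangle_ineq)
  also have "... < \<infinity>" using pp[OF 1] pp[OF Cons.IH] by simp
  finally show ?case .
 qed
 define good where "good u \<longleftrightarrow> u : Borel m & (ALL \<epsilon>>0. EX l. lp (%z. u z - G l z) < ennreal \<epsilon>)" for u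
 have good_m: "good u ==> u : Borel m" for u by (simp add: good_def)
 have add_small: "ennreal (2 powr p) * x + ennreal (2 powr p) * y < ennreal \<epsilon>"
  if "x < ennreal (\<epsilon> / (4 * 2 powr p))" "y < ennreal (\<epsilon> / (4 * 2 powr p))" "\<epsilon> > 0" for x y \<epsilon>
 proof -
  have "ennreal (2 powr p) * x + ennreal (2 powr p) * y <= ennreal (2 powr p) * ennreal (\<epsilon> / (4 * 2 powr p)) + ennreal (2 powr p) * ennreal (\<epsilon> / (4 * 2 powr p))"
   using that by (intro add_mono mult_left_mono) auto
  also have "... = ennreal (\<epsilon> / 2)" using that by (simp add: ennreal_mult'[symmetric] ennreal_plus[symmetric] del: ennreal_plus)
  also have "... < ennreal \<epsilon>" using that by (simp add: ennreal_lessI)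
  finally show ?thesis .
 qed
 have good_limit: "good u" if u[measurable]: "u : Borel m" and ap: "!!\<epsilon>. \<epsilon> > 0 ==> EX v. good v & lp (%z. u z - v z) < ennreal \<epsilon>" for u
  unfolding good_def
 proof (intro conjI u allI impI)
  fix \<epsilon> :: real assume \<epsilon>: "\<epsilon> > 0"
  then have \<delta>: "\<epsilon> / (4 * 2 powr p) > 0" by simp
  obtain v where v: "good v" "lp (%z. u z - v z) < ennreal (\<epsilon> / (4 * 2 powr p))" using ap[OF \<delta>] by blast
  obtain l where l: "lp (%z. v z - G l z) < ennreal (\<epsilon> / (4 * 2 powr p))" using v(1) \<delta> unfolding good_def by blast
  have [measurable]: "v : Borel m" using v(1) by (rule good_m)
  have "lp (%z. u z - G l z) <= ennreal (2 powr p) * lp (%z. u z - v z) + ennreal (2 powr p) * lp (%z. v z - G l z)"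
   by (rule lp_add_le) auto
  also have "... < ennreal \<epsilon>" by (rule add_small[OF v(2) l \<epsilon>])
  finally show "EX l. lp (%z. u z - G l z) < ennreal \<epsilon>" by blast
 qed
 have good_add: "good (%z. u z + v z)" if uv: "good u" "good v" for u v
  unfolding good_def
 proof (intro conjI allI impI)
  have [measurable]: "u : Borel m" "v : Borel m" using uv good_m by auto
  show "(%z. u z + v z) : Borel m" by measurable
  fix \<epsilon> :: real assume \<epsilon>: "\<epsilon> > 0"
  then have \<delta>: "\<epsilon> / (4 * 2 powr p) > 0" by simp
  obtain l l' where l: "lp (%z. u z - G l z) < ennreal (\<epsilon> / (4 * 2 powr p))" "lp (%z. v z - G l' z) < ennreal (\<epsilon> / (4 * 2 powr p))"
   using uv \<delta> unfolding good_def by blast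
  have "lp (%z. (u z + v z) - G (l @ l') z) <= ennreal (2 powr p) * lp (%z. u z - G l z) + ennreal (2 powr p) * lp (%z. v z - G l' z)"
   by (rule lp_add_le) (auto simp: G_app)
  also have "... < ennreal \<epsilon>" by (rule add_small[OF l \<epsilon>])
  finally show "EX l. lp (%z. (u z + v z) - G l z) < ennreal \<epsilon>" by blast
 qed
 have good_rat: "good (%z. of_rat r * u z)" if u: "good u" for u r
  unfolding good_def
 proof (intro conjI allI impI)
  have [measurable]: "u : Borel m" using u good_m by auto
  show "(%z. of_rat r * u z) : Borel m" by measurable
  fix \<epsilon> :: real assume \<epsilon>: "\<epsilon> > 0"
  define C where "C = \<bar>of_rat r :: real\<bar> powr p + 1"
  have C: "C > 0" unfolding C_def by (smt (verit) powr_ge_zero)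
  obtain l where l: "lp (%z. u z - G l z) < ennreal (\<epsilon> / (2 * C))"
   using u \<epsilon> C unfolding good_def by (meson divide_pos_pos mult_pos_pos zero_less_numeral)
  have "lp (%z. of_rat r * u z - G (map (%(i,n,c). (i,n,r * c)) l) z) = lp (%z. of_rat r * (u z - G l z))"
   by (simp add: G_scale right_diff_distrib)
  also have "... = ennreal (\<bar>of_rat r\<bar> powr p) * lp (%z. u z - G l z)" by (rule lp_mult) simp
  also have "... <= ennreal C * ennreal (\<epsilon> / (2 * C))" using l by (intro mult_mono) (auto simp: C_def)
  also have "... = ennreal (\<epsilon> / 2)" using C \<epsilon> by (simp add: ennreal_mult'[symmetric])
  also have "... < ennreal \<epsilon>" using \<epsilon> by (simp add: ennreal_lessI)
  finally show "EX l. lp (%z. of_rat r * u z - G l z) < ennreal \<epsilon>" by blast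
 qed
 have good_diff: "good (%z. u z - v z)" if "good u" "good v" for u v
  using good_add[OF that(1) good_rat[OF that(2), of "-1"]] by simp
 have good_zero: "good (%z. 0)" unfolding good_def using p
  by (auto intro!: exI[of _ "[]"] simp: G_Nil lp_def)
 have good_base: "good (indicator (E i \<inter> A n))" for i n
  unfolding good_def
 proof (intro conjI allI impI)
  show "indicator (E i \<inter> A n) : Borel m" by measurable
  fix \<epsilon> :: real assume "\<epsilon> > 0"
  then show "EX l. lp (%z. indicator (E i \<inter> A n) z - G l z) < ennreal \<epsilon>"
   by (intro exI[of _ "[(i,n,1)]"]) (simp add: G_Cons G_Nil lp_def)
 qed
 have good_mult: "good (%z. c * u z)" if u: "good u" "lp u < \<infinity>" for u c
 proof (rule good_limit)
  have [measurable]: "u : Borel m" using u good_m by auto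
  show "(%z. c * u z) : Borel m" by measurable
  fix \<epsilon> :: real assume \<epsilon>: "\<epsilon> > 0"
  obtain K where K: "lp u = ennreal K" "K \<ge> 0" using u(2) by (cases "lp u") auto
  define \<delta> where "\<delta> = (\<epsilon> / (2 * (K + 1))) powr (1 / p)"
  have \<delta>: "\<delta> > 0" using \<epsilon> K unfolding \<delta>_def by (simp add: powr_gt_zero)
  obtain r where r: "c < of_rat r" "of_rat r < c + \<delta>" using of_rat_dense[of c "c + \<delta>"] \<delta> by auto
  have "lp (%z. c * u z - of_rat r * u z) = ennreal (\<bar>c - of_rat r\<bar> powr p) * lp u"
   using lp_mult[of u "c - of_rat r"] by (simp add: left_diff_distrib)
  also have "... <= ennreal (\<delta> powr p) * lp u"
   using r p by (intro mult_right_mono ennreal_leI powr_mono2) auto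
  also have "\<delta> powr p = \<epsilon> / (2 * (K + 1))" unfolding \<delta>_def using p \<epsilon> K by (simp add: powr_powr)
  also have "ennreal (\<epsilon> / (2 * (K + 1))) * lp u = ennreal (\<epsilon> / (2 * (K + 1)) * K)" unfolding K(1) using K \<epsilon> by (intro ennreal_mult[symmetric]) auto
  also have "... < ennreal \<epsilon>"
  proof (rule ennreal_lessI[OF \<epsilon>])
   have "\<epsilon> * K < \<epsilon> * (2 * (K + 1))" using K \<epsilon> by (intro mult_strict_left_mono) auto
   then show "\<epsilon> / (2 * (K + 1)) * K < \<epsilon>" using K by (simp add: divide_less_eq)
  qed
  finally show "EX v. good v & lp (%z. c * u z - v z) < ennreal \<epsilon>" using good_rat[OF u(1)] by blast
 qed
 have small_tail: "EX k. emeasure m (C - B k) < ennreal \<epsilon>"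
  if C: "C : sets m" "emeasure m C ~= \<infinity>" and B: "!!k. B k : sets m" "incseq B" "C \<subseteq> (\<Union>k. B k)" and \<epsilon>: "\<epsilon> > 0" for C and B :: "nat => 'z set" and \<epsilon> :: real
 proof -
  have "(%k. emeasure m (C - B k)) ----> emeasure m (\<Inter>k. C - B k)"
  proof (rule Lim_emeasure_decseq)
   show "range (%k. C - B k) \<subseteq> sets m" using C B by auto
   show "decseq (%k. C - B k)" using B(2) by (auto simp: decseq_def incseq_def)
   have "emeasure m (C - B k) <= emeasure m C" for k using C B by (intro emeasure_mono) auto
   then show "emeasure m (C - B k) ~= \<infinity>" for k using C(2) by (metis infinity_ennreal_def top.extremum_uniqueI)
  qed
  moreover have "(\<Inter>k. C - B k) = {}" using B(3) by blast
  ultimately have "(%k. emeasure m (C - B k)) ----> 0" by (simp only: emeasure_empty)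
  then have "\<forall>\<^sub>F k in sequentially. emeasure m (C - B k) < ennreal \<epsilon>" using \<epsilon> by (intro order_tendstoD) auto
  then show ?thesis by (auto simp: eventually_sequentially)
 qed
 have ind_diff: "lp (%z. indicator C z - indicator (C \<inter> B) z) = emeasure m (C - B)" if "C : sets m" "B : sets m" for B C
 proof -
  have "lp (%z. indicator C z - indicator (C \<inter> B) z) = lp (indicator (C - B))"
   unfolding lp_def by (intro nn_integral_cong) (auto simp: indicator_def)
  then show ?thesis using that by (simp add: lp_indicator)
 qed
 have good_An: "good (indicator (B \<inter> A n))" if B: "B : sets m" for B n
 proof -
  have "B : sigma_sets (mspace Z) (range E)" using B sets_m E(3) by simp
  then show ?thesis
  proof (induction B rule: sigma_sets_induct_disjoint[OF E(2) E(1), consumes 1, case_names basic empty compl union])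
   case (basic B)
   then show ?case using good_base by auto
  next
   case empty
   have "(indicator ({} \<inter> A n) :: 'z => real) = (%z. 0)" by auto
   then show ?case using good_zero by simp
  next
   case (compl B)
   obtain j where j: "mspace Z = E j" using E(4) by blast
   have "good (%z. indicator (E j \<inter> A n) z - indicator (B \<inter> A n) z)" by (rule good_diff[OF good_base compl.IH])
   moreover have "(%z. indicator (E j \<inter> A n) z - indicator (B \<inter> A n) z :: real) = indicator ((mspace Z - B) \<inter> A n)"
   proof
    fix z
    have "B \<subseteq> E j" using sigma_sets_into_sp[OF E(1) compl.hyps] j by blast
    then show "indicator (E j \<inter> A n) z - indicator (B \<inter> A n) z = (indicator ((mspace Z - B) \<inter> A n) z :: real)"
     unfolding j by (auto simp: indicator_def)
   qed
   ultimately show ?case by simp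
  next
   case (union B)
   have Bm[measurable]: "B k : sets m" for k using union.hyps(2) sets_m E(3) by auto
   have part: "good (indicator ((\<Union>i<k. B i) \<inter> A n))" for k
   proof (induction k)
    case 0
    have "(indicator ((\<Union>i<0. B i) \<inter> A n) :: 'z => real) = (%z. 0)" by auto
    then show ?case using good_zero by simp
   next
    case (Suc k)
    have "(indicator ((\<Union>i<Suc k. B i) \<inter> A n) :: 'z => real) = (%z. indicator ((\<Union>i<k. B i) \<inter> A n) z + indicator (B k \<inter> A n) z)"
    proof
     fix z
     have "z ~: B i" if "z : B k" "i < k" for i
     proof -
      have "B i \<inter> B k = {}" using union.hyps(1) that(2) unfolding disjoint_family_on_def by (metis UNIV_I less_irrefl)
      then show ?thesis using that(1) by blast
     qed
     then show "indicator ((\<Union>i<Suc k. B i) \<inter> A n) z = (indicator ((\<Union>i<k. B i) \<inter> A n) z + indicator (B k \<inter> A n) z :: real)"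
      by (auto simp: indicator_def less_Suc_eq)
    qed
    then show ?case using good_add[OF Suc.IH union.IH[of k]] by simp
   qed
   show ?case
   proof (rule good_limit)
    show "indicator ((\<Union>i. B i) \<inter> A n) : Borel m" by measurable
    fix \<epsilon> :: real assume \<epsilon>: "\<epsilon> > 0"
    let ?C = "(\<Union>i. B i) \<inter> A n"
    have "EX k. emeasure m (?C - (\<Union>i<k. B i)) < ennreal \<epsilon>"
    proof (rule small_tail)
     show "?C : sets m" by measurable
     have "emeasure m ?C <= emeasure m (A n)" by (intro emeasure_mono) auto
     then show "emeasure m ?C ~= \<infinity>" using A(3)[of n] by (metis infinity_ennreal_def top.extremum_uniqueI)
     show "(\<Union>i<k. B i) : sets m" for k by measurable
     show "incseq (%k. \<Union>i<k. B i)" unfolding incseq_def by (intro allI impI UN_mono) auto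
     show "?C \<subseteq> (\<Union>k. \<Union>i<k. B i)" by blast
    qed (rule \<epsilon>)
    then obtain k where k: "emeasure m (?C - (\<Union>i<k. B i)) < ennreal \<epsilon>" by blast
    have "?C \<inter> (\<Union>i<k. B i) = (\<Union>i<k. B i) \<inter> A n" by blast
    then have "lp (%z. indicator ?C z - indicator ((\<Union>i<k. B i) \<inter> A n) z) < ennreal \<epsilon>"
     using ind_diff[of ?C "\<Union>i<k. B i"] k by simp
    then show "EX v. good v & lp (%z. indicator ?C z - v z) < ennreal \<epsilon>" using part[of k] by blast
   qed
  qed
 qed
 have good_ind: "good (indicator B)" if B[measurable]: "B : sets m" and fin: "emeasure m B ~= \<infinity>" for B
 proof (rule good_limit)
  show "indicator B : Borel m" by measurable
  fix \<epsilon> :: real assume \<epsilon>: "\<epsilon> > 0"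
  have "EX k. emeasure m (B - A k) < ennreal \<epsilon>"
  proof (rule small_tail[OF B fin Am A(4) _ \<epsilon>])
   show "B \<subseteq> (\<Union>k. A k)" unfolding A(2) by (rule sets.sets_into_space[OF B])
  qed
  then obtain k where k: "emeasure m (B - A k) < ennreal \<epsilon>" by blast
  have "lp (%z. indicator B z - indicator (B \<inter> A k) z) < ennreal \<epsilon>"
   using ind_diff[of B "A k"] k by simp
  then show "EX v. good v & lp (%z. indicator B z - v z) < ennreal \<epsilon>" using good_An[OF B] by blast
 qed
 have good_simple: "good s" if s: "simple_function m s" and fin: "lp s < \<infinity>" for s :: "'z => real"
 proof -
  have fi: "finite (s ` space m)" using s by (rule simple_functionD)
  define S where "S y = s -` {y} \<inter> space m" for y
  have Sm[measurable]: "S y : sets m" for y using simple_functionD(2)[OF s, of "{y}"] by (simp add: S_def)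
  have single: "good (%z. y * indicator (S y) z)" for y
  proof (cases "y = 0")
   case True then show ?thesis using good_zero by simp
  next
   case False
   have "ennreal (\<bar>y\<bar> powr p) * emeasure m (S y) = lp (%z. y * indicator (S y) z)"
    by (subst lp_mult) (auto simp: lp_indicator)
   also have "... <= lp s" by (rule lp_mono) (auto simp: S_def indicator_def)
   finally have "ennreal (\<bar>y\<bar> powr p) * emeasure m (S y) < \<infinity>" using fin by (rule order_le_less_trans)
   then have f: "emeasure m (S y) ~= \<infinity>" using False by (auto simp: ennreal_mult_less_top)
   show ?thesis by (rule good_mult[OF good_ind[OF Sm f]]) (use f in \<open>simp add: lp_indicator less_top\<close>)
  qed
  have sum: "good (%z. \<Sum>y\<in>F. y * indicator (S y) z)" if "finite F" for F
   using that
  proof (induction F rule: finite_induct)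
   case empty show ?case by (simp only: sum.empty good_zero)
  next
   case (insert x F) show ?case using good_add[OF single insert.IH] by (simp only: sum.insert[OF insert.hyps])
  qed
  show ?thesis
  proof (rule good_limit)
   show "s : Borel m" using s by (rule borel_measurable_simple_function)
   fix \<epsilon> :: real assume \<epsilon>: "\<epsilon> > 0"
   have eq: "(\<Sum>y\<in>s ` space m. y * indicator (S y) z) = s z" if z: "z : space m" for z
   proof -
    have "(\<Sum>y\<in>s ` space m. y * indicator (S y) z) = (\<Sum>y\<in>s ` space m. if y = s z then y else 0)"
     using z by (intro sum.cong refl) (auto simp: S_def)
    then show ?thesis using z fi by simp
   qed
   have "lp (%z. s z - (\<Sum>y\<in>s ` space m. y * indicator (S y) z)) = (\<integral>\<^sup>+z. 0 \<partial>m)"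
    unfolding lp_def by (intro nn_integral_cong) (simp only: eq, simp)
   then have "lp (%z. s z - (\<Sum>y\<in>s ` space m. y * indicator (S y) z)) < ennreal \<epsilon>" using \<epsilon> by simp
   then show "EX v. good v & lp (%z. s z - v z) < ennreal \<epsilon>" using sum[OF fi] by blast
  qed
 qed
 have good_all: "good u" if u[measurable]: "u : Borel m" and fin: "lp u < \<infinity>" for u
 proof -
  obtain F where F: "!!i. simple_function m (F i)" "!!x. x : space m ==> (%i. F i x) ----> u x"
   "!!i x. x : space m ==> dist (F i x) 0 <= 2 * dist (u x) 0"
   using borel_measurable_implies_sequence_metric[OF u, of 0] by blast
  have Fm[measurable]: "F i : Borel m" for i using F(1) by (rule borel_measurable_simple_function)
  have Fb: "\<bar>F i z\<bar> <= \<bar>2 * u z\<bar>" if "z : space m" for i z using F(3)[OF that, of i] by (simp add: dist_real_def)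
  have u2: "lp (%z. 2 * u z) < \<infinity>" "lp (%z. 3 * u z) < \<infinity>" using fin by (auto simp: lp_mult ennreal_mult_less_top)
  have Ff: "lp (F i) < \<infinity>" for i by (rule order_le_less_trans[OF lp_mono[OF Fb] u2(1)])
  have "(%i. lp (%z. u z - F i z)) ----> (\<integral>\<^sup>+z. 0 \<partial>m)"
   unfolding lp_def
  proof (rule nn_integral_dominated_convergence[where w="%z. ennreal (\<bar>3 * u z\<bar> powr p)"])
   show "AE z in m. ennreal (\<bar>u z - F i z\<bar> powr p) <= ennreal (\<bar>3 * u z\<bar> powr p)" for i
   proof (rule AE_I2)
    fix z assume "z : space m"
    then show "ennreal (\<bar>u z - F i z\<bar> powr p) <= ennreal (\<bar>3 * u z\<bar> powr p)"
     using Fb[of z i] p by (intro ennreal_leI powr_mono2) auto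
   qed
   show "AE z in m. (%i. ennreal (\<bar>u z - F i z\<bar> powr p)) ----> 0"
   proof (rule AE_I2)
    fix z assume z: "z : space m"
    have "(%i. \<bar>u z - F i z\<bar>) ----> \<bar>u z - u z\<bar>" by (intro tendsto_intros F(2) z)
    then have "(%i. \<bar>u z - F i z\<bar> powr p) ----> 0 powr p" by (intro tendsto_powr2 tendsto_const) (use p in auto)
    then show "(%i. ennreal (\<bar>u z - F i z\<bar> powr p)) ----> 0" using tendsto_ennrealI by fastforce
   qed
   show "(\<integral>\<^sup>+z. ennreal (\<bar>3 * u z\<bar> powr p) \<partial>m) < \<infinity>" using u2(2) by (simp add: lp_def)
  qed auto
  then have lim: "(%i. lp (%z. u z - F i z)) ----> 0" by simp
  show ?thesis
  proof (rule good_limit[OF u])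
   fix \<epsilon> :: real assume "\<epsilon> > 0"
   then have "\<forall>\<^sub>F i in sequentially. lp (%z. u z - F i z) < ennreal \<epsilon>" using lim by (intro order_tendstoD) auto
   then obtain i where "lp (%z. u z - F i z) < ennreal \<epsilon>" by (auto simp: eventually_sequentially)
   then show "EX v. good v & lp (%z. u z - v z) < ennreal \<epsilon>" using good_simple[OF F(1) Ff] by blast
  qed
 qed
 show thesis
 proof (rule that[of "range G"])
  show "countable (range G)" by (rule countable_image) simp
  show "EX \<phi>:range G. lp (%z. u z - \<phi> z) < ennreal \<epsilon>" if "u : Borel m" "lp u < \<infinity>" "0 < \<epsilon>" for u \<epsilon>
   using good_all[OF that(1,2)] that(3) unfolding good_def by blast
 qed (use G_fin in auto)
qed

end

section \<open>Test plans\<close>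

context smm
begin

text \<open>The weighted Young inequality, in a form whose constants need no optimisation.\<close>
lemma young:
 assumes "0 <= a" "0 <= b" "0 < \<delta>"
 shows "b * a <= \<delta> * a powr q + \<delta> powr (1 - p) * b powr p"
proof (cases "b <= \<delta> * a powr (q - 1)")
 case True
 then have "b * a <= \<delta> * a powr (q - 1) * a" using assms by (intro mult_right_mono) auto
 also have "... = \<delta> * a powr q" using assms q by (cases "a = 0") (auto simp: powr_diff)
 also have "... <= \<delta> * a powr q + \<delta> powr (1 - p) * b powr p" using assms by simp
 finally show ?thesis .
next
 case False
 then have lt: "a powr (q - 1) < b / \<delta>" using assms by (simp add: field_simps)
 have "0 <= a powr (q - 1)" by simp
 then have b: "b > 0" using lt assms by (smt (verit) divide_nonpos_pos)
 have qp: "(q - 1) * (p - 1) = 1" using p by (simp add: field_simps)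
 have "a = (a powr (q - 1)) powr (p - 1)" using assms by (simp add: powr_powr qp)
 also have "... <= (b / \<delta>) powr (p - 1)" using lt p by (intro powr_mono2) auto
 finally have "b * a <= b * (b / \<delta>) powr (p - 1)" using b by (intro mult_left_mono) auto
 also have "... = \<delta> powr (1 - p) * b powr p"
  using b assms by (simp add: powr_divide powr_diff)
 also have "... <= \<delta> * a powr q + \<delta> powr (1 - p) * b powr p" using assms by simp
 finally show ?thesis .
qed

abbreviation (input) "wug u g == weak_upper_gradient Z m p u g"
abbreviation "plan E \<equiv> test_plan Z m q E"

definition compress :: "(real => 'z) measure => real => bool" where
 "compress E C \<longleftrightarrow> (ALL t. ALL A:sets m. emeasure E ((%c. c (cl t)) -` A \<inter> space E) <= ennreal C * emeasure m A)"

definition energy :: "(real => 'z) measure => ennreal" where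
 "energy E = (\<integral>\<^sup>+c. \<integral>\<^sup>+t. ennreal (speed Z c t powr q) \<partial>lborel \<partial>E)"

definition lin :: "('z => real) => (real => 'z) => ennreal" where
 "lin g c = (\<integral>\<^sup>+t. ennreal (g (c (cl t)) * speed Z c t) \<partial>lborel)"

lemma plan_sets: "plan E ==> sets E = sets (\<Omega> Z)" by (simp add: test_plan_def)
lemma plan_prob: "plan E ==> prob_space E" by (simp add: test_plan_def)
lemma plan_space: "plan E ==> space E = curves Z"
 using sets_eq_imp_space_eq[OF plan_sets] by simp
lemma plan_AE:
 assumes "plan E" shows "AE c in E. c : curves Z & ac_curve Z c"
proof -
 have "AE c in E. ac_curve Z c" using assms by (simp add: test_plan_def)
 then show ?thesis using AE_space[of E] by eventually_elim (simp add: plan_space[OF assms])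
qed

lemma measurable_ev:
 assumes "sets E = sets (\<Omega> Z)" "\<phi> : measurable M E" "\<tau> : Borel M"
 shows "(%w. \<phi> w (cl (\<tau> w))) : measurable M m"
proof -
 have "\<phi> : measurable M (\<Omega> Z)" using assms(2) measurable_cong_sets[OF refl assms(1)] by blast
 from measurable_eval'[OF sep this assms(3)] show ?thesis using measurable_cong_sets[OF refl sets_m] by blast
qed

lemma measurable_sp:
 assumes "sets E = sets (\<Omega> Z)" "\<phi> : measurable M E" "\<tau> : Borel M"
 shows "(%w. speed Z (\<phi> w) (\<tau> w)) : Borel M"
proof -
 have "\<phi> : measurable M (\<Omega> Z)" using assms(2) measurable_cong_sets[OF refl assms(1)] by blast
 from measurable_speed[OF sep this assms(3)] show ?thesis .
qed

lemma compress_nn: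
 assumes E: "sets E = sets (\<Omega> Z)" and C: "compress E C" and f[measurable]: "f : Borel m"
 shows "(\<integral>\<^sup>+c. f (c (cl t)) \<partial>E) <= ennreal C * (\<integral>\<^sup>+z. f z \<partial>m)"
proof -
 have e[measurable]: "(%c. c (cl t)) : measurable E m" by (rule measurable_ev[OF E]) auto
 have "(\<integral>\<^sup>+c. f (c (cl t)) \<partial>E) = (\<integral>\<^sup>+z. f z \<partial>distr E m (%c. c (cl t)))"
  by (rule nn_integral_distr[symmetric]) auto
 also have "... <= (\<integral>\<^sup>+z. f z \<partial>density m (%_. ennreal C))"
 proof (rule nn_integral_mono_measure)
  have "emeasure (distr E m (%c. c (cl t))) A <= emeasure (density m (%_. ennreal C)) A" for A
  proof (cases "A : sets m")
   case True
   then show ?thesis using C[unfolded compress_def, rule_format, OF True, of t]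
    by (simp add: emeasure_distr[OF e] emeasure_density nn_integral_cmult_indicator)
  qed (simp add: emeasure_notin_sets)
  then show "distr E m (%c. c (cl t)) <= density m (%_. ennreal C)"
   by (simp add: le_measure_iff le_fun_def)
 qed simp
 also have "... = ennreal C * (\<integral>\<^sup>+z. f z \<partial>m)"
  by (subst nn_integral_density) (auto simp: nn_integral_cmult)
 finally show ?thesis .
qed

lemma AE_speed:
 assumes "c : curves Z" "ac_curve Z c"
 shows "AE t in lborel. (t : {0..1} --> metric_speed Z c t = speed Z c t) & (t ~: {0..1} --> speed Z c t = 0)"
 using ac_speed(4)[OF sep assms] ac_speed(5)[OF sep assms] by eventually_elim blast

lemma lin_eq:
 assumes "c : curves Z" "ac_curve Z c"
 shows "(\<integral>\<^sup>+t\<in>{0..1}. ennreal (g (c t) * metric_speed Z c t) \<partial>lborel) = lin g c"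
 unfolding lin_def
proof (rule nn_integral_cong_AE)
 show "AE t in lborel. ennreal (g (c t) * metric_speed Z c t) * indicator {0..1} t = ennreal (g (c (cl t)) * speed Z c t)"
  using AE_speed[OF assms] by eventually_elim (auto simp: indicator_def cl_id)
qed

lemma energy_eq:
 assumes "plan E"
 shows "(\<integral>\<^sup>+c. (\<integral>\<^sup>+t\<in>{0..1}. ennreal (metric_speed Z c t powr q) \<partial>lborel) \<partial>E) = energy E"
 unfolding energy_def
proof (rule nn_integral_cong_AE)
 show "AE c in E. (\<integral>\<^sup>+t\<in>{0..1}. ennreal (metric_speed Z c t powr q) \<partial>lborel) = (\<integral>\<^sup>+t. ennreal (speed Z c t powr q) \<partial>lborel)"
  using plan_AE[OF assms]
 proof eventually_elim
  case (elim c)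
  note g = elim(1)
  show ?case
  proof (rule nn_integral_cong_AE)
   show "AE t in lborel. ennreal (metric_speed Z c t powr q) * indicator {0..1} t = ennreal (speed Z c t powr q)"
    using AE_speed[OF conjunct1[OF g] conjunct2[OF g]] by eventually_elim (auto simp: indicator_def)
  qed
 qed
qed

lemma plan_bounds:
 assumes E: "plan E"
 shows "EX n::nat. compress E (real n) & energy E <= of_nat n"
proof -
 have "energy E < \<infinity>" using E unfolding energy_eq[OF E, symmetric] by (simp add: test_plan_def)
 then obtain n1 :: nat where n1: "energy E < of_nat n1" using ennreal_Ex_less_of_nat by auto
 obtain C where C: "C > 0" "!!t A. t : {0..1} ==> A : sets m ==> emeasure (distr E m (%c. c t)) A <= ennreal C * emeasure m A"
  using E unfolding test_plan_def by blast
 obtain n2 :: nat where n2: "C <= real n2" using real_arch_simple by blast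
 have "compress E (real (max n1 n2))"
  unfolding compress_def
 proof (intro allI ballI)
  fix t A assume A: "A : sets m"
  have e: "(%c. c (cl t)) : measurable E m" by (rule measurable_ev[OF plan_sets[OF E]]) auto
  have "emeasure E ((%c. c (cl t)) -` A \<inter> space E) <= ennreal C * emeasure m A"
   using C(2)[OF cl_in(1)[of t] A] by (simp add: emeasure_distr[OF e A])
  also have "... <= ennreal (real (max n1 n2)) * emeasure m A"
   using n2 by (intro mult_right_mono ennreal_leI) auto
  finally show "emeasure E ((%c. c (cl t)) -` A \<inter> space E) <= ennreal (real (max n1 n2)) * emeasure m A" .
 qed
 moreover have "energy E <= of_nat (max n1 n2)"
  using n1 by (meson less_imp_le max.cobounded1 of_nat_mono order_trans)
 ultimately show ?thesis by blast
qed

lemma planI: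
 assumes "prob_space E" and s: "sets E = sets (\<Omega> Z)" and ac: "AE \<gamma> in E. ac_curve Z \<gamma>"
  and en: "(\<integral>\<^sup>+\<gamma>. (\<integral>\<^sup>+t\<in>{0..1}. ennreal (metric_speed Z \<gamma> t powr q) \<partial>lborel) \<partial>E) < \<infinity>"
  and c: "0 < C" "!!t A. t : {0..1} ==> A : sets m ==> emeasure E ((%\<gamma>. \<gamma> (cl t)) -` A \<inter> space E) <= ennreal C * emeasure m A"
 shows "plan E"
 unfolding test_plan_def
proof (intro conjI assms exI[of _ C] ballI)
 fix t :: real and A assume t: "t : {0..1}" and A: "A : sets m"
 have e: "(%\<gamma>. \<gamma> (cl t)) : measurable E m" by (rule measurable_ev[OF s]) auto
 have ct: "cl t = t" using t by (simp add: cl_id)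
 show "emeasure (distr E m (%\<gamma>. \<gamma> t)) A <= ennreal C * emeasure m A"
  using c(2)[OF t A] emeasure_distr[OF e A] unfolding ct by simp
qed

lemma wug_iff:
 "wug u g \<longleftrightarrow> g : Borel m & lp g < \<infinity> & (ALL z:space m. 0 <= g z) &
  (ALL E. plan E --> (AE \<gamma> in E. ennreal \<bar>u (\<gamma> (cl 1)) - u (\<gamma> (cl 0))\<bar> <= lin g \<gamma>))"
proof -
 have c: "cl 1 = 1" "cl 0 = 0" by (auto simp: cl_def)
 have "(AE \<gamma> in E. ennreal \<bar>u (\<gamma> 1) - u (\<gamma> 0)\<bar> <= (\<integral>\<^sup>+t\<in>{0..1}. ennreal (g (\<gamma> t) * metric_speed Z \<gamma> t) \<partial>lborel)) \<longleftrightarrow>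
  (AE \<gamma> in E. ennreal \<bar>u (\<gamma> (cl 1)) - u (\<gamma> (cl 0))\<bar> <= lin g \<gamma>)" if "plan E" for E
 proof
  assume "AE \<gamma> in E. ennreal \<bar>u (\<gamma> 1) - u (\<gamma> 0)\<bar> <= (\<integral>\<^sup>+t\<in>{0..1}. ennreal (g (\<gamma> t) * metric_speed Z \<gamma> t) \<partial>lborel)"
  then show "AE \<gamma> in E. ennreal \<bar>u (\<gamma> (cl 1)) - u (\<gamma> (cl 0))\<bar> <= lin g \<gamma>"
   using plan_AE[OF that] by eventually_elim (simp add: lin_eq c)
 next
  assume "AE \<gamma> in E. ennreal \<bar>u (\<gamma> (cl 1)) - u (\<gamma> (cl 0))\<bar> <= lin g \<gamma>"
  then show "AE \<gamma> in E. ennreal \<bar>u (\<gamma> 1) - u (\<gamma> 0)\<bar> <= (\<integral>\<^sup>+t\<in>{0..1}. ennreal (g (\<gamma> t) * metric_speed Z \<gamma> t) \<partial>lborel)"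
   using plan_AE[OF that] by eventually_elim (simp add: lin_eq c)
 qed
 then show ?thesis unfolding weak_upper_gradient_def Lp_space_iff space_m by auto
qed

lemma lin_measurable:
 assumes E: "sets E = sets (\<Omega> Z)" and g[measurable]: "g : Borel m"
 shows "lin g : Borel E"
proof -
 have [measurable]: "(%z. pos z) : measurable (E >< lborel) m" by (rule measurable_ev[OF E]) auto
 have [measurable]: "(%z. speed Z (fst z) (snd z)) : Borel (E >< lborel)" by (rule measurable_sp[OF E]) auto
 have "(%z. ennreal (g (pos z) * speed Z (fst z) (snd z))) : Borel (E >< lborel)" by measurable
 from lborel.borel_measurable_nn_integral_fst[OF this] show ?thesis unfolding lin_def[abs_def] by simp
qed

text \<open>The Young inequality bounds line integrals by the energy of the plan and, through bounded compression, by
the \<open>L\<^sup>p\<close> norm. This makes them continuous in \<open>L\<^sup>p\<close>, uniformly over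
plans with given bounds.\<close>
lemma lin_bound:
 assumes E: "plan E" and C: "compress E C" "0 <= C" and w[measurable]: "w : Borel m" and \<delta>: "0 < \<delta>"
 shows "(\<integral>\<^sup>+c. lin (%z. \<bar>w z\<bar>) c \<partial>E) <= ennreal \<delta> * energy E + ennreal (\<delta> powr (1 - p)) * (ennreal C * lp w)"
proof -
 interpret E: prob_space E using E by (rule plan_prob)
 interpret P: pair_sigma_finite E lborel ..
 note s = plan_sets[OF E]
 have [measurable]: "(%z. pos z) : measurable (E >< lborel) m" by (rule measurable_ev[OF s]) auto
 have [measurable]: "(%z. speed Z (fst z) (snd z)) : Borel (E >< lborel)" by (rule measurable_sp[OF s]) auto
 let ?A = "%c t. ennreal (speed Z c t powr q)" and ?B = "%c t. ennreal (\<bar>w (c (cl t))\<bar> powr p) * indicator {0..1} t"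
 have A: "(%z. ?A (fst z) (snd z)) : Borel (E >< lborel)" by measurable
 have B: "(%z. ?B (fst z) (snd z)) : Borel (E >< lborel)" by measurable
 have "(\<integral>\<^sup>+c. lin (%z. \<bar>w z\<bar>) c \<partial>E) <= (\<integral>\<^sup>+c. \<integral>\<^sup>+t. ennreal \<delta> * ?A c t + ennreal (\<delta> powr (1 - p)) * ?B c t \<partial>lborel \<partial>E)"
  unfolding lin_def
 proof (rule nn_integral_mono_AE)
  show "AE c in E. (\<integral>\<^sup>+t. ennreal (\<bar>w (c (cl t))\<bar> * speed Z c t) \<partial>lborel) <= (\<integral>\<^sup>+t. ennreal \<delta> * ?A c t + ennreal (\<delta> powr (1 - p)) * ?B c t \<partial>lborel)"
   using plan_AE[OF E]
  proof eventually_elim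
   case (elim c)
   note g = elim(1)
   show ?case
   proof (rule nn_integral_mono_AE)
    show "AE t in lborel. ennreal (\<bar>w (c (cl t))\<bar> * speed Z c t) <= ennreal \<delta> * ?A c t + ennreal (\<delta> powr (1 - p)) * ?B c t"
     using AE_speed[OF conjunct1[OF g] conjunct2[OF g]]
    proof eventually_elim
     case (elim t)
     note t = elim(1)
     show ?case
     proof (cases "t : {0..1}")
      case True
      have "ennreal (\<bar>w (c (cl t))\<bar> * speed Z c t) <= ennreal (\<delta> * speed Z c t powr q + \<delta> powr (1 - p) * \<bar>w (c (cl t))\<bar> powr p)"
      using young[of "speed Z c t" "\<bar>w (c (cl t))\<bar>" \<delta>] \<delta> by (intro ennreal_leI) auto
      also have "... = ennreal \<delta> * ?A c t + ennreal (\<delta> powr (1 - p)) * ?B c t"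
      using True \<delta> by (simp add: ennreal_mult)
      finally show ?thesis .
     qed (use t in simp)
    qed
   qed
  qed
 qed
 also have "... = (\<integral>\<^sup>+z. ennreal \<delta> * ?A (fst z) (snd z) + ennreal (\<delta> powr (1 - p)) * ?B (fst z) (snd z) \<partial>(E >< lborel))"
  using A B by (subst lborel.nn_integral_fst[symmetric]) auto
 also have "... = ennreal \<delta> * (\<integral>\<^sup>+z. ?A (fst z) (snd z) \<partial>(E >< lborel)) + ennreal (\<delta> powr (1 - p)) * (\<integral>\<^sup>+z. ?B (fst z) (snd z) \<partial>(E >< lborel))"
  using A B by (subst nn_integral_add) (auto simp: nn_integral_cmult)
 also have "(\<integral>\<^sup>+z. ?A (fst z) (snd z) \<partial>(E >< lborel)) = energy E"
  unfolding energy_def using lborel.nn_integral_fst[OF A] by simp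
 also have "(\<integral>\<^sup>+z. ?B (fst z) (snd z) \<partial>(E >< lborel)) <= ennreal C * lp w"
 proof -
  have "(\<integral>\<^sup>+z. ?B (fst z) (snd z) \<partial>(E >< lborel)) = (\<integral>\<^sup>+t. \<integral>\<^sup>+c. ?B c t \<partial>E \<partial>lborel)"
   using P.nn_integral_snd[OF B] by simp
  also have "... <= (\<integral>\<^sup>+t. ennreal C * lp w * indicator {0..1::real} t \<partial>lborel)"
  proof (rule nn_integral_mono)
   fix t :: real
   have [measurable]: "(%c. c (cl t)) : measurable E m" by (rule measurable_ev[OF s]) auto
   have "(\<integral>\<^sup>+c. ?B c t \<partial>E) = (\<integral>\<^sup>+c. ennreal (\<bar>w (c (cl t))\<bar> powr p) \<partial>E) * indicator {0..1} t"
    by (subst nn_integral_multc) auto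
   also have "... <= ennreal C * lp w * indicator {0..1} t"
    unfolding lp_def by (intro mult_right_mono compress_nn[OF s C(1), of "%z. ennreal (\<bar>w z\<bar> powr p)"]) auto
   finally show "(\<integral>\<^sup>+c. ?B c t \<partial>E) <= ennreal C * lp w * indicator {0..1} t" .
  qed
  also have "... = ennreal C * lp w" by (subst nn_integral_cmult_indicator) auto
  finally show ?thesis .
 qed
 finally show ?thesis by (simp add: mult_left_mono add_left_mono)
qed

lemma ev_bound:
 assumes E: "plan E" and C: "compress E C" "0 <= C" and w[measurable]: "w : Borel m" and \<delta>: "0 < \<delta>"
 shows "(\<integral>\<^sup>+c. ennreal \<bar>w (c (cl t))\<bar> \<partial>E) <= ennreal \<delta> + ennreal (\<delta> powr (1 - p)) * (ennreal C * lp w)"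
proof -
 interpret E: prob_space E using E by (rule plan_prob)
 note s = plan_sets[OF E]
 have [measurable]: "(%c. c (cl t)) : measurable E m" by (rule measurable_ev[OF s]) auto
 have "(\<integral>\<^sup>+c. ennreal \<bar>w (c (cl t))\<bar> \<partial>E) <= (\<integral>\<^sup>+c. ennreal \<delta> + ennreal (\<delta> powr (1 - p)) * ennreal (\<bar>w (c (cl t))\<bar> powr p) \<partial>E)"
 proof (rule nn_integral_mono)
  fix c
  have "ennreal \<bar>w (c (cl t))\<bar> <= ennreal (\<delta> + \<delta> powr (1 - p) * \<bar>w (c (cl t))\<bar> powr p)"
   using young[of 1 "\<bar>w (c (cl t))\<bar>" \<delta>] \<delta> by (intro ennreal_leI) auto
  then show "ennreal \<bar>w (c (cl t))\<bar> <= ennreal \<delta> + ennreal (\<delta> powr (1 - p)) * ennreal (\<bar>w (c (cl t))\<bar> powr p)"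
   using \<delta> by (simp add: ennreal_mult)
 qed
 also have "... = ennreal \<delta> + ennreal (\<delta> powr (1 - p)) * (\<integral>\<^sup>+c. ennreal (\<bar>w (c (cl t))\<bar> powr p) \<partial>E)"
  by (subst nn_integral_add) (auto simp: nn_integral_cmult E.emeasure_space_1)
 also have "... <= ennreal \<delta> + ennreal (\<delta> powr (1 - p)) * (ennreal C * lp w)"
  unfolding lp_def by (intro add_left_mono mult_left_mono compress_nn[OF s C(1), of "%z. ennreal (\<bar>w z\<bar> powr p)"]) auto
 finally show ?thesis .
qed

text \<open>Conditioning a plan on a set of curves keeps it a plan; this localises integrated inequalities to almost
every curve.\<close>
lemma plan_restrict:
 assumes \<eta>: "plan \<eta>" and E: "E : sets \<eta>" "emeasure \<eta> E ~= 0"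
 shows "plan (uniform_measure \<eta> E)"
proof -
 interpret \<eta>: prob_space \<eta> using \<eta> by (rule plan_prob)
 note s = plan_sets[OF \<eta>]
 obtain n :: nat where n: "compress \<eta> (real n)" "energy \<eta> <= of_nat n" using plan_bounds[OF \<eta>] by blast
 define c where "c = measure \<eta> E"
 have c: "c > 0" "emeasure \<eta> E = ennreal c" using E(2) by (auto simp: c_def \<eta>.emeasure_eq_measure zero_less_measure_iff)
 have div: "x / ennreal c = ennreal (1 / c) * x" for x :: ennreal
  using c(1) by (simp add: divide_ennreal_def inverse_ennreal mult.commute divide_inverse)
 have m1: "(\<integral>\<^sup>+\<gamma>. f \<gamma> \<partial>uniform_measure \<eta> E) <= ennreal (1 / c) * (\<integral>\<^sup>+\<gamma>. f \<gamma> \<partial>\<eta>)" if [measurable]: "f : Borel \<eta>" for f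
 proof -
  have "(\<integral>\<^sup>+\<gamma>. f \<gamma> \<partial>uniform_measure \<eta> E) = ennreal (1 / c) * (\<integral>\<^sup>+\<gamma>. f \<gamma> * indicator E \<gamma> \<partial>\<eta>)"
   using E by (subst nn_integral_uniform_measure) (auto simp: c(2) div)
  also have "... <= ennreal (1 / c) * (\<integral>\<^sup>+\<gamma>. f \<gamma> \<partial>\<eta>)"
   by (intro mult_left_mono nn_integral_mono) (auto simp: indicator_def)
  finally show ?thesis .
 qed
 have ac: "AE \<gamma> in uniform_measure \<eta> E. \<gamma> : curves Z & ac_curve Z \<gamma>"
  using plan_AE[OF \<eta>] E(1) by (intro AE_uniform_measureI) auto
 show ?thesis
 proof (rule planI)
  show "prob_space (uniform_measure \<eta> E)"
   using E c by (intro prob_space_uniform_measure) auto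
  show "sets (uniform_measure \<eta> E) = sets (\<Omega> Z)" by (simp add: s)
  show "AE \<gamma> in uniform_measure \<eta> E. ac_curve Z \<gamma>" using ac by eventually_elim blast
  have "(\<integral>\<^sup>+\<gamma>. (\<integral>\<^sup>+t\<in>{0..1}. ennreal (metric_speed Z \<gamma> t powr q) \<partial>lborel) \<partial>uniform_measure \<eta> E) = (\<integral>\<^sup>+\<gamma>. \<integral>\<^sup>+t. ennreal (speed Z \<gamma> t powr q) \<partial>lborel \<partial>uniform_measure \<eta> E)"
  proof (rule nn_integral_cong_AE, use ac in eventually_elim)
   fix \<gamma> assume g: "\<gamma> : curves Z & ac_curve Z \<gamma>"
   show "(\<integral>\<^sup>+t\<in>{0..1}. ennreal (metric_speed Z \<gamma> t powr q) \<partial>lborel) = (\<integral>\<^sup>+t. ennreal (speed Z \<gamma> t powr q) \<partial>lborel)"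
    by (rule nn_integral_cong_AE, use AE_speed[OF conjunct1[OF g] conjunct2[OF g]] in eventually_elim) (auto simp: indicator_def)
  qed
  also have "... <= ennreal (1 / c) * energy \<eta>"
   unfolding energy_def
  proof (rule m1)
   have "(%z. ennreal (speed Z (fst z) (snd z) powr q)) : Borel (\<eta> >< lborel)"
    using measurable_sp[OF s, of fst "\<eta> >< lborel" snd] by measurable
   from lborel.borel_measurable_nn_integral_fst[OF this] show "(%\<gamma>. \<integral>\<^sup>+t. ennreal (speed Z \<gamma> t powr q) \<partial>lborel) : Borel \<eta>" by simp
  qed
  also have "... < \<infinity>" using n(2) by (simp add: ennreal_mult_less_top order_le_less_trans[OF _ of_nat_less_top])
  finally show "(\<integral>\<^sup>+\<gamma>. (\<integral>\<^sup>+t\<in>{0..1}. ennreal (metric_speed Z \<gamma> t powr q) \<partial>lborel) \<partial>uniform_measure \<eta> E) < \<infinity>" .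
  show "0 < (real n + 1) / c" using c by simp
  fix t A assume A[measurable]: "A : sets m"
  have e: "(%\<gamma>. \<gamma> (cl t)) -` A \<inter> space \<eta> : sets \<eta>" by (rule measurable_sets[OF measurable_ev[OF s] A]) auto
  have "emeasure (uniform_measure \<eta> E) ((%\<gamma>. \<gamma> (cl t)) -` A \<inter> space \<eta>) <= ennreal (1 / c) * emeasure \<eta> ((%\<gamma>. \<gamma> (cl t)) -` A \<inter> space \<eta>)"
   using m1[of "indicator ((%\<gamma>. \<gamma> (cl t)) -` A \<inter> space \<eta>)"] e by simp
  also have "... <= ennreal (1 / c) * (ennreal (real n) * emeasure m A)"
   using n(1) A unfolding compress_def by (intro mult_left_mono) auto
  also have "... = ennreal (real n / c) * emeasure m A" using c by (simp add: mult.assoc[symmetric] ennreal_mult''[symmetric])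
  also have "... <= ennreal ((real n + 1) / c) * emeasure m A"
   using c by (intro mult_right_mono ennreal_leI divide_right_mono) auto
  finally show "emeasure (uniform_measure \<eta> E) ((%\<gamma>. \<gamma> (cl t)) -` A \<inter> space (uniform_measure \<eta> E)) <= ennreal ((real n + 1) / c) * emeasure m A" by simp
 qed
qed

end

section \<open>Reduction to countably many test plans\<close>

context smm
begin

definition lint :: "(real => 'z) measure => ('z => real) => real" where
 "lint E w = (LINT z|(E >< lborel). w (pos z) * speed Z (fst z) (snd z))"

definition dint :: "(real => 'z) measure => ('z => real) => real" where
 "dint E w = (LINT c|E. w (c (cl 1)) - w (c (cl 0)))"

lemma lint_nn:
 assumes E: "plan E" and w[measurable]: "w : Borel m"
 shows "(\<integral>\<^sup>+z. ennreal \<bar>w (pos z) * speed Z (fst z) (snd z)\<bar> \<partial>(E >< lborel)) = (\<integral>\<^sup>+c. lin (%z. \<bar>w z\<bar>) c \<partial>E)"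
proof -
 note s = plan_sets[OF E]
 have [measurable]: "(%z. pos z) : measurable (E >< lborel) m" by (rule measurable_ev[OF s]) auto
 have [measurable]: "(%z. speed Z (fst z) (snd z)) : Borel (E >< lborel)" by (rule measurable_sp[OF s]) auto
 have "(%z. ennreal \<bar>w (pos z) * speed Z (fst z) (snd z)\<bar>) : Borel (E >< lborel)" by measurable
 from lborel.nn_integral_fst[OF this] show ?thesis unfolding lin_def by (simp add: abs_mult)
qed

lemma small_bound:
 assumes E: "plan E" and n: "compress E (real n)" "energy E <= of_nat n" and w: "w : Borel m"
  and \<delta>: "0 < \<delta>" and l: "lp w <= ennreal (\<delta> powr p)"
 shows "(\<integral>\<^sup>+c. lin (%z. \<bar>w z\<bar>) c \<partial>E) <= ennreal (2 * \<delta> * real n)"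
  and "(\<integral>\<^sup>+c. ennreal \<bar>w (c (cl t))\<bar> \<partial>E) <= ennreal (\<delta> * (1 + real n))"
proof -
 have x: "ennreal (\<delta> powr (1 - p)) * (ennreal (real n) * lp w) <= ennreal (\<delta> * real n)"
 proof -
  have "ennreal (\<delta> powr (1 - p)) * (ennreal (real n) * lp w) <= ennreal (\<delta> powr (1 - p)) * (ennreal (real n) * ennreal (\<delta> powr p))"
   using l by (intro mult_left_mono) auto
  also have "... = ennreal (\<delta> powr (1 - p) * (real n * \<delta> powr p))" by (simp add: ennreal_mult)
  also have "\<delta> powr (1 - p) * (real n * \<delta> powr p) = \<delta> * real n" using \<delta> by (simp add: powr_diff)
  finally show ?thesis .
 qed
 have "(\<integral>\<^sup>+c. lin (%z. \<bar>w z\<bar>) c \<partial>E) <= ennreal \<delta> * energy E + ennreal (\<delta> powr (1 - p)) * (ennreal (real n) * lp w)"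
  by (rule lin_bound[OF E n(1) _ w \<delta>]) simp
 also have "... <= ennreal \<delta> * ennreal (real n) + ennreal (\<delta> * real n)"
  using n(2) x by (intro add_mono mult_left_mono) (auto simp: ennreal_of_nat_eq_real_of_nat)
 also have "... = ennreal (\<delta> * real n) + ennreal (\<delta> * real n)" using \<delta> by (simp add: ennreal_mult)
 also have "... = ennreal (2 * \<delta> * real n)" using \<delta> by (subst ennreal_plus[symmetric]) auto
 finally show "(\<integral>\<^sup>+c. lin (%z. \<bar>w z\<bar>) c \<partial>E) <= ennreal (2 * \<delta> * real n)" .
 have "(\<integral>\<^sup>+c. ennreal \<bar>w (c (cl t))\<bar> \<partial>E) <= ennreal \<delta> + ennreal (\<delta> powr (1 - p)) * (ennreal (real n) * lp w)"
  by (rule ev_bound[OF E n(1) _ w \<delta>]) simp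
 also have "... <= ennreal \<delta> + ennreal (\<delta> * real n)" using x by (rule add_left_mono)
 also have "... = ennreal (\<delta> * (1 + real n))" using \<delta> by (subst ennreal_plus[symmetric]) (auto simp: algebra_simps)
 finally show "(\<integral>\<^sup>+c. ennreal \<bar>w (c (cl t))\<bar> \<partial>E) <= ennreal (\<delta> * (1 + real n))" .
qed

lemma lp_le_powr:
 assumes "lp w < \<infinity>" obtains \<delta> where "0 < \<delta>" "lp w <= ennreal (\<delta> powr p)"
proof -
 obtain K where K: "lp w = ennreal K" "K \<ge> 0" using assms by (cases "lp w") auto
 have "((K + 1) powr (1 / p)) powr p = K + 1" using p K by (simp add: powr_powr)
 then show thesis using that[of "(K + 1) powr (1 / p)"] K by (simp add: ennreal_leI)
qed

lemma plan_integrable: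
 assumes E: "plan E" and w[measurable]: "w : Borel m" and f: "lp w < \<infinity>"
 shows "integrable (E >< lborel) (%z. w (pos z) * speed Z (fst z) (snd z))"
  and "integrable E (%c. w (c (cl t)))"
  and "(\<integral>\<^sup>+c. lin (%z. \<bar>w z\<bar>) c \<partial>E) < \<infinity>"
proof -
 note s = plan_sets[OF E]
 obtain n :: nat where n: "compress E (real n)" "energy E <= of_nat n" using plan_bounds[OF E] by blast
 obtain \<delta> where \<delta>: "0 < \<delta>" "lp w <= ennreal (\<delta> powr p)" using lp_le_powr[OF f] by blast
 note b = small_bound[OF E n w \<delta>]
 have [measurable]: "(%z. pos z) : measurable (E >< lborel) m" by (rule measurable_ev[OF s]) auto
 have [measurable]: "(%c. c (cl t)) : measurable E m" for t by (rule measurable_ev[OF s]) auto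
 have [measurable]: "(%z. speed Z (fst z) (snd z)) : Borel (E >< lborel)" by (rule measurable_sp[OF s]) auto
 show fin: "(\<integral>\<^sup>+c. lin (%z. \<bar>w z\<bar>) c \<partial>E) < \<infinity>" using b(1) by (rule order_le_less_trans) simp
 show "integrable (E >< lborel) (%z. w (pos z) * speed Z (fst z) (snd z))"
 proof (rule integrableI_bounded)
  show "(\<integral>\<^sup>+z. ennreal (norm (w (pos z) * speed Z (fst z) (snd z))) \<partial>(E >< lborel)) < \<infinity>"
   using lint_nn[OF E w] fin by simp
 qed measurable
 show "integrable E (%c. w (c (cl t)))"
 proof (rule integrableI_bounded)
  show "(\<integral>\<^sup>+c. ennreal (norm (w (c (cl t)))) \<partial>E) < \<infinity>"
   using b(2)[of t] by (simp add: order_le_less_trans)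
 qed measurable
qed

lemma lint_dist:
 assumes E: "plan E" and n: "compress E (real n)" "energy E <= of_nat n"
  and u[measurable]: "u : Borel m" "lp u < \<infinity>" and v[measurable]: "v : Borel m" "lp v < \<infinity>"
  and \<delta>: "0 < \<delta>" and l: "lp (%z. u z - v z) <= ennreal (\<delta> powr p)"
 shows "\<bar>lint E u - lint E v\<bar> <= 2 * \<delta> * real n" and "\<bar>dint E u - dint E v\<bar> <= 2 * (\<delta> * (1 + real n))"
proof -
 have w[measurable]: "(%z. u z - v z) : Borel m" by measurable
 have wl: "lp (%z. u z - v z) < \<infinity>" using l by (rule order_le_less_trans) simp
 note b = small_bound[OF E n w \<delta> l]
 note iu = plan_integrable[OF E u] and iv = plan_integrable[OF E v] and iw = plan_integrable[OF E w wl]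
 have "lint E u - lint E v = (LINT z|(E >< lborel). (u (pos z) - v (pos z)) * speed Z (fst z) (snd z))"
  unfolding lint_def by (subst Bochner_Integration.integral_diff[OF iu(1) iv(1), symmetric]) (simp add: left_diff_distrib)
 also have "ennreal \<bar>...\<bar> <= (\<integral>\<^sup>+z. ennreal \<bar>(u (pos z) - v (pos z)) * speed Z (fst z) (snd z)\<bar> \<partial>(E >< lborel))"
  using integral_norm_bound_ennreal[OF iw(1)] by simp
 also have "... <= ennreal (2 * \<delta> * real n)" using lint_nn[OF E w] b(1) by simp
 finally show "\<bar>lint E u - lint E v\<bar> <= 2 * \<delta> * real n" using \<delta> by (simp add: ennreal_le_iff)
 have e: "\<bar>(LINT c|E. u (c (cl t)) - v (c (cl t)))\<bar> <= \<delta> * (1 + real n)" for t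
 proof -
  have "ennreal \<bar>(LINT c|E. u (c (cl t)) - v (c (cl t)))\<bar> <= (\<integral>\<^sup>+c. ennreal \<bar>u (c (cl t)) - v (c (cl t))\<bar> \<partial>E)"
   using integral_norm_bound_ennreal[OF iw(2)[of t]] by simp
  also have "... <= ennreal (\<delta> * (1 + real n))" by (rule b(2))
  finally show ?thesis using \<delta> by (simp add: ennreal_le_iff)
 qed
 have "dint E u - dint E v = (LINT c|E. u (c (cl 1)) - v (c (cl 1))) - (LINT c|E. u (c (cl 0)) - v (c (cl 0)))"
  unfolding dint_def using iu(2) iv(2) by simp
 then show "\<bar>dint E u - dint E v\<bar> <= 2 * (\<delta> * (1 + real n))" using e[of 1] e[of 0] by linarith
qed

text \<open>Being a weak upper gradient amounts to the integrated inequality for all plans, since a plan may be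
conditioned on the set where the inequality fails. The two integrals are determined up to a small error by
their values at elements of a countable dense set of functions, so one plan per cell of rational values is
enough.\<close>
lemma countable_test_plans:
 obtains T where "countable T" "!!\<eta>. \<eta> : T ==> plan \<eta>"
  "!!u g. u : Borel m ==> lp u < \<infinity> ==> g : Borel m ==> lp g < \<infinity> ==> (!!z. z : space m ==> 0 <= g z) ==>
   (!!\<eta>. \<eta> : T ==> AE c in \<eta>. ennreal \<bar>u (c (cl 1)) - u (c (cl 0))\<bar> <= lin g c) ==> wug u g"
proof -
 obtain \<Phi> where \<Phi>': "countable \<Phi> & (ALL \<phi>:\<Phi>. \<phi> : Borel m & lp \<phi> < \<infinity>) &
  (ALL u \<epsilon>. u : Borel m --> lp u < \<infinity> --> 0 < \<epsilon> --> (EX \<phi>:\<Phi>. lp (%z. u z - \<phi> z) < ennreal \<epsilon>))"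
 proof (rule Lp_countable_dense)
  fix \<Phi> assume a: "countable \<Phi>" "!!\<phi>. \<phi> : \<Phi> ==> \<phi> : Borel m" "!!\<phi>. \<phi> : \<Phi> ==> lp \<phi> < \<infinity>"
   and d: "!!u \<epsilon>. u : Borel m ==> lp u < \<infinity> ==> 0 < \<epsilon> ==> EX \<phi>:\<Phi>. lp (%z. u z - \<phi> z) < ennreal \<epsilon>"
  show thesis
  proof (rule that[of \<Phi>], intro conjI ballI allI impI)
   show "EX \<phi>:\<Phi>. lp (%z. u z - \<phi> z) < ennreal \<epsilon>" if "u : Borel m" "lp u < \<infinity>" "0 < \<epsilon>" for u \<epsilon> using d[OF that] .
  qed (rule a; assumption)+
 qed
 note \<Phi> = \<Phi>'[THEN conjunct1] \<Phi>'[THEN conjunct2, THEN conjunct1, rule_format, THEN conjunct1] \<Phi>'[THEN conjunct2, THEN conjunct1, rule_format, THEN conjunct2]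
  \<Phi>'[THEN conjunct2, THEN conjunct2, rule_format]
 \<comment> \<open>\<open>n\<close> bounds compression and energy, \<open>k\<close> is the accuracy, and the rationals locate the two integrals\<close>
 define good where "good = (%(\<phi>1, \<phi>2, n::nat, k::nat, r1::rat, r2::rat) \<eta>. plan \<eta> & compress \<eta> (real n) & energy \<eta> <= of_nat n &
   \<bar>dint \<eta> \<phi>1 - of_rat r1\<bar> < 1 / Suc k & \<bar>lint \<eta> \<phi>2 - of_rat r2\<bar> < 1 / Suc k)"
 define T where "T = (%i. SOME \<eta>. good i \<eta>) ` {i : \<Phi> \<times> \<Phi> \<times> UNIV. EX \<eta>. good i \<eta>}"
 have some: "good i (SOME \<eta>. good i \<eta>)" if "EX \<eta>. good i \<eta>" for i using that by (rule someI_ex)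
 have cT: "countable T" unfolding T_def
 proof (rule countable_image, rule countable_subset)
  show "{i : \<Phi> \<times> \<Phi> \<times> UNIV. EX \<eta>. good i \<eta>} \<subseteq> \<Phi> \<times> \<Phi> \<times> (UNIV :: (nat \<times> nat \<times> rat \<times> rat) set)" by blast
  show "countable (\<Phi> \<times> \<Phi> \<times> (UNIV :: (nat \<times> nat \<times> rat \<times> rat) set))" using \<Phi>(1) by simp
 qed
 have T_plan: "plan \<eta>" if T: "\<eta> : T" for \<eta>
 proof -
  obtain i where i: "\<eta> = (SOME \<eta>. good i \<eta>)" "EX \<eta>. good i \<eta>" using T unfolding T_def by blast
  then have "good i \<eta>" using some by simp
  then show ?thesis unfolding good_def by (cases i) auto
 qed
 have key: "dint \<eta> u <= lint \<eta> g"
  if u[measurable]: "u : Borel m" "lp u < \<infinity>" and g[measurable]: "g : Borel m" "lp g < \<infinity>"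
   and hyp: "!!\<eta>'. \<eta>' : T ==> dint \<eta>' u <= lint \<eta>' g" and \<eta>: "plan \<eta>" for u g \<eta>
 proof (rule field_le_epsilon)
  fix e :: real assume e: "0 < e"
  obtain n :: nat where n: "compress \<eta> (real n)" "energy \<eta> <= of_nat n" using plan_bounds[OF \<eta>] by blast
  \<comment> \<open>eight errors of size at most \<open>e/8\<close> occur below\<close>
  define \<delta> where "\<delta> = e / (16 * (1 + real n))"
  have \<delta>: "\<delta> > 0" using e by (simp add: \<delta>_def add_pos_nonneg)
  have \<delta>n: "2 * (\<delta> * (1 + real n)) = e / 8" unfolding \<delta>_def by (simp add: field_simps add_nonneg_eq_0_iff)
  have \<delta>n': "2 * \<delta> * real n <= e / 8" using \<delta> unfolding \<delta>n[symmetric] by (simp add: algebra_simps)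
  have \<delta>p: "\<delta> powr p > 0" using \<delta> by simp
  obtain \<phi>1 where \<phi>1: "\<phi>1 : \<Phi>" "lp (%z. u z - \<phi>1 z) < ennreal (\<delta> powr p)" using \<Phi>(4)[OF u \<delta>p] by blast
  obtain \<phi>2 where \<phi>2: "\<phi>2 : \<Phi>" "lp (%z. g z - \<phi>2 z) < ennreal (\<delta> powr p)" using \<Phi>(4)[OF g \<delta>p] by blast
  note l1 = lint_dist(2)[OF _ _ _ u \<Phi>(2)[OF \<phi>1(1)] \<Phi>(3)[OF \<phi>1(1)] \<delta> less_imp_le[OF \<phi>1(2)]]
  note l2 = lint_dist(1)[OF _ _ _ g \<Phi>(2)[OF \<phi>2(1)] \<Phi>(3)[OF \<phi>2(1)] \<delta> less_imp_le[OF \<phi>2(2)]]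
  obtain k where k: "1 / Suc k < e / 8" using nat_approx_posE[of "e / 8"] e by auto
  obtain r1 where r1: "dint \<eta> \<phi>1 - 1 / Suc k < of_rat r1" "of_rat r1 < dint \<eta> \<phi>1"
   using of_rat_dense[of "dint \<eta> \<phi>1 - 1 / Suc k" "dint \<eta> \<phi>1"] by auto
  obtain r2 where r2: "lint \<eta> \<phi>2 - 1 / Suc k < of_rat r2" "of_rat r2 < lint \<eta> \<phi>2"
   using of_rat_dense[of "lint \<eta> \<phi>2 - 1 / Suc k" "lint \<eta> \<phi>2"] by auto
  define i where "i = (\<phi>1, \<phi>2, n, k, r1, r2)"
  have gi: "good i \<eta>" unfolding good_def i_def using \<eta> n r1 r2 by (simp add: abs_less_iff)
  define \<eta>' where "\<eta>' = (SOME \<eta>. good i \<eta>)"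
  have \<eta>'T: "\<eta>' : T" unfolding T_def \<eta>'_def using gi \<phi>1 \<phi>2 by (intro imageI) (auto simp: i_def)
  have "good i \<eta>'" unfolding \<eta>'_def using gi by (rule someI)
  then have \<eta>': "plan \<eta>'" "compress \<eta>' (real n)" "energy \<eta>' <= of_nat n" "\<bar>dint \<eta>' \<phi>1 - of_rat r1\<bar> < 1 / Suc k" "\<bar>lint \<eta>' \<phi>2 - of_rat r2\<bar> < 1 / Suc k"
   by (simp_all add: good_def i_def)
  have "dint \<eta>' u <= lint \<eta>' g" by (rule hyp[OF \<eta>'T])
  then show "dint \<eta> u <= lint \<eta> g + e"
   using l1[OF \<eta> n] l1[OF \<eta>'(1-3)] l2[OF \<eta> n] l2[OF \<eta>'(1-3)] \<eta>'(4,5) r1 r2 k \<delta>n \<delta>n' unfolding \<delta>n abs_less_iff abs_le_iff by linarith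
 qed
 have final: "wug u g"
  if u[measurable]: "u : Borel m" and lu: "lp u < \<infinity>" and g[measurable]: "g : Borel m" and lg: "lp g < \<infinity>"
   and gpos: "!!z. z : space m ==> 0 <= g z"
   and hyp: "!!\<eta>. \<eta> : T ==> AE c in \<eta>. ennreal \<bar>u (c (cl 1)) - u (c (cl 0))\<bar> <= lin g c" for u g
 proof -
  have pos_ev: "0 <= g (c (cl t))" if "c : curves Z" for c t
   using gpos curve_in[OF that] space_m by simp
  have lin_abs: "lin (%z. \<bar>g z\<bar>) c = lin g c" if "c : curves Z" for c
   unfolding lin_def using pos_ev[OF that] by simp
  have lint_lin: "ennreal (lint \<eta> g) = (\<integral>\<^sup>+c. lin g c \<partial>\<eta>)" if \<eta>: "plan \<eta>" for \<eta>
  proof -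
   have ge0: "0 <= g (pos z) * speed Z (fst z) (snd z)" if "z : space (\<eta> >< lborel)" for z
    using that pos_ev by (auto simp: space_pair_measure plan_space[OF \<eta>])
   have "ennreal (lint \<eta> g) = (\<integral>\<^sup>+z. ennreal (g (pos z) * speed Z (fst z) (snd z)) \<partial>(\<eta> >< lborel))"
    unfolding lint_def by (rule nn_integral_eq_integral[symmetric, OF plan_integrable(1)[OF \<eta> g lg]]) (auto intro: AE_I2 ge0)
   also have "... = (\<integral>\<^sup>+z. ennreal \<bar>g (pos z) * speed Z (fst z) (snd z)\<bar> \<partial>(\<eta> >< lborel))"
    by (intro nn_integral_cong) (simp add: ge0)
   also have "... = (\<integral>\<^sup>+c. lin (%z. \<bar>g z\<bar>) c \<partial>\<eta>)" by (rule lint_nn[OF \<eta> g])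
   also have "... = (\<integral>\<^sup>+c. lin g c \<partial>\<eta>)" by (intro nn_integral_cong) (simp add: lin_abs plan_space[OF \<eta>])
   finally show ?thesis .
  qed
  have lint_pos: "0 <= lint \<eta> g" if \<eta>: "plan \<eta>" for \<eta> unfolding lint_def
   by (rule integral_nonneg_AE, rule AE_I2) (use pos_ev in \<open>auto simp: space_pair_measure plan_space[OF \<eta>]\<close>)
  have dT: "dint \<eta> v <= lint \<eta> g" if v: "v = u \<or> v = (%z. - u z)" and \<eta>: "plan \<eta>" for v \<eta>
  proof (rule key[OF _ _ g lg _ \<eta>])
   show [measurable]: "v : Borel m" using v u by auto
   show lv: "lp v < \<infinity>" using v lu by (auto simp: lp_def)
   fix \<eta>' assume T: "\<eta>' : T"
   note \<eta>' = T_plan[OF T]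
   have vi: "integrable \<eta>' (%c. v (c (cl 1)) - v (c (cl 0)))"
    by (intro Bochner_Integration.integrable_diff plan_integrable(2)[OF \<eta>' _ lv]) auto
   have "ennreal (dint \<eta>' v) <= ennreal \<bar>dint \<eta>' v\<bar>" by (intro ennreal_leI) simp
   also have "... <= (\<integral>\<^sup>+c. ennreal \<bar>v (c (cl 1)) - v (c (cl 0))\<bar> \<partial>\<eta>')"
    unfolding dint_def using integral_norm_bound_ennreal[OF vi] by simp
   also have "... <= (\<integral>\<^sup>+c. lin g c \<partial>\<eta>')"
    by (rule nn_integral_mono_AE, use hyp[OF T] in eventually_elim) (use v in \<open>auto simp: abs_minus_commute\<close>)
   also have "... = ennreal (lint \<eta>' g)" using lint_lin[OF \<eta>'] by simp
   finally show "dint \<eta>' v <= lint \<eta>' g" using lint_pos[OF \<eta>'] by (simp add: ennreal_le_iff)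
  qed
  \<comment> \<open>otherwise condition the plan on the set where the inequality fails\<close>
  have one: "AE c in \<eta>. ennreal (v (c (cl 1)) - v (c (cl 0))) <= lin g c" if v: "v = u \<or> v = (%z. - u z)" and \<eta>: "plan \<eta>" for v \<eta>
  proof -
   note s = plan_sets[OF \<eta>]
   interpret \<eta>: prob_space \<eta> using \<eta> by (rule plan_prob)
   have vm[measurable]: "v : Borel m" using v u by auto
   have lv: "lp v < \<infinity>" using v lu by (auto simp: lp_def)
   have [measurable]: "(%c. c (cl t)) : measurable \<eta> m" for t by (rule measurable_ev[OF s]) auto
   have lm[measurable]: "lin g : Borel \<eta>" by (rule lin_measurable[OF s g])
   define E where "E = {c : space \<eta>. lin g c < ennreal (v (c (cl 1)) - v (c (cl 0)))}"
   have E[measurable]: "E : sets \<eta>" unfolding E_def by measurable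
   have "emeasure \<eta> E = 0"
   proof (rule ccontr)
    assume ne: "emeasure \<eta> E ~= 0"
    let ?\<eta> = "uniform_measure \<eta> E"
    have \<eta>E: "plan ?\<eta>" by (rule plan_restrict[OF \<eta> E ne])
    have vi: "integrable ?\<eta> (%c. v (c (cl 1)) - v (c (cl 0)))"
     by (intro Bochner_Integration.integrable_diff plan_integrable(2)[OF \<eta>E _ lv]) auto
    have AE_E: "AE c in ?\<eta>. lin g c < ennreal (v (c (cl 1)) - v (c (cl 0)))"
     by (rule AE_uniform_measureI[OF E]) (auto simp: E_def)
    have pos: "AE c in ?\<eta>. 0 <= v (c (cl 1)) - v (c (cl 0))"
     using AE_E by eventually_elim (metis ennreal_neg linear not_less_zero)
    have "(\<integral>\<^sup>+c. lin g c \<partial>?\<eta>) < (\<integral>\<^sup>+c. ennreal (v (c (cl 1)) - v (c (cl 0))) \<partial>?\<eta>)"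
    proof (rule nn_integral_less)
     show "lin g : Borel ?\<eta>" using lm by simp
     show "(%c. ennreal (v (c (cl 1)) - v (c (cl 0)))) : Borel ?\<eta>" using vi by simp
     show "(\<integral>\<^sup>+c. lin g c \<partial>?\<eta>) ~= \<infinity>" using lint_lin[OF \<eta>E] by (metis ennreal_neq_top infinity_ennreal_def)
     show "AE c in ?\<eta>. lin g c <= ennreal (v (c (cl 1)) - v (c (cl 0)))" using AE_E by eventually_elim simp
     show "\<not> (AE c in ?\<eta>. ennreal (v (c (cl 1)) - v (c (cl 0))) <= lin g c)"
     proof
      assume "AE c in ?\<eta>. ennreal (v (c (cl 1)) - v (c (cl 0))) <= lin g c"
      then have "AE c in ?\<eta>. False" using AE_E by eventually_elim simp
      then show False using prob_space.AE_False[OF plan_prob[OF \<eta>E]] by blast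
     qed
    qed
    also have "... = ennreal (dint ?\<eta> v)" unfolding dint_def by (rule nn_integral_eq_integral[OF vi pos])
    also have "... <= ennreal (lint ?\<eta> g)" by (intro ennreal_leI dT[OF v \<eta>E])
    finally show False using lint_lin[OF \<eta>E] by simp
   qed
   then have "AE c in \<eta>. c ~: E" using E by (intro AE_not_in) auto
   then show ?thesis using AE_space[of \<eta>] by eventually_elim (auto simp: E_def)
  qed
  show ?thesis unfolding wug_iff
  proof (intro conjI allI impI ballI g lg gpos)
   fix \<eta> assume \<eta>: "plan \<eta>"
   have "AE c in \<eta>. ennreal (u (c (cl 1)) - u (c (cl 0))) <= lin g c" "AE c in \<eta>. ennreal (- u (c (cl 1)) - - u (c (cl 0))) <= lin g c"
    using one[of u, OF _ \<eta>] one[of "%z. - u z", OF _ \<eta>] by auto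
   then show "AE c in \<eta>. ennreal \<bar>u (c (cl 1)) - u (c (cl 0))\<bar> <= lin g c"
    by eventually_elim (auto simp: abs_if)
  qed
 qed
 show thesis by (rule that[OF cT T_plan final])
qed

end

section \<open>Affine changes of time\<close>

text \<open>The curve on the clock \<open>r + a t\<close>, restricted to \<open>[0,1]\<close> as an element of the curve
space.\<close>
definition rep :: "real => real => (real => 'z) => real => 'z" where
 "rep r a c = (\<lambda>t\<in>{0..1}. c (cl (r + a * t)))"

lemma curve_spaceI:
 assumes "!!t. t : {0..1} ==> c t : mspace Z" "c : extensional {0..1}"
  "!!t e. t : {0..1} ==> 0 < e ==> EX d>0. ALL s:{0..1}. \<bar>s - t\<bar> < d --> mdist Z (c t) (c s) < e"
 shows "c : curves Z"
 unfolding mspace_curve_space mem_Collect_eq using assms by blast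

lemma rep_curve:
 assumes c: "c : curves Z"
 shows "rep r a c : curves Z"
proof (rule curve_spaceI)
 show "rep r a c t : mspace Z" if "t : {0..1}" for t using that curve_in[OF c] by (simp add: rep_def)
 show "rep r a c : extensional {0..1}" by (simp add: rep_def)
 fix t e :: real assume t: "t : {0..1}" and e: "0 < e"
 obtain d where d: "d > 0" "!!s. s : {0..1} ==> \<bar>s - cl (r + a * t)\<bar> < d ==> mdist Z (c (cl (r + a * t))) (c s) < e"
  using curve_continuous_at[OF c cl_in(1) e, of "r + a * t"] by blast
 show "EX d>0. ALL s:{0..1}. \<bar>s - t\<bar> < d --> mdist Z (rep r a c t) (rep r a c s) < e"
 proof (intro exI conjI ballI impI)
  show "0 < d / (\<bar>a\<bar> + 1)" using d by simp
  fix s assume s: "s : {0..1}" "\<bar>s - t\<bar> < d / (\<bar>a\<bar> + 1)"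
  have "\<bar>cl (r + a * s) - cl (r + a * t)\<bar> <= \<bar>(r + a * s) - (r + a * t)\<bar>" by (rule cl_lipschitz)
  also have "... = \<bar>a\<bar> * \<bar>s - t\<bar>" by (simp add: abs_mult[symmetric] right_diff_distrib)
  also have "... <= (\<bar>a\<bar> + 1) * \<bar>s - t\<bar>" by (intro mult_right_mono) auto
  also have "... < d" using s(2) by (simp add: field_simps)
  finally show "mdist Z (rep r a c t) (rep r a c s) < e" using d(2)[OF cl_in(1)] s(1) t by (simp add: rep_def)
 qed
qed

lemma affine_prim:
 assumes h: "integrable lborel h" and pos: "!!x. 0 <= h x" and a: "a ~= 0" and st: "s <= t"
 shows "integrable lborel (%x. \<bar>a\<bar> * h (r + a * x))"
  and "\<bar>prim h (r + a * t) - prim h (r + a * s)\<bar> = prim (%x. \<bar>a\<bar> * h (r + a * x)) t - prim (%x. \<bar>a\<bar> * h (r + a * x)) s"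
proof -
 show k: "integrable lborel (%x. \<bar>a\<bar> * h (r + a * x))"
  using lborel_integrable_real_affine[OF h a, of r] by (intro integrable_mult_right)
 have I0: "0 <= (LINT l:{0..1}|lborel. h (r + a * s + a * (t - s) * l))"
  unfolding set_lebesgue_integral_def by (intro Bochner_Integration.integral_nonneg) (simp add: pos)
 have "prim h (r + a * t) - prim h (r + a * s) = a * (t - s) * (LINT l:{0..1}|lborel. h (r + a * s + a * (t - s) * l))"
  using prim_affine[OF h, of "r + a * s" "a * (t - s)"] by (simp add: algebra_simps)
 then have "\<bar>prim h (r + a * t) - prim h (r + a * s)\<bar> = \<bar>a\<bar> * (t - s) * (LINT l:{0..1}|lborel. h (r + a * s + a * (t - s) * l))"
  using I0 st by (simp add: abs_mult)
 moreover have "prim (%x. \<bar>a\<bar> * h (r + a * x)) t - prim (%x. \<bar>a\<bar> * h (r + a * x)) s = (t - s) * (LINT l:{0..1}|lborel. \<bar>a\<bar> * h (r + a * (s + (t - s) * l)))"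
  using prim_affine[OF k, of s "t - s"] by simp
 moreover have "(LINT l:{0..1}|lborel. \<bar>a\<bar> * h (r + a * (s + (t - s) * l))) = \<bar>a\<bar> * (LINT l:{0..1}|lborel. h (r + a * s + a * (t - s) * l))"
  by (simp add: algebra_simps)
 ultimately show "\<bar>prim h (r + a * t) - prim h (r + a * s)\<bar> = prim (%x. \<bar>a\<bar> * h (r + a * x)) t - prim (%x. \<bar>a\<bar> * h (r + a * x)) s"
  by (simp only: mult.assoc mult.left_commute)
qed

lemma rep_ac:
 assumes c: "c : curves Z" and ac: "ac_curve Z c"
 shows "ac_curve Z (rep r a c)"
proof -
 obtain h where h: "integrable lborel h" "!!t. 0 <= h t"
  and hd: "!!s t. s <= t ==> mdist Z (c (cl s)) (c (cl t)) <= prim h t - prim h s"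
  using abs_continuous_curve_prim[OF ac] by blast
 have hd': "mdist Z (c (cl s)) (c (cl t)) <= \<bar>prim h t - prim h s\<bar>" for s t
  using hd[of s t] hd[of t s] mdist_commute[of Z "c (cl s)" "c (cl t)"] by (cases "s <= t") auto
 show ?thesis
 proof (cases "a = 0")
  case True
  show ?thesis
  proof (rule abs_continuous_curveI[of "%_. 0"])
   fix s t :: real assume "0 <= s" "s <= t" "t <= 1"
   then have "mdist Z (rep r a c s) (rep r a c t) = mdist Z (c (cl r)) (c (cl r))" using True by (simp add: rep_def)
   also have "... = 0" using mdist_zero[OF curve_in[OF c] curve_in[OF c], of r r] by simp
   finally show "mdist Z (rep r a c s) (rep r a c t) <= prim (%_. 0) t - prim (%_. 0) s" by (simp add: prim_def)
  qed simp
 next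
  case False
  show ?thesis
  proof (rule abs_continuous_curveI[OF affine_prim(1)[OF h False order_refl]])
   fix s t :: real assume st: "0 <= s" "s <= t" "t <= 1"
   have "mdist Z (rep r a c s) (rep r a c t) = mdist Z (c (cl (r + a * s))) (c (cl (r + a * t)))" using st by (simp add: rep_def)
   also have "... <= \<bar>prim h (r + a * t) - prim h (r + a * s)\<bar>" by (rule hd')
   also have "... = prim (%x. \<bar>a\<bar> * h (r + a * x)) t - prim (%x. \<bar>a\<bar> * h (r + a * x)) s"
    by (rule affine_prim(2)[OF h False st(2)])
   finally show "mdist Z (rep r a c s) (rep r a c t) <= prim (%x. \<bar>a\<bar> * h (r + a * x)) t - prim (%x. \<bar>a\<bar> * h (r + a * x)) s" .
  qed
 qed
qed

lemma metric_speed_eqI: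
 assumes l: "((%s. mdist Z (c s) (c t) / \<bar>s - t\<bar>) \<longlongrightarrow> l) (at t within {0..1})" and t: "t : {0..1}"
 shows "metric_speed Z c t = l"
proof -
 have "at t within {0..1} ~= bot" using t by (simp add: trivial_limit_within islimpt_Icc)
 then show ?thesis unfolding metric_speed_def using l tendsto_Lim[OF _ l] by auto
qed

lemma rep_limit:
 assumes l: "((%s. mdist Z (c (cl (r + a * s))) (c (cl (r + a * t))) / \<bar>s - t\<bar>) \<longlongrightarrow> l) (at t)" and t: "t : {0..1}"
 shows "((%s. mdist Z (rep r a c s) (rep r a c t) / \<bar>s - t\<bar>) \<longlongrightarrow> l) (at t within {0..1})"
proof (rule Lim_transform_eventually)
 show "((%s. mdist Z (c (cl (r + a * s))) (c (cl (r + a * t))) / \<bar>s - t\<bar>) \<longlongrightarrow> l) (at t within {0..1})"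
  using l by (rule tendsto_within_subset) simp
 show "\<forall>\<^sub>F s in at t within {0..1}. mdist Z (c (cl (r + a * s))) (c (cl (r + a * t))) / \<bar>s - t\<bar> = mdist Z (rep r a c s) (rep r a c t) / \<bar>s - t\<bar>"
  unfolding eventually_at_filter using t by (intro always_eventually allI impI) (simp add: rep_def)
qed

lemma rep_metric_speed:
 assumes sep: "separable Z" and c: "c : curves Z" and ac: "ac_curve Z c"
 shows "AE t in lborel. t : {0..1} --> metric_speed Z (rep r a c) t = \<bar>a\<bar> * speed Z c (r + a * t)"
 using ac_speed_affine[OF assms, of r a] by eventually_elim (blast intro: metric_speed_eqI rep_limit)

context smm
begin

lemma rep_measurable: "rep r a : measurable (\<Omega> Z) (\<Omega> Z)"
proof (rule measurable_into_curve_space[OF sep])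
 show "rep r a c : curves Z" if "c : space (\<Omega> Z)" for c using that rep_curve by simp
 show "(%w. rep r a w t) : measurable (\<Omega> Z) (borel_of_metric Z)" if t: "t : {0..1}" for t
  using measurable_eval_at[OF sep, of "r + a * t"] t by (simp add: rep_def)
qed

lemma ac_iff:
 assumes c: "c : curves Z"
 shows "ac_curve Z c \<longleftrightarrow> (\<integral>\<^sup>+t. ennreal (speed Z c t) \<partial>lborel) < \<infinity> &
  (ALL s:\<rat>. ALL t:\<rat>. s <= t --> ennreal (mdist Z (c (cl s)) (c (cl t))) <= (\<integral>\<^sup>+x. ennreal (speed Z c x) * (if s <= x & x <= t then 1 else 0) \<partial>lborel))"
proof -
 have ind: "(if s <= x & x <= t then 1 else 0) = (indicator {s..t} x :: ennreal)" for s t x :: real by (simp add: indicator_def)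
 have sm[measurable]: "speed Z c : Borel borel"
  using measurable_speed[OF sep, of "%_. c" borel "%x. x"] c by simp
 show ?thesis
 proof
  assume ac: "ac_curve Z c"
  note a = ac_speed[OF sep c ac]
  have "(\<integral>\<^sup>+t. ennreal (speed Z c t) \<partial>lborel) < \<infinity>"
   using a(1) by (simp add: integrable_iff_bounded)
  moreover have "ennreal (mdist Z (c (cl s)) (c (cl t))) <= (\<integral>\<^sup>+x\<in>{s..t}. ennreal (speed Z c x) \<partial>lborel)" if "s <= t" for s t
   using a(2)[OF that] prim_diff_nn[OF a(1) speed_nonneg that] by (metis ennreal_leI)
  ultimately show "(\<integral>\<^sup>+t. ennreal (speed Z c t) \<partial>lborel) < \<infinity> &
  (ALL s:\<rat>. ALL t:\<rat>. s <= t --> ennreal (mdist Z (c (cl s)) (c (cl t))) <= (\<integral>\<^sup>+x. ennreal (speed Z c x) * (if s <= x & x <= t then 1 else 0) \<partial>lborel))"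
   unfolding ind by blast
 next
  assume H: "(\<integral>\<^sup>+t. ennreal (speed Z c t) \<partial>lborel) < \<infinity> &
  (ALL s:\<rat>. ALL t:\<rat>. s <= t --> ennreal (mdist Z (c (cl s)) (c (cl t))) <= (\<integral>\<^sup>+x. ennreal (speed Z c x) * (if s <= x & x <= t then 1 else 0) \<partial>lborel))"
  have si: "integrable lborel (speed Z c)" using H by (simp add: integrable_iff_bounded)
  have Q: "mdist Z (c (cl s)) (c (cl t)) <= prim (speed Z c) t - prim (speed Z c) s" if "s : \<rat>" "t : \<rat>" "s <= t" for s t
  proof -
   have "ennreal (mdist Z (c (cl s)) (c (cl t))) <= ennreal (prim (speed Z c) t - prim (speed Z c) s)"
    using H that prim_diff_nn[OF si speed_nonneg that(3)] unfolding ind by simp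
   then show ?thesis using prim_mono[OF si speed_nonneg that(3)] by (simp add: ennreal_le_iff)
  qed
  show "ac_curve Z c"
  proof (rule abs_continuous_curveI[OF si])
   fix s t :: real assume st: "0 <= s" "s <= t" "t <= 1"
   show "mdist Z (c s) (c t) <= prim (speed Z c) t - prim (speed Z c) s"
   proof (cases "s = t")
    case True
    then show ?thesis using mdist_zero[OF curve_in'[OF c] curve_in'[OF c], of t t] st by simp
   next
    case False
    show ?thesis
    proof (rule field_le_epsilon)
     fix e :: real assume "0 < e" then have e: "0 < e / 2" by simp
     have s01: "s : {0..1}" "t : {0..1}" using st by auto
     obtain d1 where d1: "d1 > 0" "!!x. x : {0..1} ==> \<bar>x - s\<bar> < d1 ==> mdist Z (c s) (c x) < e/2"
      using curve_continuous_at[OF c s01(1) e] by blast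
     obtain d2 where d2: "d2 > 0" "!!x. x : {0..1} ==> \<bar>x - t\<bar> < d2 ==> mdist Z (c t) (c x) < e/2"
      using curve_continuous_at[OF c s01(2) e] by blast
     have "s < min (s + d1) ((s + t) / 2)" using d1 st False by auto
     then obtain u where u: "u : \<rat>" "s < u" "u < min (s + d1) ((s + t) / 2)" using Rats_dense_in_real by blast
     have "max (t - d2) ((s + t) / 2) < t" using d2 st False by auto
     then obtain v where v: "v : \<rat>" "max (t - d2) ((s + t) / 2) < v" "v < t" using Rats_dense_in_real by blast
     have uv: "u : {0..1}" "v : {0..1}" "u <= v" using u v st by auto
     have cuv: "cl u = u" "cl v = v" using uv by (auto simp: cl_id)
     have in_Z: "c s : mspace Z" "c t : mspace Z" "c u : mspace Z" "c v : mspace Z"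
      using curve_in'[OF c] s01 uv by blast+
     have "mdist Z (c s) (c t) <= mdist Z (c s) (c u) + mdist Z (c u) (c t)"
      "mdist Z (c u) (c t) <= mdist Z (c u) (c v) + mdist Z (c v) (c t)"
      using in_Z by (auto intro!: mdist_triangle)
     moreover have "mdist Z (c u) (c v) <= prim (speed Z c) v - prim (speed Z c) u" using Q[OF u(1) v(1) uv(3)] by (simp add: cuv)
     moreover have "prim (speed Z c) s <= prim (speed Z c) u" "prim (speed Z c) v <= prim (speed Z c) t"
      using u v by (auto intro!: prim_mono[OF si speed_nonneg])
     moreover have "mdist Z (c s) (c u) < e/2" using d1(2)[OF uv(1)] u by auto
     moreover have "mdist Z (c t) (c v) < e/2" using d2(2)[OF uv(2)] v by auto
     ultimately show "mdist Z (c s) (c t) <= prim (speed Z c) t - prim (speed Z c) s + e"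
      using mdist_commute[of Z "c t" "c v"] by linarith
    qed
   qed
  qed
 qed
qed

lemma ac_measurable: "{c : space (\<Omega> Z). ac_curve Z c} : sets (\<Omega> Z)"
proof -
 have [measurable]: "(%z. speed Z (fst z) (snd z)) : Borel (\<Omega> Z >< lborel)" by (rule measurable_sp[OF refl]) auto
 have m1: "(%c. \<integral>\<^sup>+t. ennreal (speed Z c t) \<partial>lborel) : Borel (\<Omega> Z)"
 proof -
  have "(%z. ennreal (speed Z (fst z) (snd z))) : Borel (\<Omega> Z >< lborel)" by measurable
  from lborel.borel_measurable_nn_integral_fst[OF this] show ?thesis by simp
 qed
 have m2: "(%c. \<integral>\<^sup>+x. ennreal (speed Z c x) * (if s <= x & x <= t then 1 else 0) \<partial>lborel) : Borel (\<Omega> Z)" for s t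
 proof -
  have "(%z. ennreal (speed Z (fst z) (snd z)) * (if s <= snd z & snd z <= t then 1 else 0)) : Borel (\<Omega> Z >< lborel)" by measurable
  from lborel.borel_measurable_nn_integral_fst[OF this] show ?thesis by simp
 qed
 have m3: "(%c. mdist Z (c (cl s)) (c (cl t))) : Borel (\<Omega> Z)" for s t
  by (intro measurable_mdist2[OF sep] measurable_eval_at[OF sep])
 define A where "A c \<longleftrightarrow> (\<integral>\<^sup>+t. ennreal (speed Z c t) \<partial>lborel) < \<infinity>" for c
 define B where "B s t c \<longleftrightarrow> ennreal (mdist Z (c (cl s)) (c (cl t))) <= (\<integral>\<^sup>+x. ennreal (speed Z c x) * (if s <= x & x <= t then 1 else 0) \<partial>lborel)" for s t c
 define K where "K s = {c : space (\<Omega> Z). ALL t:\<rat>. s <= t --> B s t c}" for s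
 have eq: "ac_curve Z c \<longleftrightarrow> A c & (ALL s:\<rat>. ALL t:\<rat>. s <= t --> B s t c)" if "c : curves Z" for c
  unfolding A_def B_def by (rule ac_iff[OF that])
 have "{c : space (\<Omega> Z). ac_curve Z c} = {c : space (\<Omega> Z). A c} \<inter> {c : space (\<Omega> Z). ALL s:\<rat>. c : K s}"
  using eq unfolding K_def space_borel_of_metric by blast
 moreover have "{c : space (\<Omega> Z). A c} : sets (\<Omega> Z)"
  unfolding A_def using m1 by (rule borel_measurable_less) simp
 moreover have "K s : sets (\<Omega> Z)" for s
  unfolding K_def
 proof (rule sets.sets_Collect_countable_Ball'[OF countable_rat])
  fix t :: real
  have "{c : space (\<Omega> Z). B s t c} : sets (\<Omega> Z)"
   unfolding B_def by (rule borel_measurable_le[OF measurable_compose[OF m3 measurable_ennreal] m2])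
  then show "{c : space (\<Omega> Z). s <= t --> B s t c} : sets (\<Omega> Z)"
   using sets.top[of "\<Omega> Z"] by (cases "s <= t") auto
 qed
 then have "{c : space (\<Omega> Z). ALL s:\<rat>. c : K s} : sets (\<Omega> Z)"
  by (intro sets.sets_Collect_countable_Ball'[OF countable_rat]) (simp add: Collect_conj_eq sets.Int_space_eq1[of _ "\<Omega> Z", unfolded space_borel_of_metric])
 ultimately show ?thesis by (simp only: sets.Int)
qed

end

context smm
begin

lemma plan_distrI:
 assumes S: "prob_space S" and \<phi>[measurable]: "\<phi> : measurable S (\<Omega> Z)" and ac: "AE w in S. ac_curve Z (\<phi> w)"
  and en: "(\<integral>\<^sup>+w. (\<integral>\<^sup>+t\<in>{0..1}. ennreal (metric_speed Z (\<phi> w) t powr q) \<partial>lborel) \<partial>S) < \<infinity>"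
  and c: "0 < C" "!!t A. t : {0..1} ==> A : sets m ==> emeasure S {w : space S. \<phi> w t : A} <= ennreal C * emeasure m A"
 shows "plan (distr S (\<Omega> Z) \<phi>)"
proof (rule planI)
 interpret S: prob_space S by fact
 let ?D = "distr S (\<Omega> Z) \<phi>"
 show "prob_space ?D" by (rule S.prob_space_distr[OF \<phi>])
 show "sets ?D = sets (\<Omega> Z)" by simp
 show acD: "AE \<gamma> in ?D. ac_curve Z \<gamma>"
  using AE_distr_iff[OF \<phi> ac_measurable] ac by blast
 have enm: "(%c. \<integral>\<^sup>+t. ennreal (speed Z c t powr q) \<partial>lborel) : Borel (\<Omega> Z)"
 proof -
  have [measurable]: "(%z. speed Z (fst z) (snd z)) : Borel (\<Omega> Z >< lborel)" by (rule measurable_sp[OF refl]) auto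
  have "(%z. ennreal (speed Z (fst z) (snd z) powr q)) : Borel (\<Omega> Z >< lborel)" by measurable
  from lborel.borel_measurable_nn_integral_fst[OF this] show ?thesis by simp
 qed
 have enm': "(%c. \<integral>\<^sup>+t. ennreal (speed Z c t powr q) \<partial>lborel) : Borel ?D"
  using enm unfolding measurable_distr_eq1 .
 have en_eq: "(\<integral>\<^sup>+t\<in>{0..1}. ennreal (metric_speed Z \<gamma> t powr q) \<partial>lborel) = (\<integral>\<^sup>+t. ennreal (speed Z \<gamma> t powr q) \<partial>lborel)"
  if g: "\<gamma> : curves Z" "ac_curve Z \<gamma>" for \<gamma>
  by (rule nn_integral_cong_AE, use AE_speed[OF g] in eventually_elim) (auto simp: indicator_def)
 have in_\<Omega>: "\<phi> w : curves Z" if "w : space S" for w using measurable_space[OF \<phi> that] by simp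
 have "(\<integral>\<^sup>+\<gamma>. (\<integral>\<^sup>+t\<in>{0..1}. ennreal (metric_speed Z \<gamma> t powr q) \<partial>lborel) \<partial>?D) = (\<integral>\<^sup>+\<gamma>. (\<integral>\<^sup>+t. ennreal (speed Z \<gamma> t powr q) \<partial>lborel) \<partial>?D)"
  using acD AE_space[of ?D] by (intro nn_integral_cong_AE, eventually_elim) (simp add: en_eq)
 also have "... = (\<integral>\<^sup>+w. (\<integral>\<^sup>+t. ennreal (speed Z (\<phi> w) t powr q) \<partial>lborel) \<partial>S)"
  by (rule nn_integral_distr[OF \<phi> enm'])
 also have "... = (\<integral>\<^sup>+w. (\<integral>\<^sup>+t\<in>{0..1}. ennreal (metric_speed Z (\<phi> w) t powr q) \<partial>lborel) \<partial>S)"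
  using ac AE_space[of S] by (intro nn_integral_cong_AE, eventually_elim) (simp add: en_eq in_\<Omega>)
 finally show "(\<integral>\<^sup>+\<gamma>. (\<integral>\<^sup>+t\<in>{0..1}. ennreal (metric_speed Z \<gamma> t powr q) \<partial>lborel) \<partial>?D) < \<infinity>" using en by simp
 fix t :: real and A assume t: "t : {0..1}" and A: "A : sets m"
 have e: "(%\<gamma>. \<gamma> (cl t)) -` A \<inter> space ?D : sets (\<Omega> Z)"
  using measurable_sets[OF measurable_ev[OF refl, of "%x. x" "\<Omega> Z" "%_. t"] A] by simp
 have eq: "\<phi> -` ((%\<gamma>. \<gamma> (cl t)) -` A \<inter> space ?D) \<inter> space S = {w : space S. \<phi> w t : A}"
  using t in_\<Omega> by (auto simp: cl_id)
 from c(2)[OF t A] show "emeasure ?D ((%\<gamma>. \<gamma> (cl t)) -` A \<inter> space ?D) <= ennreal C * emeasure m A"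
  unfolding emeasure_distr[OF \<phi> e] eq .
qed (rule c(1))

text \<open>Outside \<open>[0,1]\<close> curves are continued by their endpoints, so no restriction on \<open>r\<close>
and \<open>a\<close> is needed: the continued part has speed zero.\<close>
lemma plan_rep:
 assumes E: "plan E"
 shows "plan (distr E (\<Omega> Z) (rep r a))"
proof -
 note s = plan_sets[OF E]
 obtain n :: nat where n: "compress E (real n)" "energy E <= of_nat n" using plan_bounds[OF E] by blast
 show ?thesis
 proof (rule plan_distrI[OF plan_prob[OF E]])
  show "rep r a : measurable E (\<Omega> Z)" using rep_measurable measurable_cong_sets[OF s refl] by blast
  show "AE c in E. ac_curve Z (rep r a c)"
   using plan_AE[OF E] by eventually_elim (simp add: rep_ac)
  have pt: "(\<integral>\<^sup>+t\<in>{0..1}. ennreal (metric_speed Z (rep r a c) t powr q) \<partial>lborel) <= ennreal (\<bar>a\<bar> powr (q - 1)) * (\<integral>\<^sup>+t. ennreal (speed Z c t powr q) \<partial>lborel)"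
   if g: "c : curves Z" "ac_curve Z c" for c
  proof -
   have [measurable]: "speed Z c : Borel borel"
    using measurable_speed[OF sep, of "%_. c" borel "%x. x"] g by simp
   have "(\<integral>\<^sup>+t\<in>{0..1}. ennreal (metric_speed Z (rep r a c) t powr q) \<partial>lborel) <= (\<integral>\<^sup>+t. ennreal ((\<bar>a\<bar> * speed Z c (r + a * t)) powr q) \<partial>lborel)"
    using rep_metric_speed[OF sep g, of r a] by (intro nn_integral_mono_AE, eventually_elim) (auto simp: indicator_def)
   also have "... <= ennreal (\<bar>a\<bar> powr (q - 1)) * (\<integral>\<^sup>+t. ennreal (speed Z c t powr q) \<partial>lborel)"
   proof (cases "a = 0")
    case False
    have "(\<integral>\<^sup>+t. ennreal ((\<bar>a\<bar> * speed Z c (r + a * t)) powr q) \<partial>lborel) = (\<integral>\<^sup>+t. ennreal (\<bar>a\<bar> powr q) * ennreal (speed Z c (r + a * t) powr q) \<partial>lborel)"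
     by (intro nn_integral_cong) (simp add: powr_mult ennreal_mult)
    also have "... = ennreal (\<bar>a\<bar> powr (q - 1)) * (ennreal \<bar>a\<bar> * (\<integral>\<^sup>+t. ennreal (speed Z c (r + a * t) powr q) \<partial>lborel))"
     using False by (subst nn_integral_cmult) (auto simp: mult.assoc[symmetric] ennreal_mult[symmetric] powr_diff)
    also have "ennreal \<bar>a\<bar> * (\<integral>\<^sup>+t. ennreal (speed Z c (r + a * t) powr q) \<partial>lborel) = (\<integral>\<^sup>+t. ennreal (speed Z c t powr q) \<partial>lborel)"
     by (rule nn_integral_real_affine[OF _ False, symmetric]) measurable
    finally show ?thesis by simp
   qed simp
   finally show ?thesis .
  qed
  have "(\<integral>\<^sup>+c. (\<integral>\<^sup>+t\<in>{0..1}. ennreal (metric_speed Z (rep r a c) t powr q) \<partial>lborel) \<partial>E) <= (\<integral>\<^sup>+c. ennreal (\<bar>a\<bar> powr (q - 1)) * (\<integral>\<^sup>+t. ennreal (speed Z c t powr q) \<partial>lborel) \<partial>E)"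
   using plan_AE[OF E] by (intro nn_integral_mono_AE, eventually_elim) (simp add: pt)
  also have "... = ennreal (\<bar>a\<bar> powr (q - 1)) * energy E"
  proof -
   have [measurable]: "(%z. speed Z (fst z) (snd z)) : Borel (E >< lborel)" by (rule measurable_sp[OF s]) auto
   have "(%z. ennreal (speed Z (fst z) (snd z) powr q)) : Borel (E >< lborel)" by measurable
   from lborel.borel_measurable_nn_integral_fst[OF this] show ?thesis unfolding energy_def by (subst nn_integral_cmult) auto
  qed
  also have "... < \<infinity>" using n(2) by (simp add: ennreal_mult_less_top order_le_less_trans[OF _ of_nat_less_top])
  finally show "(\<integral>\<^sup>+c. (\<integral>\<^sup>+t\<in>{0..1}. ennreal (metric_speed Z (rep r a c) t powr q) \<partial>lborel) \<partial>E) < \<infinity>" .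
  show "0 < real n + 1" by simp
  fix t :: real and A assume t: "t : {0..1}" and A: "A : sets m"
  have "{w : space E. rep r a w t : A} = (%c. c (cl (r + a * t))) -` A \<inter> space E" using t by (auto simp: rep_def)
  then have "emeasure E {w : space E. rep r a w t : A} <= ennreal (real n) * emeasure m A"
   using n(1) A by (simp add: compress_def)
  also have "... <= ennreal (real n + 1) * emeasure m A" by (intro mult_right_mono ennreal_leI) auto
  finally show "emeasure E {w : space E. rep r a w t : A} <= ennreal (real n + 1) * emeasure m A" .
 qed
qed

text \<open>The defining inequality for the plan rescaled to the interval.\<close>
lemma wug_interval:
 assumes g: "wug u g" and \<eta>: "plan \<eta>" and st: "s < t"
 shows "AE \<gamma> in \<eta>. ennreal \<bar>u (\<gamma> (cl t)) - u (\<gamma> (cl s))\<bar> <= (\<integral>\<^sup>+x\<in>{s..t}. ennreal (g (\<gamma> (cl x)) * speed Z \<gamma> x) \<partial>lborel)"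
proof -
 define a where "a = t - s"
 have a: "a > 0" using st by (simp add: a_def)
 have gm[measurable]: "g : Borel m" using g by (simp add: wug_iff)
 have R: "rep s a : measurable \<eta> (\<Omega> Z)" using rep_measurable measurable_cong_sets[OF plan_sets[OF \<eta>] refl] by blast
 have "AE c in distr \<eta> (\<Omega> Z) (rep s a). ennreal \<bar>u (c 1) - u (c 0)\<bar> <= (\<integral>\<^sup>+x\<in>{0..1}. ennreal (g (c x) * metric_speed Z c x) \<partial>lborel)"
  using g plan_rep[OF \<eta>] unfolding weak_upper_gradient_def by blast
 from AE_distrD[OF R this]
 have "AE \<gamma> in \<eta>. ennreal \<bar>u (rep s a \<gamma> 1) - u (rep s a \<gamma> 0)\<bar> <= (\<integral>\<^sup>+x\<in>{0..1}. ennreal (g (rep s a \<gamma> x) * metric_speed Z (rep s a \<gamma>) x) \<partial>lborel)" .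
 then show ?thesis using plan_AE[OF \<eta>]
 proof eventually_elim
  case (elim \<gamma>)
  note le = elim(1) and c = elim(2)
  have c': "\<gamma> : curves Z" "ac_curve Z \<gamma>" using c by auto
  have sm[measurable]: "speed Z \<gamma> : Borel borel"
   using measurable_speed[OF sep, of "%_. \<gamma>" borel "%x. x"] c' by simp
  have em[measurable]: "(%x. \<gamma> (cl x)) : measurable borel m"
   using measurable_ev[OF refl, of "%_. \<gamma>" borel "%x. x"] c' by simp
  have "(\<integral>\<^sup>+x\<in>{0..1}. ennreal (g (rep s a \<gamma> x) * metric_speed Z (rep s a \<gamma>) x) \<partial>lborel)
   = (\<integral>\<^sup>+x. ennreal a * (ennreal (g (\<gamma> (cl (s + a * x))) * speed Z \<gamma> (s + a * x)) * indicator {s..t} (s + a * x)) \<partial>lborel)"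
  proof (rule nn_integral_cong_AE, use rep_metric_speed[OF sep c', of s a] in eventually_elim)
   fix x :: real assume x: "x : {0..1} --> metric_speed Z (rep s a \<gamma>) x = \<bar>a\<bar> * speed Z \<gamma> (s + a * x)"
   have i: "(indicator {s..t} (s + a * x) :: ennreal) = indicator {0..1} x"
   proof -
    have t: "t = s + a" by (simp add: a_def)
    have "(s + a * x <= t) = (x <= 1)" unfolding t using mult_le_cancel_left_pos[OF a, of x 1] by simp
    moreover have "(s <= s + a * x) = (0 <= x)" using a by (simp add: zero_le_mult_iff)
    ultimately show ?thesis by (simp add: indicator_def)
   qed
   show "ennreal (g (rep s a \<gamma> x) * metric_speed Z (rep s a \<gamma>) x) * indicator {0..1} x =
    ennreal a * (ennreal (g (\<gamma> (cl (s + a * x))) * speed Z \<gamma> (s + a * x)) * indicator {s..t} (s + a * x))"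
    unfolding i using x a by (auto simp: indicator_def rep_def ennreal_mult'[symmetric] mult.left_commute)
  qed
  also have "... = ennreal a * (\<integral>\<^sup>+x. ennreal (g (\<gamma> (cl (s + a * x))) * speed Z \<gamma> (s + a * x)) * indicator {s..t} (s + a * x) \<partial>lborel)"
   by (rule nn_integral_cmult) measurable
  also have "ennreal a = ennreal \<bar>a\<bar>" using a by (simp only: abs_of_pos)
  also have "ennreal \<bar>a\<bar> * (\<integral>\<^sup>+x. ennreal (g (\<gamma> (cl (s + a * x))) * speed Z \<gamma> (s + a * x)) * indicator {s..t} (s + a * x) \<partial>lborel)
   = (\<integral>\<^sup>+x\<in>{s..t}. ennreal (g (\<gamma> (cl x)) * speed Z \<gamma> x) \<partial>lborel)"
  proof (rule nn_integral_real_affine[where f="%x. ennreal (g (\<gamma> (cl x)) * speed Z \<gamma> x) * indicator {s..t} x", symmetric])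
   show "a ~= 0" using a by simp
   show "(%x. ennreal (g (\<gamma> (cl x)) * speed Z \<gamma> x) * indicator {s..t} x) : Borel borel" by measurable
  qed
  finally have E: "(\<integral>\<^sup>+x\<in>{0..1}. ennreal (g (rep s a \<gamma> x) * metric_speed Z (rep s a \<gamma>) x) \<partial>lborel)
   = (\<integral>\<^sup>+x\<in>{s..t}. ennreal (g (\<gamma> (cl x)) * speed Z \<gamma> x) \<partial>lborel)" .
  have v: "rep s a \<gamma> 1 = \<gamma> (cl t)" "rep s a \<gamma> 0 = \<gamma> (cl s)" by (simp_all add: rep_def a_def)
  show ?case
   using le unfolding v E .
 qed
qed

end

section \<open>Sobolev functions along curves\<close>

context smm
begin

lemma lin_finite:
 assumes E: "plan E" and g[measurable]: "g : Borel m" and f: "lp g < \<infinity>"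
 shows "AE c in E. integrable lborel (%x. g (c (cl x)) * speed Z c x)"
proof -
 interpret E: prob_space E using E by (rule plan_prob)
 interpret P: pair_sigma_finite E lborel ..
 show ?thesis using P.AE_integrable_fst'[OF plan_integrable(1)[OF E g f]] by simp
qed

text \<open>The inequality holds for rational times along almost every curve, and by Fubini between all rational and
almost all times; this is the input of the extension lemma. The slope is thus a density of the function
along the curve.\<close>
theorem ac_along_plan:
 assumes u[measurable]: "u : Borel m" and wug: "wug u g" and E: "plan E"
 shows "AE \<gamma> in E. integrable lborel (slope u \<gamma>) & (AE t in lborel. \<bar>slope u \<gamma> t\<bar> <= g (\<gamma> (cl t)) * speed Z \<gamma> t) &
  (EX c. (ALL t:\<rat>. u (\<gamma> (cl t)) = c + prim (slope u \<gamma>) t) & (AE t in lborel. u (\<gamma> (cl t)) = c + prim (slope u \<gamma>) t))"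
proof -
 interpret E: prob_space E using E by (rule plan_prob)
 interpret P: pair_sigma_finite E lborel ..
 note s = plan_sets[OF E]
 have g[measurable]: "g : Borel m" and gl: "lp g < \<infinity>" and gpos: "!!z. z : space m ==> 0 <= g z"
  using wug by (auto simp: wug_iff)
 define H where "H s t \<gamma> = (\<integral>\<^sup>+x. ennreal (g (\<gamma> (cl x)) * speed Z \<gamma> x) * (if min s t <= x & x <= max s t then 1 else 0) \<partial>lborel)" for s t \<gamma>
 define Q where "Q s t \<gamma> \<longleftrightarrow> ennreal \<bar>u (\<gamma> (cl t)) - u (\<gamma> (cl s))\<bar> <= H s t \<gamma>" for s t \<gamma>
 have Hind: "H s t \<gamma> = (\<integral>\<^sup>+x\<in>{min s t..max s t}. ennreal (g (\<gamma> (cl x)) * speed Z \<gamma> x) \<partial>lborel)" for s t \<gamma>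
  unfolding H_def by (intro nn_integral_cong) (simp add: indicator_def)
 have Q_AE: "AE \<gamma> in E. Q s t \<gamma>" for s t
 proof (cases s t rule: linorder_cases)
  case less
  then show ?thesis using wug_interval[OF wug E less] by (simp add: Q_def Hind)
 next
  case greater
  then show ?thesis using wug_interval[OF wug E greater] by (simp add: Q_def Hind abs_minus_commute)
 qed (simp add: Q_def)
 have Q_meas: "{z : space (E >< lborel). Q s (snd z) (fst z)} : sets (E >< lborel)" for s
 proof -
  have f1: "(%w. fst (fst w)) : measurable ((E >< lborel) >< lborel) E" by measurable
  have [measurable]: "(%w. fst (fst w) (cl (snd w))) : measurable ((E >< lborel) >< lborel) m" by (rule measurable_ev[OF s f1]) measurable
  have [measurable]: "(%w. speed Z (fst (fst w)) (snd w)) : Borel ((E >< lborel) >< lborel)" by (rule measurable_sp[OF s f1]) measurable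
  have "(%w. ennreal (g (fst (fst w) (cl (snd w))) * speed Z (fst (fst w)) (snd w)) * (if min s (snd (fst w)) <= snd w & snd w <= max s (snd (fst w)) then 1 else 0))
   : Borel ((E >< lborel) >< lborel)" by measurable
  from lborel.borel_measurable_nn_integral_fst[OF this]
  have [measurable]: "(%z. H s (snd z) (fst z)) : Borel (E >< lborel)" by (simp add: H_def)
  have [measurable]: "(%z. pos z) : measurable (E >< lborel) m" by (rule measurable_ev[OF s]) auto
  have [measurable]: "(%z. fst z (cl s)) : measurable (E >< lborel) m" by (rule measurable_ev[OF s, of fst _ "%_. s"]) auto
  show ?thesis unfolding Q_def by measurable
 qed
 have Q1: "AE \<gamma> in E. ALL s:\<rat>. ALL t:\<rat>. Q s t \<gamma>"
  unfolding AE_ball_countable[OF countable_rat] using Q_AE by blast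
 have Q2: "AE \<gamma> in E. ALL s:\<rat>. AE t in lborel. Q s t \<gamma>"
  unfolding AE_ball_countable[OF countable_rat]
 proof
  fix s :: real
  have "AE t in lborel. AE \<gamma> in E. Q s t \<gamma>" using Q_AE by simp
  then show "AE \<gamma> in E. AE t in lborel. Q s t \<gamma>"
   using P.AE_commute[of "%\<gamma> t. Q s t \<gamma>", OF Q_meas] by simp
 qed
 show ?thesis using Q1 Q2 lin_finite[OF E g gl] plan_AE[OF E]
 proof eventually_elim
  case (elim \<gamma>)
  note q1 = elim(1) and q2 = elim(2) and hi = elim(3) and c = elim(4)
  let ?h = "%x. g (\<gamma> (cl x)) * speed Z \<gamma> x" and ?F = "%t. u (\<gamma> (cl t))"
  have pos: "0 <= ?h x" for x using gpos curve_in[OF conjunct1[OF c], of x] by (simp add: space_m)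
  have conv: "\<bar>?F t - ?F s\<bar> <= \<bar>prim ?h t - prim ?h s\<bar>" if Q: "Q s t \<gamma>" for s t
  proof -
   have "min s t <= max s t" by simp
   then have "ennreal \<bar>?F t - ?F s\<bar> <= ennreal (prim ?h (max s t) - prim ?h (min s t))"
    using Q unfolding Q_def Hind by (subst prim_diff_nn[OF hi pos])
   moreover have "0 <= prim ?h (max s t) - prim ?h (min s t)" using prim_mono[OF hi pos, of "min s t" "max s t"] by simp
   ultimately have "\<bar>?F t - ?F s\<bar> <= prim ?h (max s t) - prim ?h (min s t)" by (simp add: ennreal_le_iff)
   then show ?thesis by (auto simp: min_def max_def split: if_splits)
  qed
  have a1: "\<bar>?F t - ?F s\<bar> <= \<bar>prim ?h t - prim ?h s\<bar>" if "s : \<rat>" "t : \<rat>" for s t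
   using that q1 by (intro conv) blast
  have "AE t in lborel. ALL s:\<rat>. Q s t \<gamma>" unfolding AE_ball_countable[OF countable_rat] using q2 .
  then have a2: "AE t in lborel. ALL s:\<rat>. \<bar>?F t - ?F s\<bar> <= \<bar>prim ?h t - prim ?h s\<bar>"
   by eventually_elim (use conv in blast)
  obtain d c where d: "integrable lborel d" "AE t in lborel. \<bar>d t\<bar> <= ?h t"
   "!!t. t : \<rat> ==> ?F t = c + prim d t" "AE t in lborel. ?F t = c + prim d t"
   "AE t in lborel. (%k. (?F (t + 1 / real (Suc k)) - ?F t) * real (Suc k)) ----> d t"
   using ac_imp_prim_AE[OF hi pos a1 a2] by blast
  have eq: "AE t in lborel. d t = slope u \<gamma> t"
   using d(5) by eventually_elim (simp add: slope_def limI del: of_nat_Suc)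
  have u': "(%p. u (fst p)) : Borel (borel_of_metric Z >< (count_space UNIV :: unit measure))"
   using u measurable_cong_sets[OF sets_m refl] by (intro measurable_compose[OF measurable_fst]) blast
  have sm: "slope u \<gamma> : Borel lborel"
   using measurable_slope[OF sep, of "%_. \<gamma>" borel "%x. x" "%_. u" "count_space UNIV :: unit measure" "%_. ()"] u' conjunct1[OF c] by simp
  have si: "integrable lborel (slope u \<gamma>)" by (rule integrable_cong_AE_imp[OF d(1) sm eq])
  have pe: "prim d t = prim (slope u \<gamma>) t" for t by (rule prim_cong_AE[OF eq]) (use d sm in auto)
  show ?case
  proof (intro conjI si exI[of _ c] ballI)
   show "AE t in lborel. \<bar>slope u \<gamma> t\<bar> <= ?h t" using d(2) eq by eventually_elim simp
   show "?F t = c + prim (slope u \<gamma>) t" if "t : \<rat>" for t using d(3)[OF that] pe by simp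
   show "AE t in lborel. ?F t = c + prim (slope u \<gamma>) t" using d(4) pe by simp
  qed
 qed
qed

lemma wug_AE_slope:
 assumes "u : Borel m" "wug u g" "plan E"
 shows "AE c in E. AE t in lborel. \<bar>slope u c t\<bar> <= g (c (cl t)) * speed Z c t"
 using ac_along_plan[OF assms] by eventually_elim blast

text \<open>A known weak upper gradient makes the function a primitive of its slope along the curve, so any other bound
for the slope integrates.\<close>
lemma slope_bound_imp_lin:
 assumes u: "u : Borel m" and wug: "wug u g" and E: "plan E"
  and D: "AE \<gamma> in E. AE t in lborel. \<bar>slope u \<gamma> t\<bar> <= D (\<gamma> (cl t)) * speed Z \<gamma> t"
 shows "AE \<gamma> in E. ennreal \<bar>u (\<gamma> (cl 1)) - u (\<gamma> (cl 0))\<bar> <= lin D \<gamma>"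
 using ac_along_plan[OF u wug E] D
proof eventually_elim
 case (elim \<gamma>)
 note A = elim(1) and B = elim(2)
 then obtain c where si: "integrable lborel (slope u \<gamma>)" and c: "!!t. t : \<rat> ==> u (\<gamma> (cl t)) = c + prim (slope u \<gamma>) t" by blast
 have "u (\<gamma> (cl 1)) - u (\<gamma> (cl 0)) = prim (slope u \<gamma>) 1 - prim (slope u \<gamma>) 0" using c[OF Rats_1] c[OF Rats_0] by simp
 also have "... = (LINT x:{0<..1}|lborel. slope u \<gamma> x)" by (rule prim_diff[OF si]) simp
 finally have e: "u (\<gamma> (cl 1)) - u (\<gamma> (cl 0)) = (LINT x|lborel. indicator {0<..1} x * slope u \<gamma> x)" by (simp add: set_lebesgue_integral_def)
 have i: "integrable lborel (%x. indicator {0<..1} x * slope u \<gamma> x)" by (rule integrable_indicator_mult[OF si]) simp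
 have "ennreal \<bar>u (\<gamma> (cl 1)) - u (\<gamma> (cl 0))\<bar> <= (\<integral>\<^sup>+x. ennreal \<bar>indicator {0<..1} x * slope u \<gamma> x\<bar> \<partial>lborel)"
  unfolding e using integral_norm_bound_ennreal[OF i] by simp
 also have "... <= lin D \<gamma>" unfolding lin_def
  by (rule nn_integral_mono_AE, use B in eventually_elim) (auto simp: indicator_def intro: ennreal_leI order_trans[OF abs_ge_zero])
 finally show "ennreal \<bar>u (\<gamma> (cl 1)) - u (\<gamma> (cl 0))\<bar> <= lin D \<gamma>" .
qed

end

section \<open>Measurable families of minimal gradients\<close>

text \<open>The set where \<open>D\<close> is nonzero is the essential image of \<open>R\<close> under \<open>(s, y)
\<mapsto> (e s, y)\<close>: it contains the image of almost every point and, for almost every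
\<open>y\<close>, nothing of positive measure that is missed. Images of measurable sets need not be
measurable; \<open>D\<close> is the density of the push-forward of the product measure restricted to
\<open>R\<close>, and its slices are identified on a countable generator.\<close>
lemma essential_projection:
 fixes M :: "'z measure" and S :: "'s measure" and P :: "'y measure" and e :: "'s => 'z"
 assumes M: "sigma_finite_measure M" and S: "finite_measure S" and P: "sigma_finite_measure P"
  and gen: "EX E :: nat => 'z set. range E \<subseteq> Pow (space M) & Int_stable (range E) &
   sets M = sigma_sets (space M) (range E) & space M : range E"
  and e[measurable]: "e : measurable S M"
  and ac: "!!A. A : null_sets M ==> e -` A \<inter> space S : null_sets S"
  and R[measurable]: "R : sets (S >< P)"
 shows "EX D:Borel (M >< P). (AE y in P. AE s in S. (s, y) : R --> D (e s, y) ~= (0::ennreal)) &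
  (AE y in P. ALL A:sets M. (AE s in S. (s, y) : R --> e s ~: A) --> (AE z in M. z : A --> D (z, y) = 0))"
proof -
 interpret M: sigma_finite_measure M by fact
 interpret P: sigma_finite_measure P by fact
 interpret S: finite_measure S by fact
 interpret MP: pair_sigma_finite M P ..
 interpret SP: pair_sigma_finite S P ..
 define \<phi> where "\<phi> w = (e (fst w), snd w)" for w :: "'s \<times> 'y"
 have \<phi>[measurable]: "\<phi> : measurable (S >< P) (M >< P)" unfolding \<phi>_def by measurable
 define \<rho> where "\<rho> = distr (density (S >< P) (indicator R)) (M >< P) \<phi>"
 have \<rho>: "emeasure \<rho> Q = (\<integral>\<^sup>+w. indicator R w * indicator Q (\<phi> w) \<partial>(S >< P))" if Q[measurable]: "Q : sets (M >< P)" for Q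
 proof -
  have "emeasure \<rho> Q = emeasure (density (S >< P) (indicator R)) (\<phi> -` Q \<inter> space (S >< P))"
   unfolding \<rho>_def by (subst emeasure_distr) auto
  also have "... = (\<integral>\<^sup>+w. indicator R w * indicator (\<phi> -` Q \<inter> space (S >< P)) w \<partial>(S >< P))"
   by (rule emeasure_density) auto
  also have "... = (\<integral>\<^sup>+w. indicator R w * indicator Q (\<phi> w) \<partial>(S >< P))"
   by (intro nn_integral_cong) (simp add: indicator_def)
  finally show ?thesis .
 qed
 have abs: "absolutely_continuous (M >< P) \<rho>"
  unfolding absolutely_continuous_def
 proof
  fix Q assume Q: "Q : null_sets (M >< P)"
  then have Qm[measurable]: "Q : sets (M >< P)" by auto
  have "AE w in M >< P. w ~: Q" using Q by (rule AE_not_in)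
  then have "AE z in M. AE y in P. (z, y) ~: Q" by (rule MP.AE_pair)
  then obtain A where A: "A : null_sets M" "{z\<in>space M. \<not> (AE y in P. (z, y) ~: Q)} \<subseteq> A" by (auto simp: eventually_ae_filter)
  have "AE s in S. s ~: e -` A \<inter> space S" by (rule AE_not_in[OF ac[OF A(1)]])
  then have "AE s in S. AE y in P. \<phi> (s, y) ~: Q"
   using AE_space[of S]
  proof eventually_elim
   case (elim s)
   then show ?case using A(2) measurable_space[OF e, of s] by (auto simp: \<phi>_def)
  qed
  then have "AE w in S >< P. \<phi> w ~: Q" by (intro SP.AE_pair_measure) auto
  then have "(\<integral>\<^sup>+w. indicator R w * indicator Q (\<phi> w) \<partial>(S >< P)) = 0"
   by (subst nn_integral_0_iff_AE) (auto elim!: eventually_mono)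
  then show "Q : null_sets \<rho>" using \<rho>[OF Qm] Qm by (auto simp: null_sets_def \<rho>_def)
 qed
 have "sets \<rho> = sets (M >< P)" by (simp add: \<rho>_def)
 from MP.Radon_Nikodym[OF abs this] obtain D :: "'z \<times> 'y => ennreal"
  where D[measurable]: "D : Borel (M >< P)" and dens: "density (M >< P) D = \<rho>" by blast
 have \<rho>D: "emeasure \<rho> Q = (\<integral>\<^sup>+w. D w * indicator Q w \<partial>(M >< P))" if "Q : sets (M >< P)" for Q
  unfolding dens[symmetric] using that by (intro emeasure_density) auto
 have i: "AE w in S >< P. w : R --> D (\<phi> w) ~= 0"
 proof -
  define Q where "Q = {z : space (M >< P). D z = 0}"
  have Q[measurable]: "Q : sets (M >< P)" unfolding Q_def by measurable
  have "emeasure \<rho> Q = (\<integral>\<^sup>+w. 0 \<partial>(M >< P))" unfolding \<rho>D[OF Q] by (intro nn_integral_cong) (simp add: Q_def indicator_def)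
  then have "(\<integral>\<^sup>+w. indicator R w * indicator Q (\<phi> w) \<partial>(S >< P)) = 0" unfolding \<rho>[OF Q] by simp
  then have "AE w in S >< P. indicator R w * indicator Q (\<phi> w) = (0::ennreal)"
   by (subst (asm) nn_integral_0_iff_AE) auto
  then show ?thesis using AE_space
  proof eventually_elim
   case (elim w)
   then show ?case
    using measurable_space[OF \<phi>, of w] by (auto simp: Q_def indicator_def split: if_splits)
  qed
 qed
 have "AE y in P. AE s in S. (s, y) : R --> D (\<phi> (s, y)) ~= 0"
  using SP.AE_pair[OF i] by (subst (asm) SP.AE_commute) auto
 moreover have "AE y in P. ALL A:sets M. (AE s in S. (s, y) : R --> e s ~: A) --> (AE z in M. z : A --> D (z, y) = 0)"
 proof -
  obtain E :: "nat => 'z set" where E: "range E \<subseteq> Pow (space M)" "Int_stable (range E)"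
   "sets M = sigma_sets (space M) (range E)" "space M : range E" using gen by (elim exE conjE)
  have Em[measurable]: "E i : sets M" for i unfolding E(3) by (rule sigma_sets.Basic[OF rangeI])
  have "AE y in P. (\<integral>\<^sup>+s. indicator R (s, y) * indicator (E i) (e s) \<partial>S) = (\<integral>\<^sup>+z. D (z, y) * indicator (E i) z \<partial>M)" for i
  proof -
   let ?f = "%y. \<integral>\<^sup>+s. indicator R (s, y) * indicator (E i) (e s) \<partial>S"
   let ?g = "%y. \<integral>\<^sup>+z. D (z, y) * indicator (E i) z \<partial>M"
   have f[measurable]: "?f : Borel P" by measurable
   have g[measurable]: "?g : Borel P" by measurable
   have "density P ?f = density P ?g"
   proof (rule measure_eqI)
    fix B assume "B : sets (density P ?f)"
    then have B[measurable]: "B : sets P" by simp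
    have "emeasure (density P ?f) B = (\<integral>\<^sup>+y. ?f y * indicator B y \<partial>P)" by (rule emeasure_density) auto
    also have "... = (\<integral>\<^sup>+y. \<integral>\<^sup>+s. indicator R (s, y) * indicator (E i \<times> B) (\<phi> (s, y)) \<partial>S \<partial>P)"
     by (intro nn_integral_cong) (auto intro!: nn_integral_cong simp: \<phi>_def split: split_indicator)
    also have "... = emeasure \<rho> (E i \<times> B)" by (subst SP.nn_integral_snd) (auto simp: \<rho>)
    also have "... = (\<integral>\<^sup>+y. \<integral>\<^sup>+z. D (z, y) * indicator (E i \<times> B) (z, y) \<partial>M \<partial>P)" by (subst MP.nn_integral_snd) (auto simp: \<rho>D)
    also have "... = (\<integral>\<^sup>+y. ?g y * indicator B y \<partial>P)"
     by (intro nn_integral_cong) (auto intro!: nn_integral_cong split: split_indicator)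
    also have "... = emeasure (density P ?g) B" by (rule emeasure_density[symmetric]) auto
    finally show "emeasure (density P ?f) B = emeasure (density P ?g) B" .
   qed simp
   then show ?thesis using P.density_unique_iff[OF f g] by simp
  qed
  then have "AE y in P. ALL i. (\<integral>\<^sup>+s. indicator R (s, y) * indicator (E i) (e s) \<partial>S) = (\<integral>\<^sup>+z. D (z, y) * indicator (E i) z \<partial>M)"
   by (simp add: AE_all_countable)
  then show ?thesis using AE_space[of P]
  proof eventually_elim
   case (elim y)
   note eq = elim(1) and y[measurable] = elim(2)
   define \<alpha> where "\<alpha> = distr (density S (%s. indicator R (s, y))) M e"
   define \<beta> where "\<beta> = density M (%z. D (z, y))"
   have \<alpha>: "emeasure \<alpha> A = (\<integral>\<^sup>+s. indicator R (s, y) * indicator A (e s) \<partial>S)" if A[measurable]: "A : sets M" for A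
   proof -
    have "emeasure \<alpha> A = emeasure (density S (%s. indicator R (s, y))) (e -` A \<inter> space S)"
     unfolding \<alpha>_def by (subst emeasure_distr) auto
    also have "... = (\<integral>\<^sup>+s. indicator R (s, y) * indicator (e -` A \<inter> space S) s \<partial>S)"
     by (rule emeasure_density) auto
    also have "... = (\<integral>\<^sup>+s. indicator R (s, y) * indicator A (e s) \<partial>S)"
     by (intro nn_integral_cong) (simp add: indicator_def)
    finally show ?thesis .
   qed
   have \<beta>: "emeasure \<beta> A = (\<integral>\<^sup>+z. D (z, y) * indicator A z \<partial>M)" if "A : sets M" for A
    unfolding \<beta>_def using that by (intro emeasure_density) auto
   have "\<alpha> = \<beta>"
   proof (rule measure_eqI_generator_eq[OF E(2,1), where A="%_. space M"])
    show "emeasure \<alpha> A = emeasure \<beta> A" if "A : range E" for A using that eq by (auto simp: \<alpha> \<beta>)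
    have "emeasure \<alpha> (space M) <= (\<integral>\<^sup>+s. 1 \<partial>S)" unfolding \<alpha>[OF sets.top] by (intro nn_integral_mono) (simp add: indicator_def)
    also have "... < \<infinity>" by (simp add: S.emeasure_finite less_top[symmetric])
    finally show "emeasure \<alpha> (space M) ~= \<infinity>" by simp
   qed (use E in \<open>auto simp: \<alpha>_def \<beta>_def\<close>)
   show ?case
   proof (intro ballI impI)
    fix A assume A[measurable]: "A : sets M" and ae: "AE s in S. (s, y) : R --> e s ~: A"
    have "(\<integral>\<^sup>+s. indicator R (s, y) * indicator A (e s) \<partial>S) = 0"
     by (subst nn_integral_0_iff_AE) (use ae in \<open>auto elim!: eventually_mono simp: indicator_def\<close>)
    then have "(\<integral>\<^sup>+z. D (z, y) * indicator A z \<partial>M) = 0" using \<open>\<alpha> = \<beta>\<close> \<alpha>[OF A] \<beta>[OF A] by simp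
    then have "AE z in M. D (z, y) * indicator A z = 0" by (subst (asm) nn_integral_0_iff_AE) auto
    then show "AE z in M. z : A --> D (z, y) = 0" by eventually_elim (auto simp: indicator_def)
   qed
  qed
 qed
 ultimately show ?thesis by (intro bexI[of _ D] conjI) (simp_all add: \<phi>_def)
qed

context smm
begin

lemma measurable_slope_slice:
 assumes s: "sets E = sets (\<Omega> Z)" and \<phi>: "\<phi> : measurable M E" and \<tau>: "\<tau> : Borel M"
  and \<psi>: "\<psi> : measurable M P" and f: "f : Borel (m >< P)"
 shows "(%w. slope (%z. f (z, \<psi> w)) (\<phi> w) (\<tau> w)) : Borel M"
proof -
 have \<phi>': "\<phi> : measurable M (\<Omega> Z)" using \<phi> measurable_cong_sets[OF refl s] by blast
 have f': "(%p. f (fst p, snd p)) : Borel (borel_of_metric Z >< P)"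
  using f measurable_cong_sets[OF sets_pair_measure_cong[OF sets_m refl] refl] by auto
 show ?thesis using measurable_slope[OF sep \<phi>' \<tau>, of "%y z. f (z, y)", OF f' \<psi>] .
qed

lemma plan_null:
 assumes E: "plan E" and A: "A : null_sets m"
 shows "AE c in E. AE t in lborel. c (cl t) ~: A"
proof -
 interpret E: prob_space E using E by (rule plan_prob)
 interpret P: pair_sigma_finite E lborel ..
 note s = plan_sets[OF E]
 obtain n :: nat where n: "compress E (real n)" using plan_bounds[OF E] by blast
 have Am[measurable]: "A : sets m" using A by auto
 have [measurable]: "(%z. pos z) : measurable (E >< lborel) m" by (rule measurable_ev[OF s]) auto
 have "AE c in E. c (cl t) ~: A" for t
 proof (rule AE_I')
  have m: "(%c. c (cl t)) -` A \<inter> space E : sets E" by (rule measurable_sets[OF measurable_ev[OF s] Am]) auto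
  have "emeasure E ((%c. c (cl t)) -` A \<inter> space E) <= ennreal (real n) * emeasure m A" using n Am by (simp add: compress_def)
  then show "(%c. c (cl t)) -` A \<inter> space E : null_sets E" using A m by (simp add: null_sets_def)
 qed auto
 then have "AE t in lborel. AE c in E. c (cl t) ~: A" by simp
 moreover have "{z : space (E >< lborel). pos z ~: A} : sets (E >< lborel)" by measurable
 ultimately show ?thesis using P.AE_commute[of "%c t. c (cl t) ~: A"] by blast
qed

lemma generator: "EX E :: nat => 'z set. range E \<subseteq> Pow (space m) & Int_stable (range E) &
  sets m = sigma_sets (space m) (range E) & space m : range E"
 using borel_of_metric_countable_generator[OF sep] unfolding sets_m space_m .

text \<open>The essential image of the set of times at which the slope exceeds \<open>c\<close> times the speed. A bound
\<open>h\<close> for the slopes excludes it from \<open>h < c\<close>.\<close>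
lemma slope_projection:
 assumes E: "plan E" and P: "sigma_finite_measure P" and f[measurable]: "f : Borel (m >< P)"
 shows "EX d:Borel (m >< P).
  (AE y in P. AE \<gamma> in E. AE t in lborel. t : {0..1} --> c * speed Z \<gamma> t < \<bar>slope (%z. f (z, y)) \<gamma> t\<bar> --> d (\<gamma> (cl t), y) ~= (0::ennreal)) &
  (AE y in P. ALL h:Borel m. (AE \<gamma> in E. AE t in lborel. \<bar>slope (%z. f (z, y)) \<gamma> t\<bar> <= h (\<gamma> (cl t)) * speed Z \<gamma> t) -->
   (AE z in m. h z < c --> d (z, y) = 0))"
proof -
 interpret E: prob_space E using E by (rule plan_prob)
 \<comment> \<open>a finite time measure suffices, as the speed vanishes outside the unit interval\<close>
 define U where "U = uniform_measure lborel {0..1::real}"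
 have U[measurable_cong]: "sets U = sets borel" by (simp add: U_def)
 interpret U: prob_space U unfolding U_def by (rule prob_space_uniform_measure) auto
 interpret P: sigma_finite_measure P by fact
 interpret EU: pair_sigma_finite E U ..
 interpret EU: pair_prob_space E U ..
 note s = plan_sets[OF E]
 have AE_U: "(AE t in U. Q t) \<longleftrightarrow> (AE t in lborel. t : {0..1} --> Q t)" for Q
  unfolding U_def by (subst AE_uniform_measure) auto
 define e where "e w = pos w" for w :: "(real => 'z) \<times> real"
 have e[measurable]: "e : measurable (E >< U) m" unfolding e_def by (rule measurable_ev[OF s]) (auto simp: measurable_cong_sets[OF refl U])
 define R where "R = {w : space ((E >< U) >< P). c * speed Z (fst (fst w)) (snd (fst w)) < \<bar>slope (%z. f (z, snd w)) (fst (fst w)) (snd (fst w))\<bar>}"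
 have [measurable]: "(%w. speed Z (fst (fst w)) (snd (fst w))) : Borel ((E >< U) >< P)"
  by (rule measurable_sp[OF s]) measurable
 have [measurable]: "(%w. slope (%z. f (z, snd w)) (fst (fst w)) (snd (fst w))) : Borel ((E >< U) >< P)"
  by (rule measurable_slope_slice[OF s _ _ _ f]) measurable
 have R[measurable]: "R : sets ((E >< U) >< P)" unfolding R_def by measurable
 have ac: "e -` A \<inter> space (E >< U) : null_sets (E >< U)" if A: "A : null_sets m" for A
 proof -
  have [measurable]: "A : sets m" using A by auto
  have "AE \<gamma> in E. AE t in U. e (\<gamma>, t) ~: A"
   unfolding AE_U using plan_null[OF E A] by eventually_elim (auto simp: e_def)
  then have "AE w in E >< U. e w ~: A" by (intro EU.AE_pair_measure) auto
  then have "AE w in E >< U. w ~: e -` A \<inter> space (E >< U)" by eventually_elim simp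
  then show ?thesis using AE_iff_null_sets[of "e -` A \<inter> space (E >< U)" "E >< U"] by simp
 qed
 obtain d where d: "d : Borel (m >< P)" "AE y in P. AE w in E >< U. (w, y) : R --> d (e w, y) ~= (0::ennreal)"
  "AE y in P. ALL A:sets m. (AE w in E >< U. (w, y) : R --> e w ~: A) --> (AE z in m. z : A --> d (z, y) = 0)"
  using essential_projection[OF sigma_finite_measure_axioms EU.finite_measure_axioms P generator e ac R] by blast
 show ?thesis
 proof (intro bexI[of _ d] conjI d(1))
  show "AE y in P. AE \<gamma> in E. AE t in lborel. t : {0..1} --> c * speed Z \<gamma> t < \<bar>slope (%z. f (z, y)) \<gamma> t\<bar> --> d (\<gamma> (cl t), y) ~= 0"
   using d(2) AE_space[of P]
  proof eventually_elim
   case (elim y)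
   note a = elim(1) and y = elim(2)
   have "AE \<gamma> in E. AE t in U. ((\<gamma>, t), y) : R --> d (e (\<gamma>, t), y) ~= 0" using EU.AE_pair[OF a] .
   then show ?case
    unfolding AE_U using AE_space[of E]
    by eventually_elim (auto simp: R_def e_def space_pair_measure y sets_eq_imp_space_eq[OF U] elim!: eventually_mono)
  qed
  show "AE y in P. ALL h:Borel m. (AE \<gamma> in E. AE t in lborel. \<bar>slope (%z. f (z, y)) \<gamma> t\<bar> <= h (\<gamma> (cl t)) * speed Z \<gamma> t) -->
   (AE z in m. h z < c --> d (z, y) = 0)"
   using d(3) AE_space[of P]
  proof (eventually_elim, intro ballI impI)
   fix y h assume a: "ALL A:sets m. (AE w in E >< U. (w, y) : R --> e w ~: A) --> (AE z in m. z : A --> d (z, y) = 0)"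
    and y[measurable]: "y : space P" and h[measurable]: "h : Borel m"
    and ae: "AE \<gamma> in E. AE t in lborel. \<bar>slope (%z. f (z, y)) \<gamma> t\<bar> <= h (\<gamma> (cl t)) * speed Z \<gamma> t"
   have [measurable]: "(%w. speed Z (fst w) (snd w)) : Borel (E >< U)"
    by (rule measurable_sp[OF s]) measurable
   have [measurable]: "(%w. slope (%z. f (z, y)) (fst w) (snd w)) : Borel (E >< U)"
    by (rule measurable_slope_slice[OF s _ _ _ f, of fst _ snd "%_. y"]) (use y in \<open>auto simp: measurable_cong_sets[OF refl U]\<close>)
   have "AE \<gamma> in E. AE t in U. \<bar>slope (%z. f (z, y)) \<gamma> t\<bar> <= h (e (\<gamma>, t)) * speed Z \<gamma> t"
    unfolding AE_U using ae by eventually_elim (auto simp: e_def elim!: eventually_mono)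
   then have le: "AE w in E >< U. \<bar>slope (%z. f (z, y)) (fst w) (snd w)\<bar> <= h (e w) * speed Z (fst w) (snd w)"
    by (intro EU.AE_pair_measure) auto
   have A: "{z : space m. h z < c} : sets m" by measurable
   have "AE w in E >< U. (w, y) : R --> e w ~: {z : space m. h z < c}"
    using le
   proof eventually_elim
    case (elim w)
    note w = elim(1)
    have "h (e w) * speed Z (fst w) (snd w) <= c * speed Z (fst w) (snd w)" if "h (e w) < c"
     using that by (intro mult_right_mono) auto
    then show ?case using w by (auto simp: R_def)
   qed
   then have "AE z in m. z : {z : space m. h z < c} --> d (z, y) = 0" using a A by blast
   then show "AE z in m. h z < c --> d (z, y) = 0" using AE_space by eventually_elim auto
  qed
 qed
qed

text \<open>Joint measurability in the parameter is what makes the partial gradients of a function on a product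
legitimate; it cannot be read off the slices separately.\<close>
theorem minimal_slice_gradient:
 fixes f G :: "'z \<times> 'y => real"
 assumes P: "sigma_finite_measure P" and f[measurable]: "f : Borel (m >< P)" and G[measurable]: "G : Borel (m >< P)"
  and Gpos: "!!z y. z : space m ==> y : space P ==> 0 <= G (z, y)"
  and fl: "AE y in P. lp (%z. f (z, y)) < \<infinity>" and Gl: "AE y in P. lp (%z. G (z, y)) < \<infinity>"
  and H: "!!E. plan E ==> AE y in P. AE \<gamma> in E. ennreal \<bar>f (\<gamma> (cl 1), y) - f (\<gamma> (cl 0), y)\<bar> <= lin (%z. G (z, y)) \<gamma>"
 shows "EX D:Borel (m >< P). (ALL w. 0 <= D w) &
  (AE y in P. wug (%z. f (z, y)) (%z. D (z, y)) & (AE z in m. D (z, y) <= G (z, y)) &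
   (ALL h. wug (%z. f (z, y)) h --> (AE z in m. D (z, y) <= h z)))"
proof -
 interpret P: sigma_finite_measure P by fact
 obtain T where T: "countable T" "!!E. E : T ==> plan E"
  "!!u g. u : Borel m ==> lp u < \<infinity> ==> g : Borel m ==> lp g < \<infinity> ==> (!!z. z : space m ==> 0 <= g z) ==>
   (!!E. E : T ==> AE \<gamma> in E. ennreal \<bar>u (\<gamma> (cl 1)) - u (\<gamma> (cl 0))\<bar> <= lin g \<gamma>) ==> wug u g"
  by (rule countable_test_plans) blast
 have fm: "(%z. f (z, y)) : Borel m" and Gm: "(%z. G (z, y)) : Borel m" if [measurable]: "y : space P" for y
  by measurable
 have W: "AE y in P. wug (%z. f (z, y)) (%z. G (z, y))"
 proof -
  have "AE y in P. ALL E:T. AE \<gamma> in E. ennreal \<bar>f (\<gamma> (cl 1), y) - f (\<gamma> (cl 0), y)\<bar> <= lin (%z. G (z, y)) \<gamma>"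
   unfolding AE_ball_countable[OF T(1)] using H T(2) by blast
  then show ?thesis using fl Gl AE_space[of P]
  proof eventually_elim
   case (elim y)
   note a = elim(1) and b = elim(2-4)
   show ?case
    by (rule T(3)[OF fm[OF b(3)] b(1) Gm[OF b(3)] b(2)]) (use Gpos b(3) a in auto)
  qed
 qed
 define C where "C = {c::real. c : \<rat> & 0 <= c}"
 have C: "countable C" unfolding C_def by (rule countable_subset[OF _ countable_rat]) auto
 define good where "good = (%i d. d : Borel (m >< P) &
  (AE y in P. AE \<gamma> in fst i. AE t in lborel. t : {0..1} --> snd i * speed Z \<gamma> t < \<bar>slope (%z. f (z, y)) \<gamma> t\<bar> --> d (\<gamma> (cl t), y) ~= (0::ennreal)) &
  (AE y in P. ALL h:Borel m. (AE \<gamma> in fst i. AE t in lborel. \<bar>slope (%z. f (z, y)) \<gamma> t\<bar> <= h (\<gamma> (cl t)) * speed Z \<gamma> t) -->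
   (AE z in m. h z < snd i --> d (z, y) = 0)))"
 have "ALL i:T \<times> C. EX d. good i d"
 proof
  fix i assume "i : T \<times> C"
  then have "fst i : T" by auto
  from slope_projection[OF T(2)[OF this] P f, of "snd i"] show "EX d. good i d" unfolding good_def by blast
 qed
 then obtain d where d: "!!i. i : T \<times> C ==> good i (d i)" by metis
 have I: "countable (T \<times> C)" using T(1) C by simp
 have dm[measurable]: "d i : Borel (m >< P)" if "i : T \<times> C" for i using d[OF that] by (auto simp: good_def)
 have d1: "AE y in P. ALL i:T \<times> C. AE \<gamma> in fst i. AE t in lborel. t : {0..1} --> snd i * speed Z \<gamma> t < \<bar>slope (%z. f (z, y)) \<gamma> t\<bar> --> d i (\<gamma> (cl t), y) ~= 0"
  unfolding AE_ball_countable[OF I] using d by (auto simp: good_def)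
 have d2: "AE y in P. ALL i:T \<times> C. ALL h:Borel m. (AE \<gamma> in fst i. AE t in lborel. \<bar>slope (%z. f (z, y)) \<gamma> t\<bar> <= h (\<gamma> (cl t)) * speed Z \<gamma> t) -->
   (AE z in m. h z < snd i --> d i (z, y) = 0)"
  unfolding AE_ball_countable[OF I] using d by (auto simp: good_def)
 \<comment> \<open>for a curve in one of the plans, a rational \<open>c\<close> between this supremum and slope over speed would contradict its definition\<close>
 define S where "S w = (SUP i\<in>T \<times> C. ennreal (snd i) * indicator {w. d i w ~= 0} w)" for w
 have S[measurable]: "S : Borel (m >< P)"
  unfolding S_def
 proof (rule borel_measurable_SUP[OF I])
  fix i assume i: "i : T \<times> C"
  have "(%w. if d i w ~= 0 then ennreal (snd i) else 0) : Borel (m >< P)" using dm[OF i] by measurable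
  then show "(%w. ennreal (snd i) * indicator {w. d i w ~= 0} w) : Borel (m >< P)"
   by (rule measurable_cong[THEN iffD1, rotated]) (auto simp: indicator_def)
 qed
 define D where "D w = enn2real (S w)" for w
 have D[measurable]: "D : Borel (m >< P)" unfolding D_def by measurable
 have Dpos: "0 <= D w" for w by (simp add: D_def)
 have "AE y in P. wug (%z. f (z, y)) (%z. D (z, y)) & (AE z in m. D (z, y) <= G (z, y)) &
   (ALL h. wug (%z. f (z, y)) h --> (AE z in m. D (z, y) <= h z))"
  using W d1 d2 fl Gl AE_space[of P]
 proof eventually_elim
  case (elim y)
  note W = elim(1) and d1 = elim(2) and d2 = elim(3) and fy = elim(4) and Gy = elim(5) and y[measurable] = elim(6)
  have min: "AE z in m. S (z, y) <= ennreal (h z)" if h: "wug (%z. f (z, y)) h" for h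
  proof -
   have hm: "h : Borel m" using h by (simp add: wug_iff)
   have "AE z in m. ALL i:T \<times> C. h z < snd i --> d i (z, y) = 0"
    unfolding AE_ball_countable[OF I]
   proof
    fix i assume i: "i : T \<times> C"
    then have "plan (fst i)" using T(2) by auto
    from wug_AE_slope[OF fm[OF y] h this] show "AE z in m. h z < snd i --> d i (z, y) = 0" using d2 i hm by blast
   qed
   then show ?thesis
   proof eventually_elim
    case (elim z)
    note a = elim(1)
    show ?case unfolding S_def
    proof (rule SUP_least)
     fix i assume i: "i : T \<times> C"
     show "ennreal (snd i) * indicator {w. d i w ~= 0} (z, y) <= ennreal (h z)"
     proof (cases "d i (z, y) = 0")
      case False
      then have "snd i <= h z" using a i by force
      then show ?thesis by (simp add: indicator_def ennreal_leI)
     qed simp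
    qed
   qed
  qed
  have minD: "AE z in m. D (z, y) <= h z" if h: "wug (%z. f (z, y)) h" for h
   using min[OF h] AE_space
  proof eventually_elim
   case (elim z)
   moreover have "0 <= h z" using h \<open>z : space m\<close> by (simp add: wug_iff)
   ultimately show "D (z, y) <= h z" unfolding D_def by (metis enn2real_ennreal enn2real_mono ennreal_less_top)
  qed
  have DG: "AE z in m. D (z, y) <= G (z, y)" by (rule minD[OF W])
  have Dl: "lp (%z. D (z, y)) < \<infinity>"
  proof -
   have "lp (%z. D (z, y)) <= lp (%z. G (z, y))"
    unfolding lp_def by (intro nn_integral_mono_AE, use DG in eventually_elim) (use p Dpos in \<open>auto intro!: ennreal_leI powr_mono2\<close>)
   then show ?thesis using Gy by (rule order_le_less_trans)
  qed
  have Dm: "(%z. D (z, y)) : Borel m" by measurable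
  have "wug (%z. f (z, y)) (%z. D (z, y))"
  proof (rule T(3)[OF fm[OF y] fy Dm Dl Dpos])
   fix E assume ET: "E : T"
   then have E: "plan E" by (rule T(2))
   obtain A where A: "A : null_sets m" "{z : space m. \<not> S (z, y) <= ennreal (G (z, y))} \<subseteq> A" using min[OF W] by (auto simp: eventually_ae_filter)
   have "AE \<gamma> in E. ALL c:C. AE t in lborel. t : {0..1} --> c * speed Z \<gamma> t < \<bar>slope (%z. f (z, y)) \<gamma> t\<bar> --> d (E, c) (\<gamma> (cl t), y) ~= 0"
    unfolding AE_ball_countable[OF C]
   proof
    fix c assume "c : C"
    then have "(E, c) : T \<times> C" using ET by blast
    from bspec[OF d1 this] show "AE \<gamma> in E. AE t in lborel. t : {0..1} --> c * speed Z \<gamma> t < \<bar>slope (%z. f (z, y)) \<gamma> t\<bar> --> d (E, c) (\<gamma> (cl t), y) ~= 0"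
     unfolding fst_conv snd_conv .
   qed
   then have "AE \<gamma> in E. AE t in lborel. \<bar>slope (%z. f (z, y)) \<gamma> t\<bar> <= D (\<gamma> (cl t), y) * speed Z \<gamma> t"
    using wug_AE_slope[OF fm[OF y] W E] plan_null[OF E A(1)] plan_AE[OF E]
   proof eventually_elim
    case (elim \<gamma>)
    note 1 = elim(1) and 2 = elim(2) and 3 = elim(3) and 4 = elim(4)
    have 5: "AE t in lborel. t ~: {0..1} --> speed Z \<gamma> t = 0" using AE_speed[of \<gamma>] 4 by (auto elim: eventually_mono)
    have "AE t in lborel. ALL c:C. t : {0..1} --> c * speed Z \<gamma> t < \<bar>slope (%z. f (z, y)) \<gamma> t\<bar> --> d (E, c) (\<gamma> (cl t), y) ~= 0"
     unfolding AE_ball_countable[OF C] using 1 .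
    then show ?case
     using 2 3 5
    proof eventually_elim
     case (elim t)
     note 1 = elim(1) and 2 = elim(2) and 3 = elim(3) and 5 = elim(4)
     define v where "v = speed Z \<gamma> t"
     define s where "s = \<bar>slope (%z. f (z, y)) \<gamma> t\<bar>"
     define x where "x = D (\<gamma> (cl t), y)"
     have v0: "0 <= v" by (simp add: v_def)
     have "S (\<gamma> (cl t), y) <= ennreal (G (\<gamma> (cl t), y))"
      using A(2) 3 curve_in[OF conjunct1[OF 4], of t] by (auto simp: space_m)
     then have Sx: "S (\<gamma> (cl t), y) = ennreal x" unfolding x_def D_def
      by (simp add: order_le_less_trans[OF _ ennreal_less_top])
     have "s <= x * v"
     proof (cases "v = 0")
      case True then show ?thesis using 2 by (simp add: v_def s_def)
     next
      case False
      then have v: "v > 0" using v0 by simp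
      have t: "t : {0..1}" using False 5 by (auto simp: v_def)
      show ?thesis
      proof (rule ccontr)
      assume "\<not> s <= x * v"
      then have "x < s / v" using v by (simp add: field_simps)
      then obtain c where c: "c : \<rat>" "x < c" "c < s / v" using Rats_dense_in_real by blast
      have "0 <= x" by (simp add: x_def Dpos)
      then have cC: "c : C" using c by (simp add: C_def)
      have "c * v < s" using c v by (simp add: field_simps)
      then have "d (E, c) (\<gamma> (cl t), y) ~= 0" using 1 cC t by (simp add: v_def s_def)
      then have "ennreal c <= S (\<gamma> (cl t), y)" unfolding S_def
      by (intro SUP_upper2[of "(E, c)"]) (use ET cC in \<open>auto simp: indicator_def\<close>)
      then have "c <= x" unfolding Sx using \<open>0 <= x\<close> by (simp add: ennreal_le_iff)
      then show False using c by simp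
      qed
     qed
     then show ?case by (simp add: s_def x_def v_def)
    qed
   qed
   from slope_bound_imp_lin[OF fm[OF y] W E this]
   show "AE \<gamma> in E. ennreal \<bar>f (\<gamma> (cl 1), y) - f (\<gamma> (cl 0), y)\<bar> <= lin (%z. D (z, y)) \<gamma>" .
  qed
  then show ?case
   using DG minD by blast
 qed
 then show ?thesis using D Dpos by blast
qed

end

section \<open>Planar norms and product plans\<close>

locale planar =
 fixes N :: "real \<times> real => real"
 assumes planar: "planar_norm N"
begin

lemma N_nonneg: "0 <= N v" and N_eq0: "N v = 0 \<longleftrightarrow> v = 0" and N_tri: "N (v + w) <= N v + N w"
 and N_mono: "0 <= a ==> a <= a' ==> 0 <= b ==> b <= b' ==> N (a, b) <= N (a', b')"
 and N_scaleR: "N (c *\<^sub>R v) = \<bar>c\<bar> * N v"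
 using planar unfolding planar_norm_def by blast+

lemma N_zero: "N (0, 0) = 0" using N_eq0[of "(0, 0)"] by (simp add: zero_prod_def)
lemma N_scale: "N (c * a, c * b) = \<bar>c\<bar> * N (a, b)" using N_scaleR[of c "(a, b)"] by simp
lemma N_fst: "N (a, 0) = \<bar>a\<bar> * N (1, 0)" using N_scale[of a 1 0] by simp
lemma N_snd: "N (0, b) = \<bar>b\<bar> * N (0, 1)" using N_scale[of b 0 1] by simp
lemma N_le: "N (a, b) <= \<bar>a\<bar> * N (1, 0) + \<bar>b\<bar> * N (0, 1)"
 using N_tri[of "(a, 0)" "(0, b)"] by (simp add: N_fst[symmetric] N_snd[symmetric])
lemma N_ge: "0 <= a ==> 0 <= b ==> a * N (1, 0) <= N (a, b)" "0 <= a ==> 0 <= b ==> b * N (0, 1) <= N (a, b)"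
 using N_mono[of a a 0 b] N_mono[of 0 a b b] N_fst[of a] N_snd[of b] by auto
lemma N_pos: "0 < N (1, 0)" "0 < N (0, 1)"
 using N_nonneg[of "(1,0)"] N_eq0[of "(1,0)"] N_nonneg[of "(0,1)"] N_eq0[of "(0,1)"] by (auto simp: zero_prod_def less_le)

lemma N_diff: "\<bar>N v - N w\<bar> <= \<bar>fst v - fst w\<bar> * N (1, 0) + \<bar>snd v - snd w\<bar> * N (0, 1)"
proof -
 have "N v <= N w + N (v - w)" using N_tri[of w "v - w"] by simp
 moreover have "N w <= N v + N (w - v)" using N_tri[of v "w - v"] by simp
 moreover have "N (v - w) <= \<bar>fst v - fst w\<bar> * N (1, 0) + \<bar>snd v - snd w\<bar> * N (0, 1)"
  using N_le[of "fst (v - w)" "snd (v - w)"] by (cases v; cases w) simp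
 moreover have "N (w - v) <= \<bar>fst v - fst w\<bar> * N (1, 0) + \<bar>snd v - snd w\<bar> * N (0, 1)"
  using N_le[of "fst (w - v)" "snd (w - v)"] by (cases v; cases w) (simp add: abs_minus_commute)
 ultimately show ?thesis by linarith
qed

lemma N_isCont: "isCont N v"
proof -
 have "((%x. N x - N v) \<longlongrightarrow> 0) (at v)"
 proof (rule Lim_null_comparison)
  show "\<forall>\<^sub>F x in at v. norm (N x - N v) <= \<bar>fst x - fst v\<bar> * N (1, 0) + \<bar>snd x - snd v\<bar> * N (0, 1)"
   using N_diff by (intro always_eventually) simp
  show "((%x. \<bar>fst x - fst v\<bar> * N (1, 0) + \<bar>snd x - snd v\<bar> * N (0, 1)) \<longlongrightarrow> 0) (at v)"
   by (auto intro!: tendsto_eq_intros)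
 qed
 then show ?thesis unfolding isCont_def by (simp add: LIM_zero_iff)
qed

lemma N_tendsto: "(x \<longlongrightarrow> l) F ==> (y \<longlongrightarrow> l') F ==> ((%s. N (x s, y s)) \<longlongrightarrow> N (l, l')) F"
 by (rule isCont_tendsto_compose[OF N_isCont]) (rule tendsto_Pair)

lemma N_measurable [measurable]: "N : Borel borel"
 by (rule borel_measurable_continuous_onI) (simp add: continuous_at_imp_continuous_on N_isCont)

end

context smm
begin

text \<open>Constant curves distributed over a set of finite measure. Paired with a plan on the other factor they give
the inequality on slices.\<close>
lemma plan_const:
 assumes B: "B : sets m" "emeasure m B ~= 0" "emeasure m B < \<infinity>"
 shows "plan (distr (uniform_measure m B) (\<Omega> Z) (%z. \<lambda>t\<in>{0..1}. z))" (is "plan (distr ?U _ ?k)")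
  and "(%z. \<lambda>t\<in>{0..1}. z) : measurable (uniform_measure m B) (\<Omega> Z)"
proof -
 have k: "?k z : curves Z" if z: "z : mspace Z" for z
 proof (rule curve_spaceI)
  fix t e :: real assume t: "t : {0..1}" and e: "0 < e"
  have "mdist Z z z = 0" using mdist_zero[OF z z] by simp
  then show "EX d>0. ALL s:{0..1}. \<bar>s - t\<bar> < d --> mdist Z (?k z t) (?k z s) < e"
   using t e by (intro exI[of _ 1]) auto
 qed (use z in auto)
 have sU: "space ?U = mspace Z" by (simp add: space_m)
 have id: "(%z. z) : measurable m (borel_of_metric Z)" using measurable_ident_sets[OF sets_m] .
 show km: "?k : measurable ?U (\<Omega> Z)"
 proof (rule measurable_into_curve_space[OF sep])
  show "?k z : curves Z" if "z : space ?U" for z using that k unfolding sU by blast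
  fix t :: real assume t: "t : {0..1}"
  have "(%z. ?k z t) = (%z. z)" using t by auto
  then show "(%z. ?k z t) : measurable ?U (borel_of_metric Z)" using id by (simp add: measurable_cong_sets[OF sets_uniform_measure refl])
 qed
 have PU: "prob_space ?U" by (rule prob_space_uniform_measure) (use B in auto)
 define c where "c = measure m B"
 have c: "c > 0" "emeasure m B = ennreal c" using B(2,3)
  by (auto simp: c_def emeasure_eq_ennreal_measure less_top zero_less_measure_iff)
 have sp0: "metric_speed Z (?k z) t = 0" if z: "z : mspace Z" and t: "t : {0..1}" for z t
 proof (rule metric_speed_eqI[OF _ t])
  have z0: "mdist Z z z = 0" using mdist_zero[OF z z] by simp
  have "\<forall>\<^sub>F s in at t within {0..1}. 0 = mdist Z (?k z s) (?k z t) / \<bar>s - t\<bar>"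
   unfolding eventually_at_filter using t z0 by (intro always_eventually allI impI) simp
  then show "((%s. mdist Z (?k z s) (?k z t) / \<bar>s - t\<bar>) \<longlongrightarrow> 0) (at t within {0..1})"
   by (rule Lim_transform_eventually[OF tendsto_const])
 qed
 show "plan (distr ?U (\<Omega> Z) ?k)"
 proof (rule plan_distrI[OF PU km])
  have "ac_curve Z (?k z)" if z: "z : mspace Z" for z
  proof (rule abs_continuous_curveI[of "%_. 0"])
   fix s t :: real assume "0 <= s" "s <= t" "t <= 1"
   then show "mdist Z (?k z s) (?k z t) <= prim (%_. 0) t - prim (%_. 0) s" using mdist_zero[OF z z] by (simp add: prim_def)
  qed simp
  then show "AE z in ?U. ac_curve Z (?k z)" using AE_space[of ?U] unfolding sU by (auto elim: eventually_mono)
  have "(\<integral>\<^sup>+t\<in>{0..1}. ennreal (metric_speed Z (?k z) t powr q) \<partial>lborel) = (\<integral>\<^sup>+t. 0 \<partial>(lborel::real measure))" if z: "z : mspace Z" for z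
   by (intro nn_integral_cong) (use q sp0[OF z] in \<open>auto simp: indicator_def\<close>)
  then have "(\<integral>\<^sup>+z. (\<integral>\<^sup>+t\<in>{0..1}. ennreal (metric_speed Z (?k z) t powr q) \<partial>lborel) \<partial>?U) = (\<integral>\<^sup>+z. 0 \<partial>?U)"
   by (intro nn_integral_cong) (simp add: space_m)
  then show "(\<integral>\<^sup>+z. (\<integral>\<^sup>+t\<in>{0..1}. ennreal (metric_speed Z (?k z) t powr q) \<partial>lborel) \<partial>?U) < \<infinity>" by simp
  show "0 < 1 / c" using c by simp
  fix t :: real and A assume t: "t : {0..1}" and A: "A : sets m"
  have "{w : space ?U. ?k w t : A} = A" using t sets.sets_into_space[OF A] by auto
  then have "emeasure ?U {w : space ?U. ?k w t : A} = emeasure ?U A" by (simp only:)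
  also have "... = emeasure m (B \<inter> A) / emeasure m B" by (rule emeasure_uniform_measure[OF B(1) A])
  also have "... <= emeasure m A / emeasure m B" by (intro divide_right_mono_ennreal emeasure_mono A) auto
  also have "... = ennreal (1 / c) * emeasure m A" using c by (simp add: divide_ennreal_def inverse_ennreal inverse_eq_divide mult.commute)
  finally show "emeasure ?U {w : space ?U. ?k w t : A} <= ennreal (1 / c) * emeasure m A" .
 qed
qed

lemma AE_by_uniform:
 assumes "!!B. B : sets m ==> emeasure m B ~= 0 ==> emeasure m B < \<infinity> ==> AE z in uniform_measure m B. Q z"
 shows "AE z in m. Q z"
proof -
 obtain A :: "nat => 'z set" where A: "range A \<subseteq> sets m" "(\<Union>i. A i) = space m" "!!i. emeasure m (A i) ~= \<infinity>"
  using sigma_finite by blast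
 have Am: "A i : sets m" for i using A(1) by blast
 have "AE z in m. z : A i --> Q z" for i
 proof (cases "emeasure m (A i) = 0")
  case True
  then have "A i : null_sets m" using Am by (simp add: null_setsI)
  from AE_not_in[OF this] show ?thesis by eventually_elim simp
 next
  case False
  have f: "emeasure m (A i) < \<infinity>" using A(3) by (simp add: less_top)
  from assms[OF Am False f] show ?thesis by (subst (asm) AE_uniform_measure) (use False f in auto)
 qed
 then have "AE z in m. ALL i. z : A i --> Q z" by (subst AE_all_countable) blast
 then show ?thesis using AE_space by eventually_elim (use A(2) in blast)
qed

end

locale tensor = X: smm \<mu> X p + Y: smm \<nu> Y p + planar N
 for \<mu> :: "'a measure" and X :: "'a metric" and \<nu> :: "'b measure" and Y :: "'b metric" and p :: real and N :: "real \<times> real => real"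
begin

abbreviation "XY \<equiv> planar_prod_metric N X Y"

abbreviation (input) "\<pi> == \<mu> >< \<nu>"

lemma mdist_XY: "mdist XY z z' = N (mdist X (fst z) (fst z'), mdist Y (snd z) (snd z'))"
 using mdist_planar_prod_metric[OF planar, of X Y "fst z" "snd z" "fst z'" "snd z'"] by simp

lemma mspace_XY: "mspace XY = mspace X \<times> mspace Y" using planar by simp

lemma separable_XY: "separable XY"
proof -
 obtain D where D: "countable D" "D \<subseteq> mspace X" "!!x e. x : mspace X ==> 0 < e ==> EX a:D. mdist X x a < e"
  using separable_dense_set[OF X.sep] by blast
 obtain E where E: "countable E" "E \<subseteq> mspace Y" "!!x e. x : mspace Y ==> 0 < e ==> EX a:E. mdist Y x a < e"
  using separable_dense_set[OF Y.sep] by blast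
 show ?thesis
 proof (rule separable_spaceI[of "D \<times> E"])
  show "countable (D \<times> E)" using D E by simp
  show "D \<times> E \<subseteq> mspace XY" using D E by (auto simp: mspace_XY)
  fix z and e :: real assume z: "z : mspace XY" and e: "0 < e"
  define K where "K = N (1, 0) + N (0, 1)"
  have K: "K > 0" using N_pos by (simp add: K_def)
  have zz: "fst z : mspace X" "snd z : mspace Y" using z by (auto simp: mspace_XY)
  have e': "0 < e / K" using e K by simp
  obtain a where a: "a : D" "mdist X (fst z) a < e / K" using D(3)[OF zz(1) e'] by blast
  obtain b where b: "b : E" "mdist Y (snd z) b < e / K" using E(3)[OF zz(2) e'] by blast
  have "mdist XY z (a, b) <= mdist X (fst z) a * N (1, 0) + mdist Y (snd z) b * N (0, 1)"
   using N_le[of "mdist X (fst z) a" "mdist Y (snd z) b"] by (simp add: mdist_XY)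
  also have "... < e / K * N (1, 0) + e / K * N (0, 1)"
   using a b N_pos by (intro add_strict_mono mult_strict_right_mono) auto
  also have "... = e / K * K" by (simp only: K_def distrib_left)
  also have "... = e" using K by simp
  finally show "EX c:D \<times> E. mdist XY z c < e" using a(1) b(1) by (intro bexI[of _ "(a, b)"]) auto
 qed
qed

text \<open>Both identity maps are measurable: the coordinates are Lipschitz for the product metric, and its distance
functions are continuous functions of the coordinate distances.\<close>
lemma sets_XY: "sets \<pi> = sets (borel_of_metric XY)"
proof -
 have sp: "space \<pi> = mspace X \<times> mspace Y" by (simp add: space_pair_measure X.space_m Y.space_m)
 have f: "fst : measurable (borel_of_metric XY) \<mu>"
 proof -
  have "fst : measurable (borel_of_metric XY) (borel_of_metric X)"
  proof (rule measurable_borel_of_metricI[OF X.sep])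
   fix a assume a: "a : mspace X"
   show "(%w. mdist X (fst w) a) : Borel (borel_of_metric XY)"
   proof (rule measurable_lipschitz[where c="1 / N (1, 0)"])
    fix x y assume "x : mspace XY" "y : mspace XY"
    then have m: "fst x : mspace X" "fst y : mspace X" by (auto simp: mspace_XY)
    have "mdist X (fst x) (fst y) * N (1, 0) <= mdist XY x y" unfolding mdist_XY by (rule N_ge) auto
    then have "mdist X (fst x) (fst y) <= 1 / N (1, 0) * mdist XY x y" using N_pos by (simp add: field_simps)
    moreover have "\<bar>mdist X (fst x) a - mdist X (fst y) a\<bar> <= mdist X (fst x) (fst y)"
     using mdist_triangle[OF m(1,2) a] mdist_triangle[OF m(2,1) a] mdist_commute[of X "fst x" "fst y"] by linarith
    ultimately show "\<bar>mdist X (fst x) a - mdist X (fst y) a\<bar> <= 1 / N (1, 0) * mdist XY x y" by linarith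
   qed
  qed (auto simp: mspace_XY)
  then show ?thesis using measurable_cong_sets[OF refl X.sets_m] by blast
 qed
 have s: "snd : measurable (borel_of_metric XY) \<nu>"
 proof -
  have "snd : measurable (borel_of_metric XY) (borel_of_metric Y)"
  proof (rule measurable_borel_of_metricI[OF Y.sep])
   fix a assume a: "a : mspace Y"
   show "(%w. mdist Y (snd w) a) : Borel (borel_of_metric XY)"
   proof (rule measurable_lipschitz[where c="1 / N (0, 1)"])
    fix x y assume "x : mspace XY" "y : mspace XY"
    then have m: "snd x : mspace Y" "snd y : mspace Y" by (auto simp: mspace_XY)
    have "mdist Y (snd x) (snd y) * N (0, 1) <= mdist XY x y" unfolding mdist_XY by (rule N_ge) auto
    then have "mdist Y (snd x) (snd y) <= 1 / N (0, 1) * mdist XY x y" using N_pos by (simp add: field_simps)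
    moreover have "\<bar>mdist Y (snd x) a - mdist Y (snd y) a\<bar> <= mdist Y (snd x) (snd y)"
     using mdist_triangle[OF m(1,2) a] mdist_triangle[OF m(2,1) a] mdist_commute[of Y "snd x" "snd y"] by linarith
    ultimately show "\<bar>mdist Y (snd x) a - mdist Y (snd y) a\<bar> <= 1 / N (0, 1) * mdist XY x y" by linarith
   qed
  qed (auto simp: mspace_XY)
  then show ?thesis using measurable_cong_sets[OF refl Y.sets_m] by blast
 qed
 have "(%z. (fst z, snd z)) : measurable (borel_of_metric XY) \<pi>" by (rule measurable_Pair[OF f s])
 then have i1: "(%z. z) : measurable (borel_of_metric XY) \<pi>" by simp
 have i2: "(%z. z) : measurable \<pi> (borel_of_metric XY)"
 proof (rule measurable_borel_of_metricI[OF separable_XY])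
  show "w : mspace XY" if "w : space \<pi>" for w using that by (simp add: sp mspace_XY)
  fix a assume "a : mspace XY"
  then have a: "fst a : mspace X" "snd a : mspace Y" by (auto simp: mspace_XY)
  have "(%w. mdist X w (fst a)) : Borel \<mu>" using measurable_mdist[OF a(1)] measurable_cong_sets[OF X.sets_m refl] by blast
  note [measurable] = this
  have "(%w. mdist Y w (snd a)) : Borel \<nu>" using measurable_mdist[OF a(2)] measurable_cong_sets[OF Y.sets_m refl] by blast
  note [measurable] = this
  show "(%w. mdist XY w a) : Borel \<pi>" unfolding mdist_XY by measurable
 qed
 show ?thesis
 proof
  show "sets \<pi> \<subseteq> sets (borel_of_metric XY)"
  proof
   fix A assume A: "A : sets \<pi>"
   have "A \<subseteq> mspace XY" using sets.sets_into_space[OF A] by (simp add: sp mspace_XY)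
   then have "(%z. z) -` A \<inter> space (borel_of_metric XY) = A" unfolding space_borel_of_metric by blast
   then show "A : sets (borel_of_metric XY)" using measurable_sets[OF i1 A] by (simp only:)
  qed
  show "sets (borel_of_metric XY) \<subseteq> sets \<pi>"
  proof
   fix A assume A: "A : sets (borel_of_metric XY)"
   have "A \<subseteq> space \<pi>" using sets.sets_into_space[OF A] by (simp add: sp mspace_XY)
   then have "(%z. z) -` A \<inter> space \<pi> = A" by blast
   then show "A : sets \<pi>" using measurable_sets[OF i2 A] by (simp only:)
  qed
 qed
qed

sublocale XY: pair_sigma_finite \<mu> \<nu> ..

sublocale Z: smm \<pi> XY p
 by unfold_locales (rule separable_XY sets_XY X.p)+

definition pc :: "(real => 'a) \<times> (real => 'b) => real => 'a \<times> 'b" where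
 "pc w = (\<lambda>t\<in>{0..1}. (fst w t, snd w t))"

lemma pc_curve:
 assumes g: "c : curves X" and w: "\<omega> : curves Y"
 shows "pc (c, \<omega>) : curves XY"
proof (rule curve_spaceI)
 show "pc (c, \<omega>) t : mspace XY" if "t : {0..1}" for t
  using curve_in'[OF g that] curve_in'[OF w that] that by (simp add: pc_def mspace_XY)
 show "pc (c, \<omega>) : extensional {0..1}" by (simp add: pc_def)
 fix t e :: real assume t: "t : {0..1}" and e: "0 < e"
 define K where "K = N (1, 0) + N (0, 1)"
 have K: "K > 0" using N_pos by (simp add: K_def)
 have e': "0 < e / K" using e K by simp
 obtain d1 where d1: "d1 > 0" "!!s. s : {0..1} ==> \<bar>s - t\<bar> < d1 ==> mdist X (c t) (c s) < e / K"
  using curve_continuous_at[OF g t e'] by blast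
 obtain d2 where d2: "d2 > 0" "!!s. s : {0..1} ==> \<bar>s - t\<bar> < d2 ==> mdist Y (\<omega> t) (\<omega> s) < e / K"
  using curve_continuous_at[OF w t e'] by blast
 show "EX d>0. ALL s:{0..1}. \<bar>s - t\<bar> < d --> mdist XY (pc (c, \<omega>) t) (pc (c, \<omega>) s) < e"
 proof (rule exI[of _ "min d1 d2"], intro conjI ballI impI)
  show "0 < min d1 d2" using d1 d2 by simp
  fix s :: real assume s: "s : {0..1}" "\<bar>s - t\<bar> < min d1 d2"
  have "mdist XY (pc (c, \<omega>) t) (pc (c, \<omega>) s) <= mdist X (c t) (c s) * N (1, 0) + mdist Y (\<omega> t) (\<omega> s) * N (0, 1)"
   using N_le[of "mdist X (c t) (c s)" "mdist Y (\<omega> t) (\<omega> s)"] s t by (simp add: mdist_XY pc_def)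
  also have "... < e / K * N (1, 0) + e / K * N (0, 1)"
   using d1(2)[OF s(1)] d2(2)[OF s(1)] s(2) N_pos by (intro add_strict_mono mult_strict_right_mono) auto
  also have "... = e / K * K" by (simp only: K_def distrib_left)
  also have "... = e" using K by simp
  finally show "mdist XY (pc (c, \<omega>) t) (pc (c, \<omega>) s) < e" .
 qed
qed

lemma pc_ac:
 assumes g: "c : curves X" "ac_curve X c" and w: "\<omega> : curves Y" "ac_curve Y \<omega>"
 shows "ac_curve XY (pc (c, \<omega>))"
proof -
 note a = ac_speed[OF X.sep g] and b = ac_speed[OF Y.sep w]
 let ?h = "%x. N (1, 0) * speed X c x" and ?k = "%x. N (0, 1) * speed Y \<omega> x"
 have i: "integrable lborel ?h" "integrable lborel ?k" using a(1) b(1) by auto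
 have pm: "prim ?h t = N (1, 0) * prim (speed X c) t" "prim ?k t = N (0, 1) * prim (speed Y \<omega>) t" for t
  unfolding prim_def by (simp_all add: set_integral_mult_right)
 show ?thesis
 proof (rule abs_continuous_curveI[of "%x. ?h x + ?k x"])
  show "integrable lborel (%x. ?h x + ?k x)" using i by auto
  fix s t :: real assume st: "0 <= s" "s <= t" "t <= 1"
  have "mdist XY (pc (c, \<omega>) s) (pc (c, \<omega>) t) <= mdist X (c s) (c t) * N (1, 0) + mdist Y (\<omega> s) (\<omega> t) * N (0, 1)"
   using N_le[of "mdist X (c s) (c t)" "mdist Y (\<omega> s) (\<omega> t)"] st by (simp add: mdist_XY pc_def)
  also have "... <= (prim (speed X c) t - prim (speed X c) s) * N (1, 0) + (prim (speed Y \<omega>) t - prim (speed Y \<omega>) s) * N (0, 1)"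
   using a(2)[OF st(2)] b(2)[OF st(2)] st N_pos by (intro add_mono mult_right_mono) (auto simp: cl_id)
  also have "... = prim (%x. ?h x + ?k x) t - prim (%x. ?h x + ?k x) s"
   unfolding prim_add[OF i] pm by (simp add: algebra_simps)
  finally show "mdist XY (pc (c, \<omega>) s) (pc (c, \<omega>) t) <= prim (%x. ?h x + ?k x) t - prim (%x. ?h x + ?k x) s" .
 qed
qed

lemma pc_speed:
 assumes g: "c : curves X" "ac_curve X c" and w: "\<omega> : curves Y" "ac_curve Y \<omega>"
 shows "AE t in lborel. t : {0..1} --> metric_speed XY (pc (c, \<omega>)) t = N (speed X c t, speed Y \<omega> t)"
 using ac_speed(3)[OF X.sep g] ac_speed(3)[OF Y.sep w]
proof (eventually_elim, intro impI)
 fix t :: real assume lx: "((%s. mdist X (c (cl s)) (c (cl t)) / \<bar>s - t\<bar>) \<longlongrightarrow> speed X c t) (at t)"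
  and ly: "((%s. mdist Y (\<omega> (cl s)) (\<omega> (cl t)) / \<bar>s - t\<bar>) \<longlongrightarrow> speed Y \<omega> t) (at t)" and t: "t : {0..1}"
 have "((%s. N (mdist X (c (cl s)) (c (cl t)) / \<bar>s - t\<bar>, mdist Y (\<omega> (cl s)) (\<omega> (cl t)) / \<bar>s - t\<bar>)) \<longlongrightarrow> N (speed X c t, speed Y \<omega> t)) (at t)"
  by (rule N_tendsto[OF lx ly])
 then have l: "((%s. N (mdist X (c (cl s)) (c (cl t)) / \<bar>s - t\<bar>, mdist Y (\<omega> (cl s)) (\<omega> (cl t)) / \<bar>s - t\<bar>)) \<longlongrightarrow> N (speed X c t, speed Y \<omega> t)) (at t within {0..1})"
  by (rule tendsto_within_subset) simp
 show "metric_speed XY (pc (c, \<omega>)) t = N (speed X c t, speed Y \<omega> t)"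
 proof (rule metric_speed_eqI[OF Lim_transform_eventually[OF l] t])
  show "\<forall>\<^sub>F s in at t within {0..1}. N (mdist X (c (cl s)) (c (cl t)) / \<bar>s - t\<bar>, mdist Y (\<omega> (cl s)) (\<omega> (cl t)) / \<bar>s - t\<bar>) = mdist XY (pc (c, \<omega>) s) (pc (c, \<omega>) t) / \<bar>s - t\<bar>"
   unfolding eventually_at_filter
  proof (intro always_eventually allI impI)
   fix s :: real assume s: "s : {0..1}"
   show "N (mdist X (c (cl s)) (c (cl t)) / \<bar>s - t\<bar>, mdist Y (\<omega> (cl s)) (\<omega> (cl t)) / \<bar>s - t\<bar>) = mdist XY (pc (c, \<omega>) s) (pc (c, \<omega>) t) / \<bar>s - t\<bar>"
    using N_scale[of "1 / \<bar>s - t\<bar>" "mdist X (c s) (c t)" "mdist Y (\<omega> s) (\<omega> t)"] s t by (simp add: mdist_XY pc_def cl_id)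
  qed
 qed
qed

end

context smm
begin

lemma energy_measurable:
 assumes s: "sets E = sets (\<Omega> Z)"
 shows "(%c. \<integral>\<^sup>+t. ennreal (speed Z c t powr q) \<partial>lborel) : Borel E"
proof -
 have [measurable]: "(%z. speed Z (fst z) (snd z)) : Borel (E >< lborel)" by (rule measurable_sp[OF s]) auto
 have "(%z. ennreal (speed Z (fst z) (snd z) powr q)) : Borel (E >< lborel)" by measurable
 from lborel.borel_measurable_nn_integral_fst[OF this] show ?thesis by simp
qed

end

context tensor
begin

lemma pc_measurable:
 assumes s: "sets E = sets (\<Omega> X)" and s': "sets T = sets (\<Omega> Y)"
 shows "pc : measurable (E >< T) (\<Omega> XY)"
proof (rule measurable_into_curve_space[OF separable_XY])
 show "pc w : curves XY" if "w : space (E >< T)" for w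
  using that pc_curve[of "fst w" "snd w"] sets_eq_imp_space_eq[OF s] sets_eq_imp_space_eq[OF s'] by (auto simp: space_pair_measure)
 fix t :: real assume t: "t : {0..1}"
 have "(%w. (fst w (cl t), snd w (cl t))) : measurable (E >< T) \<pi>"
  by (intro measurable_Pair X.measurable_ev[OF s measurable_fst] Y.measurable_ev[OF s' measurable_snd]) auto
 then have "(%w. (fst w (cl t), snd w (cl t))) : measurable (E >< T) (borel_of_metric XY)"
  using measurable_cong_sets[OF refl sets_XY] by blast
 then show "(%w. pc w t) : measurable (E >< T) (borel_of_metric XY)"
  using t by (simp add: pc_def cl_id)
qed

lemma plan_pair_AE:
 assumes E: "X.plan E" and T: "Y.plan T"
 shows "AE w in E >< T. fst w : curves X & ac_curve X (fst w) &
  snd w : curves Y & ac_curve Y (snd w)"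
proof -
 interpret T: prob_space T using T by (rule Y.plan_prob)
 show ?thesis
  using AE_fstI[OF T.sigma_finite_measure_axioms X.plan_AE[OF E]] AE_sndI[OF T.sigma_finite_measure_axioms Y.plan_AE[OF T], of E]
  by eventually_elim blast
qed

lemma N_powr_le:
 assumes "0 <= v" "0 <= w" "0 < r"
 shows "N (v, w) powr r <= (N (1, 0) + N (0, 1)) powr r * (v powr r + w powr r)"
proof -
 define K where "K = N (1, 0) + N (0, 1)"
 have K: "0 <= K" using N_pos by (simp add: K_def)
 have "N (v, w) <= v * N (1, 0) + w * N (0, 1)" using N_le[of v w] assms by simp
 also have "... <= max v w * N (1, 0) + max v w * N (0, 1)" using N_pos by (intro add_mono mult_right_mono) auto
 also have "... = K * max v w" by (simp add: K_def algebra_simps)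
 finally have "N (v, w) powr r <= (K * max v w) powr r" using assms N_nonneg by (intro powr_mono2) auto
 also have "... = K powr r * max v w powr r" using K assms by (intro powr_mult)
 also have "... <= K powr r * (v powr r + w powr r)" by (intro mult_left_mono) (auto simp: max_def)
 finally show ?thesis by (simp add: K_def)
qed

lemma compress_pair:
 assumes E: "X.plan E" and T: "Y.plan T"
 shows "EX n::nat. ALL r s. ALL G:Borel \<pi>. (\<integral>\<^sup>+w. G (fst w (cl r), snd w (cl s)) \<partial>(E >< T)) <= of_nat n * (\<integral>\<^sup>+z. G z \<partial>\<pi>)"
proof -
 interpret E: prob_space E using E by (rule X.plan_prob)
 interpret T: prob_space T using T by (rule Y.plan_prob)
 note se = X.plan_sets[OF E] and st = Y.plan_sets[OF T]
 obtain n1 :: nat where n1: "X.compress E (real n1)" using X.plan_bounds[OF E] by blast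
 obtain n2 :: nat where n2: "Y.compress T (real n2)" using Y.plan_bounds[OF T] by blast
 show ?thesis
 proof (intro exI[of _ "n1 * n2"] allI ballI)
  fix r s :: real and G :: "'a \<times> 'b => ennreal" assume G[measurable]: "G : Borel \<pi>"
  have [measurable]: "(%w. fst w (cl r)) : measurable (E >< T) \<mu>" "(%w. snd w (cl s)) : measurable (E >< T) \<nu>"
   by (intro X.measurable_ev[OF se measurable_fst] Y.measurable_ev[OF st measurable_snd]; simp)+
  have ev1[measurable]: "(%c. c (cl r)) : measurable E \<mu>" by (rule X.measurable_ev[OF se]) auto
  have Gm: "(%w. G (fst w (cl r), snd w (cl s))) : Borel (E >< T)" by measurable
  define \<phi> where "\<phi> x = (\<integral>\<^sup>+y. G (x, y) \<partial>\<nu>)" for x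
  have \<phi>[measurable]: "\<phi> : Borel \<mu>" unfolding \<phi>_def by measurable
  have "(\<integral>\<^sup>+w. G (fst w (cl r), snd w (cl s)) \<partial>(E >< T)) = (\<integral>\<^sup>+c. \<integral>\<^sup>+\<omega>. G (c (cl r), \<omega> (cl s)) \<partial>T \<partial>E)"
   using T.nn_integral_fst[OF Gm] by simp
  also have "... <= (\<integral>\<^sup>+c. ennreal (real n2) * \<phi> (c (cl r)) \<partial>E)"
  proof (rule nn_integral_mono)
   fix c assume "c : space E"
   then have "c (cl r) : space \<mu>" using measurable_space[OF ev1] by blast
   then have "(%y. G (c (cl r), y)) : Borel \<nu>" by measurable
   from Y.compress_nn[OF st n2 this, of s]
   show "(\<integral>\<^sup>+\<omega>. G (c (cl r), \<omega> (cl s)) \<partial>T) <= ennreal (real n2) * \<phi> (c (cl r))" unfolding \<phi>_def .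
  qed
  also have "... = ennreal (real n2) * (\<integral>\<^sup>+c. \<phi> (c (cl r)) \<partial>E)" by (rule nn_integral_cmult) measurable
  also have "... <= ennreal (real n2) * (ennreal (real n1) * (\<integral>\<^sup>+x. \<phi> x \<partial>\<mu>))"
   by (intro mult_left_mono X.compress_nn[OF se n1] \<phi>) auto
  also have "(\<integral>\<^sup>+x. \<phi> x \<partial>\<mu>) = (\<integral>\<^sup>+z. G z \<partial>\<pi>)" unfolding \<phi>_def by (rule Y.nn_integral_fst[OF G])
  finally show "(\<integral>\<^sup>+w. G (fst w (cl r), snd w (cl s)) \<partial>(E >< T)) <= of_nat (n1 * n2) * (\<integral>\<^sup>+z. G z \<partial>\<pi>)"
   by (simp add: ennreal_of_nat_eq_real_of_nat ennreal_mult mult_ac)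
 qed
qed

text \<open>Independent pairs of curves are compressed by the product of the two constants, and the norm of the pair of
speeds is dominated by their sum.\<close>
lemma plan_prod:
 assumes E: "X.plan E" and T: "Y.plan T"
 shows "Z.plan (distr (E >< T) (\<Omega> XY) pc)"
proof -
 interpret E: prob_space E using E by (rule X.plan_prob)
 interpret T: prob_space T using T by (rule Y.plan_prob)
 interpret P: pair_prob_space E T ..
 note s = X.plan_sets[OF E] and s' = Y.plan_sets[OF T]
 define EnX where "EnX c = (\<integral>\<^sup>+t. ennreal (speed X c t powr X.q) \<partial>lborel)" for c
 define EnY where "EnY c = (\<integral>\<^sup>+t. ennreal (speed Y c t powr X.q) \<partial>lborel)" for c
 have [measurable]: "EnX : Borel E" "EnY : Borel T"
  unfolding EnX_def[abs_def] EnY_def[abs_def] by (rule X.energy_measurable[OF s] Y.energy_measurable[OF s'])+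
 obtain n1 :: nat where n1: "X.energy E <= of_nat n1" using X.plan_bounds[OF E] by blast
 obtain n2 :: nat where n2: "Y.energy T <= of_nat n2" using Y.plan_bounds[OF T] by blast
 obtain n :: nat where n: "!!r s G. G : Borel \<pi> ==> (\<integral>\<^sup>+w. G (fst w (cl r), snd w (cl s)) \<partial>(E >< T)) <= of_nat n * (\<integral>\<^sup>+z. G z \<partial>\<pi>)"
  using compress_pair[OF E T] by blast
 have mX: "(%w. EnX (fst w)) : Borel (E >< T)" and mY: "(%w. EnY (snd w)) : Borel (E >< T)" by measurable
 define K where "K = (N (1, 0) + N (0, 1)) powr X.q"
 have q: "0 < X.q" using X.q by simp
 show ?thesis
 proof (rule Z.plan_distrI[OF P.prob_space_axioms pc_measurable[OF s s']])
  show "AE w in E >< T. ac_curve XY (pc w)"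
   using plan_pair_AE[OF E T]
  proof eventually_elim
   case (elim w)
   then show ?case using pc_ac[of "fst w" "snd w"] by simp
  qed
  have "(\<integral>\<^sup>+w. (\<integral>\<^sup>+t\<in>{0..1}. ennreal (metric_speed XY (pc w) t powr X.q) \<partial>lborel) \<partial>(E >< T)) <= (\<integral>\<^sup>+w. ennreal K * (EnX (fst w) + EnY (snd w)) \<partial>(E >< T))"
  proof (rule nn_integral_mono_AE, use plan_pair_AE[OF E T] in eventually_elim)
   fix w assume w: "fst w : curves X & ac_curve X (fst w) & snd w : curves Y & ac_curve Y (snd w)"
   have [measurable]: "speed X (fst w) : Borel borel" "speed Y (snd w) : Borel borel"
    using measurable_speed[OF X.sep, of "%_. fst w" borel "%x. x"] measurable_speed[OF Y.sep, of "%_. snd w" borel "%x. x"] w by simp_all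
   have "AE t in lborel. t : {0..1} --> metric_speed XY (pc w) t = N (speed X (fst w) t, speed Y (snd w) t)"
    using pc_speed[of "fst w" "snd w"] w by simp
   then have "(\<integral>\<^sup>+t\<in>{0..1}. ennreal (metric_speed XY (pc w) t powr X.q) \<partial>lborel) <= (\<integral>\<^sup>+t. ennreal K * (ennreal (speed X (fst w) t powr X.q) + ennreal (speed Y (snd w) t powr X.q)) \<partial>lborel)"
   proof (intro nn_integral_mono_AE, eventually_elim)
    fix t :: real assume t: "t : {0..1} --> metric_speed XY (pc w) t = N (speed X (fst w) t, speed Y (snd w) t)"
    have "ennreal (N (speed X (fst w) t, speed Y (snd w) t) powr X.q) <= ennreal K * (ennreal (speed X (fst w) t powr X.q) + ennreal (speed Y (snd w) t powr X.q))"
     using ennreal_leI[OF N_powr_le[of "speed X (fst w) t" "speed Y (snd w) t" X.q]] q by (simp add: K_def ennreal_mult')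
    then show "ennreal (metric_speed XY (pc w) t powr X.q) * indicator {0..1} t <= ennreal K * (ennreal (speed X (fst w) t powr X.q) + ennreal (speed Y (snd w) t powr X.q))"
     using t by (auto simp: indicator_def)
   qed
   also have "... = ennreal K * (EnX (fst w) + EnY (snd w))"
    unfolding EnX_def EnY_def by (subst nn_integral_cmult) (auto simp: nn_integral_add)
   finally show "(\<integral>\<^sup>+t\<in>{0..1}. ennreal (metric_speed XY (pc w) t powr X.q) \<partial>lborel) <= ennreal K * (EnX (fst w) + EnY (snd w))" .
  qed
  also have "... = ennreal K * ((\<integral>\<^sup>+w. EnX (fst w) \<partial>(E >< T)) + (\<integral>\<^sup>+w. EnY (snd w) \<partial>(E >< T)))"
   by (simp add: nn_integral_cmult nn_integral_add)
  also have "(\<integral>\<^sup>+w. EnX (fst w) \<partial>(E >< T)) = X.energy E"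
   using T.nn_integral_fst[OF mX] by (simp add: T.emeasure_space_1 X.energy_def EnX_def)
  also have "(\<integral>\<^sup>+w. EnY (snd w) \<partial>(E >< T)) = Y.energy T"
   using T.nn_integral_fst[OF mY] by (simp add: E.emeasure_space_1 Y.energy_def EnY_def)
  also have "ennreal K * (X.energy E + Y.energy T) < \<infinity>"
   using n1 n2 by (simp add: ennreal_mult_less_top order_le_less_trans[OF _ of_nat_less_top])
  finally show "(\<integral>\<^sup>+w. (\<integral>\<^sup>+t\<in>{0..1}. ennreal (metric_speed XY (pc w) t powr X.q) \<partial>lborel) \<partial>(E >< T)) < \<infinity>" .
  show "0 < real n + 1" by simp
  fix t :: real and A assume t: "t : {0..1}" and A[measurable]: "A : sets \<pi>"
  have e: "pc w t = (fst w (cl t), snd w (cl t))" for w using t by (simp add: pc_def cl_id)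
  have [measurable]: "(%w. fst w (cl t)) : measurable (E >< T) \<mu>" "(%w. snd w (cl t)) : measurable (E >< T) \<nu>"
   by (intro X.measurable_ev[OF s measurable_fst] Y.measurable_ev[OF s' measurable_snd]; simp)+
  have set: "{w : space (E >< T). pc w t : A} : sets (E >< T)" unfolding e by measurable
  have "emeasure (E >< T) {w : space (E >< T). pc w t : A} = (\<integral>\<^sup>+w. indicator A (fst w (cl t), snd w (cl t)) \<partial>(E >< T))"
   unfolding nn_integral_indicator[OF set, symmetric] by (intro nn_integral_cong) (simp add: indicator_def e)
  also have "... <= of_nat n * emeasure \<pi> A" using n[of "indicator A" t t] by simp
  also have "... <= ennreal (real n + 1) * emeasure \<pi> A"
   unfolding ennreal_of_nat_eq_real_of_nat by (intro mult_right_mono ennreal_leI) auto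
  finally show "emeasure (E >< T) {w : space (E >< T). pc w t : A} <= ennreal (real n + 1) * emeasure \<pi> A" .
 qed
qed

text \<open>The weak upper gradient inequality for the pair of curves on the clocks \<open>r + a l\<close> and \<open>s
+ b l\<close>.\<close>
definition flux_bound :: "('a \<times> 'b => real) => ('a \<times> 'b => real) => real => real => (real => 'a) => (real => 'b) => real => real => bool" where
 "flux_bound f g a b c \<omega> r s \<longleftrightarrow> ennreal \<bar>f (c (cl (r + a)), \<omega> (cl (s + b))) - f (c (cl r), \<omega> (cl s))\<bar> <=
  (\<integral>\<^sup>+l\<in>{0..1}. ennreal (g (c (cl (r + a * l)), \<omega> (cl (s + b * l))) * N (\<bar>a\<bar> * speed X c (r + a * l), \<bar>b\<bar> * speed Y \<omega> (s + b * l))) \<partial>lborel)"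

lemma measurable_flux_bound:
 assumes s: "sets E = sets (\<Omega> X)" and s': "sets T = sets (\<Omega> Y)"
  and f[measurable]: "f : Borel \<pi>" and g[measurable]: "g : Borel \<pi>"
  and \<phi>[measurable]: "\<phi> : measurable M E" and \<psi>[measurable]: "\<psi> : measurable M T"
  and \<rho>[measurable]: "\<rho> : Borel M" and \<sigma>[measurable]: "\<sigma> : Borel M"
 shows "{w : space M. flux_bound f g a b (\<phi> w) (\<psi> w) (\<rho> w) (\<sigma> w)} : sets M"
proof -
 have m1[measurable]: "(%w. \<phi> w (cl (\<rho> w + a))) : measurable M \<mu>" "(%w. \<phi> w (cl (\<rho> w))) : measurable M \<mu>"
  by (intro X.measurable_ev[OF s \<phi>]; measurable)+
 have m2[measurable]: "(%w. \<psi> w (cl (\<sigma> w + b))) : measurable M \<nu>" "(%w. \<psi> w (cl (\<sigma> w))) : measurable M \<nu>"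
  by (intro Y.measurable_ev[OF s' \<psi>]; measurable)+
 have p1: "(%w. \<phi> (fst w)) : measurable (M >< lborel) E" and p2: "(%w. \<psi> (fst w)) : measurable (M >< lborel) T" by measurable
 have [measurable]: "(%w. \<phi> (fst w) (cl (\<rho> (fst w) + a * snd w))) : measurable (M >< lborel) \<mu>" by (rule X.measurable_ev[OF s p1]) measurable
 have [measurable]: "(%w. \<psi> (fst w) (cl (\<sigma> (fst w) + b * snd w))) : measurable (M >< lborel) \<nu>" by (rule Y.measurable_ev[OF s' p2]) measurable
 have [measurable]: "(%w. speed X (\<phi> (fst w)) (\<rho> (fst w) + a * snd w)) : Borel (M >< lborel)" by (rule X.measurable_sp[OF s p1]) measurable
 have [measurable]: "(%w. speed Y (\<psi> (fst w)) (\<sigma> (fst w) + b * snd w)) : Borel (M >< lborel)" by (rule Y.measurable_sp[OF s' p2]) measurable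
 have "(%w. ennreal (g (\<phi> (fst w) (cl (\<rho> (fst w) + a * snd w)), \<psi> (fst w) (cl (\<sigma> (fst w) + b * snd w))) *
   N (\<bar>a\<bar> * speed X (\<phi> (fst w)) (\<rho> (fst w) + a * snd w), \<bar>b\<bar> * speed Y (\<psi> (fst w)) (\<sigma> (fst w) + b * snd w))) * indicator {0..1} (snd w)) : Borel (M >< lborel)"
  by measurable
 from lborel.borel_measurable_nn_integral_fst[OF this]
 have [measurable]: "(%w. \<integral>\<^sup>+l\<in>{0..1}. ennreal (g (\<phi> w (cl (\<rho> w + a * l)), \<psi> w (cl (\<sigma> w + b * l))) *
   N (\<bar>a\<bar> * speed X (\<phi> w) (\<rho> w + a * l), \<bar>b\<bar> * speed Y (\<psi> w) (\<sigma> w + b * l))) \<partial>lborel) : Borel M" by simp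
 show ?thesis unfolding flux_bound_def by measurable
qed

text \<open>The defining inequality for the product of two plans with independently rescaled clocks.\<close>
lemma flux_bound_AE:
 assumes wug: "Z.wug f g" and E: "X.plan E" and T: "Y.plan T"
 shows "AE w in E >< T. flux_bound f g a b (fst w) (snd w) r s"
proof -
 interpret E: prob_space E using E by (rule X.plan_prob)
 interpret T: prob_space T using T by (rule Y.plan_prob)
 note se = X.plan_sets[OF E] and st = Y.plan_sets[OF T]
 let ?E' = "distr E (\<Omega> X) (rep r a)" and ?T' = "distr T (\<Omega> Y) (rep s b)"
 have E': "X.plan ?E'" and T': "Y.plan ?T'" by (rule X.plan_rep[OF E] Y.plan_rep[OF T])+
 interpret T': prob_space ?T' using T' by (rule Y.plan_prob)
 have rx: "rep r a : measurable E (\<Omega> X)" using X.rep_measurable measurable_cong_sets[OF se refl] by blast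
 have ry: "rep s b : measurable T (\<Omega> Y)" using Y.rep_measurable measurable_cong_sets[OF st refl] by blast
 define Q where "Q c \<longleftrightarrow> ennreal \<bar>f (c 1) - f (c 0)\<bar> <= (\<integral>\<^sup>+t\<in>{0..1}. ennreal (g (c t) * metric_speed XY c t) \<partial>lborel)" for c
 have "AE c in distr (?E' >< ?T') (\<Omega> XY) pc. Q c"
  using wug plan_prod[OF E' T'] unfolding weak_upper_gradient_def Q_def by blast
 then have "AE w in ?E' >< ?T'. Q (pc w)"
  by (rule AE_distrD[rotated]) (rule pc_measurable; simp)
 then have "AE w in distr (E >< T) (\<Omega> X >< \<Omega> Y) (%(x, y). (rep r a x, rep s b y)). Q (pc w)"
  unfolding pair_measure_distr[OF rx ry T'.sigma_finite_measure_axioms] .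
 then have "AE w in E >< T. Q (pc ((%(x, y). (rep r a x, rep s b y)) w))"
  by (rule AE_distrD[rotated]) (use rx ry in measurable)
 then show ?thesis using plan_pair_AE[OF E T]
 proof eventually_elim
  case (elim w)
  note Q = elim(1) and w = elim(2)
  obtain \<gamma> \<omega> where w_eq: "w = (\<gamma>, \<omega>)" by (cases w)
  have g: "\<gamma> : curves X" "ac_curve X \<gamma>" and o: "\<omega> : curves Y" "ac_curve Y \<omega>"
   using w by (auto simp: w_eq)
  let ?c = "pc (rep r a \<gamma>, rep s b \<omega>)"
  have v: "?c 1 = (\<gamma> (cl (r + a)), \<omega> (cl (s + b)))" "?c 0 = (\<gamma> (cl r), \<omega> (cl s))" by (simp_all add: pc_def rep_def)
  have sp: "AE t in lborel. t : {0..1} --> metric_speed XY ?c t = N (\<bar>a\<bar> * speed X \<gamma> (r + a * t), \<bar>b\<bar> * speed Y \<omega> (s + b * t))"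
   using pc_speed[OF rep_curve[OF g(1)] rep_ac[OF g] rep_curve[OF o(1)] rep_ac[OF o], of r a s b]
    rep_metric_speed[OF X.sep g, of r a] rep_metric_speed[OF Y.sep o, of s b]
    X.AE_speed[OF rep_curve[OF g(1)] rep_ac[OF g], of r a] Y.AE_speed[OF rep_curve[OF o(1)] rep_ac[OF o], of s b]
   by eventually_elim simp
  have "(\<integral>\<^sup>+t\<in>{0..1}. ennreal (g (?c t) * metric_speed XY ?c t) \<partial>lborel) = (\<integral>\<^sup>+l\<in>{0..1}. ennreal (g (\<gamma> (cl (r + a * l)), \<omega> (cl (s + b * l))) * N (\<bar>a\<bar> * speed X \<gamma> (r + a * l), \<bar>b\<bar> * speed Y \<omega> (s + b * l))) \<partial>lborel)"
  proof (rule nn_integral_cong_AE, use sp in eventually_elim)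
   fix t :: real assume "t : {0..1} --> metric_speed XY ?c t = N (\<bar>a\<bar> * speed X \<gamma> (r + a * t), \<bar>b\<bar> * speed Y \<omega> (s + b * t))"
   then show "ennreal (g (?c t) * metric_speed XY ?c t) * indicator {0..1} t =
    ennreal (g (\<gamma> (cl (r + a * t)), \<omega> (cl (s + b * t))) * N (\<bar>a\<bar> * speed X \<gamma> (r + a * t), \<bar>b\<bar> * speed Y \<omega> (s + b * t))) * indicator {0..1} t"
    by (cases "t : {0..1}") (simp_all add: pc_def rep_def)
  qed
  then show ?case
   using Q unfolding Q_def flux_bound_def w_eq prod.case fst_conv snd_conv v by simp
 qed
qed

lemma slice_X:
 assumes f: "f : Borel \<pi>" and wug: "Z.wug f g" and E: "X.plan E"
 shows "AE y in \<nu>. AE c in E. ennreal \<bar>f (c (cl 1), y) - f (c (cl 0), y)\<bar> <= X.lin (%x. N (1, 0) * g (x, y)) c"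
proof (rule Y.AE_by_uniform)
 fix B assume B: "B : sets \<nu>" "emeasure \<nu> B ~= 0" "emeasure \<nu> B < \<infinity>"
 have g: "g : Borel \<pi>" using wug by (simp add: Z.wug_iff)
 let ?k = "%y. \<lambda>t\<in>{0..1::real}. y"
 let ?T = "distr (uniform_measure \<nu> B) (\<Omega> Y) ?k"
 note T = Y.plan_const(1)[OF B] and k = Y.plan_const(2)[OF B]
 interpret E: prob_space E using E by (rule X.plan_prob)
 interpret T: prob_space ?T using T by (rule Y.plan_prob)
 interpret P: pair_sigma_finite E ?T ..
 have m: "{w : space (E >< ?T). flux_bound f g 1 0 (fst w) (snd w) 0 0} : sets (E >< ?T)"
  by (rule measurable_flux_bound[OF X.plan_sets[OF E] Y.plan_sets[OF T] f g]) auto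
 have "AE c in E. AE \<omega> in ?T. flux_bound f g 1 0 c \<omega> 0 0"
  using P.AE_pair[OF flux_bound_AE[OF wug E T, of 1 0 0 0]] by simp
 then have "AE \<omega> in ?T. AE c in E. flux_bound f g 1 0 c \<omega> 0 0"
  using P.AE_commute[of "%c \<omega>. flux_bound f g 1 0 c \<omega> 0 0", OF m] by blast
 from AE_distrD[OF k this]
 show "AE y in uniform_measure \<nu> B. AE c in E. ennreal \<bar>f (c (cl 1), y) - f (c (cl 0), y)\<bar> <= X.lin (%x. N (1, 0) * g (x, y)) c"
 proof eventually_elim
  case (elim y)
  then show ?case
  proof eventually_elim
   case (elim c)
   note a = elim(1)
   have "ennreal \<bar>f (c (cl 1), y) - f (c (cl 0), y)\<bar> <= (\<integral>\<^sup>+l\<in>{0..1}. ennreal (g (c (cl l), y) * N (speed X c l, 0)) \<partial>lborel)"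
    using a unfolding flux_bound_def k by simp
   also have "... <= X.lin (%x. N (1, 0) * g (x, y)) c"
    unfolding X.lin_def by (intro nn_integral_mono) (auto simp: indicator_def N_fst[of "speed X _ _"] mult_ac)
   finally show "ennreal \<bar>f (c (cl 1), y) - f (c (cl 0), y)\<bar> <= X.lin (%x. N (1, 0) * g (x, y)) c" .
  qed
 qed
qed

lemma slice_Y:
 assumes f: "f : Borel \<pi>" and wug: "Z.wug f g" and T: "Y.plan T"
 shows "AE x in \<mu>. AE \<omega> in T. ennreal \<bar>f (x, \<omega> (cl 1)) - f (x, \<omega> (cl 0))\<bar> <= Y.lin (%y. N (0, 1) * g (x, y)) \<omega>"
proof (rule X.AE_by_uniform)
 fix B assume B: "B : sets \<mu>" "emeasure \<mu> B ~= 0" "emeasure \<mu> B < \<infinity>"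
 let ?k = "%y. \<lambda>t\<in>{0..1::real}. y"
 let ?E = "distr (uniform_measure \<mu> B) (\<Omega> X) ?k"
 note E = X.plan_const(1)[OF B] and k = X.plan_const(2)[OF B]
 interpret E: prob_space ?E using E by (rule X.plan_prob)
 interpret T: prob_space T using T by (rule Y.plan_prob)
 interpret P: pair_sigma_finite ?E T ..
 have "AE c in ?E. AE \<omega> in T. flux_bound f g 0 1 c \<omega> 0 0"
  using P.AE_pair[OF flux_bound_AE[OF wug E T, of 0 1 0 0]] by simp
 from AE_distrD[OF k this]
 show "AE x in uniform_measure \<mu> B. AE \<omega> in T. ennreal \<bar>f (x, \<omega> (cl 1)) - f (x, \<omega> (cl 0))\<bar> <= Y.lin (%y. N (0, 1) * g (x, y)) \<omega>"
 proof eventually_elim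
  case (elim x)
  then show ?case
  proof eventually_elim
   case (elim \<omega>)
   note a = elim(1)
   have k: "?k x (cl t) = x" for t using cl_in[of t] by simp
   have "ennreal \<bar>f (x, \<omega> (cl 1)) - f (x, \<omega> (cl 0))\<bar> <= (\<integral>\<^sup>+l\<in>{0..1}. ennreal (g (x, \<omega> (cl l)) * N (0, speed Y \<omega> l)) \<partial>lborel)"
    using a unfolding flux_bound_def k by simp
   also have "... <= Y.lin (%y. N (0, 1) * g (x, y)) \<omega>"
    unfolding Y.lin_def by (intro nn_integral_mono) (auto simp: indicator_def N_snd[of "speed Y _ _"] mult_ac)
   finally show "ennreal \<bar>f (x, \<omega> (cl 1)) - f (x, \<omega> (cl 0))\<bar> <= Y.lin (%y. N (0, 1) * g (x, y)) \<omega>" .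
  qed
 qed
qed

end

section \<open>Exchanging null sets of points and of curves\<close>

lemma nn_integral_middle_swap:
 assumes "sigma_finite_measure A" "sigma_finite_measure B" "sigma_finite_measure C" "sigma_finite_measure D"
  and Q[measurable]: "Q : sets ((A >< B) >< (C >< D))"
 shows "(\<integral>\<^sup>+w. indicator Q w \<partial>((A >< B) >< (C >< D))) =
  (\<integral>\<^sup>+w. indicator Q ((fst (fst w), fst (snd w)), (snd (fst w), snd (snd w))) \<partial>((A >< C) >< (B >< D)))"
proof -
 interpret A: sigma_finite_measure A by fact
 interpret B: sigma_finite_measure B by fact
 interpret C: sigma_finite_measure C by fact
 interpret D: sigma_finite_measure D by fact
 interpret BC: pair_sigma_finite B C ..
 interpret CD: pair_sigma_finite C D ..
 interpret BD: pair_sigma_finite B D ..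
 have m1: "(%w. indicator Q w :: ennreal) : Borel ((A >< B) >< (C >< D))" by measurable
 have m2: "(%w. indicator Q ((fst (fst w), fst (snd w)), (snd (fst w), snd (snd w))) :: ennreal) : Borel ((A >< C) >< (B >< D))"
  by measurable
 have "(\<integral>\<^sup>+w. indicator Q w \<partial>((A >< B) >< (C >< D))) = (\<integral>\<^sup>+u. \<integral>\<^sup>+z. indicator Q (u, z) \<partial>(C >< D) \<partial>(A >< B))"
  by (rule CD.nn_integral_fst[OF m1, symmetric])
 also have "... = (\<integral>\<^sup>+x. \<integral>\<^sup>+y. \<integral>\<^sup>+z. indicator Q ((x, y), z) \<partial>(C >< D) \<partial>B \<partial>A)"
  by (rule B.nn_integral_fst[OF CD.borel_measurable_nn_integral_fst[OF m1], symmetric])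
 also have "... = (\<integral>\<^sup>+x. \<integral>\<^sup>+r. \<integral>\<^sup>+v. indicator Q ((x, fst v), (r, snd v)) \<partial>(B >< D) \<partial>C \<partial>A)"
 proof (rule nn_integral_cong)
  fix x assume x[measurable]: "x : space A"
  have "(\<integral>\<^sup>+y. \<integral>\<^sup>+z. indicator Q ((x, y), z) \<partial>(C >< D) \<partial>B) = (\<integral>\<^sup>+y. \<integral>\<^sup>+r. \<integral>\<^sup>+s. indicator Q ((x, y), (r, s)) \<partial>D \<partial>C \<partial>B)"
  proof (rule nn_integral_cong)
   fix y assume y[measurable]: "y : space B"
   have "(%z. indicator Q ((x, y), z) :: ennreal) : Borel (C >< D)" by measurable
   from D.nn_integral_fst[OF this] show "(\<integral>\<^sup>+z. indicator Q ((x, y), z) \<partial>(C >< D)) = (\<integral>\<^sup>+r. \<integral>\<^sup>+s. indicator Q ((x, y), (r, s)) \<partial>D \<partial>C)" by simp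
  qed
  also have "... = (\<integral>\<^sup>+r. \<integral>\<^sup>+y. \<integral>\<^sup>+s. indicator Q ((x, y), (r, s)) \<partial>D \<partial>B \<partial>C)"
   by (rule BC.Fubini'[symmetric]) measurable
  also have "... = (\<integral>\<^sup>+r. \<integral>\<^sup>+v. indicator Q ((x, fst v), (r, snd v)) \<partial>(B >< D) \<partial>C)"
  proof (rule nn_integral_cong)
   fix r assume r[measurable]: "r : space C"
   have "(%v. indicator Q ((x, fst v), (r, snd v)) :: ennreal) : Borel (B >< D)" by measurable
   from D.nn_integral_fst[OF this] show "(\<integral>\<^sup>+y. \<integral>\<^sup>+s. indicator Q ((x, y), (r, s)) \<partial>D \<partial>B) = (\<integral>\<^sup>+v. indicator Q ((x, fst v), (r, snd v)) \<partial>(B >< D))" by simp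
  qed
  finally show "(\<integral>\<^sup>+y. \<integral>\<^sup>+z. indicator Q ((x, y), z) \<partial>(C >< D) \<partial>B) = (\<integral>\<^sup>+r. \<integral>\<^sup>+v. indicator Q ((x, fst v), (r, snd v)) \<partial>(B >< D) \<partial>C)" .
 qed
 also have "... = (\<integral>\<^sup>+u. \<integral>\<^sup>+v. indicator Q ((fst u, fst v), (snd u, snd v)) \<partial>(B >< D) \<partial>(A >< C))"
  using C.nn_integral_fst[OF BD.borel_measurable_nn_integral_fst[OF m2]] by simp
 also have "... = (\<integral>\<^sup>+w. indicator Q ((fst (fst w), fst (snd w)), (snd (fst w), snd (snd w))) \<partial>((A >< C) >< (B >< D)))"
  using BD.nn_integral_fst[OF m2] by simp
 finally show ?thesis .
qed

text \<open>Pairs of (curve, time) against a pair of curves and a pair of times.\<close>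
lemma AE_middle_swap:
 assumes sf: "sigma_finite_measure A" "sigma_finite_measure B" "sigma_finite_measure C" "sigma_finite_measure D"
  and Q: "{w : space ((A >< B) >< (C >< D)). Q (fst (fst w)) (snd (fst w)) (fst (snd w)) (snd (snd w))} : sets ((A >< B) >< (C >< D))"
 shows "(AE w in (A >< B) >< (C >< D). Q (fst (fst w)) (snd (fst w)) (fst (snd w)) (snd (snd w))) \<longleftrightarrow>
  (AE w in (A >< C) >< (B >< D). Q (fst (fst w)) (fst (snd w)) (snd (fst w)) (snd (snd w)))"
proof -
 define S where "S = space ((A >< B) >< (C >< D)) - {w : space ((A >< B) >< (C >< D)). Q (fst (fst w)) (snd (fst w)) (fst (snd w)) (snd (snd w))}"
 have S[measurable]: "S : sets ((A >< B) >< (C >< D))" unfolding S_def by (intro sets.Diff sets.top Q)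
 have m1: "(%w. indicator S w :: ennreal) : Borel ((A >< B) >< (C >< D))" by measurable
 have m2: "(%w. indicator S ((fst (fst w), fst (snd w)), (snd (fst w), snd (snd w))) :: ennreal) : Borel ((A >< C) >< (B >< D))"
  by measurable
 have "(AE w in (A >< B) >< (C >< D). Q (fst (fst w)) (snd (fst w)) (fst (snd w)) (snd (snd w))) \<longleftrightarrow>
  (AE w in (A >< B) >< (C >< D). indicator S w = (0::ennreal))"
  by (rule AE_cong) (auto simp: S_def indicator_def)
 also have "... \<longleftrightarrow> (AE w in (A >< C) >< (B >< D). indicator S ((fst (fst w), fst (snd w)), (snd (fst w), snd (snd w))) = (0::ennreal))"
  unfolding nn_integral_0_iff_AE[OF m1, symmetric] nn_integral_0_iff_AE[OF m2, symmetric] nn_integral_middle_swap[OF sf S] ..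
 also have "... \<longleftrightarrow> (AE w in (A >< C) >< (B >< D). Q (fst (fst w)) (fst (snd w)) (snd (fst w)) (snd (snd w)))"
  by (rule AE_cong) (auto simp: S_def indicator_def space_pair_measure)
 finally show ?thesis .
qed

text \<open>\<open>u\<close> is a primitive of its slope between \<open>r\<close> and \<open>r + \<alpha>\<close>. The
slope is cut off to the unit interval because, as a function of two times, it is integrable only there.\<close>
definition incr :: "('z => real) => real => (real => 'z) => real => bool" where
 "incr u \<alpha> c r \<longleftrightarrow> (0 < r & r < 1 & 0 < r + \<alpha> & r + \<alpha> < 1 -->
  u (c (cl (r + \<alpha>))) - u (c (cl r)) =
   prim (%x. indicator {0<..<1} x * slope u c x) (r + \<alpha>) - prim (%x. indicator {0<..<1} x * slope u c x) r)"

lemma prim_diff_local: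
 assumes h: "integrable lborel h" and r: "0 < r" "r < 1" "0 < t" "t < (1::real)"
 shows "prim (%x. indicator {0<..<1} x * h x) t - prim (%x. indicator {0<..<1} x * h x) r = prim h t - prim h r"
proof -
 have i: "integrable lborel (%x. indicator {0<..<1} x * h x)" by (rule integrable_indicator_mult[OF h]) simp
 have *: "prim (%x. indicator {0<..<1} x * h x) t - prim (%x. indicator {0<..<1} x * h x) r = prim h t - prim h r" if "r <= t" "0 < r" "t < 1" for r t
  unfolding prim_diff[OF i that(1)] prim_diff[OF h that(1)] set_lebesgue_integral_def
  by (intro Bochner_Integration.integral_cong) (use that in \<open>auto simp: indicator_def\<close>)
 show ?thesis
 proof (cases "r <= t")
  case True
  then show ?thesis using *[of r t] r by simp
 next
  case False
  then show ?thesis using *[of t r] r by simp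
 qed
qed

context smm
begin

lemma incr_measurable:
 assumes s: "sets E = sets (\<Omega> Z)" and \<phi>[measurable]: "\<phi> : measurable M E" and \<tau>[measurable]: "\<tau> : Borel M"
  and \<psi>[measurable]: "\<psi> : measurable M P" and f[measurable]: "f : Borel (m >< P)"
 shows "{w : space M. incr (%z. f (z, \<psi> w)) \<alpha> (\<phi> w) (\<tau> w)} : sets M"
proof -
 have [measurable]: "(%w. \<phi> w (cl (\<tau> w + \<alpha>))) : measurable M m" "(%w. \<phi> w (cl (\<tau> w))) : measurable M m"
  by (intro measurable_ev[OF s \<phi>]; measurable)+
 have p1: "(%w. \<phi> (fst w)) : measurable (M >< lborel) E" and p2: "(%w. \<psi> (fst w)) : measurable (M >< lborel) P" by measurable
 have [measurable]: "(%w. slope (%z. f (z, \<psi> (fst w))) (\<phi> (fst w)) (snd w)) : Borel (M >< lborel)"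
  by (rule measurable_slope_slice[OF s p1 _ p2 f]) measurable
 have pm: "(%w. prim (%x. indicator {0<..<1} x * slope (%z. f (z, \<psi> w)) (\<phi> w) x) (\<tau>' w)) : Borel M"
  if [measurable]: "\<tau>' : Borel M" for \<tau>'
 proof -
  have "(%(w, x). (if x <= \<tau>' w then 1 else 0) *\<^sub>R ((if 0 < x & x < 1 then 1 else 0) * slope (%z. f (z, \<psi> w)) (\<phi> w) x)) : Borel (M >< lborel)"
   unfolding split_beta' by measurable
  from lborel.borel_measurable_lebesgue_integral[OF this] show ?thesis
   by (simp add: prim_def set_lebesgue_integral_def indicator_def of_bool_def)
 qed
 have [measurable]: "(%w. prim (%x. indicator {0<..<1} x * slope (%z. f (z, \<psi> w)) (\<phi> w) x) (\<tau> w + \<alpha>)) : Borel M"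
  "(%w. prim (%x. indicator {0<..<1} x * slope (%z. f (z, \<psi> w)) (\<phi> w) x) (\<tau> w)) : Borel M"
  by (rule pm; measurable)+
 show ?thesis unfolding incr_def by measurable
qed

lemma incr_AE:
 assumes u: "u : Borel m" and wug: "wug u g" and E: "plan E"
 shows "AE w in E >< lborel. incr u \<alpha> (fst w) (snd w)"
proof -
 interpret E: prob_space E using E by (rule plan_prob)
 interpret P: pair_sigma_finite E lborel ..
 have u': "(%p. u (fst p)) : Borel (m >< (count_space UNIV :: unit measure))" using u by measurable
 have "{w : space (E >< lborel). incr (%z. u z) \<alpha> (fst w) (snd w)} : sets (E >< lborel)"
  using incr_measurable[OF plan_sets[OF E], of fst "E >< lborel" snd "%_. ()" "count_space UNIV" "%p. u (fst p)", OF _ _ _ u'] by simp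
 then have m: "{w : space (E >< lborel). incr u \<alpha> (fst w) (snd w)} : sets (E >< lborel)" .
 have "AE \<gamma> in E. AE r in lborel. incr u \<alpha> \<gamma> r"
  using ac_along_plan[OF u wug E]
 proof eventually_elim
  case (elim \<gamma>)
  note A = elim(1)
  then obtain c where si: "integrable lborel (slope u \<gamma>)" and c: "AE t in lborel. u (\<gamma> (cl t)) = c + prim (slope u \<gamma>) t" by blast
  show ?case
   using c AE_lborel_shift[OF c, of \<alpha>]
   by eventually_elim (auto simp: incr_def prim_diff_local[OF si])
 qed
 then show ?thesis using m by (intro P.AE_pair_measure) auto
qed

lemma slope_AE:
 assumes u: "u : Borel m" and wug: "wug u g" and E: "plan E"
 shows "AE w in E >< lborel. \<bar>slope u (fst w) (snd w)\<bar> <= g (pos w) * speed Z (fst w) (snd w)"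
proof -
 interpret E: prob_space E using E by (rule plan_prob)
 interpret P: pair_sigma_finite E lborel ..
 have [measurable]: "g : Borel m" using wug by (simp add: wug_iff)
 have u': "(%p. u (fst p)) : Borel (m >< (count_space UNIV :: unit measure))" using u by measurable
 have [measurable]: "(%w. slope u (fst w) (snd w)) : Borel (E >< lborel)"
  using measurable_slope_slice[OF plan_sets[OF E], of fst "E >< lborel" snd "%_. ()" "count_space UNIV" "%p. u (fst p)", OF _ _ _ u'] by simp
 have [measurable]: "(%z. pos z) : measurable (E >< lborel) m" by (rule measurable_ev[OF plan_sets[OF E]]) auto
 have [measurable]: "(%z. speed Z (fst z) (snd z)) : Borel (E >< lborel)" by (rule measurable_sp[OF plan_sets[OF E]]) auto
 have m: "{w : space (E >< lborel). \<bar>slope u (fst w) (snd w)\<bar> <= g (pos w) * speed Z (fst w) (snd w)} : sets (E >< lborel)"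
  by measurable
 show ?thesis by (rule P.AE_pair_measure[OF m]) (use wug_AE_slope[OF u wug E] in simp)
qed

lemma plan_null_pair:
 assumes E: "plan E" and Q: "AE z in m. Q z"
 shows "AE w in E >< lborel. Q (pos w)"
proof -
 interpret E: prob_space E using E by (rule plan_prob)
 interpret P: pair_sigma_finite E lborel ..
 note s = plan_sets[OF E]
 obtain A where A: "A : null_sets m" "{z : space m. \<not> Q z} \<subseteq> A" using Q by (auto simp: eventually_ae_filter)
 have [measurable]: "A : sets m" using A by auto
 have e[measurable]: "(%z. pos z) : measurable (E >< lborel) m" by (rule measurable_ev[OF s]) auto
 have m: "{w : space (E >< lborel). pos w ~: A} : sets (E >< lborel)" by measurable
 have "AE w in E >< lborel. pos w ~: A"
  by (rule P.AE_pair_measure[OF m]) (use plan_null[OF E A(1)] in simp)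
 then show ?thesis using AE_space
 proof eventually_elim
  case (elim w)
  then show ?case using A(2) measurable_space[OF e, of w] by blast
 qed
qed

lemma slice_slope:
 fixes f D g :: "'z \<times> 'y => real"
 assumes f[measurable]: "f : Borel (m >< P)" and E: "plan E"
  and D: "AE y in P. wug (%z. f (z, y)) (%z. D (z, y)) & (AE z in m. D (z, y) <= c * g (z, y))"
 shows "AE y in P. AE u in E >< lborel. \<bar>slope (%z. f (z, y)) (fst u) (snd u)\<bar> <= c * g (pos u, y) * speed Z (fst u) (snd u)"
  and "AE y in P. AE u in E >< lborel. incr (%z. f (z, y)) \<alpha> (fst u) (snd u)"
proof -
 have fm: "(%z. f (z, y)) : Borel m" if [measurable]: "y : space P" for y by measurable
 show "AE y in P. AE u in E >< lborel. \<bar>slope (%z. f (z, y)) (fst u) (snd u)\<bar> <= c * g (pos u, y) * speed Z (fst u) (snd u)"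
  using D AE_space
 proof eventually_elim
  case (elim y)
  show ?case using slope_AE[OF fm[OF elim(2)] conjunct1[OF elim(1)] E] plan_null_pair[OF E conjunct2[OF elim(1)]]
  proof eventually_elim
   case (elim u)
   show ?case by (rule order_trans[OF elim(1) mult_right_mono[OF elim(2) speed_nonneg]])
  qed
 qed
 show "AE y in P. AE u in E >< lborel. incr (%z. f (z, y)) \<alpha> (fst u) (snd u)"
  using D AE_space
 proof eventually_elim
  case (elim y)
  show ?case using incr_AE[OF fm[OF elim(2)] conjunct1[OF elim(1)] E] .
 qed
qed

lemma slice_slope_measurable:
 fixes f g :: "'z \<times> 'y => real"
 assumes E: "plan E" and f[measurable]: "f : Borel (m >< P)" and g[measurable]: "g : Borel (m >< P)"
 shows "{w : space ((E >< lborel) >< P). \<bar>slope (%z. f (z, snd w)) (fst (fst w)) (snd (fst w))\<bar>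
   <= c * g (pos (fst w), snd w) * speed Z (fst (fst w)) (snd (fst w))} : sets ((E >< lborel) >< P)"
  and "{w : space ((E >< lborel) >< P). incr (%z. f (z, snd w)) \<alpha> (fst (fst w)) (snd (fst w))} : sets ((E >< lborel) >< P)"
proof -
 let ?M = "(E >< lborel) >< P"
 have m: "(%w. fst (fst w)) : measurable ?M E" "(%w. snd (fst w)) : Borel ?M" "snd : measurable ?M P" by measurable
 note s = plan_sets[OF E]
 note [measurable] = measurable_slope_slice[OF s m f] measurable_ev[OF s m(1,2)] measurable_sp[OF s m(1,2)]
 show "{w : space ?M. \<bar>slope (%z. f (z, snd w)) (fst (fst w)) (snd (fst w))\<bar>
   <= c * g (pos (fst w), snd w) * speed Z (fst (fst w)) (snd (fst w))} : sets ?M" by measurable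
 show "{w : space ?M. incr (%z. f (z, snd w)) \<alpha> (fst (fst w)) (snd (fst w))} : sets ?M" by (rule incr_measurable[OF s m f])
qed

end

context tensor
begin

text \<open>A property valid for almost every \<open>y\<close> is valid at almost every point of almost every curve,
because plans do not charge null sets; together with the exchange of variables this moves slice statements
to pairs of curves.\<close>
lemma transport_X:
 assumes E: "X.plan E" and T: "Y.plan T"
  and Q: "{w : space ((E >< lborel) >< \<nu>). Q (fst (fst w)) (snd (fst w)) (snd w)} : sets ((E >< lborel) >< \<nu>)"
  and ae: "AE y in \<nu>. AE u in E >< lborel. Q (fst u) (snd u) y"
 shows "AE w in E >< T. AE z in lborel. Q (fst w) (fst z) (snd w (cl (snd z)))"
proof -
 interpret E: prob_space E using E by (rule X.plan_prob)
 interpret T: prob_space T using T by (rule Y.plan_prob)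
 interpret EL: pair_sigma_finite E lborel ..
 interpret TL: pair_sigma_finite T lborel ..
 interpret ET: pair_sigma_finite E T ..
 interpret ELN: pair_sigma_finite "E >< lborel" \<nu> ..
 interpret BIG: pair_sigma_finite "E >< lborel" "T >< lborel" ..
 interpret BIG': pair_sigma_finite "E >< T" "lborel >< lborel" ..
 let ?A = "{w : space ((E >< lborel) >< \<nu>). Q (fst (fst w)) (snd (fst w)) (snd w)}"
 have "AE u in E >< lborel. AE y in \<nu>. Q (fst u) (snd u) y"
  using ELN.AE_commute[of "%u y. Q (fst u) (snd u) y", OF Q] ae by blast
 then have "AE u in E >< lborel. AE v in T >< lborel. Q (fst u) (snd u) (pos v)"
  by eventually_elim (rule Y.plan_null_pair[OF T])
 moreover have "{w : space ((E >< lborel) >< (T >< lborel)). Q (fst (fst w)) (snd (fst w)) (pos (snd w))} : sets ((E >< lborel) >< (T >< lborel))"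
 proof -
  have "(%w. (fst w, pos (snd w))) : measurable ((E >< lborel) >< (T >< lborel)) ((E >< lborel) >< \<nu>)"
   by (intro measurable_Pair measurable_fst Y.measurable_ev[OF Y.plan_sets[OF T], of "%w. fst (snd w)" _ "%w. snd (snd w)"]) measurable
  from measurable_sets_Collect[OF this, of "%w. Q (fst (fst w)) (snd (fst w)) (snd w)", OF Q] show ?thesis by simp
 qed
 ultimately have "AE w in (E >< lborel) >< (T >< lborel). Q (fst (fst w)) (snd (fst w)) (pos (snd w))"
  by (intro BIG.AE_pair_measure) auto
 moreover have "{w : space ((E >< T) >< (lborel >< lborel)). Q (fst (fst w)) (fst (snd w)) (snd (fst w) (cl (snd (snd w))))} : sets ((E >< T) >< (lborel >< lborel))"
 proof -
  have "(%w. ((fst (fst w), fst (snd w)), snd (fst w) (cl (snd (snd w))))) : measurable ((E >< T) >< (lborel >< lborel)) ((E >< lborel) >< \<nu>)"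
   by (intro measurable_Pair Y.measurable_ev[OF Y.plan_sets[OF T], of "%w. snd (fst w)" _ "%w. snd (snd w)"]) measurable
  from measurable_sets_Collect[OF this, of "%w. Q (fst (fst w)) (snd (fst w)) (snd w)", OF Q] show ?thesis by simp
 qed
 ultimately have "AE w in (E >< T) >< (lborel >< lborel). Q (fst (fst w)) (fst (snd w)) (snd (fst w) (cl (snd (snd w))))"
  using AE_middle_swap[OF E.sigma_finite_measure_axioms T.sigma_finite_measure_axioms sigma_finite_lborel sigma_finite_lborel, of "%c \<omega> r s. Q c r (\<omega> (cl s))"] by blast
 from BIG'.AE_pair[OF this] show ?thesis unfolding lborel_prod fst_conv snd_conv .
qed

lemma transport_Y:
 assumes E: "X.plan E" and T: "Y.plan T"
  and Q: "{w : space ((T >< lborel) >< \<mu>). Q (fst (fst w)) (snd (fst w)) (snd w)} : sets ((T >< lborel) >< \<mu>)"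
  and ae: "AE x in \<mu>. AE v in T >< lborel. Q (fst v) (snd v) x"
 shows "AE w in E >< T. AE z in lborel. Q (snd w) (snd z) (fst w (cl (fst z)))"
proof -
 interpret E: prob_space E using E by (rule X.plan_prob)
 interpret T: prob_space T using T by (rule Y.plan_prob)
 interpret EL: pair_sigma_finite E lborel ..
 interpret TL: pair_sigma_finite T lborel ..
 interpret ET: pair_sigma_finite E T ..
 interpret BIG: pair_sigma_finite "E >< lborel" "T >< lborel" ..
 interpret BIG': pair_sigma_finite "E >< T" "lborel >< lborel" ..
 have "AE u in E >< lborel. AE v in T >< lborel. Q (fst v) (snd v) (pos u)"
  by (rule X.plan_null_pair[OF E ae])
 moreover have "{w : space ((E >< lborel) >< (T >< lborel)). Q (fst (snd w)) (snd (snd w)) (pos (fst w))} : sets ((E >< lborel) >< (T >< lborel))"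
 proof -
  have "(%w. (snd w, pos (fst w))) : measurable ((E >< lborel) >< (T >< lborel)) ((T >< lborel) >< \<mu>)"
   by (intro measurable_Pair measurable_snd X.measurable_ev[OF X.plan_sets[OF E], of "%w. fst (fst w)" _ "%w. snd (fst w)"]) measurable
  from measurable_sets_Collect[OF this, of "%w. Q (fst (fst w)) (snd (fst w)) (snd w)", OF Q] show ?thesis by simp
 qed
 ultimately have "AE w in (E >< lborel) >< (T >< lborel). Q (fst (snd w)) (snd (snd w)) (pos (fst w))"
  by (intro BIG.AE_pair_measure) auto
 moreover have "{w : space ((E >< T) >< (lborel >< lborel)). Q (snd (fst w)) (snd (snd w)) (fst (fst w) (cl (fst (snd w))))} : sets ((E >< T) >< (lborel >< lborel))"
 proof -
  have "(%w. ((snd (fst w), snd (snd w)), fst (fst w) (cl (fst (snd w))))) : measurable ((E >< T) >< (lborel >< lborel)) ((T >< lborel) >< \<mu>)"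
   by (intro measurable_Pair X.measurable_ev[OF X.plan_sets[OF E], of "%w. fst (fst w)" _ "%w. fst (snd w)"]) measurable
  from measurable_sets_Collect[OF this, of "%w. Q (fst (fst w)) (snd (fst w)) (snd w)", OF Q] show ?thesis by simp
 qed
 ultimately have "AE w in (E >< T) >< (lborel >< lborel). Q (snd (fst w)) (snd (snd w)) (fst (fst w) (cl (fst (snd w))))"
  using AE_middle_swap[OF E.sigma_finite_measure_axioms T.sigma_finite_measure_axioms sigma_finite_lborel sigma_finite_lborel, of "%c \<omega> r s. Q \<omega> s (c (cl r))"] by blast
 from BIG'.AE_pair[OF this] show ?thesis unfolding lborel_prod fst_conv snd_conv .
qed

end

section \<open>Slices of a Sobolev function on the product\<close>

lemma rational_approx:
 fixes x :: real
 shows "EX r. (ALL n. r n : \<rat>) & r ----> x"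
proof -
 have "ALL n. EX q:\<rat>. x < q & q < x + 1 / real (Suc n)" by (intro allI Rats_dense_in_real) simp
 then obtain r where r: "!!n. r n : \<rat>" "!!n. x < r n" "!!n. r n < x + 1 / real (Suc n)" by metis
 have l: "(%n. x + 1 / real (Suc n)) ----> x"
  using tendsto_add[OF tendsto_const LIMSEQ_Suc[OF lim_1_over_n], of x] by simp
 have "r ----> x"
  by (rule real_tendsto_sandwich[OF _ _ tendsto_const l]; intro always_eventually allI less_imp_le r)
 then show ?thesis using r(1) by blast
qed

context tensor
begin

lemma lp_slice_X:
 assumes [measurable]: "h : Borel \<pi>" and f: "Z.lp h < \<infinity>"
 shows "AE y in \<nu>. X.lp (%x. h (x, y)) < \<infinity>"
proof -
 have m: "(%w. ennreal (\<bar>h w\<bar> powr p)) : Borel \<pi>" by measurable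
 have m': "(%y. X.lp (%x. h (x, y))) : Borel \<nu>" unfolding X.lp_def by measurable
 have "(\<integral>\<^sup>+y. X.lp (%x. h (x, y)) \<partial>\<nu>) = Z.lp h" unfolding X.lp_def Z.lp_def by (rule XY.nn_integral_snd[OF m])
 then have "(\<integral>\<^sup>+y. X.lp (%x. h (x, y)) \<partial>\<nu>) ~= \<infinity>" using f by simp
 from nn_integral_PInf_AE[OF m' this] show ?thesis by eventually_elim (simp add: less_top)
qed

lemma lp_slice_Y:
 assumes [measurable]: "h : Borel \<pi>" and f: "Z.lp h < \<infinity>"
 shows "AE x in \<mu>. Y.lp (%y. h (x, y)) < \<infinity>"
proof -
 have m: "(%w. ennreal (\<bar>h w\<bar> powr p)) : Borel \<pi>" by measurable
 have m': "(%x. Y.lp (%y. h (x, y))) : Borel \<mu>" unfolding Y.lp_def by measurable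
 have "(\<integral>\<^sup>+x. Y.lp (%y. h (x, y)) \<partial>\<mu>) = Z.lp h" unfolding Y.lp_def Z.lp_def by (rule Y.nn_integral_fst[OF m])
 then have "(\<integral>\<^sup>+x. Y.lp (%y. h (x, y)) \<partial>\<mu>) ~= \<infinity>" using f by simp
 from nn_integral_PInf_AE[OF m' this] show ?thesis by eventually_elim (simp add: less_top)
qed

lemma gradient_X:
 assumes f[measurable]: "f : Borel \<pi>" and fl: "Z.lp f < \<infinity>" and wug: "Z.wug f g"
 shows "EX D:Borel \<pi>. (ALL w. 0 <= D w) &
  (AE y in \<nu>. X.wug (%x. f (x, y)) (%x. D (x, y)) & (AE x in \<mu>. D (x, y) <= N (1, 0) * g (x, y)) &
   (ALL h. X.wug (%x. f (x, y)) h --> (AE x in \<mu>. D (x, y) <= h x)))"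
proof -
 have g[measurable]: "g : Borel \<pi>" and gl: "Z.lp g < \<infinity>" and gp: "!!w. w : space \<pi> ==> 0 <= g w"
  using wug by (auto simp: Z.wug_iff)
 have G[measurable]: "(%w. N (1, 0) * g w) : Borel \<pi>" by measurable
 have "Z.lp (%w. N (1, 0) * g w) < \<infinity>" using gl unfolding Z.lp_mult[OF g] by (simp add: ennreal_mult_less_top)
 note Gl = lp_slice_X[OF G this]
 have Gp: "0 <= N (1, 0) * g (x, y)" if "x : space \<mu>" "y : space \<nu>" for x y
  using gp[of "(x, y)"] that N_nonneg by (simp add: space_pair_measure)
 show ?thesis
  by (rule X.minimal_slice_gradient[OF Y.sigma_finite_measure_axioms f G Gp lp_slice_X[OF f fl] Gl slice_X[OF f wug]])
qed

lemma gradient_Y: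
 assumes f[measurable]: "f : Borel \<pi>" and fl: "Z.lp f < \<infinity>" and wug: "Z.wug f g"
 shows "EX D:Borel \<pi>. (ALL w. 0 <= D w) &
  (AE x in \<mu>. Y.wug (%y. f (x, y)) (%y. D (x, y)) & (AE y in \<nu>. D (x, y) <= N (0, 1) * g (x, y)) &
   (ALL h. Y.wug (%y. f (x, y)) h --> (AE y in \<nu>. D (x, y) <= h y)))"
proof -
 have g[measurable]: "g : Borel \<pi>" and gl: "Z.lp g < \<infinity>" and gp: "!!w. w : space \<pi> ==> 0 <= g w"
  using wug by (auto simp: Z.wug_iff)
 have G[measurable]: "(%w. N (0, 1) * g w) : Borel \<pi>" by measurable
 have "Z.lp (%w. N (0, 1) * g w) < \<infinity>" using gl unfolding Z.lp_mult[OF g] by (simp add: ennreal_mult_less_top)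
 note Gl = lp_slice_Y[OF G this]
 have f': "(%w. f (snd w, fst w)) : Borel (\<nu> >< \<mu>)" and G': "(%w. N (0, 1) * g (snd w, fst w)) : Borel (\<nu> >< \<mu>)"
  by measurable
 have Gp: "0 <= N (0, 1) * g (x, y)" if "x : space \<mu>" "y : space \<nu>" for x y
  using gp[of "(x, y)"] that N_nonneg by (simp add: space_pair_measure)
 have "EX D:Borel (\<nu> >< \<mu>). (ALL w. 0 <= D w) &
  (AE x in \<mu>. Y.wug (%y. f (snd (y, x), fst (y, x))) (%y. D (y, x)) & (AE y in \<nu>. D (y, x) <= N (0, 1) * g (snd (y, x), fst (y, x))) &
   (ALL h. Y.wug (%y. f (snd (y, x), fst (y, x))) h --> (AE y in \<nu>. D (y, x) <= h y)))"
  by (rule Y.minimal_slice_gradient[OF X.sigma_finite_measure_axioms f' G'])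
   (use Gp lp_slice_Y[OF f fl] Gl slice_Y[OF f wug] in simp_all)
 then obtain D where D[measurable]: "D : Borel (\<nu> >< \<mu>)" and D0: "ALL w. 0 <= D w"
  and DD: "AE x in \<mu>. Y.wug (%y. f (x, y)) (%y. D (y, x)) & (AE y in \<nu>. D (y, x) <= N (0, 1) * g (x, y)) &
   (ALL h. Y.wug (%y. f (x, y)) h --> (AE y in \<nu>. D (y, x) <= h y))"
  unfolding fst_conv snd_conv by blast
 have D': "(%w. D (snd w, fst w)) : Borel \<pi>" by measurable
 show ?thesis by (rule bexI[OF _ D']) (use D0 DD in simp)
qed

lemma slope_slice_X:
 assumes f[measurable]: "f : Borel \<pi>" and fl: "Z.lp f < \<infinity>" and wug: "Z.wug f g" and E: "X.plan E"
 shows "AE y in \<nu>. AE u in E >< lborel. \<bar>slope (%x. f (x, y)) (fst u) (snd u)\<bar> <= N (1, 0) * g (pos u, y) * speed X (fst u) (snd u)"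
  and "AE y in \<nu>. AE u in E >< lborel. incr (%x. f (x, y)) \<alpha> (fst u) (snd u)"
proof -
 obtain D where D: "AE y in \<nu>. X.wug (%x. f (x, y)) (%x. D (x, y)) & (AE x in \<mu>. D (x, y) <= N (1, 0) * g (x, y))"
  using gradient_X[OF f fl wug] by (auto elim: eventually_mono)
 note s = X.slice_slope[OF f E D]
 show "AE y in \<nu>. AE u in E >< lborel. \<bar>slope (%x. f (x, y)) (fst u) (snd u)\<bar> <= N (1, 0) * g (pos u, y) * speed X (fst u) (snd u)"
  by (rule s(1))
 show "AE y in \<nu>. AE u in E >< lborel. incr (%x. f (x, y)) \<alpha> (fst u) (snd u)" by (rule s(2))
qed

lemma slope_slice_Y:
 assumes f[measurable]: "f : Borel \<pi>" and fl: "Z.lp f < \<infinity>" and wug: "Z.wug f g" and T: "Y.plan T"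
 shows "AE x in \<mu>. AE v in T >< lborel. \<bar>slope (%y. f (x, y)) (fst v) (snd v)\<bar> <= N (0, 1) * g (x, pos v) * speed Y (fst v) (snd v)"
  and "AE x in \<mu>. AE v in T >< lborel. incr (%y. f (x, y)) \<alpha> (fst v) (snd v)"
proof -
 obtain D where D: "AE x in \<mu>. Y.wug (%y. f (x, y)) (%y. D (x, y)) & (AE y in \<nu>. D (x, y) <= N (0, 1) * g (x, y))"
  using gradient_Y[OF f fl wug] by (auto elim: eventually_mono)
 have f': "(%w. f (snd w, fst w)) : Borel (\<nu> >< \<mu>)" by measurable
 note s = Y.slice_slope[OF f' T, where D="%w. D (snd w, fst w)" and g="%w. g (snd w, fst w)", unfolded fst_conv snd_conv, OF D]
 show "AE x in \<mu>. AE v in T >< lborel. \<bar>slope (%y. f (x, y)) (fst v) (snd v)\<bar> <= N (0, 1) * g (x, pos v) * speed Y (fst v) (snd v)"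
  by (rule s(1))
 show "AE x in \<mu>. AE v in T >< lborel. incr (%y. f (x, y)) \<alpha> (fst v) (snd v)" by (rule s(2))
qed

lemma box_measurable:
 assumes E: "X.plan E" and T: "Y.plan T" and f: "f : Borel \<pi>" and g: "g : Borel \<pi>"
  and \<phi>: "\<phi> : measurable M E" and \<psi>: "\<psi> : measurable M T" and \<rho>: "\<rho> : Borel M" and \<sigma>: "\<sigma> : Borel M"
 shows "(%w. slope (%x. f (x, \<psi> w (cl (\<sigma> w)))) (\<phi> w) (\<rho> w)) : Borel M"
  and "(%w. slope (%y. f (\<phi> w (cl (\<rho> w)), y)) (\<psi> w) (\<sigma> w)) : Borel M"
  and "(%w. g (\<phi> w (cl (\<rho> w)), \<psi> w (cl (\<sigma> w)))) : Borel M"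
  and "(%w. speed X (\<phi> w) (\<rho> w)) : Borel M"
  and "(%w. speed Y (\<psi> w) (\<sigma> w)) : Borel M"
proof -
 note [measurable] = f g
 note se = X.plan_sets[OF E] and st = Y.plan_sets[OF T]
 have e1[measurable]: "(%w. \<phi> w (cl (\<rho> w))) : measurable M \<mu>" by (rule X.measurable_ev[OF se \<phi> \<rho>])
 have e2[measurable]: "(%w. \<psi> w (cl (\<sigma> w))) : measurable M \<nu>" by (rule Y.measurable_ev[OF st \<psi> \<sigma>])
 have f': "(%w. f (snd w, fst w)) : Borel (\<nu> >< \<mu>)" by measurable
 show "(%w. slope (%x. f (x, \<psi> w (cl (\<sigma> w)))) (\<phi> w) (\<rho> w)) : Borel M"
  by (rule X.measurable_slope_slice[OF se \<phi> \<rho> e2 f])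
 show "(%w. slope (%y. f (\<phi> w (cl (\<rho> w)), y)) (\<psi> w) (\<sigma> w)) : Borel M"
  using Y.measurable_slope_slice[OF st \<psi> \<sigma> e1 f'] by simp
 show "(%w. g (\<phi> w (cl (\<rho> w)), \<psi> w (cl (\<sigma> w)))) : Borel M" by measurable
 show "(%w. speed X (\<phi> w) (\<rho> w)) : Borel M" by (rule X.measurable_sp[OF se \<phi> \<rho>])
 show "(%w. speed Y (\<psi> w) (\<sigma> w)) : Borel M" by (rule Y.measurable_sp[OF st \<psi> \<sigma>])
qed

text \<open>The Young inequality separates the gradient from the speeds. The gradient is integrable over pairs by
bounded compression, the speeds by finite energy.\<close>
lemma box_integrable:
 assumes wug: "Z.wug f g" and \<eta>: "X.plan \<eta>" and T: "Y.plan T"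
 shows "AE w in \<eta> >< T. integrable lborel (%z. indicator ({0<..<1} \<times> {0<..<1}) z *
  (g (pt w z) * (speed X (fst w) (fst z) + speed Y (snd w) (snd z))))"
proof -
 interpret \<eta>: prob_space \<eta> using \<eta> by (rule X.plan_prob)
 interpret T: prob_space T using T by (rule Y.plan_prob)
 interpret ET: pair_prob_space \<eta> T ..
 interpret BIG: pair_sigma_finite "\<eta> >< T" "lborel >< lborel :: (real \<times> real) measure" ..
 let ?Q = "{0<..<1::real} \<times> {0<..<1::real}"
 have g[measurable]: "g : Borel \<pi>" and gl: "Z.lp g < \<infinity>" and gp: "!!w. w : space \<pi> ==> 0 <= g w"
  using wug by (auto simp: Z.wug_iff)
 note se = X.plan_sets[OF \<eta>] and st = Y.plan_sets[OF T]
 have EV: "AE w in \<eta> >< T. (\<integral>\<^sup>+t. ennreal (speed X (fst w) t powr X.q) \<partial>lborel) < \<infinity>"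
 proof (rule AE_fstI[OF T.sigma_finite_measure_axioms])
  have "X.energy \<eta> < \<infinity>" using X.plan_bounds[OF \<eta>] of_nat_less_top order_le_less_trans by fastforce
  then have "(\<integral>\<^sup>+c. \<integral>\<^sup>+t. ennreal (speed X c t powr X.q) \<partial>lborel \<partial>\<eta>) ~= \<infinity>" by (simp add: X.energy_def)
  from nn_integral_PInf_AE[OF X.energy_measurable[OF se] this]
  show "AE c in \<eta>. (\<integral>\<^sup>+t. ennreal (speed X c t powr X.q) \<partial>lborel) < \<infinity>" by eventually_elim (simp add: less_top)
 qed
 have EW: "AE w in \<eta> >< T. (\<integral>\<^sup>+t. ennreal (speed Y (snd w) t powr X.q) \<partial>lborel) < \<infinity>"
 proof (rule AE_sndI[OF T.sigma_finite_measure_axioms])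
  have "Y.energy T < \<infinity>" using Y.plan_bounds[OF T] of_nat_less_top order_le_less_trans by fastforce
  then have "(\<integral>\<^sup>+c. \<integral>\<^sup>+t. ennreal (speed Y c t powr X.q) \<partial>lborel \<partial>T) ~= \<infinity>" by (simp add: Y.energy_def)
  from nn_integral_PInf_AE[OF Y.energy_measurable[OF st] this]
  show "AE c in T. (\<integral>\<^sup>+t. ennreal (speed Y c t powr X.q) \<partial>lborel) < \<infinity>" by eventually_elim (simp add: less_top)
 qed
 have EG: "AE w in \<eta> >< T. (\<integral>\<^sup>+z. indicator ?Q z * ennreal (\<bar>g (pt w z)\<bar> powr p) \<partial>(lborel >< lborel)) < \<infinity>"
 proof -
  obtain n :: nat where n: "!!r s G. G : Borel \<pi> ==> (\<integral>\<^sup>+w. G (fst w (cl r), snd w (cl s)) \<partial>(\<eta> >< T)) <= of_nat n * (\<integral>\<^sup>+z. G z \<partial>\<pi>)"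
   using compress_pair[OF \<eta> T] by blast
  have [measurable]: "(%w. g (pt (fst w) (snd w))) : Borel ((\<eta> >< T) >< (lborel >< lborel))"
   by (rule box_measurable(3)[OF \<eta> T g g]) measurable
  have gz: "(%w. g (fst w (cl r), snd w (cl s))) : Borel (\<eta> >< T)" for r s
   using box_measurable(3)[OF \<eta> T g g, of fst "\<eta> >< T" snd "%_. r" "%_. s"] by simp
  have m: "(%w. indicator ?Q (snd w) * ennreal (\<bar>g (pt (fst w) (snd w))\<bar> powr p)) : Borel ((\<eta> >< T) >< (lborel >< lborel))"
   by measurable
  have m': "(%(w, z). indicator ?Q z * ennreal (\<bar>g (pt w z)\<bar> powr p)) : Borel ((\<eta> >< T) >< (lborel >< lborel))"
   using m by (simp add: split_beta')
  have "(\<integral>\<^sup>+w. \<integral>\<^sup>+z. indicator ?Q z * ennreal (\<bar>g (pt w z)\<bar> powr p) \<partial>(lborel >< lborel) \<partial>(\<eta> >< T))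
   = (\<integral>\<^sup>+z. \<integral>\<^sup>+w. indicator ?Q z * ennreal (\<bar>g (pt w z)\<bar> powr p) \<partial>(\<eta> >< T) \<partial>(lborel >< lborel))"
   by (rule BIG.Fubini'[OF m', symmetric])
  also have "... <= (\<integral>\<^sup>+z. (of_nat n * Z.lp g) * indicator ?Q z \<partial>(lborel >< lborel))"
  proof (rule nn_integral_mono)
   fix z :: "real \<times> real"
   have "(\<integral>\<^sup>+w. ennreal (\<bar>g (pt w z)\<bar> powr p) \<partial>(\<eta> >< T)) <= of_nat n * Z.lp g"
    using n[of "%z. ennreal (\<bar>g z\<bar> powr p)" "fst z" "snd z"] unfolding Z.lp_def by measurable
   then show "(\<integral>\<^sup>+w. indicator ?Q z * ennreal (\<bar>g (pt w z)\<bar> powr p) \<partial>(\<eta> >< T)) <= (of_nat n * Z.lp g) * indicator ?Q z"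
    by (cases "z : ?Q") simp_all
  qed
  also have "... = of_nat n * Z.lp g * emeasure (lborel >< lborel) ?Q" by (rule nn_integral_cmult_indicator) simp
  also have "emeasure (lborel >< lborel) ?Q = 1" by (simp add: lborel.emeasure_pair_measure_Times)
  also have "of_nat n * Z.lp g * 1 < \<infinity>" using gl by (simp add: ennreal_mult_less_top of_nat_less_top)
  finally have fin: "(\<integral>\<^sup>+w. \<integral>\<^sup>+z. indicator ?Q z * ennreal (\<bar>g (pt w z)\<bar> powr p) \<partial>(lborel >< lborel) \<partial>(\<eta> >< T)) ~= \<infinity>" by simp
  have "(%w. \<integral>\<^sup>+z. indicator ?Q z * ennreal (\<bar>g (pt w z)\<bar> powr p) \<partial>(lborel >< lborel)) : Borel (\<eta> >< T)"
   using lborel_pair.borel_measurable_nn_integral_fst[OF m] by simp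
  from nn_integral_PInf_AE[OF this fin] show ?thesis by eventually_elim (simp add: less_top)
 qed
 show ?thesis using EV EW EG AE_space
 proof eventually_elim
  case (elim w)
  note V = elim(1) and W = elim(2) and G = elim(3) and w = elim(4)
  have w': "fst w : space \<eta>" "snd w : space T" using w by (auto simp: space_pair_measure)
  have bm: "(%_. fst w) : measurable (lborel >< lborel) \<eta>" "(%_. snd w) : measurable (lborel >< lborel) T" using w' by auto
  have [measurable]: "(%z. g (pt w z)) : Borel (lborel >< lborel)"
   "(%z. speed X (fst w) (fst z)) : Borel (lborel >< lborel)" "(%z. speed Y (snd w) (snd z)) : Borel (lborel >< lborel)"
   by (rule box_measurable(3-5)[OF \<eta> T g g bm]; measurable)+
  have [measurable]: "speed X (fst w) : Borel borel" "speed Y (snd w) : Borel borel"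
   using X.measurable_sp[OF se, of "%_. fst w" borel "%x. x"] Y.measurable_sp[OF st, of "%_. snd w" borel "%x. x"] w' by simp_all
  have gpos: "0 <= g (fst w (cl r), snd w (cl s))" for r s
   using gp[of "(fst w (cl r), snd w (cl s))"] w' curve_in[of "fst w" X r] curve_in[of "snd w" Y s]
   by (simp add: space_pair_measure X.plan_space[OF \<eta>] Y.plan_space[OF T] X.space_m Y.space_m)
  let ?E = "%z. g (pt w z) * (speed X (fst w) (fst z) + speed Y (snd w) (snd z))"
  have E0: "0 <= ?E z" for z using gpos by simp
  let ?v = "%z. indicator ?Q z * ennreal (speed X (fst w) (fst z) powr X.q)" and ?u = "%z. indicator ?Q z * ennreal (speed Y (snd w) (snd z) powr X.q)"
   and ?g = "%z. indicator ?Q z * ennreal (\<bar>g (pt w z)\<bar> powr p)"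
  have "(\<integral>\<^sup>+z. ennreal (norm (indicator ?Q z * ?E z)) \<partial>(lborel >< lborel)) <= (\<integral>\<^sup>+z. ?v z + ?u z + (?g z + ?g z) \<partial>(lborel >< lborel))"
  proof (rule nn_integral_mono)
   fix z :: "real \<times> real"
   have y1: "g (pt w z) * speed X (fst w) (fst z) <= speed X (fst w) (fst z) powr X.q + \<bar>g (pt w z)\<bar> powr p"
    using X.young[of "speed X (fst w) (fst z)" "g (pt w z)" 1] gpos by simp
   have y2: "g (pt w z) * speed Y (snd w) (snd z) <= speed Y (snd w) (snd z) powr X.q + \<bar>g (pt w z)\<bar> powr p"
    using X.young[of "speed Y (snd w) (snd z)" "g (pt w z)" 1] gpos by simp
   have "?E z <= speed X (fst w) (fst z) powr X.q + speed Y (snd w) (snd z) powr X.q + (\<bar>g (pt w z)\<bar> powr p + \<bar>g (pt w z)\<bar> powr p)"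
    using y1 y2 by (simp add: distrib_left)
   from ennreal_leI[OF this] show "ennreal (norm (indicator ?Q z * ?E z)) <= ?v z + ?u z + (?g z + ?g z)"
    using E0[of z] by (cases "z : ?Q") (simp_all add: ennreal_plus[symmetric] del: ennreal_plus)
  qed
  also have "... = (\<integral>\<^sup>+z. ?v z \<partial>(lborel >< lborel)) + (\<integral>\<^sup>+z. ?u z \<partial>(lborel >< lborel)) + ((\<integral>\<^sup>+z. ?g z \<partial>(lborel >< lborel)) + (\<integral>\<^sup>+z. ?g z \<partial>(lborel >< lborel)))"
   by (simp add: nn_integral_add)
  also have "... < \<infinity>"
  proof -
   have vm: "?v : Borel (lborel >< lborel)" and um: "?u : Borel (lborel >< lborel)" by measurable
   have "(\<integral>\<^sup>+z. ?v z \<partial>(lborel >< lborel)) = (\<integral>\<^sup>+r. \<integral>\<^sup>+s. ?v (r, s) \<partial>lborel \<partial>lborel)" by (rule lborel.nn_integral_fst[OF vm, symmetric])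
   also have "... <= (\<integral>\<^sup>+r. ennreal (speed X (fst w) r powr X.q) \<partial>lborel)"
   proof (rule nn_integral_mono)
    fix r :: real
    have "(\<integral>\<^sup>+s. ?v (r, s) \<partial>lborel) <= (\<integral>\<^sup>+s. ennreal (speed X (fst w) r powr X.q) * indicator {0<..<1::real} s \<partial>lborel)"
     by (intro nn_integral_mono) (auto simp: indicator_def)
    then show "(\<integral>\<^sup>+s. ?v (r, s) \<partial>lborel) <= ennreal (speed X (fst w) r powr X.q)" by (simp add: nn_integral_cmult_indicator)
   qed
   finally have 1: "(\<integral>\<^sup>+z. ?v z \<partial>(lborel >< lborel)) < \<infinity>" using V by (rule order_le_less_trans)
   have "(\<integral>\<^sup>+z. ?u z \<partial>(lborel >< lborel)) = (\<integral>\<^sup>+s. \<integral>\<^sup>+r. ?u (r, s) \<partial>lborel \<partial>lborel)" by (rule lborel_pair.nn_integral_snd[OF um, symmetric])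
   also have "... <= (\<integral>\<^sup>+s. ennreal (speed Y (snd w) s powr X.q) \<partial>lborel)"
   proof (rule nn_integral_mono)
    fix s :: real
    have "(\<integral>\<^sup>+r. ?u (r, s) \<partial>lborel) <= (\<integral>\<^sup>+r. ennreal (speed Y (snd w) s powr X.q) * indicator {0<..<1::real} r \<partial>lborel)"
     by (intro nn_integral_mono) (auto simp: indicator_def)
    then show "(\<integral>\<^sup>+r. ?u (r, s) \<partial>lborel) <= ennreal (speed Y (snd w) s powr X.q)" by (simp add: nn_integral_cmult_indicator)
   qed
   finally have 2: "(\<integral>\<^sup>+z. ?u z \<partial>(lborel >< lborel)) < \<infinity>" using W by (rule order_le_less_trans)
   show ?thesis using 1 2 G by simp
  qed
  finally have "integrable (lborel >< lborel) (%z. indicator ?Q z * ?E z)"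
   by (intro integrableI_bounded) auto
  then show ?case unfolding lborel_prod .
 qed
qed

end

section \<open>The flux inequality\<close>

context tensor
begin

lemma incr_transport_X:
 assumes f[measurable]: "f : Borel \<pi>" and fl: "Z.lp f < \<infinity>" and wug: "Z.wug f g"
  and E: "X.plan E" and T: "Y.plan T"
 shows "AE w in E >< T. AE z in lborel. incr (%x. f (x, snd w (cl (snd z)))) \<alpha> (fst w) (fst z)"
  and "AE w in E >< T. AE z in lborel. \<bar>slope (%x. f (x, snd w (cl (snd z)))) (fst w) (fst z)\<bar> <= N (1, 0) * g (pt w z) * speed X (fst w) (fst z)"
proof -
 have g: "g : Borel \<pi>" using wug by (simp add: Z.wug_iff)
 note m = X.slice_slope_measurable[OF E f g] and s = slope_slice_X[OF f fl wug E]
 show "AE w in E >< T. AE z in lborel. incr (%x. f (x, snd w (cl (snd z)))) \<alpha> (fst w) (fst z)"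
  by (rule transport_X[OF E T, of "%c r y. incr (%x. f (x, y)) \<alpha> c r", OF m(2) s(2)])
 show "AE w in E >< T. AE z in lborel. \<bar>slope (%x. f (x, snd w (cl (snd z)))) (fst w) (fst z)\<bar> <= N (1, 0) * g (pt w z) * speed X (fst w) (fst z)"
  by (rule transport_X[OF E T, of "%c r y. \<bar>slope (%x. f (x, y)) c r\<bar> <= N (1, 0) * g (c (cl r), y) * speed X c r", OF m(1) s(1)])
qed

lemma incr_transport_Y:
 assumes f[measurable]: "f : Borel \<pi>" and fl: "Z.lp f < \<infinity>" and wug: "Z.wug f g"
  and E: "X.plan E" and T: "Y.plan T"
 shows "AE w in E >< T. AE z in lborel. incr (%y. f (fst w (cl (fst z)), y)) \<alpha> (snd w) (snd z)"
  and "AE w in E >< T. AE z in lborel. \<bar>slope (%y. f (fst w (cl (fst z)), y)) (snd w) (snd z)\<bar> <= N (0, 1) * g (pt w z) * speed Y (snd w) (snd z)"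
proof -
 have [measurable]: "g : Borel \<pi>" using wug by (simp add: Z.wug_iff)
 have fg: "(%w. f (snd w, fst w)) : Borel (\<nu> >< \<mu>)" "(%w. g (snd w, fst w)) : Borel (\<nu> >< \<mu>)" by measurable
 note m = Y.slice_slope_measurable[OF T fg, unfolded fst_conv snd_conv] and s = slope_slice_Y[OF f fl wug T]
 show "AE w in E >< T. AE z in lborel. incr (%y. f (fst w (cl (fst z)), y)) \<alpha> (snd w) (snd z)"
  by (rule transport_Y[OF E T, of "%c r x. incr (%y. f (x, y)) \<alpha> c r", OF m(2) s(2)])
 show "AE w in E >< T. AE z in lborel. \<bar>slope (%y. f (fst w (cl (fst z)), y)) (snd w) (snd z)\<bar> <= N (0, 1) * g (pt w z) * speed Y (snd w) (snd z)"
  by (rule transport_Y[OF E T, of "%c r x. \<bar>slope (%y. f (x, y)) c r\<bar> <= N (0, 1) * g (x, c (cl r)) * speed Y c r", OF m(1) s(1)])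
qed

lemma flux_AE:
 assumes f: "f : Borel \<pi>" and fl: "Z.lp f < \<infinity>" and wug: "Z.wug f g"
  and \<eta>: "X.plan \<eta>" and T: "Y.plan T"
 shows "AE w in \<eta> >< T. AE z in lborel. 0 < fst z --> fst z < 1 --> 0 < snd z --> snd z < 1 -->
  \<bar>a * slope (%x. f (x, snd w (cl (snd z)))) (fst w) (fst z) + b * slope (%y. f (fst w (cl (fst z)), y)) (snd w) (snd z)\<bar>
   <= g (pt w z) * N (\<bar>a\<bar> * speed X (fst w) (fst z), \<bar>b\<bar> * speed Y (snd w) (snd z))"
proof -
 interpret \<eta>: prob_space \<eta> using \<eta> by (rule X.plan_prob)
 interpret T: prob_space T using T by (rule Y.plan_prob)
 interpret ET: pair_prob_space \<eta> T ..
 interpret BIG: pair_sigma_finite "\<eta> >< T" "lborel >< lborel :: (real \<times> real) measure" ..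
 note se = X.plan_sets[OF \<eta>] and st = Y.plan_sets[OF T]
 have g: "g : Borel \<pi>" and gp: "!!w. w : space \<pi> ==> 0 <= g w"
  using wug by (auto simp: Z.wug_iff)
 let ?ak = "%k. a / real (Suc k)" and ?bk = "%k. b / real (Suc k)"
 have A1: "AE w in \<eta> >< T. ALL k. AE z in lborel. incr (%x. f (x, snd w (cl (snd z)))) (?ak k) (fst w) (fst z)"
  unfolding AE_all_countable using incr_transport_X(1)[OF f fl wug \<eta> T] by blast
 have A2: "AE w in \<eta> >< T. ALL k. AE z in lborel. incr (%y. f (fst w (cl (fst z)), y)) (?bk k) (snd w) (snd z)"
  unfolding AE_all_countable using incr_transport_Y(1)[OF f fl wug \<eta> T] by blast
 have A5: "AE w in \<eta> >< T. ALL k. AE z in lborel. flux_bound f g (?ak k) (?bk k) (fst w) (snd w) (fst z) (snd z)"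
  unfolding AE_all_countable
 proof
  fix k
  have m: "{w : space ((\<eta> >< T) >< (lborel >< lborel)). flux_bound f g (?ak k) (?bk k) (fst (fst w)) (snd (fst w)) (fst (snd w)) (snd (snd w))} : sets ((\<eta> >< T) >< (lborel >< lborel))"
   by (rule measurable_flux_bound[OF se st f g]) measurable
  have "AE z in lborel >< lborel. AE w in \<eta> >< T. flux_bound f g (?ak k) (?bk k) (fst w) (snd w) (fst z) (snd z)"
   by (intro AE_I2 flux_bound_AE[OF wug \<eta> T])
  then show "AE w in \<eta> >< T. AE z in lborel. flux_bound f g (?ak k) (?bk k) (fst w) (snd w) (fst z) (snd z)"
   using BIG.AE_commute[of "%w z. flux_bound f g (?ak k) (?bk k) (fst w) (snd w) (fst z) (snd z)", OF m] unfolding lborel_prod by blast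
 qed
 show ?thesis using A1 A2 incr_transport_X(2)[OF f fl wug \<eta> T] incr_transport_Y(2)[OF f fl wug \<eta> T] A5 box_integrable[OF wug \<eta> T] AE_space
 proof (eventually_elim, goal_cases)
  case (1 w)
  let ?Q = "{0<..<1::real} \<times> {0<..<1::real}"
  define s1 where "s1 z = slope (%x. f (x, snd w (cl (snd z)))) (fst w) (fst z)" for z
  define s2 where "s2 z = slope (%y. f (fst w (cl (fst z)), y)) (snd w) (snd z)" for z
  define gz where "gz z = g (pt w z)" for z
  define V where "V z = speed X (fst w) (fst z)" for z :: "real \<times> real"
  define W where "W z = speed Y (snd w) (snd z)" for z :: "real \<times> real"
  have w: "fst w : space \<eta>" "snd w : space T" using 1(7) by (auto simp: space_pair_measure)
  have bm: "(%_. fst w) : measurable (lborel >< lborel) \<eta>" "(%_. snd w) : measurable (lborel >< lborel) T" using w by auto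
  have fs: "fst : Borel (lborel >< lborel :: (real \<times> real) measure)" "snd : Borel (lborel >< lborel :: (real \<times> real) measure)" by measurable
  note bx = box_measurable[OF \<eta> T f g bm fs, unfolded lborel_prod, folded s1_def s2_def gz_def V_def W_def]
  note [measurable] = bx
  have Qm[measurable]: "?Q : sets borel" by (simp add: borel_prod[symmetric])
  have gpos: "0 <= gz z" for z
   using gp[of "(pt w z)"] w curve_in[of "fst w" X "fst z"] curve_in[of "snd w" Y "snd z"]
   by (simp add: gz_def space_pair_measure X.plan_space[OF \<eta>] Y.plan_space[OF T] X.space_m Y.space_m)
  have VW: "0 <= V z" "0 <= W z" for z by (auto simp: V_def W_def)
  have E: "integrable lborel (%z. indicator ?Q z * (gz z * (V z + W z)))" using 1(6) by (simp only: gz_def V_def W_def)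
  \<comment> \<open>outside the square a slope is constant in the time of the other curve, hence not integrable\<close>
  define d1 where "d1 z = indicator ?Q z * s1 z" for z
  define d2 where "d2 z = indicator ?Q z * s2 z" for z
  define H where "H z = indicator ?Q z * (gz z * N (\<bar>a\<bar> * V z, \<bar>b\<bar> * W z))" for z
  have d1: "integrable lborel d1"
  proof (rule Bochner_Integration.integrable_bound[OF integrable_mult_right[OF E, of "N (1, 0)"]])
   show "d1 : Borel lborel" unfolding d1_def by measurable
   show "AE z in lborel. norm (d1 z) <= norm (N (1, 0) * (indicator ?Q z * (gz z * (V z + W z))))"
    using 1(3)
   proof eventually_elim
    case (elim z)
    have "\<bar>s1 z\<bar> <= N (1, 0) * (gz z * V z)" using elim by (simp only: s1_def gz_def V_def mult.assoc)
    also have "... <= N (1, 0) * (gz z * (V z + W z))" using gpos VW N_nonneg by (intro mult_left_mono) auto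
    finally show ?case using gpos VW N_nonneg by (cases "z : ?Q") (simp_all add: d1_def)
   qed
  qed
  have d2: "integrable lborel d2"
  proof (rule Bochner_Integration.integrable_bound[OF integrable_mult_right[OF E, of "N (0, 1)"]])
   show "d2 : Borel lborel" unfolding d2_def by measurable
   show "AE z in lborel. norm (d2 z) <= norm (N (0, 1) * (indicator ?Q z * (gz z * (V z + W z))))"
    using 1(4)
   proof eventually_elim
    case (elim z)
    have "\<bar>s2 z\<bar> <= N (0, 1) * (gz z * W z)" using elim by (simp only: s2_def gz_def W_def mult.assoc)
    also have "... <= N (0, 1) * (gz z * (V z + W z))" using gpos VW N_nonneg by (intro mult_left_mono) auto
    finally show ?case using gpos VW N_nonneg by (cases "z : ?Q") (simp_all add: d2_def)
   qed
  qed
  have Hpos: "0 <= H z" for z unfolding H_def using gpos N_nonneg by simp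
  define K where "K = \<bar>a\<bar> * N (1, 0) + \<bar>b\<bar> * N (0, 1)"
  have H: "integrable lborel H"
  proof (rule Bochner_Integration.integrable_bound[OF integrable_mult_right[OF E, of K]])
   show "H : Borel lborel" unfolding H_def by measurable
   have K0: "0 <= K" unfolding K_def using N_nonneg by simp
   show "AE z in lborel. norm (H z) <= norm (K * (indicator ?Q z * (gz z * (V z + W z))))"
   proof (rule AE_I2)
    fix z
    have "N (\<bar>a\<bar> * V z, \<bar>b\<bar> * W z) <= \<bar>a\<bar> * V z * N (1, 0) + \<bar>b\<bar> * W z * N (0, 1)"
     using N_le[of "\<bar>a\<bar> * V z" "\<bar>b\<bar> * W z"] VW by simp
    also have "... <= (\<bar>a\<bar> * N (1, 0)) * (V z + W z) + (\<bar>b\<bar> * N (0, 1)) * (V z + W z)"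
     using VW[of z] N_nonneg[of "(1, 0)"] N_nonneg[of "(0, 1)"] by (simp add: distrib_left mult_ac)
    also have "... = K * (V z + W z)" unfolding K_def by (simp add: distrib_right)
    finally have "gz z * N (\<bar>a\<bar> * V z, \<bar>b\<bar> * W z) <= gz z * (K * (V z + W z))" by (rule mult_left_mono) (rule gpos)
    then show "norm (H z) <= norm (K * (indicator ?Q z * (gz z * (V z + W z))))"
     using gpos[of z] VW[of z] K0 N_nonneg by (cases "z : ?Q") (simp_all add: H_def mult_ac)
   qed
  qed
  define F where "F r s = f (fst w (cl r), snd w (cl s))" for r s
  have "AE z in lborel. 0 < fst z --> fst z < 1 --> 0 < snd z --> snd z < 1 --> \<bar>a * d1 z + b * d2 z\<bar> <= H z"
  proof (rule AE_box_flux[where F=F, OF d1 d2 H Hpos])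
   fix k
   show "AE z in lborel. 0 < fst z & fst z < 1 & 0 < snd z & snd z < 1 & 0 < fst z + ?ak k & fst z + ?ak k < 1 -->
    F (fst z + ?ak k) (snd z) - F (fst z) (snd z) = prim (%x. d1 (x, snd z)) (fst z + ?ak k) - prim (%x. d1 (x, snd z)) (fst z)"
    using spec[OF 1(1), of k]
   proof (eventually_elim, intro impI)
    fix z assume i: "incr (%x. f (x, snd w (cl (snd z)))) (?ak k) (fst w) (fst z)"
     and z: "0 < fst z & fst z < 1 & 0 < snd z & snd z < 1 & 0 < fst z + ?ak k & fst z + ?ak k < 1"
    have e: "(%x. d1 (x, snd z)) = (%x. indicator {0<..<1} x * slope (%x. f (x, snd w (cl (snd z)))) (fst w) x)"
     using z by (auto simp: d1_def s1_def indicator_def)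
    show "F (fst z + ?ak k) (snd z) - F (fst z) (snd z) = prim (%x. d1 (x, snd z)) (fst z + ?ak k) - prim (%x. d1 (x, snd z)) (fst z)"
     unfolding e F_def using i z unfolding incr_def by blast
   qed
   show "AE z in lborel. 0 < fst z & fst z < 1 & 0 < snd z & snd z < 1 & 0 < snd z + ?bk k & snd z + ?bk k < 1 -->
    F (fst z) (snd z + ?bk k) - F (fst z) (snd z) = prim (%y. d2 (fst z, y)) (snd z + ?bk k) - prim (%y. d2 (fst z, y)) (snd z)"
    using spec[OF 1(2), of k]
   proof (eventually_elim, intro impI)
    fix z assume i: "incr (%y. f (fst w (cl (fst z)), y)) (?bk k) (snd w) (snd z)"
     and z: "0 < fst z & fst z < 1 & 0 < snd z & snd z < 1 & 0 < snd z + ?bk k & snd z + ?bk k < 1"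
    have e: "(%y. d2 (fst z, y)) = (%x. indicator {0<..<1} x * slope (%y. f (fst w (cl (fst z)), y)) (snd w) x)"
     using z by (auto simp: d2_def s2_def indicator_def)
    show "F (fst z) (snd z + ?bk k) - F (fst z) (snd z) = prim (%y. d2 (fst z, y)) (snd z + ?bk k) - prim (%y. d2 (fst z, y)) (snd z)"
     unfolding e F_def using i z unfolding incr_def by blast
   qed
   show "AE z in lborel. 0 < fst z & fst z < 1 & 0 < snd z & snd z < 1 &
     0 < fst z + ?ak k & fst z + ?ak k < 1 & 0 < snd z + ?bk k & snd z + ?bk k < 1 -->
    ennreal \<bar>F (fst z + ?ak k) (snd z + ?bk k) - F (fst z) (snd z)\<bar> <=
     (\<integral>\<^sup>+l\<in>{0..1}. ennreal (H (fst z + ?ak k * l, snd z + ?bk k * l) / real (Suc k)) \<partial>lborel)"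
    using spec[OF 1(5), of k]
   proof (eventually_elim, intro impI)
    fix z assume fb: "flux_bound f g (?ak k) (?bk k) (fst w) (snd w) (fst z) (snd z)"
     and z: "0 < fst z & fst z < 1 & 0 < snd z & snd z < 1 & 0 < fst z + ?ak k & fst z + ?ak k < 1 & 0 < snd z + ?bk k & snd z + ?bk k < 1"
    have conv: "0 < r + c * l & r + c * l < 1" if "0 < r" "r < 1" "0 < r + c" "r + c < 1" "0 <= l" "l <= 1" for r c l :: real
    proof -
     have e: "r + c * l = (1 - l) * r + l * (r + c)" by (simp add: algebra_simps)
     have "r + c * l \<ge> min r (r + c)" "r + c * l <= max r (r + c)"
      unfolding e using that convex_bound_le[of r "max r (r + c)" "r + c" "1 - l" l] convex_bound_le[of "- r" "- min r (r + c)" "- (r + c)" "1 - l" l]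
      by (auto simp: algebra_simps)
     then show ?thesis using that by auto
    qed
    have "ennreal \<bar>F (fst z + ?ak k) (snd z + ?bk k) - F (fst z) (snd z)\<bar> <=
     (\<integral>\<^sup>+l\<in>{0..1}. ennreal (g (fst w (cl (fst z + ?ak k * l)), snd w (cl (snd z + ?bk k * l))) * N (\<bar>?ak k\<bar> * speed X (fst w) (fst z + ?ak k * l), \<bar>?bk k\<bar> * speed Y (snd w) (snd z + ?bk k * l))) \<partial>lborel)"
     using fb unfolding flux_bound_def F_def .
    also have "... = (\<integral>\<^sup>+l\<in>{0..1}. ennreal (H (fst z + ?ak k * l, snd z + ?bk k * l) / real (Suc k)) \<partial>lborel)"
    proof (rule nn_integral_cong)
     fix l :: real
     show "ennreal (g (fst w (cl (fst z + ?ak k * l)), snd w (cl (snd z + ?bk k * l))) * N (\<bar>?ak k\<bar> * speed X (fst w) (fst z + ?ak k * l), \<bar>?bk k\<bar> * speed Y (snd w) (snd z + ?bk k * l))) * indicator {0..1} l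
      = ennreal (H (fst z + ?ak k * l, snd z + ?bk k * l) / real (Suc k)) * indicator {0..1} l"
     proof (cases "l : {0..1}")
      case True
      then have inQ: "(fst z + ?ak k * l, snd z + ?bk k * l) : ?Q" using conv[of "fst z" "?ak k" l] conv[of "snd z" "?bk k" l] z by auto
      have "N (\<bar>?ak k\<bar> * speed X (fst w) (fst z + ?ak k * l), \<bar>?bk k\<bar> * speed Y (snd w) (snd z + ?bk k * l))
      = N (1 / real (Suc k) * (\<bar>a\<bar> * speed X (fst w) (fst z + ?ak k * l)), 1 / real (Suc k) * (\<bar>b\<bar> * speed Y (snd w) (snd z + ?bk k * l)))"
      by (simp add: abs_divide del: of_nat_Suc)
      also have "... = N (\<bar>a\<bar> * speed X (fst w) (fst z + ?ak k * l), \<bar>b\<bar> * speed Y (snd w) (snd z + ?bk k * l)) / real (Suc k)"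
      unfolding N_scale by (simp add: abs_divide del: of_nat_Suc)
      finally show ?thesis using inQ by (simp add: H_def gz_def V_def W_def del: of_nat_Suc)
     qed simp
    qed
    finally show "ennreal \<bar>F (fst z + ?ak k) (snd z + ?bk k) - F (fst z) (snd z)\<bar> <=
     (\<integral>\<^sup>+l\<in>{0..1}. ennreal (H (fst z + ?ak k * l, snd z + ?bk k * l) / real (Suc k)) \<partial>lborel)" .
   qed
  qed
  then show ?case
  proof (eventually_elim, intro impI)
   fix z :: "real \<times> real" assume "0 < fst z --> fst z < 1 --> 0 < snd z --> snd z < 1 --> \<bar>a * d1 z + b * d2 z\<bar> <= H z"
    and z: "0 < fst z" "fst z < 1" "0 < snd z" "snd z < 1"
   moreover have "z : ?Q" using z by (simp add: mem_Times_iff)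
   ultimately show "\<bar>a * slope (%x. f (x, snd w (cl (snd z)))) (fst w) (fst z) + b * slope (%y. f (fst w (cl (fst z)), y)) (snd w) (snd z)\<bar>
    <= g (pt w z) * N (\<bar>a\<bar> * speed X (fst w) (fst z), \<bar>b\<bar> * speed Y (snd w) (snd z))"
    by (simp add: d1_def d2_def H_def s1_def s2_def gz_def V_def W_def)
  qed
 qed
qed

text \<open>By continuity the bound extends to all directions; the direction is then weighted by the speeds so that
homogeneity of the norm leaves \<open>N (t, s)\<close>, with no division by a speed.\<close>
lemma flux_pointwise:
 assumes rat: "!!a b. a : \<rat> ==> b : \<rat> ==> \<bar>a * x + b * y\<bar> <= G * N (\<bar>a\<bar> * V, \<bar>b\<bar> * W)"
  and V: "0 <= V" and W: "0 <= W" and G: "0 <= G" and t: "0 <= t" and s: "0 <= s" and N: "N (t, s) <= 1"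
 shows "t * \<bar>x\<bar> * W + s * \<bar>y\<bar> * V <= G * V * W"
proof -
 have real: "\<bar>a * x + b * y\<bar> <= G * N (\<bar>a\<bar> * V, \<bar>b\<bar> * W)" for a b
 proof -
  obtain r where r: "!!n. r n : \<rat>" "r ----> a" using rational_approx[of a] by blast
  obtain r' where r': "!!n. r' n : \<rat>" "r' ----> b" using rational_approx[of b] by blast
  show ?thesis
  proof (rule LIMSEQ_le)
   show "(%n. \<bar>r n * x + r' n * y\<bar>) ----> \<bar>a * x + b * y\<bar>" by (intro tendsto_intros r r')
   show "(%n. G * N (\<bar>r n\<bar> * V, \<bar>r' n\<bar> * W)) ----> G * N (\<bar>a\<bar> * V, \<bar>b\<bar> * W)" by (intro tendsto_intros N_tendsto r r')
  qed (use rat r r' in blast)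
 qed
 \<comment> \<open>the signs make both terms of the directional derivative positive\<close>
 define a where "a = t * W * sgn x"
 define b where "b = s * V * sgn y"
 have ab: "a * x = t * \<bar>x\<bar> * W" "b * y = s * \<bar>y\<bar> * V" by (simp_all add: a_def b_def abs_sgn mult_ac)
 have "t * \<bar>x\<bar> * W + s * \<bar>y\<bar> * V <= G * N (\<bar>a\<bar> * V, \<bar>b\<bar> * W)" using real[of a b] unfolding ab by linarith
 also have "... <= G * N (V * W * t, V * W * s)"
 proof (intro mult_left_mono G N_mono)
  have "\<bar>a\<bar> <= t * W" "\<bar>b\<bar> <= s * V" using t s V W by (auto simp: a_def b_def abs_mult sgn_real_def)
  then show "\<bar>a\<bar> * V <= V * W * t" "\<bar>b\<bar> * W <= V * W * s"
   using mult_right_mono[of "\<bar>a\<bar>" "t * W" V] mult_right_mono[of "\<bar>b\<bar>" "s * V" W] V W by (simp_all add: mult_ac)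
 qed (use V W in auto)
 also have "... = G * (V * W * N (t, s))" using N_scale[of "V * W" t s] V W by simp
 also have "... <= G * (V * W * 1)" using G V W N by (intro mult_left_mono) auto
 finally show ?thesis by (simp add: mult_ac)
qed

theorem flux_inequality:
 assumes f: "f : Borel \<pi>" and fl: "Z.lp f < \<infinity>" and wug: "Z.wug f g"
  and E: "X.plan E" and T: "Y.plan T" and t: "0 <= t" and s: "0 <= s" and ts: "N (t, s) <= 1"
 shows "AE u in E >< lborel. AE v in T >< lborel. 0 < snd u --> snd u < 1 --> 0 < snd v --> snd v < 1 -->
  t * \<bar>slope (%x. f (x, pos v)) (fst u) (snd u)\<bar> * speed Y (fst v) (snd v)
   + s * \<bar>slope (%y. f (pos u, y)) (fst v) (snd v)\<bar> * speed X (fst u) (snd u)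
  <= g (pos u, pos v) * speed X (fst u) (snd u) * speed Y (fst v) (snd v)"
proof -
 interpret E: prob_space E using E by (rule X.plan_prob)
 interpret T: prob_space T using T by (rule Y.plan_prob)
 interpret ET: pair_prob_space E T ..
 interpret EL: pair_sigma_finite E lborel ..
 interpret TL: pair_sigma_finite T lborel ..
 interpret BIG: pair_sigma_finite "E >< T" "lborel >< lborel :: (real \<times> real) measure" ..
 interpret BIG': pair_sigma_finite "E >< lborel" "T >< lborel" ..
 have g: "g : Borel \<pi>" and gp: "!!w. w : space \<pi> ==> 0 <= g w"
  using wug by (auto simp: Z.wug_iff)
 define C where "C c \<omega> r \<sigma> \<longleftrightarrow> (0 < r --> r < 1 --> 0 < \<sigma> --> \<sigma> < 1 -->
  t * \<bar>slope (%x. f (x, \<omega> (cl \<sigma>))) c r\<bar> * speed Y \<omega> \<sigma> + s * \<bar>slope (%y. f (c (cl r), y)) \<omega> \<sigma>\<bar> * speed X c r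
  <= g (c (cl r), \<omega> (cl \<sigma>)) * speed X c r * speed Y \<omega> \<sigma>)" for c \<omega> and r \<sigma> :: real
 have "AE w in E >< T. ALL a:\<rat>. ALL b:\<rat>. AE z in lborel. 0 < fst z --> fst z < 1 --> 0 < snd z --> snd z < 1 -->
  \<bar>a * slope (%x. f (x, snd w (cl (snd z)))) (fst w) (fst z) + b * slope (%y. f (fst w (cl (fst z)), y)) (snd w) (snd z)\<bar>
   <= g (pt w z) * N (\<bar>a\<bar> * speed X (fst w) (fst z), \<bar>b\<bar> * speed Y (snd w) (snd z))"
  unfolding AE_ball_countable[OF countable_rat] using flux_AE[OF f fl wug E T] by blast
 then have "AE w in E >< T. AE z in lborel >< lborel. C (fst w) (snd w) (fst z) (snd z)"
  unfolding lborel_prod using AE_space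
 proof eventually_elim
  case (elim w)
  note a = elim(1) and w = elim(2)
  have w': "fst w : curves X" "snd w : curves Y"
   using w by (auto simp: space_pair_measure X.plan_space[OF E] Y.plan_space[OF T])
  have gpos: "0 <= g (pt w z)" for z :: "real \<times> real"
   using gp[of "(pt w z)"] curve_in[OF w'(1), of "fst z"] curve_in[OF w'(2), of "snd z"]
   by (simp add: space_pair_measure X.space_m Y.space_m)
  have "AE z in lborel. ALL a:\<rat>. ALL b:\<rat>. 0 < fst z --> fst z < 1 --> 0 < snd z --> snd z < 1 -->
   \<bar>a * slope (%x. f (x, snd w (cl (snd z)))) (fst w) (fst z) + b * slope (%y. f (fst w (cl (fst z)), y)) (snd w) (snd z)\<bar>
   <= g (pt w z) * N (\<bar>a\<bar> * speed X (fst w) (fst z), \<bar>b\<bar> * speed Y (snd w) (snd z))"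
   unfolding AE_ball_countable[OF countable_rat] using a .
  then show ?case
  proof (eventually_elim)
   case (elim z)
   show ?case unfolding C_def
    by (intro impI flux_pointwise[OF _ speed_nonneg speed_nonneg gpos t s ts]) (use elim in blast)
  qed
 qed
 moreover have m: "{w : space ((E >< T) >< (lborel >< lborel)). C (fst (fst w)) (snd (fst w)) (fst (snd w)) (snd (snd w))} : sets ((E >< T) >< (lborel >< lborel))"
 proof -
  have m: "(%w. fst (fst w)) : measurable ((E >< T) >< (lborel >< lborel)) E" "(%w. snd (fst w)) : measurable ((E >< T) >< (lborel >< lborel)) T"
   "(%w. fst (snd w)) : Borel ((E >< T) >< (lborel >< lborel))" "(%w. snd (snd w)) : Borel ((E >< T) >< (lborel >< lborel))"
   by measurable
  note [measurable] = box_measurable[OF E T f g m]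
  show ?thesis unfolding C_def by measurable
 qed
 ultimately have "AE w in (E >< T) >< (lborel >< lborel). C (fst (fst w)) (snd (fst w)) (fst (snd w)) (snd (snd w))"
  by (intro BIG.AE_pair_measure) auto
 then have "AE w in (E >< lborel) >< (T >< lborel). C (fst (fst w)) (fst (snd w)) (snd (fst w)) (snd (snd w))"
  using AE_middle_swap[OF E.sigma_finite_measure_axioms T.sigma_finite_measure_axioms sigma_finite_lborel sigma_finite_lborel m] by blast
 from BIG'.AE_pair[OF this] show ?thesis unfolding fst_conv snd_conv C_def .
qed

end

section \<open>Bounding the sum of the partial gradients\<close>

context smm
begin

lemma speed_outside:
 assumes E: "plan E"
 shows "AE u in E >< lborel. (0 < snd u & snd u < 1) \<or> speed Z (fst u) (snd u) = 0"
proof -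
 interpret E: prob_space E using E by (rule plan_prob)
 interpret P: pair_sigma_finite E lborel ..
 have [measurable]: "(%z. speed Z (fst z) (snd z)) : Borel (E >< lborel)" by (rule measurable_sp[OF plan_sets[OF E]]) auto
 have m: "{u : space (E >< lborel). (0 < snd u & snd u < 1) \<or> speed Z (fst u) (snd u) = 0} : sets (E >< lborel)" by measurable
 have "AE c in E. AE t in lborel. (0 < t & t < 1) \<or> speed Z c t = 0"
  using plan_AE[OF E]
 proof eventually_elim
  case (elim c)
  note g = elim(1)
  show ?case
   using AE_speed[OF conjunct1[OF g] conjunct2[OF g]] AE_lborel_singleton[of "0::real"] AE_lborel_singleton[of "1::real"]
   by eventually_elim auto
 qed
 then show ?thesis by (intro P.AE_pair_measure[OF m]) simp
qed

lemma minimal_wugI: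
 assumes D: "wug u D" and min: "!!h. wug u h ==> AE z in m. D z <= h z"
 shows "wug u (minimal_wug Z m p u)" and "AE z in m. minimal_wug Z m p u z = D z"
proof -
 have "wug u (minimal_wug Z m p u) & (ALL h. wug u h --> (AE z in m. minimal_wug Z m p u z <= h z))"
  unfolding minimal_wug_def by (rule someI[where x=D]) (use D min in blast)
 then have a: "wug u (minimal_wug Z m p u)" and b: "AE z in m. minimal_wug Z m p u z <= D z" using D by blast+
 show "wug u (minimal_wug Z m p u)" by (rule a)
 show "AE z in m. minimal_wug Z m p u z = D z" using b min[OF a] by eventually_elim simp
qed

lemma minimal_wug_is_wug:
 assumes u[measurable]: "u : Borel m" and ul: "lp u < \<infinity>" and wug: "wug u g"
 shows "wug u (minimal_wug Z m p u)"
proof -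
 let ?P = "count_space (UNIV :: unit set)"
 have P: "sigma_finite_measure ?P" by (rule sigma_finite_measure_count_space_finite) simp
 have g[measurable]: "g : Borel m" and gl: "lp g < \<infinity>" and gp: "!!z. z : space m ==> 0 <= g z"
  and gw: "!!E. plan E ==> AE c in E. ennreal \<bar>u (c (cl 1)) - u (c (cl 0))\<bar> <= lin g c"
  using wug by (auto simp: wug_iff)
 have m: "(%w. u (fst w)) : Borel (m >< ?P)" "(%w. g (fst w)) : Borel (m >< ?P)" by measurable
 have "EX D:Borel (m >< ?P). (ALL w. 0 <= D w) &
  (AE y in ?P. wug (%z. u (fst (z, y))) (%z. D (z, y)) & (AE z in m. D (z, y) <= g (fst (z, y))) &
   (ALL h. wug (%z. u (fst (z, y))) h --> (AE z in m. D (z, y) <= h z)))"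
  by (rule minimal_slice_gradient[OF P m]) (use gp ul gl gw in simp_all)
 then obtain D where D: "AE y in ?P. wug u (%z. D (z, y)) & (ALL h. wug u h --> (AE z in m. D (z, y) <= h z))"
  unfolding fst_conv by (auto elim: eventually_mono)
 then have "wug u (%z. D (z, ())) & (ALL h. wug u h --> (AE z in m. D (z, ()) <= h z))"
  unfolding AE_count_space by blast
 then show ?thesis by (intro minimal_wugI(1)[of u "%z. D (z, ())"]) blast+
qed

end

context tensor
begin

text \<open>For a fixed curve and time in the first factor, the flux inequality exhibits a weak upper gradient of a
slice in the second factor. Comparison with the minimal one no longer involves the second curve.\<close>
lemma reduced_slope_bound:
 assumes f[measurable]: "f : Borel \<pi>" and fl: "Z.lp f < \<infinity>" and wug: "Z.wug f g"
  and D[measurable]: "D : Borel \<pi>" and D0: "!!w. 0 <= D w"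
  and DD: "AE x in \<mu>. Y.wug (%y. f (x, y)) (%y. D (x, y)) & (AE y in \<nu>. D (x, y) <= N (0, 1) * g (x, y)) &
   (ALL h. Y.wug (%y. f (x, y)) h --> (AE y in \<nu>. D (x, y) <= h y))"
  and E: "X.plan E" and t: "0 < t" and s: "0 < s" and ts: "N (t, s) <= 1"
 shows "AE y in \<nu>. AE u in E >< lborel. t * \<bar>slope (%x. f (x, y)) (fst u) (snd u)\<bar>
  <= max 0 (g (pos u, y) - s * D (pos u, y)) * speed X (fst u) (snd u)"
proof -
 interpret E: prob_space E using E by (rule X.plan_prob)
 interpret EL: pair_sigma_finite E lborel ..
 interpret ELN: pair_sigma_finite "E >< lborel" \<nu> ..
 note se = X.plan_sets[OF E]
 have g[measurable]: "g : Borel \<pi>" and gl: "Z.lp g < \<infinity>" and gp: "!!w. w : space \<pi> ==> 0 <= g w"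
  using wug by (auto simp: Z.wug_iff)
 obtain T where T: "countable T" "!!\<theta>. \<theta> : T ==> Y.plan \<theta>"
  "!!u g. u : Borel \<nu> ==> Y.lp u < \<infinity> ==> g : Borel \<nu> ==> Y.lp g < \<infinity> ==> (!!z. z : space \<nu> ==> 0 <= g z) ==>
   (!!E. E : T ==> AE \<gamma> in E. ennreal \<bar>u (\<gamma> (cl 1)) - u (\<gamma> (cl 0))\<bar> <= Y.lin g \<gamma>) ==> Y.wug u g"
  by (rule Y.countable_test_plans) blast
 let ?m = "(E >< lborel) >< \<nu>"
 have m1: "(%w. fst (fst w)) : measurable ?m E" and m2: "(%w. snd (fst w)) : Borel ?m"
  and m3: "snd : measurable ?m \<nu>" by measurable
 have [measurable]: "(%w. slope (%x. f (x, snd w)) (fst (fst w)) (snd (fst w))) : Borel ?m"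
  by (rule X.measurable_slope_slice[OF se m1 m2 m3 f])
 have [measurable]: "(%w. pos (fst w)) : measurable ?m \<mu>" by (rule X.measurable_ev[OF se m1 m2])
 have [measurable]: "(%w. speed X (fst (fst w)) (snd (fst w))) : Borel ?m" by (rule X.measurable_sp[OF se m1 m2])
 define x where "x u = pos u" for u :: "(real => 'a) \<times> real"
 define V where "V u = speed X (fst u) (snd u)" for u
 define \<delta> where "\<delta> u y = \<bar>slope (%x. f (x, y)) (fst u) (snd u)\<bar>" for u y
 have B1: "AE u in E >< lborel. ALL \<theta>:T. AE v in \<theta> >< lborel. 0 < snd u --> snd u < 1 --> 0 < snd v --> snd v < 1 -->
  t * \<delta> u (pos v) * speed Y (fst v) (snd v) + s * \<bar>slope (%y. f (x u, y)) (fst v) (snd v)\<bar> * V u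
  <= g (x u, pos v) * V u * speed Y (fst v) (snd v)"
  unfolding AE_ball_countable[OF T(1)] x_def V_def \<delta>_def using flux_inequality[OF f fl wug E T(2) _ _ ts] t s by simp
 have "AE x in \<mu>. (Y.wug (%y. f (x, y)) (%y. D (x, y)) &
   (ALL h. Y.wug (%y. f (x, y)) h --> (AE y in \<nu>. D (x, y) <= h y))) & Y.lp (%y. g (x, y)) < \<infinity> & Y.lp (%y. f (x, y)) < \<infinity> & x : space \<mu>"
  using DD lp_slice_Y[OF g gl] lp_slice_Y[OF f fl] AE_space by eventually_elim blast
 from X.plan_null_pair[OF E this, folded x_def]
 have B2: "AE u in E >< lborel. (Y.wug (%y. f (x u, y)) (%y. D (x u, y)) &
   (ALL h. Y.wug (%y. f (x u, y)) h --> (AE y in \<nu>. D (x u, y) <= h y))) & Y.lp (%y. g (x u, y)) < \<infinity> & Y.lp (%y. f (x u, y)) < \<infinity> & x u : space \<mu>" .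
 have B3: "AE u in E >< lborel. AE y in \<nu>. \<delta> u y <= N (1, 0) * g (x u, y) * V u"
 proof -
  have m: "{w : space ?m. \<delta> (fst w) (snd w) <= N (1, 0) * g (x (fst w), snd w) * V (fst w)} : sets ?m" unfolding \<delta>_def x_def V_def by measurable
  show ?thesis using ELN.AE_commute[of "%u y. \<delta> u y <= N (1, 0) * g (x u, y) * V u", OF m] slope_slice_X(1)[OF f fl wug E, folded x_def V_def \<delta>_def] by blast
 qed
 have main: "AE u in E >< lborel. AE y in \<nu>. t * \<delta> u y <= max 0 (g (x u, y) - s * D (x u, y)) * V u"
  using B1 B2 B3 X.speed_outside[OF E, folded V_def] AE_space
 proof (eventually_elim, goal_cases)
  case (1 u)
  note flux = 1(1) and d = 1(2) and sl = 1(3) and out = 1(4)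
  have V0: "0 <= V u" by (simp add: V_def)
  have u: "fst u : space E" using 1(5) by (auto simp: space_pair_measure)
  have xm[measurable]: "x u : space \<mu>" using d by blast
  have gpos: "0 <= g (x u, y)" if "y : space \<nu>" for y using gp[of "(x u, y)"] that xm by (simp add: space_pair_measure)
  show ?case
  proof (cases "V u = 0")
   case True
   show ?thesis using sl by eventually_elim (use True t in \<open>auto simp: \<delta>_def\<close>)
  next
   case False
   then have V: "0 < V u" and r: "0 < snd u" "snd u < 1" using V0 out by auto
   \<comment> \<open>solving the flux inequality for the slope in the second factor\<close>
   define h where "h y = max 0 (g (x u, y) - t * \<delta> u y / V u) / s" for y
   have [measurable]: "(%y. \<delta> u y) : Borel \<nu>"
   proof -
    have "(%y. slope (%x. f (x, y)) (fst u) (snd u)) : Borel \<nu>"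
     by (rule X.measurable_slope_slice[OF se _ _ _ f, of "%_. fst u" \<nu> "%_. snd u" "%y. y"]) (use u in auto)
    then show ?thesis unfolding \<delta>_def by measurable
   qed
   have hm: "h : Borel \<nu>" unfolding h_def by measurable
   have h0: "0 <= h y" for y using s by (simp add: h_def)
   have gm: "(%y. g (x u, y)) : Borel \<nu>" by measurable
   have fm: "(%y. f (x u, y)) : Borel \<nu>" by measurable
   have "Y.lp h <= Y.lp (%y. (1 / s) * g (x u, y))"
   proof (rule Y.lp_mono)
    fix y assume y: "y : space \<nu>"
    have "0 <= t * \<delta> u y / V u" using t V by (simp add: \<delta>_def)
    then have "max 0 (g (x u, y) - t * \<delta> u y / V u) <= g (x u, y)" using gpos[OF y] by simp
    then have "h y <= g (x u, y) / s" unfolding h_def using s by (simp add: divide_right_mono)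
    then show "\<bar>h y\<bar> <= \<bar>(1 / s) * g (x u, y)\<bar>" using h0[of y] s gpos[OF y] by (simp add: abs_of_nonneg)
   qed
   also have "... < \<infinity>" unfolding Y.lp_mult[OF gm] using d by (simp add: ennreal_mult_less_top)
   finally have hl: "Y.lp h < \<infinity>" .
   have "Y.wug (%y. f (x u, y)) h"
   proof (rule T(3)[OF fm _ hm hl h0])
    show "Y.lp (%y. f (x u, y)) < \<infinity>" using d by blast
    fix \<theta> assume \<theta>T: "\<theta> : T"
    then have \<theta>: "Y.plan \<theta>" by (rule T(2))
    interpret \<theta>: prob_space \<theta> using \<theta> by (rule Y.plan_prob)
    interpret TL: pair_sigma_finite \<theta> lborel ..
    have wd: "Y.wug (%y. f (x u, y)) (%y. D (x u, y))" using d by blast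
    have "AE v in \<theta> >< lborel. \<bar>slope (%y. f (x u, y)) (fst v) (snd v)\<bar> <= h (pos v) * speed Y (fst v) (snd v)"
     using bspec[OF flux \<theta>T] Y.slope_AE[OF fm wd \<theta>] Y.speed_outside[OF \<theta>]
    proof eventually_elim
     fix v :: "(real => 'b) \<times> real"
     define W where "W = speed Y (fst v) (snd v)"
     define y where "y = pos v"
     define e where "e = \<bar>slope (%y. f (x u, y)) (fst v) (snd v)\<bar>"
     assume a: "0 < snd u --> snd u < 1 --> 0 < snd v --> snd v < 1 -->
      t * \<delta> u (pos v) * speed Y (fst v) (snd v) + s * \<bar>slope (%y. f (x u, y)) (fst v) (snd v)\<bar> * V u
      <= g (x u, pos v) * V u * speed Y (fst v) (snd v)"
      and b: "\<bar>slope (%y. f (x u, y)) (fst v) (snd v)\<bar> <= D (x u, pos v) * speed Y (fst v) (snd v)"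
      and c: "(0 < snd v & snd v < 1) \<or> speed Y (fst v) (snd v) = 0"
     have "e <= h y * W"
     proof (cases "W = 0")
      case True
      then show ?thesis using b by (simp add: W_def e_def)
     next
      case False
      then have "t * \<delta> u y * W + s * e * V u <= g (x u, y) * V u * W"
      using a c r unfolding W_def y_def e_def by simp
      then have "e * (s * V u) <= (g (x u, y) * V u - t * \<delta> u y) * W" by (simp add: algebra_simps)
      then have "e <= (g (x u, y) * V u - t * \<delta> u y) * W / (s * V u)" using s V by (simp add: pos_le_divide_eq)
      also have "... = (g (x u, y) - t * \<delta> u y / V u) / s * W" using s V by (simp add: field_simps)
      also have "... <= h y * W"
      unfolding h_def using s by (intro mult_right_mono divide_right_mono) (auto simp: W_def)
      finally show ?thesis .
     qed
     then show "\<bar>slope (%y. f (x u, y)) (fst v) (snd v)\<bar> <= h (pos v) * speed Y (fst v) (snd v)"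
      by (simp only: e_def y_def W_def)
    qed
    from TL.AE_pair[OF this]
    have "AE \<omega> in \<theta>. AE \<sigma> in lborel. \<bar>slope (%y. f (x u, y)) \<omega> \<sigma>\<bar> <= h (\<omega> (cl \<sigma>)) * speed Y \<omega> \<sigma>" by simp
    from Y.slope_bound_imp_lin[OF fm wd \<theta> this]
    show "AE \<omega> in \<theta>. ennreal \<bar>f (x u, \<omega> (cl 1)) - f (x u, \<omega> (cl 0))\<bar> <= Y.lin h \<omega>" .
   qed
   then have "AE y in \<nu>. D (x u, y) <= h y" using d by blast
   then show ?thesis using sl AE_space
   proof eventually_elim
    case (elim y)
    note Dh = elim(1) and b = elim(2) and y = elim(3)
    have "t * N (1, 0) <= 1" using N_ge(1)[of t s] t s ts by simp
    then have "(t * N (1, 0)) * (g (x u, y) * V u) <= 1 * (g (x u, y) * V u)"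
     using gpos[OF y] V0 by (intro mult_right_mono) auto
    moreover have "t * \<delta> u y <= t * (N (1, 0) * g (x u, y) * V u)" using b t by simp
    ultimately have "t * \<delta> u y <= g (x u, y) * V u" by (simp add: mult_ac)
    then have "t * \<delta> u y / V u <= g (x u, y)" using V by (simp add: pos_divide_le_eq)
    then have "h y * s = g (x u, y) - t * \<delta> u y / V u" using s by (simp add: h_def)
    moreover have "D (x u, y) * s <= h y * s" using Dh s by simp
    ultimately have "t * \<delta> u y / V u <= g (x u, y) - s * D (x u, y)" by (simp add: mult.commute)
    then have "t * \<delta> u y <= (g (x u, y) - s * D (x u, y)) * V u" using V by (simp add: pos_divide_le_eq)
    also have "... <= max 0 (g (x u, y) - s * D (x u, y)) * V u" using V0 by (intro mult_right_mono) auto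
    finally show "t * \<delta> u y <= max 0 (g (x u, y) - s * D (x u, y)) * V u" .
   qed
  qed
 qed
 have m: "{w : space ?m. t * \<delta> (fst w) (snd w) <= max 0 (g (x (fst w), snd w) - s * D (x (fst w), snd w)) * V (fst w)} : sets ?m"
  unfolding \<delta>_def x_def V_def by measurable
 show ?thesis
  using ELN.AE_commute[of "%u y. t * \<delta> u y <= max 0 (g (x u, y) - s * D (x u, y)) * V u", OF m] main
  unfolding \<delta>_def x_def V_def by blast
qed

lemma AE_XY_swap:
 assumes Q: "{w : space \<pi>. Q w} : sets \<pi>" and ae: "AE y in \<nu>. AE x in \<mu>. Q (x, y)"
 shows "AE w in \<pi>. Q w"
proof -
 have "AE x in \<mu>. AE y in \<nu>. Q (x, y)" using XY.AE_commute[of "%x y. Q (x, y)"] Q ae by simp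
 then show ?thesis by (rule XY.AE_pair_measure[OF Q])
qed

text \<open>The preceding bound exhibits \<open>(g - s D\<^sub>Y)\<^sup>+ / t\<close> as a weak upper gradient in the
first factor. The positive part disappears because \<open>s D\<^sub>Y \<le> g\<close>; the same elementary
bounds settle the cases \<open>t = 0\<close> and \<open>s = 0\<close>.\<close>
theorem gradient_sum_le:
 assumes f[measurable]: "f : Borel \<pi>" and fl: "Z.lp f < \<infinity>" and wug: "Z.wug f g"
  and DX[measurable]: "DX : Borel \<pi>" and DX0: "!!w. 0 <= DX w"
  and DXD: "AE y in \<nu>. X.wug (%x. f (x, y)) (%x. DX (x, y)) & (AE x in \<mu>. DX (x, y) <= N (1, 0) * g (x, y)) &
   (ALL h. X.wug (%x. f (x, y)) h --> (AE x in \<mu>. DX (x, y) <= h x))"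
  and DY[measurable]: "DY : Borel \<pi>" and DY0: "!!w. 0 <= DY w"
  and DYD: "AE x in \<mu>. Y.wug (%y. f (x, y)) (%y. DY (x, y)) & (AE y in \<nu>. DY (x, y) <= N (0, 1) * g (x, y)) &
   (ALL h. Y.wug (%y. f (x, y)) h --> (AE y in \<nu>. DY (x, y) <= h y))"
  and t: "0 <= t" and s: "0 <= s" and ts: "N (t, s) <= 1"
 shows "AE w in \<pi>. DX w * t + DY w * s <= g w"
proof -
 have g[measurable]: "g : Borel \<pi>" and gl: "Z.lp g < \<infinity>" and gp: "!!w. w : space \<pi> ==> 0 <= g w"
  using wug by (auto simp: Z.wug_iff)
 have "AE y in \<nu>. AE x in \<mu>. DX (x, y) <= N (1, 0) * g (x, y)" using DXD by eventually_elim blast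
 then have X1: "AE w in \<pi>. DX w <= N (1, 0) * g w" by (intro AE_XY_swap) auto
 have mY: "{w : space \<pi>. DY w <= N (0, 1) * g w} : sets \<pi>" by measurable
 have "AE x in \<mu>. AE y in \<nu>. DY (x, y) <= N (0, 1) * g (x, y)" using DYD by eventually_elim blast
 then have Y1: "AE w in \<pi>. DY w <= N (0, 1) * g w" by (rule XY.AE_pair_measure[OF mY])
 have t1: "t * N (1, 0) <= 1" and s1: "s * N (0, 1) <= 1" using N_ge[of t s] t s ts by auto
 have Xg: "AE w in \<pi>. DX w * t <= g w" using X1 AE_space
 proof eventually_elim
  case (elim w)
  have "DX w * t <= (N (1, 0) * g w) * t" using elim(1) t by (rule mult_right_mono)
  also have "... = (t * N (1, 0)) * g w" by simp
  also have "... <= 1 * g w" using t1 gp[OF elim(2)] by (rule mult_right_mono)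
  finally show ?case by simp
 qed
 have Yg: "AE w in \<pi>. DY w * s <= g w" using Y1 AE_space
 proof eventually_elim
  case (elim w)
  have "DY w * s <= (N (0, 1) * g w) * s" using elim(1) s by (rule mult_right_mono)
  also have "... = (s * N (0, 1)) * g w" by simp
  also have "... <= 1 * g w" using s1 gp[OF elim(2)] by (rule mult_right_mono)
  finally show ?case by simp
 qed
 consider "t = 0" | "s = 0" | "0 < t" "0 < s" using t s by linarith
 then show ?thesis
 proof cases
  case 1 then show ?thesis using Yg by simp
 next
  case 2 then show ?thesis using Xg by simp
 next
  case 3
  obtain T where T: "countable T" "!!E. E : T ==> X.plan E"
   "!!u g. u : Borel \<mu> ==> X.lp u < \<infinity> ==> g : Borel \<mu> ==> X.lp g < \<infinity> ==> (!!z. z : space \<mu> ==> 0 <= g z) ==>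
    (!!E. E : T ==> AE c in E. ennreal \<bar>u (c (cl 1)) - u (c (cl 0))\<bar> <= X.lin g c) ==> X.wug u g"
   by (rule X.countable_test_plans) blast
  have R: "AE y in \<nu>. ALL E:T. AE u in E >< lborel. t * \<bar>slope (%x. f (x, y)) (fst u) (snd u)\<bar>
   <= max 0 (g (pos u, y) - s * DY (pos u, y)) * speed X (fst u) (snd u)"
   unfolding AE_ball_countable[OF T(1)] using reduced_slope_bound[OF f fl wug DY DY0 DYD T(2) 3 ts] by blast
  have "AE y in \<nu>. AE x in \<mu>. DX (x, y) * t <= max 0 (g (x, y) - s * DY (x, y))"
   using R DXD lp_slice_X[OF g gl] lp_slice_X[OF f fl] AE_space
  proof (eventually_elim, goal_cases)
   case (1 y)
   note R = 1(1) and d = 1(2)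
   have y[measurable]: "y : space \<nu>" by (rule 1(5))
   define k where "k x = max 0 (g (x, y) - s * DY (x, y)) / t" for x
   have km: "k : Borel \<mu>" unfolding k_def by measurable
   have k0: "0 <= k x" for x using 3 by (simp add: k_def)
   have gm: "(%x. g (x, y)) : Borel \<mu>" and fm: "(%x. f (x, y)) : Borel \<mu>" by measurable
   have "X.lp k <= X.lp (%x. (1 / t) * g (x, y))"
   proof (rule X.lp_mono)
    fix x assume x: "x : space \<mu>"
    have "0 <= s * DY (x, y)" using DY0 s by simp
    moreover have gxy: "0 <= g (x, y)" using gp[of "(x, y)"] x y by (simp add: space_pair_measure)
    ultimately have "max 0 (g (x, y) - s * DY (x, y)) <= g (x, y)" by simp
    then have "k x <= g (x, y) / t" unfolding k_def using 3 by (simp add: divide_right_mono)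
    then show "\<bar>k x\<bar> <= \<bar>(1 / t) * g (x, y)\<bar>" using k0[of x] 3 gxy by (simp add: abs_of_nonneg)
   qed
   also have "... < \<infinity>" unfolding X.lp_mult[OF gm] using 1(3) by (simp add: ennreal_mult_less_top)
   finally have kl: "X.lp k < \<infinity>" .
   have wd: "X.wug (%x. f (x, y)) (%x. DX (x, y))" using d by blast
   have "X.wug (%x. f (x, y)) k"
   proof (rule T(3)[OF fm 1(4) km kl k0])
    fix E assume ET: "E : T"
    then have E: "X.plan E" by (rule T(2))
    interpret E: prob_space E using E by (rule X.plan_prob)
    interpret EL: pair_sigma_finite E lborel ..
    have "AE u in E >< lborel. \<bar>slope (%x. f (x, y)) (fst u) (snd u)\<bar> <= k (pos u) * speed X (fst u) (snd u)"
     using bspec[OF R ET]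
    proof eventually_elim
     case (elim u)
     then have "\<bar>slope (%x. f (x, y)) (fst u) (snd u)\<bar> <= max 0 (g (pos u, y) - s * DY (pos u, y)) * speed X (fst u) (snd u) / t"
      using 3 by (simp add: pos_le_divide_eq mult.commute)
     then show ?case by (simp add: k_def)
    qed
    from EL.AE_pair[OF this]
    have "AE c in E. AE r in lborel. \<bar>slope (%x. f (x, y)) c r\<bar> <= k (c (cl r)) * speed X c r" by simp
    from X.slope_bound_imp_lin[OF fm wd E this]
    show "AE c in E. ennreal \<bar>f (c (cl 1), y) - f (c (cl 0), y)\<bar> <= X.lin k c" .
   qed
   then have "AE x in \<mu>. DX (x, y) <= k x" using d by blast
   then show ?case by eventually_elim (use 3 in \<open>simp add: k_def pos_le_divide_eq\<close>)
  qed
  then have "AE w in \<pi>. DX w * t <= max 0 (g w - s * DY w)" by (intro AE_XY_swap) auto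
  then show ?thesis using Yg by eventually_elim (simp add: mult.commute)
 qed
qed

end

section \<open>The partial dual norm\<close>

context planar
begin

abbreviation "dual \<equiv> partial_dual_norm N"

lemma dual_bdd:
 assumes "0 <= t" "0 <= s" "N (t, s) <= 1"
 shows "a * t + b * s <= \<bar>a\<bar> / N (1, 0) + \<bar>b\<bar> / N (0, 1)"
proof -
 have "t <= 1 / N (1, 0)" "s <= 1 / N (0, 1)" using N_ge[of t s] N_pos assms by (auto simp: pos_le_divide_eq)
 then have "\<bar>a\<bar> * t <= \<bar>a\<bar> / N (1, 0)" "\<bar>b\<bar> * s <= \<bar>b\<bar> / N (0, 1)"
  using mult_left_mono[of t "1 / N (1, 0)" "\<bar>a\<bar>"] mult_left_mono[of s "1 / N (0, 1)" "\<bar>b\<bar>"] by simp_all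
 moreover have "a * t <= \<bar>a\<bar> * t" "b * s <= \<bar>b\<bar> * s" using assms by (auto intro: mult_right_mono)
 ultimately show ?thesis by linarith
qed

lemma dual_upper:
 assumes "0 <= t" "0 <= s" "N (t, s) <= 1"
 shows "a * t + b * s <= dual a b"
 unfolding partial_dual_norm_def
proof (rule cSup_upper)
 show "bdd_above {a * t + b * s | t s. 0 <= t & 0 <= s & N (t, s) <= 1}"
  by (rule bdd_aboveI[of _ "\<bar>a\<bar> / N (1, 0) + \<bar>b\<bar> / N (0, 1)"]) (use dual_bdd in blast)
qed (use assms in blast)

lemma dual_least:
 assumes "!!t s. 0 <= t ==> 0 <= s ==> N (t, s) <= 1 ==> a * t + b * s <= c"
 shows "dual a b <= c"
 unfolding partial_dual_norm_def
proof (rule cSup_least)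
 have "N (0, 0) <= 1" by (simp add: N_zero)
 then show "{a * t + b * s | t s. 0 <= t & 0 <= s & N (t, s) <= 1} ~= {}" by force
qed (use assms in blast)

lemma dual_nonneg: "0 <= dual a b"
 using dual_upper[of 0 0 a b] by (simp add: N_zero)

text \<open>Rational pairs below \<open>(t, s)\<close> stay in the unit ball since the norm is monotone.\<close>
lemma dual_least_rational:
 assumes ab: "0 <= a" "0 <= b" and le: "!!t s. t : \<rat> ==> s : \<rat> ==> 0 <= t ==> 0 <= s ==> N (t, s) <= 1 ==> a * t + b * s <= c"
 shows "dual a b <= c"
proof (rule dual_least)
 fix t s :: real assume ts: "0 <= t" "0 <= s" "N (t, s) <= 1"
 have approx: "EX q:\<rat>. 0 <= q & q <= t & t - d < q" if "0 <= t" "0 < d" for t d :: real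
 proof (cases "t = 0")
  case True then show ?thesis using that by (intro bexI[of _ 0]) auto
 next
  case False
  then have "max 0 (t - d) < t" using that by simp
  then obtain q where "q : \<rat>" "max 0 (t - d) < q" "q < t" using Rats_dense_in_real by blast
  then show ?thesis by (intro bexI[of _ q]) auto
 qed
 show "a * t + b * s <= c"
 proof (rule field_le_epsilon)
  fix e :: real assume e: "0 < e"
  define d where "d = e / (a + b + 1)"
  have d: "0 < d" using e ab by (simp add: d_def)
  obtain t' where t': "t' : \<rat>" "0 <= t'" "t' <= t" "t - d < t'" using approx[OF ts(1) d] by blast
  obtain s' where s': "s' : \<rat>" "0 <= s'" "s' <= s" "s - d < s'" using approx[OF ts(2) d] by blast
  have "N (t', s') <= 1" using N_mono[OF t'(2,3) s'(2,3)] ts(3) by linarith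
  then have "a * t' + b * s' <= c" by (intro le t' s')
  moreover have "a * t <= a * (t' + d)" "b * s <= b * (s' + d)" using t' s' ab by (auto intro!: mult_left_mono)
  moreover have "(a + b) * d <= e"
  proof -
   have "(a + b) * d <= (a + b + 1) * d" using d by (intro mult_right_mono) auto
   also have "... = e" using ab by (simp add: d_def)
   finally show ?thesis .
  qed
  ultimately show "a * t + b * s <= c + e" by (simp add: algebra_simps)
 qed
qed

text \<open>A supremum of equi-Lipschitz functions; this gives measurability for free.\<close>
lemma dual_lipschitz: "dual a b <= dual a' b' + (\<bar>a - a'\<bar> / N (1, 0) + \<bar>b - b'\<bar> / N (0, 1))"
proof (rule dual_least)
 fix t s assume ts: "0 <= t" "0 <= s" "N (t, s) <= 1"
 have "a * t + b * s = (a' * t + b' * s) + ((a - a') * t + (b - b') * s)" by (simp add: algebra_simps)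
 also have "... <= dual a' b' + (\<bar>a - a'\<bar> / N (1, 0) + \<bar>b - b'\<bar> / N (0, 1))"
  by (rule add_mono[OF dual_upper[OF ts] dual_bdd[OF ts]])
 finally show "a * t + b * s <= dual a' b' + (\<bar>a - a'\<bar> / N (1, 0) + \<bar>b - b'\<bar> / N (0, 1))" .
qed

lemma dual_measurable:
 assumes [measurable]: "u : Borel M" "v : Borel M"
 shows "(%w. dual (u w) (v w)) : Borel M"
proof -
 have "isCont (%z. dual (fst z) (snd z)) w" for w
 proof -
  have "((%x. dual (fst x) (snd x) - dual (fst w) (snd w)) \<longlongrightarrow> 0) (at w)"
  proof (rule Lim_null_comparison)
   show "\<forall>\<^sub>F x in at w. norm (dual (fst x) (snd x) - dual (fst w) (snd w)) <= \<bar>fst x - fst w\<bar> / N (1, 0) + \<bar>snd x - snd w\<bar> / N (0, 1)"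
   proof (intro always_eventually allI)
    fix x :: "real \<times> real"
    show "norm (dual (fst x) (snd x) - dual (fst w) (snd w)) <= \<bar>fst x - fst w\<bar> / N (1, 0) + \<bar>snd x - snd w\<bar> / N (0, 1)"
     using dual_lipschitz[of "fst x" "snd x" "fst w" "snd w"] dual_lipschitz[of "fst w" "snd w" "fst x" "snd x"]
     unfolding abs_minus_commute[of "fst w" "fst x"] abs_minus_commute[of "snd w" "snd x"] real_norm_def by linarith
   qed
   have "((%x. \<bar>fst x - fst w\<bar> / N (1, 0) + \<bar>snd x - snd w\<bar> / N (0, 1)) \<longlongrightarrow> \<bar>fst w - fst w\<bar> / N (1, 0) + \<bar>snd w - snd w\<bar> / N (0, 1)) (at w)"
    using N_pos by (intro tendsto_intros) auto
   then show "((%x. \<bar>fst x - fst w\<bar> / N (1, 0) + \<bar>snd x - snd w\<bar> / N (0, 1)) \<longlongrightarrow> 0) (at w)" by simp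
  qed
  then show ?thesis unfolding isCont_def by (simp add: LIM_zero_iff)
 qed
 then have "(%z. dual (fst z) (snd z)) : Borel borel"
  by (intro borel_measurable_continuous_onI) (simp add: continuous_at_imp_continuous_on)
 from measurable_compose[OF _ this, of "%w. (u w, v w)" M] show ?thesis by simp
qed

end

section \<open>Sobolev functions are Beppo--Levi functions\<close>

text \<open>Balls around a point have finite measure and exhaust the space.\<close>
lemma metric_measure_space_smm:
 assumes Z: "metric_measure_space Z m" and p: "1 < p"
 shows "smm m Z p"
proof -
 have sep: "separable Z" and sm: "sets m = sets (borel_of_metric Z)"
  and fin: "!!B. B : sets m ==> Metric_space.mbounded (mspace Z) (mdist Z) B ==> emeasure m B < \<infinity>"
  using Z unfolding metric_measure_space_def by blast+
 interpret Z: Metric_space "mspace Z" "mdist Z" by (rule Metric_space_mspace_mdist)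
 have sp: "space m = mspace Z" using sets_eq_imp_space_eq[OF sm] by simp
 have "sigma_finite_measure m"
 proof (cases "mspace Z = {}")
  case True
  then show ?thesis by (intro sigma_finite_measure.intro exI[of _ "{}"]) (simp add: sp)
 next
  case False
  then obtain a where a: "a : mspace Z" by blast
  define B where "B n = {z : mspace Z. mdist Z z a <= real n}" for n
  have Bm: "B n : sets m" for n
  proof -
   have "{z : space (borel_of_metric Z). mdist Z z a <= real n} : sets (borel_of_metric Z)"
    by (rule borel_measurable_le[OF measurable_mdist[OF a]]) simp
   then show ?thesis by (simp add: B_def sm)
  qed
  have "Z.mbounded (B n)" for n
   unfolding Z.mbounded_def B_def Z.mcball_def using a mdist_commute[of Z a]
   by (intro exI[of _ a] exI[of _ "real n"]) auto
  then have Bf: "emeasure m (B n) ~= \<infinity>" for n using fin[OF Bm, of n] by simp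
  have "(\<Union>n. B n) = space m"
   unfolding sp B_def using real_arch_simple by blast
  then show ?thesis
   by (intro sigma_finite_measure.intro exI[of _ "range B"]) (use Bm Bf in auto)
 qed
 then show ?thesis using sep sm p by (intro smm.intro smm_axioms.intro)
qed

theorem theorem1p5:
  fixes X :: "'a metric" and \<mu> :: "'a measure"
    and Y :: "'b metric" and \<nu> :: "'b measure"
    and N :: "real \<times> real \<Rightarrow> real" and p :: real
    and f :: "'a \<times> 'b \<Rightarrow> real"
  assumes "metric_measure_space X \<mu>" and "metric_measure_space Y \<nu>"
    and "planar_norm N"
    and "1 < p"
    and "f \<in> sobolev_space (planar_prod_metric N X Y) (\<mu> \<Otimes>\<^sub>M \<nu>) p"
  shows "f \<in> beppo_levi_space N X \<mu> Y \<nu> p \<and>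
    (\<forall>DX DY. partial_gradient_X X \<mu> \<nu> p f DX \<and> partial_gradient_Y \<mu> Y \<nu> p f DY \<longrightarrow>
       (AE z in \<mu> \<Otimes>\<^sub>M \<nu>. partial_dual_norm N (DX z) (DY z)
          \<le> minimal_wug (planar_prod_metric N X Y) (\<mu> \<Otimes>\<^sub>M \<nu>) p f z))"
proof -
 interpret tensor \<mu> X \<nu> Y p N
  by (intro tensor.intro metric_measure_space_smm planar.intro assms)
 define g where "g = minimal_wug XY \<pi> p f"
 have fL: "f : Lp_space p \<pi>" and fw: "EX g. Z.wug f g"
  using assms(5) by (auto simp: sobolev_space_def)
 have f[measurable]: "f : Borel \<pi>" and fl: "Z.lp f < \<infinity>" using fL by (auto simp: Z.Lp_space_iff)
 have wug: "Z.wug f g"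
  using fw Z.minimal_wug_is_wug[OF f fl] unfolding g_def by blast
 have g[measurable]: "g : Borel \<pi>" and gL: "g : Lp_space p \<pi>"
  using wug unfolding weak_upper_gradient_def by (auto simp: Z.Lp_space_iff)
 obtain DX where DX[measurable]: "DX : Borel \<pi>" and DX0: "!!w. 0 <= DX w"
  and DXD: "AE y in \<nu>. X.wug (%x. f (x, y)) (%x. DX (x, y)) & (AE x in \<mu>. DX (x, y) <= N (1, 0) * g (x, y)) &
   (ALL h. X.wug (%x. f (x, y)) h --> (AE x in \<mu>. DX (x, y) <= h x))"
  using gradient_X[OF f fl wug] by blast
 obtain DY where DY[measurable]: "DY : Borel \<pi>" and DY0: "!!w. 0 <= DY w"
  and DYD: "AE x in \<mu>. Y.wug (%y. f (x, y)) (%y. DY (x, y)) & (AE y in \<nu>. DY (x, y) <= N (0, 1) * g (x, y)) &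
   (ALL h. Y.wug (%y. f (x, y)) h --> (AE y in \<nu>. DY (x, y) <= h y))"
  using gradient_Y[OF f fl wug] by blast
 have dual_le: "AE w in \<pi>. dual (DX w) (DY w) <= g w"
 proof -
  have "AE w in \<pi>. ALL t:\<rat>. ALL s:\<rat>. 0 <= t --> 0 <= s --> N (t, s) <= 1 --> DX w * t + DY w * s <= g w"
   unfolding AE_ball_countable[OF countable_rat]
  proof (intro ballI)
   fix t s :: real
   show "AE w in \<pi>. 0 <= t --> 0 <= s --> N (t, s) <= 1 --> DX w * t + DY w * s <= g w"
    by (cases "0 <= t & 0 <= s & N (t, s) <= 1")
     (use gradient_sum_le[OF f fl wug DX DX0 DXD DY DY0 DYD] in auto)
  qed
  then show ?thesis by eventually_elim (rule dual_least_rational[OF DX0 DY0], blast)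
 qed
 have eqX: "AE y in \<nu>. AE x in \<mu>. minimal_wug X \<mu> p (%x'. f (x', y)) x = DX (x, y)"
  using DXD by eventually_elim (rule X.minimal_wugI(2), blast+)
 have eqY: "AE x in \<mu>. AE y in \<nu>. minimal_wug Y \<nu> p (%y'. f (x, y')) y = DY (x, y)"
  using DYD by eventually_elim (rule Y.minimal_wugI(2), blast+)
 have pX: "partial_gradient_X X \<mu> \<nu> p f DX"
  unfolding partial_gradient_X_def using DX eqX by (auto elim!: eventually_mono)
 have pY: "partial_gradient_Y \<mu> Y \<nu> p f DY"
  unfolding partial_gradient_Y_def using DY eqY by (auto elim!: eventually_mono)
 have dm[measurable]: "(%w. dual (DX w) (DY w)) : Borel \<pi>" by (rule dual_measurable[OF DX DY])
 have dL: "(%w. dual (DX w) (DY w)) : Lp_space p \<pi>"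
  unfolding Lp_space_def mem_Collect_eq
 proof
  show "(%w. dual (DX w) (DY w)) : Borel \<pi>" by (rule dm)
  have gi: "integrable \<pi> (%w. \<bar>g w\<bar> powr p)" using gL by (simp add: Lp_space_def)
  show "integrable \<pi> (%w. \<bar>dual (DX w) (DY w)\<bar> powr p)"
  proof (rule Bochner_Integration.integrable_bound[OF gi])
   show "AE w in \<pi>. norm (\<bar>dual (DX w) (DY w)\<bar> powr p) <= norm (\<bar>g w\<bar> powr p)"
    using dual_le
   proof eventually_elim
    case (elim w)
    then have "\<bar>dual (DX w) (DY w)\<bar> <= \<bar>g w\<bar>" using dual_nonneg[of "DX w" "DY w"] by simp
    then have "\<bar>dual (DX w) (DY w)\<bar> powr p <= \<bar>g w\<bar> powr p" using assms(4) by (intro powr_mono2) auto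
    then show ?case by simp
   qed
  qed measurable
 qed
 have sX: "AE y in \<nu>. (%x. f (x, y)) : sobolev_space X \<mu> p"
  using DXD lp_slice_X[OF f fl] AE_space
 proof eventually_elim
  case (elim y)
  have "(%x. f (x, y)) : Borel \<mu>" using elim(3) by measurable
  then show ?case using elim unfolding sobolev_space_def by (auto simp: X.Lp_space_iff)
 qed
 have sY: "AE x in \<mu>. (%y. f (x, y)) : sobolev_space Y \<nu> p"
  using DYD lp_slice_Y[OF f fl] AE_space
 proof eventually_elim
  case (elim x)
  have "(%y. f (x, y)) : Borel \<nu>" using elim(3) by measurable
  then show ?case using elim unfolding sobolev_space_def by (auto simp: Y.Lp_space_iff)
 qed
 show ?thesis
 proof (intro conjI allI impI)
  show "f : beppo_levi_space N X \<mu> Y \<nu> p"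
   unfolding beppo_levi_space_def using fL sX sY pX pY dL by blast
  fix DX' DY' assume a: "partial_gradient_X X \<mu> \<nu> p f DX' & partial_gradient_Y \<mu> Y \<nu> p f DY'"
  have [measurable]: "DX' : Borel \<pi>" "DY' : Borel \<pi>"
   using a by (auto simp: partial_gradient_X_def partial_gradient_Y_def)
  have "AE y in \<nu>. AE x in \<mu>. DX' (x, y) = minimal_wug X \<mu> p (%x'. f (x', y)) x" using a by (simp add: partial_gradient_X_def)
  then have "AE y in \<nu>. AE x in \<mu>. DX' (x, y) = DX (x, y)"
   using eqX
  proof eventually_elim
   case (elim y) show ?case using elim by eventually_elim simp
  qed
  then have "AE w in \<pi>. DX' w = DX w" by (intro AE_XY_swap) auto
  moreover have "AE w in \<pi>. DY' w = DY w"
  proof -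
   have m: "{w : space \<pi>. DY' w = DY w} : sets \<pi>" by measurable
   have "AE x in \<mu>. AE y in \<nu>. DY' (x, y) = minimal_wug Y \<nu> p (%y'. f (x, y')) y" using a by (simp add: partial_gradient_Y_def)
   then have "AE x in \<mu>. AE y in \<nu>. DY' (x, y) = DY (x, y)"
    using eqY
   proof eventually_elim
    case (elim x) show ?case using elim by eventually_elim simp
   qed
   then show ?thesis by (rule XY.AE_pair_measure[OF m])
  qed
  ultimately show "AE z in \<pi>. dual (DX' z) (DY' z) <= minimal_wug XY \<pi> p f z"
   using dual_le unfolding g_def by eventually_elim simp
 qed
qed

end
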